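(* Let $b,\sigma:[0,T]\times\mathbb{R}\to\mathbb{R}$ be measurable functions for which there is $L>0$ such that for all $x,y\in\mathbb{R}$ and $t\in[0,T]$, $$|b(t,x)-b(t,y)|+|\sigma(t,x)-\sigma(t,y)|\le L|x-y|,\qquad |b(t,x)|+|\sigma(t,x)|\le L(1+|x|).$$ Assume moreover that for each $t\in[0,T]$ the functions $b(t,\cdot),\sigma(t,\cdot)$ are differentiable on $\mathbb{R}$ and, for some $\nu>0$ and $\delta\in(0,1]$ (and the constant $L>0$, enlarged if necessary), $$|b'(t,x)-b'(t,y)|+|\sigma'(t,x)-\sigma'(t,y)|\le L(1+|x|^\nu+|y|^\nu)|x-y|^\delta\quad\forall x,y\in\mathbb{R},\ t\in[0,T].$$ For $\alpha\in(\frac12,1]$ let $(X_{\alpha,t})_{t\in[0,T]}$ be the solution of the Caputo fractional stochastic differential equation of order $\alpha$ with coefficients $b,\sigma$ and initial value $x_0\in\mathbb{R}$. For $\beta\in(\frac12,1]$ let $(Y_{\beta,t})_{0\le t\le T}$ be defined by $$\begin{aligned}Y_{\beta,t}=&-\frac{\Gamma'(\beta)}{\Gamma^2(\beta)}\left(\int_0^t(t-s)^{\beta-1}b(s,X_{\beta,s})\,ds+\int_0^t(t-s)^{\beta-1}\sigma(s,X_{\beta,s})\,dB_s\right)\\&+\frac{1}{\Gamma(\beta)}\int_0^t(t-s)^{\beta-1}\big(\ln(t-s)\,b(s,X_{\beta,s})+b'(s,X_{\beta,s})Y_{\beta,s}\big)\,ds\\&+\frac{1}{\Gamma(\beta)}\int_0^t(t-s)^{\beta-1}\big(\ln(t-s)\,\sigma(s,X_{\beta,s})+\sigma'(s,X_{\beta,s})Y_{\beta,s}\big)\,dB_s,\quad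 0\le t\le T.\end{aligned}$$ Then for every $p\ge2$ and $\alpha_0\in(\frac12,1]$ there is a positive constant $C$ depending only on $L,T,p,\alpha_0,x_0,\nu,\delta$ such that $$\sup_{0\le t\le T}E\left|\frac{X_{\alpha,t}-X_{\beta,t}}{\alpha-\beta}-Y_{\beta,t}\right|^p\le C|\alpha-\beta|^{p\delta}\qquad\text{for all }\alpha,\beta\in[\alpha_0,1],\ \alpha\ne\beta.$$
   Context: $T>0$ is fixed, $B=(B_t)_{t\in[0,T]}$ is a standard Brownian motion on a complete probability space with its natural filtration $\mathbb{F}$, and $\Gamma(\alpha)=\int_0^\infty x^{\alpha-1}e^{-x}dx$ is the Gamma function. For a function $h(t,x)$, $h'(t,x)=\frac{\partial h}{\partial x}(t,x)$. The solution of the Caputo fractional stochastic differential equation of order $\alpha\in(\frac12,1]$ with coefficients $b,\sigma$ and initial value $x_0$ is the ($\mathbb{F}$-adapted) process satisfying, for $0\le t\le T$, $$X_{\alpha,t}=x_0+\frac{1}{\Gamma(\alpha)}\left(\int_0^t(t-s)^{\alpha-1}b(s,X_{\alpha,s})\,ds+\int_0^t(t-s)^{\alpha-1}\sigma(s,X_{\alpha,s})\,dB_s\right),$$ where the second integral is an Itô integral; under the Lipschitz and linear growth conditions it exists and is unique. The same Brownian motion and the same $x_0,b,\sigma$ are used for all orders. *)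

theory Defs
  imports "HOL-Probability.Probability"
begin

locale brownian_motion = prob_space M
  for M :: "'a measure" +
  fixes T :: real and B :: "real \<Rightarrow> 'a \<Rightarrow> real"
  assumes measurable_B: "\<And>t. t \<in> {0..T} \<Longrightarrow> B t \<in> borel_measurable M"
    and B_zero: "AE \<omega> in M. B 0 \<omega> = 0"
    and normal_increments: "\<And>s t. 0 \<le> s \<Longrightarrow> s < t \<Longrightarrow> t \<le> T \<Longrightarrow>
      distributed M lborel (\<lambda>\<omega>. B t \<omega> - B s \<omega>) (normal_density 0 (sqrt (t - s)))"
    and indep_increments: "\<And>n \<tau>. 0 \<le> \<tau> 0 \<Longrightarrow> (\<forall>i<n. \<tau> i \<le> \<tau> (Suc i)) \<Longrightarrow> \<tau> n \<le> T \<Longrightarrow>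
      indep_vars (\<lambda>_. borel) (\<lambda>i \<omega>. B (\<tau> (Suc i)) \<omega> - B (\<tau> i) \<omega>) {..<n::nat}"
    and continuous_paths: "AE \<omega> in M. continuous_on {0..T} (\<lambda>t. B t \<omega>)"

text \<open>The natural filtration is augmented by the null sets of the underlying complete space, as
  is usual. This only enlarges the class of adapted processes.\<close>

definition natural_filtration :: "'a measure \<Rightarrow> (real \<Rightarrow> 'a \<Rightarrow> real) \<Rightarrow> real \<Rightarrow> 'a measure" where
  "natural_filtration M B t = sigma (space M)
     ({B s -` A \<inter> space M | s A. s \<in> {0..t} \<and> A \<in> sets borel} \<union> null_sets M)"

definition adapted_process ::
  "'a measure \<Rightarrow> (real \<Rightarrow> 'a measure) \<Rightarrow> real \<Rightarrow> (real \<Rightarrow> 'a \<Rightarrow> real) \<Rightarrow> bool" where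
  "adapted_process M F T X \<longleftrightarrow>
     (\<lambda>(t, \<omega>). X t \<omega>) \<in> borel_measurable (restrict_space borel {0..T} \<Otimes>\<^sub>M M) \<and>
     (\<forall>t\<in>{0..T}. X t \<in> borel_measurable (F t))"

definition ito_integrand ::
  "'a measure \<Rightarrow> (real \<Rightarrow> 'a measure) \<Rightarrow> real \<Rightarrow> (real \<Rightarrow> 'a \<Rightarrow> real) \<Rightarrow> bool" where
  "ito_integrand M F t \<phi> \<longleftrightarrow> adapted_process M F t \<phi> \<and>
     (\<integral>\<^sup>+\<omega>. (\<integral>\<^sup>+s\<in>{0..t}. ennreal ((\<phi> s \<omega>)\<^sup>2) \<partial>lborel) \<partial>M) < \<infinity>"

text \<open>A simple process on \<open>[0,t]\<close> is given by its number \<open>n\<close> of steps, its partition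
  points \<open>\<tau> 0 \<le> \<dots> \<le> \<tau> n\<close> and its values \<open>\<xi> i\<close> on \<open>(\<tau> i, \<tau> (i+1)]\<close>.\<close>

definition simple_data ::
  "'a measure \<Rightarrow> (real \<Rightarrow> 'a measure) \<Rightarrow> real \<Rightarrow> nat \<Rightarrow> (nat \<Rightarrow> real) \<Rightarrow> (nat \<Rightarrow> 'a \<Rightarrow> real) \<Rightarrow> bool"
where
  "simple_data M F t n \<tau> \<xi> \<longleftrightarrow>
     0 \<le> \<tau> 0 \<and> (\<forall>i<n. \<tau> i \<le> \<tau> (Suc i)) \<and> \<tau> n \<le> t \<and>
     (\<forall>i<n. \<xi> i \<in> borel_measurable (F (\<tau> i)) \<and> (\<exists>K. \<forall>\<omega>\<in>space M. \<bar>\<xi> i \<omega>\<bar> \<le> K))"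

definition simple_process ::
  "nat \<Rightarrow> (nat \<Rightarrow> real) \<Rightarrow> (nat \<Rightarrow> 'a \<Rightarrow> real) \<Rightarrow> real \<Rightarrow> 'a \<Rightarrow> real" where
  "simple_process n \<tau> \<xi> s \<omega> = (\<Sum>i<n. \<xi> i \<omega> * indicator {\<tau> i<..\<tau> (Suc i)} s)"

definition simple_ito_integral ::
  "(real \<Rightarrow> 'a \<Rightarrow> real) \<Rightarrow> nat \<Rightarrow> (nat \<Rightarrow> real) \<Rightarrow> (nat \<Rightarrow> 'a \<Rightarrow> real) \<Rightarrow> 'a \<Rightarrow> real" where
  "simple_ito_integral B n \<tau> \<xi> \<omega> = (\<Sum>i<n. \<xi> i \<omega> * (B (\<tau> (Suc i)) \<omega> - B (\<tau> i) \<omega>))"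

text \<open>The Ito integral over \<open>[0,t]\<close> is the limit in \<open>L\<^sup>2(M)\<close> of the integrals of simple
  processes approximating the integrand in \<open>L\<^sup>2(dt \<otimes> M)\<close>. It is unique only up to null sets.\<close>

definition has_ito_integral ::
  "'a measure \<Rightarrow> (real \<Rightarrow> 'a measure) \<Rightarrow> (real \<Rightarrow> 'a \<Rightarrow> real) \<Rightarrow> real \<Rightarrow> (real \<Rightarrow> 'a \<Rightarrow> real)
     \<Rightarrow> ('a \<Rightarrow> real) \<Rightarrow> bool" where
  "has_ito_integral M F B t \<phi> I \<longleftrightarrow>
     ito_integrand M F t \<phi> \<and> I \<in> borel_measurable M \<and>
     (\<exists>n \<tau> \<xi>. (\<forall>k. simple_data M F t (n k) (\<tau> k) (\<xi> k)) \<and>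
        (\<lambda>k. \<integral>\<^sup>+\<omega>. (\<integral>\<^sup>+s\<in>{0..t}.
            ennreal ((\<phi> s \<omega> - simple_process (n k) (\<tau> k) (\<xi> k) s \<omega>)\<^sup>2) \<partial>lborel) \<partial>M)
          \<longlonglongrightarrow> 0 \<and>
        (\<lambda>k. \<integral>\<^sup>+\<omega>. ennreal ((I \<omega> - simple_ito_integral B (n k) (\<tau> k) (\<xi> k) \<omega>)\<^sup>2) \<partial>M)
          \<longlonglongrightarrow> 0)"

definition ito_integrable ::
  "'a measure \<Rightarrow> (real \<Rightarrow> 'a measure) \<Rightarrow> (real \<Rightarrow> 'a \<Rightarrow> real) \<Rightarrow> real \<Rightarrow> (real \<Rightarrow> 'a \<Rightarrow> real) \<Rightarrow> bool"
where
  "ito_integrable M F B t \<phi> \<longleftrightarrow> (\<exists>I. has_ito_integral M F B t \<phi> I)"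

definition ito_integral ::
  "'a measure \<Rightarrow> (real \<Rightarrow> 'a measure) \<Rightarrow> (real \<Rightarrow> 'a \<Rightarrow> real) \<Rightarrow> real \<Rightarrow> (real \<Rightarrow> 'a \<Rightarrow> real)
     \<Rightarrow> 'a \<Rightarrow> real" where
  "ito_integral M F B t \<phi> = (SOME I. has_ito_integral M F B t \<phi> I)"

text \<open>The equations below hold almost surely for each fixed \<open>t\<close>. Since a Bochner integral of a
  non-integrable function is \<open>0\<close> by convention, integrability is part of each equation. The
  conventions for \<open>0 powr a\<close> and \<open>ln 0\<close> only affect the integrands at the single point
  \<open>s = t\<close>.\<close>

definition caputo_fsde_solution ::
  "'a measure \<Rightarrow> real \<Rightarrow> (real \<Rightarrow> 'a \<Rightarrow> real) \<Rightarrow> (real \<Rightarrow> real \<Rightarrow> real) \<Rightarrow> (real \<Rightarrow> real \<Rightarrow> real)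
     \<Rightarrow> real \<Rightarrow> real \<Rightarrow> (real \<Rightarrow> 'a \<Rightarrow> real) \<Rightarrow> bool" where
  "caputo_fsde_solution M T B b \<sigma> x\<^sub>0 \<alpha> X \<longleftrightarrow>
     (let F = natural_filtration M B;
          \<phi> = (\<lambda>t s \<omega>. (t - s) powr (\<alpha> - 1) * b s (X s \<omega>));
          \<psi> = (\<lambda>t s \<omega>. (t - s) powr (\<alpha> - 1) * \<sigma> s (X s \<omega>))
      in adapted_process M F T X \<and>
         (\<forall>t\<in>{0..T}.
            (AE \<omega> in M. set_integrable lborel {0..t} (\<lambda>s. \<phi> t s \<omega>)) \<and>
            ito_integrable M F B t (\<psi> t) \<and>
            (AE \<omega> in M. X t \<omega> = x\<^sub>0 + 1 / Gamma \<alpha> *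
               ((LBINT s:{0..t}. \<phi> t s \<omega>) + ito_integral M F B t (\<psi> t) \<omega>))))"

text \<open>The derivative process \<open>Y\<close> of order \<open>\<beta>\<close>, where \<open>X\<close> is the solution of order \<open>\<beta>\<close>, so that
  the first two integrals are those of the equation for \<open>X\<close>.\<close>

definition order_derivative_process ::
  "'a measure \<Rightarrow> real \<Rightarrow> (real \<Rightarrow> 'a \<Rightarrow> real) \<Rightarrow> (real \<Rightarrow> real \<Rightarrow> real) \<Rightarrow> (real \<Rightarrow> real \<Rightarrow> real)
     \<Rightarrow> real \<Rightarrow> (real \<Rightarrow> 'a \<Rightarrow> real) \<Rightarrow> (real \<Rightarrow> 'a \<Rightarrow> real) \<Rightarrow> bool" where
  "order_derivative_process M T B b \<sigma> \<beta> X Y \<longleftrightarrow>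
     (let F = natural_filtration M B;
          \<phi> = (\<lambda>t s \<omega>. (t - s) powr (\<beta> - 1) * b s (X s \<omega>));
          \<psi> = (\<lambda>t s \<omega>. (t - s) powr (\<beta> - 1) * \<sigma> s (X s \<omega>));
          \<phi>' = (\<lambda>t s \<omega>. (t - s) powr (\<beta> - 1) *
                  (ln (t - s) * b s (X s \<omega>) + deriv (b s) (X s \<omega>) * Y s \<omega>));
          \<psi>' = (\<lambda>t s \<omega>. (t - s) powr (\<beta> - 1) *
                  (ln (t - s) * \<sigma> s (X s \<omega>) + deriv (\<sigma> s) (X s \<omega>) * Y s \<omega>))
      in adapted_process M F T Y \<and>
         (\<forall>t\<in>{0..T}.
            (AE \<omega> in M. set_integrable lborel {0..t} (\<lambda>s. \<phi> t s \<omega>)) \<and>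
            (AE \<omega> in M. set_integrable lborel {0..t} (\<lambda>s. \<phi>' t s \<omega>)) \<and>
            ito_integrable M F B t (\<psi> t) \<and>
            ito_integrable M F B t (\<psi>' t) \<and>
            (AE \<omega> in M. Y t \<omega> =
               - (deriv Gamma \<beta> / (Gamma \<beta>)\<^sup>2) *
                 ((LBINT s:{0..t}. \<phi> t s \<omega>) + ito_integral M F B t (\<psi> t) \<omega>)
               + 1 / Gamma \<beta> * (LBINT s:{0..t}. \<phi>' t s \<omega>)
               + 1 / Gamma \<beta> * ito_integral M F B t (\<psi>' t) \<omega>)))"

end

theory Submission
  imports Defs
begin

text \<open>Moments of Ito integrals are bounded without Ito's formula. The truncated powers
  \<open>x\<^sup>2 * (x\<^sup>2 / (1 + e * x\<^sup>2)) ^ k\<close> have quadratic growth, so their expectations are finite for square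
  integrable variables, and a second-order Taylor expansion over each step of a simple process,
  whose linear term has expectation \<open>0\<close>, bounds these expectations with constants that do not
  depend on \<open>e\<close>. Such bounds pass to \<open>L\<^sup>2\<close> limits.

  All kernels of orders in \<open>[\<alpha>\<^sub>0,1]\<close>, and their derivatives in the order, are dominated by
  \<open>K * u powr (g - 1)\<close> with a single \<open>g \<in> (1/2,1)\<close>. If a process \<open>Z\<close> solves a Volterra equation whose
  two integrands are at most \<open>K * (t - s) powr (g - 1) * (H s + |Z s|)\<close>, then Gronwall's inequality
  for the truncated powers of \<open>Z\<close>, with \<open>e\<close> tending to \<open>0\<close>, bounds all moments of \<open>Z\<close> by
  moments of \<open>H\<close>. This is applied in turn to \<open>X\<close>, to \<open>Y\<close>, to \<open>(X \<alpha> - X \<beta>) / (\<alpha> - \<beta>)\<close>, and to the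
  remainder divided by \<open>|\<alpha> - \<beta>| powr \<delta>\<close>; in the last case the inhomogeneity \<open>H\<close> comes from the
  expansion of the kernel in the order and the Hoelder condition on \<open>b'\<close> and \<open>\<sigma>'\<close>.\<close>

section \<open>Truncated powers\<close>

text \<open>The Taylor remainder of a step contains the weight of the past sum times the square of
  the new value. An unweighted Young inequality would turn this into truncated powers of the
  integrand itself, hence into the kernel to the power \<open>2 * k + 2\<close>, which is not
  integrable for large k. The split is therefore made at each time with the weight
  \<open>u powr (2 * g - 2)\<close> on the past sum. This weight is integrable for every k because
  \<open>2 * g - 2 > - 1\<close>, so it can serve as a Gronwall coefficient, and the other half of
  the split is \<open>trunc_energy\<close>, in which an integrand \<open>u powr (g - 1) * x\<close>
  costs only \<open>u powr (2 * g - 2) * trunc_pow e k x\<close>. One kernel exponent thus serves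
  all moments, as Jensen's inequality for the measure with density \<open>u powr (2 * g - 2)\<close>
  would do.

  Truncation serves a second purpose: absorbing a term in Gronwall's inequality requires a finite
  quantity, and at that point only the second moment of the process is known to be finite.

  Dividing the remainder by \<open>\<bar>\<alpha> - \<beta>\<bar> powr \<delta>\<close> beforehand
  turns the rate into a plain moment bound, uniform in the two orders.\<close>

definition trunc_wt :: "real \<Rightarrow> nat \<Rightarrow> real \<Rightarrow> real" where
  "trunc_wt e k x = (x\<^sup>2 / (1 + e * x\<^sup>2)) ^ k"

definition trunc_pow :: "real \<Rightarrow> nat \<Rightarrow> real \<Rightarrow> real" where
  "trunc_pow e k x = x\<^sup>2 * trunc_wt e k x"

lemma trunc_wt_nonneg: "e \<ge> 0 \<Longrightarrow> 0 \<le> trunc_wt e k x"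
  by (auto simp: trunc_wt_def intro!: zero_le_power divide_nonneg_nonneg)

lemma trunc_pow_nonneg: "e \<ge> 0 \<Longrightarrow> 0 \<le> trunc_pow e k x"
  by (simp add: trunc_pow_def trunc_wt_nonneg)

lemma trunc_wt_measurable [measurable]: "trunc_wt e k \<in> borel_measurable borel"
  unfolding trunc_wt_def[abs_def] by measurable

lemma trunc_pow_measurable [measurable]: "trunc_pow e k \<in> borel_measurable borel"
  unfolding trunc_pow_def[abs_def] by measurable

lemma trunc_wt_abs [simp]: "trunc_wt e k \<bar>x\<bar> = trunc_wt e k x"
  by (simp add: trunc_wt_def)

lemma trunc_pow_abs [simp]: "trunc_pow e k \<bar>x\<bar> = trunc_pow e k x"
  by (simp add: trunc_pow_def)

lemma trunc_ratio_mono: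
  fixes u v :: real
  assumes "e \<ge> 0" "0 \<le> u" "u \<le> v"
  shows "u / (1 + e * u) \<le> v / (1 + e * v)"
proof -
  have "1 + e * u > 0" "1 + e * v > 0" using assms by (auto intro!: add_pos_nonneg)
  then show ?thesis using assms by (simp add: divide_simps) (simp add: algebra_simps)
qed

lemma trunc_wt_mono:
  assumes "e \<ge> 0" "\<bar>x\<bar> \<le> \<bar>y\<bar>"
  shows "trunc_wt e k x \<le> trunc_wt e k y"
  unfolding trunc_wt_def
proof (rule power_mono)
  have "x\<^sup>2 \<le> y\<^sup>2" using assms(2) by (simp add: abs_le_square_iff)
  then show "x\<^sup>2 / (1 + e * x\<^sup>2) \<le> y\<^sup>2 / (1 + e * y\<^sup>2)" using assms(1) by (intro trunc_ratio_mono) auto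
qed (use assms(1) in auto)

lemma trunc_pow_mono:
  assumes "e \<ge> 0" "\<bar>x\<bar> \<le> \<bar>y\<bar>"
  shows "trunc_pow e k x \<le> trunc_pow e k y"
  unfolding trunc_pow_def
  using assms trunc_wt_mono[OF assms] trunc_wt_nonneg[OF assms(1)]
  by (intro mult_mono) (auto simp: abs_le_square_iff)

text \<open>The factor c^2 alone fails for |c| < 1, because a smaller argument also has a smaller
  denominator. The number 1 + c^2 is at least 1, and enlarging the argument by such a factor only
  enlarges the denominator.\<close>

lemma trunc_wt_scale:
  assumes "e \<ge> 0"
  shows "trunc_wt e k (c * x) \<le> (1 + c\<^sup>2) ^ k * trunc_wt e k x"
  unfolding trunc_wt_def power_mult_distrib[symmetric, where n=k]
proof (rule power_mono)
  have 1: "1 + e * x\<^sup>2 > 0" "1 + e * (c * x)\<^sup>2 > 0" using assms by (auto intro!: add_pos_nonneg)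
  have "(c * x)\<^sup>2 / (1 + e * (c * x)\<^sup>2) \<le> ((1 + c\<^sup>2) * x\<^sup>2) / (1 + e * ((1 + c\<^sup>2) * x\<^sup>2))"
    using assms by (intro trunc_ratio_mono) (auto simp: power_mult_distrib algebra_simps)
  also have "\<dots> \<le> ((1 + c\<^sup>2) * x\<^sup>2) / (1 + e * x\<^sup>2)"
    using assms 1 by (intro divide_left_mono mult_pos_pos add_pos_nonneg)
      (auto simp: algebra_simps)
  finally show "(c * x)\<^sup>2 / (1 + e * (c * x)\<^sup>2) \<le> (1 + c\<^sup>2) * (x\<^sup>2 / (1 + e * x\<^sup>2))" by simp
qed (use assms in auto)

lemma trunc_pow_scale:
  assumes "e \<ge> 0"
  shows "trunc_pow e k (c * x) \<le> c\<^sup>2 * (1 + c\<^sup>2) ^ k * trunc_pow e k x"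
  using mult_left_mono[OF trunc_wt_scale[OF assms, of k c x], of "(c * x)\<^sup>2"]
  by (simp add: trunc_pow_def power_mult_distrib mult_ac)

lemma trunc_pow_le_power: "e \<ge> 0 \<Longrightarrow> trunc_pow e k x \<le> \<bar>x\<bar> ^ (2 * k + 2)"
proof -
  assume e: "e \<ge> 0"
  have "x\<^sup>2 / (1 + e * x\<^sup>2) \<le> x\<^sup>2" using trunc_ratio_mono[of 0] e
    by (simp add: divide_le_eq add_pos_nonneg algebra_simps)
  then have "trunc_wt e k x \<le> (x\<^sup>2) ^ k" using e unfolding trunc_wt_def by (intro power_mono) auto
  then have "trunc_pow e k x \<le> x\<^sup>2 * (x\<^sup>2) ^ k" unfolding trunc_pow_def by (intro mult_left_mono) auto
  then show ?thesis by (simp add: power_mult[symmetric] power_add[symmetric] power_even_abs)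
qed

lemma trunc_wt_le:
  assumes "e > 0"
  shows "trunc_wt e k x \<le> (1 / e) ^ k"
  unfolding trunc_wt_def
  using assms by (intro power_mono) (auto simp: divide_simps add_pos_nonneg add_nonneg_nonneg)

lemma trunc_pow_le_square:
  assumes "e > 0"
  shows "trunc_pow e k x \<le> (1 / e) ^ k * x\<^sup>2"
  using mult_left_mono[OF trunc_wt_le[OF assms, of k x], of "x\<^sup>2"] by (simp add: trunc_pow_def mult_ac)

text \<open>A Young inequality without exponents: monotonicity allows the smaller of |x| and |y| to
  be replaced by the larger.\<close>

lemma trunc_wt_mult_square:
  assumes "e \<ge> 0"
  shows "trunc_wt e k x * y\<^sup>2 \<le> trunc_pow e k x + trunc_pow e k y"
proof (cases "\<bar>x\<bar> \<le> \<bar>y\<bar>")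
  case True
  then have "trunc_wt e k x * y\<^sup>2 \<le> trunc_wt e k y * y\<^sup>2"
    using assms by (intro mult_right_mono trunc_wt_mono) auto
  then show ?thesis using trunc_pow_nonneg[OF assms, of k x] by (simp add: trunc_pow_def mult_ac)
next
  case False
  then have "y\<^sup>2 \<le> x\<^sup>2" by (simp add: abs_le_square_iff[symmetric])
  then have "trunc_wt e k x * y\<^sup>2 \<le> trunc_wt e k x * x\<^sup>2"
    using assms by (intro mult_left_mono trunc_wt_nonneg) auto
  then show ?thesis using trunc_pow_nonneg[OF assms, of k y] by (simp add: trunc_pow_def mult_ac)
qed

text \<open>Twice the larger of |x| and |y| dominates |z|, and 5 is \<open>1 + 2 ^ 2\<close> from
  \<open>trunc_wt_scale\<close>.\<close>

lemma trunc_wt_add: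
  assumes "e \<ge> 0" "\<bar>z\<bar> \<le> \<bar>x\<bar> + \<bar>y\<bar>"
  shows "trunc_wt e k z \<le> 5 ^ k * (trunc_wt e k x + trunc_wt e k y)"
proof -
  define m where "m = (if \<bar>x\<bar> \<le> \<bar>y\<bar> then y else x)"
  have "trunc_wt e k z \<le> trunc_wt e k (2 * m)"
    using assms by (intro trunc_wt_mono) (auto simp: m_def)
  also have "\<dots> \<le> 5 ^ k * trunc_wt e k m" using trunc_wt_scale[OF assms(1), of k 2 m] by simp
  also have "\<dots> \<le> 5 ^ k * (trunc_wt e k x + trunc_wt e k y)"
    using trunc_wt_nonneg[OF assms(1)] by (intro mult_left_mono) (auto simp: m_def)
  finally show ?thesis .
qed

lemma trunc_pow_add:
  assumes "e \<ge> 0" "\<bar>z\<bar> \<le> \<bar>x\<bar> + \<bar>y\<bar>"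
  shows "trunc_pow e k z \<le> 4 * 5 ^ k * (trunc_pow e k x + trunc_pow e k y)"
proof -
  define m where "m = (if \<bar>x\<bar> \<le> \<bar>y\<bar> then y else x)"
  have "trunc_pow e k z \<le> trunc_pow e k (2 * m)"
    using assms by (intro trunc_pow_mono) (auto simp: m_def)
  also have "\<dots> \<le> 4 * 5 ^ k * trunc_pow e k m" using trunc_pow_scale[OF assms(1), of k 2 m] by simp
  also have "\<dots> \<le> 4 * 5 ^ k * (trunc_pow e k x + trunc_pow e k y)"
    using trunc_pow_nonneg[OF assms(1)] by (intro mult_left_mono) (auto simp: m_def)
  finally show ?thesis .
qed

section \<open>Second-order expansion of the truncated powers\<close>

definition trunc_deriv :: "real \<Rightarrow> nat \<Rightarrow> real \<Rightarrow> real" where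
  "trunc_deriv e k x = 2 * x * (1 + real k / (1 + e * x\<^sup>2)) * trunc_wt e k x"

lemma trunc_deriv_measurable [measurable]: "trunc_deriv e k \<in> borel_measurable borel"
  unfolding trunc_deriv_def[abs_def] by measurable

lemma trunc_deriv_le:
  assumes "e > 0"
  shows "\<bar>trunc_deriv e k x\<bar> \<le> 2 * (1 + real k) * (1 / e) ^ k * \<bar>x\<bar>"
proof -
  have *: "1 + e * x\<^sup>2 \<ge> 1" using assms by simp
  have "\<bar>1 + real k / (1 + e * x\<^sup>2)\<bar> \<le> 1 + real k"
    using * mult_left_mono[OF *, of "real k"] by (simp add: divide_le_eq)
  then have "\<bar>2 * x * (1 + real k / (1 + e * x\<^sup>2))\<bar> * \<bar>trunc_wt e k x\<bar> \<le> (2 * \<bar>x\<bar> * (1 + real k)) * (1 / e) ^ k"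
    using trunc_wt_le[OF assms, of k x] trunc_wt_nonneg[of e k x] assms
    by (intro mult_mono) (auto simp: abs_mult intro!: mult_left_mono)
  then show ?thesis unfolding trunc_deriv_def abs_mult[symmetric] by (simp add: mult_ac)
qed

lemma trunc_ratio_has_derivative:
  assumes "e \<ge> 0"
  shows "((\<lambda>x. x\<^sup>2 / (1 + e * x\<^sup>2)) has_real_derivative 2 * x / (1 + e * x\<^sup>2)\<^sup>2) (at x)"
proof -
  have "1 + e * x\<^sup>2 \<noteq> 0" using assms by (smt (verit) mult_nonneg_nonneg zero_le_power2)
  then show ?thesis
    by (auto intro!: derivative_eq_intros simp: power2_eq_square field_simps)
qed

text \<open>The exponent \<open>k - 1\<close> is a truncated subtraction; for k = 0 the factor
  \<open>real k\<close> makes it harmless.\<close>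

lemma trunc_wt_has_derivative:
  assumes "e \<ge> 0"
  shows "(trunc_wt e k has_real_derivative
      real k * (2 * x / (1 + e * x\<^sup>2)\<^sup>2) * (x\<^sup>2 / (1 + e * x\<^sup>2)) ^ (k - 1)) (at x)"
  unfolding trunc_wt_def[abs_def]
  using DERIV_power[OF trunc_ratio_has_derivative[OF assms, of x], of k] by (simp add: mult_ac)

lemma trunc_pow_has_derivative:
  assumes "e \<ge> 0"
  shows "(trunc_pow e k has_real_derivative trunc_deriv e k x) (at x)"
proof (cases k)
  case 0
  then show ?thesis unfolding trunc_pow_def[abs_def] trunc_wt_def trunc_deriv_def
    by (auto intro!: derivative_eq_intros)
next
  case (Suc j)
  have "(trunc_pow e k has_real_derivative (2 * x * trunc_wt e k x + x\<^sup>2 *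
      (real k * (2 * x / (1 + e * x\<^sup>2)\<^sup>2) * (x\<^sup>2 / (1 + e * x\<^sup>2)) ^ (k - 1)))) (at x)"
    unfolding trunc_pow_def[abs_def]
    by (rule derivative_eq_intros trunc_wt_has_derivative[OF assms] refl | simp)+
  moreover have "2 * x * trunc_wt e k x + x\<^sup>2 *
      (real k * (2 * x / (1 + e * x\<^sup>2)\<^sup>2) * (x\<^sup>2 / (1 + e * x\<^sup>2)) ^ (k - 1)) = trunc_deriv e k x"
  proof -
    define r where "r = 1 / (1 + e * x\<^sup>2)"
    have "2 * x / (1 + e * x\<^sup>2)\<^sup>2 = 2 * x * r\<^sup>2" "x\<^sup>2 / (1 + e * x\<^sup>2) = x\<^sup>2 * r"
      "real k / (1 + e * x\<^sup>2) = k * r"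
      by (auto simp: r_def power_divide)
    then show ?thesis unfolding trunc_deriv_def trunc_wt_def
      by (simp add: Suc power2_eq_square algebra_simps)
  qed
  ultimately show ?thesis by simp
qed

text \<open>The second derivative is written as \<open>trunc_wt\<close> times an expression in r and
  \<open>e * x^2 * r\<close>. Both lie between 0 and 1, so the expression has an upper bound that
  depends on k alone, not on e.\<close>

lemma trunc_deriv_has_derivative:
  assumes "e \<ge> 0"
  defines "r \<equiv> \<lambda>x. 1 / (1 + e * x\<^sup>2)"
  shows "(trunc_deriv e k has_real_derivative trunc_wt e k x *
     (2 * (1 + k * r x) + 4 * k * r x * (1 + k * r x) - 4 * k * (e * x\<^sup>2 * r x) * r x)) (at x)"
proof -
  have nz: "1 + e * x\<^sup>2 \<noteq> 0" for x using assms by (smt (verit) mult_nonneg_nonneg zero_le_power2)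
  have D1: "((\<lambda>x. 2 * x * (1 + real k / (1 + e * x\<^sup>2))) has_real_derivative
     2 * (1 + k * r x) - 4 * k * (e * x\<^sup>2 * r x) * r x) (at x)"
  proof -
    have "(r has_real_derivative - (2 * e * x) * (r x)\<^sup>2) (at x)"
      using nz[of x] unfolding r_def by (auto intro!: derivative_eq_intros simp: power2_eq_square)
    then have "((\<lambda>x. 2 * x * (1 + real k * r x)) has_real_derivative
        2 * (1 + k * r x) + 2 * x * (real k * (- (2 * e * x) * (r x)\<^sup>2))) (at x)"
      by (auto intro!: derivative_eq_intros)
    then show ?thesis unfolding r_def by (simp add: power2_eq_square algebra_simps)
  qed
  have x: "2 * x * (1 + k * r x) * (real k * (2 * x / (1 + e * x\<^sup>2)\<^sup>2) * (x\<^sup>2 / (1 + e * x\<^sup>2)) ^ (k - 1))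
      = trunc_wt e k x * (4 * k * r x * (1 + k * r x))"
  proof (cases k)
    case (Suc j)
    have "2 * x / (1 + e * x\<^sup>2)\<^sup>2 = 2 * x * (r x)\<^sup>2" "x\<^sup>2 / (1 + e * x\<^sup>2) = x\<^sup>2 * r x"
      by (auto simp: r_def power_divide)
    then show ?thesis unfolding trunc_wt_def
      by (simp add: Suc power2_eq_square algebra_simps)
  qed simp
  have "(trunc_deriv e k has_real_derivative
     (2 * (1 + k * r x) - 4 * k * (e * x\<^sup>2 * r x) * r x) * trunc_wt e k x +
     (real k * (2 * x / (1 + e * x\<^sup>2)\<^sup>2) * (x\<^sup>2 / (1 + e * x\<^sup>2)) ^ (k - 1)) * (2 * x * (1 + real k / (1 + e * x\<^sup>2)))) (at x)"
    unfolding trunc_deriv_def[abs_def]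
    by (rule DERIV_mult[OF D1 trunc_wt_has_derivative[OF assms(1)]])
  then show ?thesis using x unfolding r_def by (simp add: algebra_simps)
qed

text \<open>The polynomial dominates half of \<open>2 * (1 + k) + 4 * k * (1 + k)\<close>, an upper
  bound for the expression multiplying \<open>trunc_wt\<close> in the second derivative;
  \<open>5 ^ k\<close> comes from splitting the weight at the intermediate point by
  \<open>trunc_wt_add\<close>.\<close>

definition trunc_const :: "nat \<Rightarrow> real" where
  "trunc_const k = (1 + 5 * real k + 2 * real k ^ 2) * 5 ^ k"

lemma trunc_const_ge_1: "trunc_const k \<ge> 1"
proof -
  have "(1 + 5 * real k + 2 * real k ^ 2) * 5 ^ k \<ge> 1 * 1" by (intro mult_mono) auto
  then show ?thesis by (simp add: trunc_const_def)
qed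

text \<open>The intermediate point is at most |x| + |y| in absolute value, so the weight there
  splits into a weight at x and a weight at y. The separation prepares the use of independence: x
  will be a variable of the past and y a variable of the past times an increment, and
  \<open>trunc_wt e k y * y^2\<close> is again a truncated power.\<close>

lemma trunc_pow_taylor:
  assumes "e \<ge> 0"
  shows "trunc_pow e k (x + y) \<le> trunc_pow e k x + trunc_deriv e k x * y
           + trunc_const k * (trunc_wt e k x + trunc_wt e k y) * y\<^sup>2"
proof (cases "y = 0")
  case False
  define D where "D = (\<lambda>x. trunc_wt e k x * (let r = 1 / (1 + e * x\<^sup>2) in
     (2 * (1 + k * r) + 4 * k * r * (1 + k * r) - 4 * k * (e * x\<^sup>2 * r) * r)))"
  \<comment> \<open>Taylor's theorem takes a sequence of derivatives, of which only the orders 0, 1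
    and 2 occur; y may be negative, hence the interval from the minimum to the maximum of x and x +
    y.\<close>
  define d where "d = (\<lambda>n::nat. if n = 0 then trunc_pow e k else if n = 1 then trunc_deriv e k else D)"
  have "\<exists>t. (if x + y < x then x + y < t \<and> t < x else x < t \<and> t < x + y) \<and>
      trunc_pow e k (x + y) = (\<Sum>m<2. (d m x / fact m) * (x + y - x) ^ m) + (d 2 t / fact 2) * (x + y - x) ^ 2"
  proof (rule Taylor[where a = "min x (x + y)" and b = "max x (x + y)" and n = 2])
    show "\<forall>m t. m < 2 \<and> min x (x + y) \<le> t \<and> t \<le> max x (x + y) \<longrightarrow> DERIV (d m) t :> d (Suc m) t"
      using trunc_pow_has_derivative[OF assms] trunc_deriv_has_derivative[OF assms]
      by (auto simp: d_def D_def less_2_cases_iff Let_def)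
  qed (use False in \<open>auto simp: d_def\<close>)
  then obtain t where t: "if x + y < x then x + y < t \<and> t < x else x < t \<and> t < x + y"
    and eq: "trunc_pow e k (x + y) = trunc_pow e k x + trunc_deriv e k x * y + (D t / 2) * y\<^sup>2"
    by (auto simp: d_def lessThan_Suc numeral_2_eq_2)
  have tle: "\<bar>t\<bar> \<le> \<bar>x\<bar> + \<bar>y\<bar>" using t by (auto split: if_splits)
  define r where "r = 1 / (1 + e * t\<^sup>2)"
  have p: "1 + e * t\<^sup>2 > 0" using assms by (auto intro!: add_pos_nonneg)
  have r: "0 \<le> r" "r \<le> 1" "0 \<le> e * t\<^sup>2 * r"
    using p assms by (auto simp: r_def)
  have kr: "0 \<le> k * r" "k * r \<le> k" using r by (auto simp: mult_left_le)
  have "k * r * (1 + k * r) \<le> real k * (1 + real k)" using kr by (intro mult_mono) auto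
  then have "2 * (1 + k * r) + 4 * k * r * (1 + k * r) - 4 * k * (e * t\<^sup>2 * r) * r \<le> 2 * (1 + k) + 4 * k * (1 + k)"
    using kr mult_nonneg_nonneg[OF mult_nonneg_nonneg[OF of_nat_0_le_iff[of k] r(3)] r(1)]
    by (simp add: algebra_simps)
  then have "D t \<le> trunc_wt e k t * (2 * (1 + k) + 4 * k * (1 + k))"
    unfolding D_def Let_def r_def[symmetric] using trunc_wt_nonneg[OF assms, of k t] by (intro mult_left_mono) auto
  also have "\<dots> \<le> (5 ^ k * (trunc_wt e k x + trunc_wt e k y)) * (2 * (1 + k) + 4 * k * (1 + k))"
    using trunc_wt_add[OF assms tle, of k] by (intro mult_right_mono) auto
  also have "\<dots> \<le> 2 * trunc_const k * (trunc_wt e k x + trunc_wt e k y)"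
  proof -
    have "(2 * (1 + real k) + 4 * k * (1 + real k)) \<le> 2 * (1 + 5 * real k + 2 * real k ^ 2)"
      by (simp add: power2_eq_square algebra_simps)
    then have "(2 * (1 + real k) + 4 * k * (1 + real k)) * 5 ^ k * (trunc_wt e k x + trunc_wt e k y)
       \<le> 2 * (1 + 5 * real k + 2 * real k ^ 2) * 5 ^ k * (trunc_wt e k x + trunc_wt e k y)"
      using trunc_wt_nonneg[OF assms, of k] by (intro mult_right_mono) auto
    then show ?thesis by (simp add: trunc_const_def algebra_simps)
  qed
  finally have "(D t / 2) * y\<^sup>2 \<le> (trunc_const k * (trunc_wt e k x + trunc_wt e k y)) * y\<^sup>2"
    by (intro mult_right_mono) auto
  then show ?thesis using eq by simp
qed (simp add: trunc_deriv_def trunc_const_def)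

lemma trunc_pow_tendsto:
  "(\<lambda>n. trunc_pow (1 / real (Suc n)) k x) \<longlonglongrightarrow> \<bar>x\<bar> ^ (2 * k + 2)"
proof -
  have "(\<lambda>n. 1 / real (Suc n)) \<longlonglongrightarrow> 0" using LIMSEQ_inverse_real_of_nat by (simp add: inverse_eq_divide)
  then have "(\<lambda>n. trunc_pow (1 / real (Suc n)) k x) \<longlonglongrightarrow> x\<^sup>2 * (x\<^sup>2 / (1 + 0 * x\<^sup>2)) ^ k"
    unfolding trunc_pow_def trunc_wt_def by (intro tendsto_intros) auto
  moreover have "x\<^sup>2 * (x\<^sup>2 / (1 + 0 * x\<^sup>2)) ^ k = (\<bar>x\<bar>\<^sup>2) ^ Suc k" by simp
  ultimately show ?thesis by (simp only: power_mult[symmetric]) simp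
qed

section \<open>Independence of the increments of Brownian motion\<close>

lemma space_natural_filtration [simp]: "space (natural_filtration M B t) = space M"
  unfolding natural_filtration_def by (rule space_measure_of_conv)

lemma sets_natural_filtration:
  "sets (natural_filtration M B t) = sigma_sets (space M)
     ({B s -` A \<inter> space M | s A. s \<in> {0..t} \<and> A \<in> sets borel} \<union> null_sets M)"
  unfolding natural_filtration_def
  by (rule sets_measure_of) (use sets.sets_into_space in \<open>auto simp: null_sets_def\<close>)

lemma sets_natural_filtration_mono:
  assumes "s \<le> t"
  shows "sets (natural_filtration M B s) \<subseteq> sets (natural_filtration M B t)"
  unfolding sets_natural_filtration
proof (intro sigma_sets_mono' Un_mono subset_refl)
  show "{B r -` A \<inter> space M | r A. r \<in> {0..s} \<and> A \<in> sets borel} \<subseteq>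
      {B r -` A \<inter> space M | r A. r \<in> {0..t} \<and> A \<in> sets borel}"
    using assms by fastforce
qed

lemma measurable_natural_filtration_mono:
  assumes "X \<in> borel_measurable (natural_filtration M B s)" "s \<le> t"
  shows "X \<in> borel_measurable (natural_filtration M B t)"
  using assms(1) sets_natural_filtration_mono[OF assms(2), of M B] unfolding measurable_def by auto

lemma measurable_natural_filtration_self:
  assumes "s \<in> {0..t}"
  shows "B s \<in> borel_measurable (natural_filtration M B t)"
proof (rule measurableI)
  fix A :: "real set" assume "A \<in> sets borel"
  then show "B s -` A \<inter> space (natural_filtration M B t) \<in> sets (natural_filtration M B t)"
    using assms by (auto simp: sets_natural_filtration intro!: sigma_sets.Basic)
qed auto

context brownian_motion
begin

abbreviation "F \<equiv> natural_filtration M B"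

lemma sets_filtration_subset:
  assumes "t \<le> T"
  shows "sets (F t) \<subseteq> events"
  unfolding sets_natural_filtration
proof (rule sets.sigma_sets_subset)
  show "{B s -` A \<inter> space M | s A. s \<in> {0..t} \<and> A \<in> sets borel} \<union> null_sets M \<subseteq> events"
    using measurable_B assms by (auto intro: measurable_sets)
qed

lemma measurable_filtrationD:
  assumes "X \<in> borel_measurable (F t)" "t \<le> T"
  shows "X \<in> borel_measurable M"
  using assms(1) sets_filtration_subset[OF assms(2)] unfolding measurable_def by auto

text \<open>The generator used in the definition of the filtration constrains one time only and is
  not stable under intersection; events about finitely many times are.\<close>

definition cylinders :: "real \<Rightarrow> 'a set set" where
  "cylinders s = {{\<omega>\<in>space M. \<forall>r\<in>R. B r \<omega> \<in> A r} | R A. finite R \<and> R \<subseteq> {0..s} \<and> (\<forall>r\<in>R. A r \<in> sets borel)}"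

lemma cylinders_subset:
  assumes "s \<le> T" shows "cylinders s \<subseteq> events"
proof
  fix C assume "C \<in> cylinders s"
  then obtain R A where C: "C = {\<omega>\<in>space M. \<forall>r\<in>R. B r \<omega> \<in> A r}" and R: "finite R" "R \<subseteq> {0..s}"
     "\<forall>r\<in>R. A r \<in> sets borel" by (auto simp: cylinders_def)
  have "{\<omega>\<in>space M. B r \<omega> \<in> A r} \<in> events" if "r \<in> R" for r
    using measurable_sets[OF measurable_B[of r], of "A r"] R assms that
    by (auto simp: vimage_def Int_def conj_commute)
  then show "C \<in> events" unfolding C using R by (intro sets.sets_Collect_finite_All) auto
qed

lemma Int_stable_cylinders_null:
  assumes "s \<le> T"
  shows "Int_stable (cylinders s \<union> null_sets M)"
proof (rule Int_stableI)
  fix a b assume ab: "a \<in> cylinders s \<union> null_sets M" "b \<in> cylinders s \<union> null_sets M"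
  consider "a \<in> null_sets M" | "b \<in> null_sets M" | "a \<in> cylinders s" "b \<in> cylinders s" using ab by auto
  then show "a \<inter> b \<in> cylinders s \<union> null_sets M"
  proof cases
    case 1
    then show ?thesis using ab cylinders_subset[OF assms] null_set_Int2 by (auto intro: null_set_Int2)
  next
    case 2
    then show ?thesis using ab cylinders_subset[OF assms] by (auto intro: null_set_Int1)
  next
    case 3
    then obtain R1 A1 R2 A2 where
      "a = {\<omega>\<in>space M. \<forall>r\<in>R1. B r \<omega> \<in> A1 r}" "finite R1" "R1 \<subseteq> {0..s}" "\<forall>r\<in>R1. A1 r \<in> sets borel"
      "b = {\<omega>\<in>space M. \<forall>r\<in>R2. B r \<omega> \<in> A2 r}" "finite R2" "R2 \<subseteq> {0..s}" "\<forall>r\<in>R2. A2 r \<in> sets borel"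
      unfolding cylinders_def by blast
    \<comment> \<open>A time that occurs in only one of the two index sets is constrained by UNIV in
      the other.\<close>
    then have "a \<inter> b \<in> cylinders s"
      unfolding cylinders_def
      by (auto intro!: exI[of _ "R1 \<union> R2"]
        exI[of _ "\<lambda>r. (if r \<in> R1 then A1 r else UNIV) \<inter> (if r \<in> R2 then A2 r else UNIV)"] split: if_splits)
    then show ?thesis by simp
  qed
qed

text \<open>Up to null sets the values of \<open>B\<close> at finitely many times are functions of the increments
  between these times, because \<open>B 0 = 0\<close>.\<close>

lemma indep_cylinder_increment:
  assumes st: "0 \<le> s" "s \<le> t" "t \<le> T" and C: "C \<in> cylinders s" and D: "D \<in> sets borel"
  shows "prob (C \<inter> ((\<lambda>\<omega>. B t \<omega> - B s \<omega>) -` D \<inter> space M))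
    = prob C * prob ((\<lambda>\<omega>. B t \<omega> - B s \<omega>) -` D \<inter> space M)"
proof -
  obtain R A where C': "C = {\<omega>\<in>space M. \<forall>r\<in>R. B r \<omega> \<in> A r}" and R: "finite R" "R \<subseteq> {0..s}"
     "\<And>r. r \<in> R \<Longrightarrow> A r \<in> sets borel" using C by (auto simp: cylinders_def)
  \<comment> \<open>The time 0 is added so that the increments sum up to the values of B, and s is
    added so that the increment number m, after t has been appended, is exactly
    \<open>B t - B s\<close>.\<close>
  define \<rho> where "\<rho> = sorted_list_of_set (insert 0 (insert s R))"
  define m where "m = length \<rho> - 1"
  define \<tau> where "\<tau> = (\<lambda>i. (\<rho> @ [t]) ! i)"
  define X where "X = (\<lambda>i \<omega>. B (\<tau> (Suc i)) \<omega> - B (\<tau> i) \<omega>)"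
  have set\<rho>: "set \<rho> = insert 0 (insert s R)" and sorted: "sorted \<rho>"
    unfolding \<rho>_def using R by (auto simp del: sorted_list_of_set.fold_insort_key.remove
      sorted_list_of_set_insert_remove intro: sorted_sorted_list_of_set)
  have len: "length \<rho> = Suc m" using set\<rho> by (cases \<rho>) (auto simp: m_def)
  have \<tau>le: "\<tau> i = \<rho> ! i" "\<tau> i \<in> {0..s}" if "i \<le> m" for i
  proof -
    show "\<tau> i = \<rho> ! i" using that len by (simp add: \<tau>_def nth_append)
    moreover have "\<rho> ! i \<in> set \<rho>" using that len by simp
    ultimately show "\<tau> i \<in> {0..s}" using set\<rho> R st by auto
  qed
  have \<tau>t: "\<tau> (Suc m) = t" using len by (simp add: \<tau>_def nth_append)
  have ex: "\<exists>i\<le>m. \<tau> i = r" if "r \<in> insert 0 (insert s R)" for r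
  proof -
    have "r \<in> set \<rho>" using that set\<rho> by simp
    then obtain i where "i < length \<rho>" "\<rho> ! i = r" by (auto simp: in_set_conv_nth)
    then show ?thesis using \<tau>le(1)[of i] len by (intro exI[of _ i]) auto
  qed
  have mono: "\<tau> i \<le> \<tau> j" if "i \<le> j" "j \<le> m" for i j
    using that sorted_nth_mono[OF sorted, of i j] len by (simp add: \<tau>le)
  have \<tau>0: "\<tau> 0 = 0"
  proof -
    obtain i where "i \<le> m" "\<tau> i = 0" using ex[of 0] by auto
    then show ?thesis using mono[of 0 i] \<tau>le(2)[of 0] by auto
  qed
  have \<tau>m: "\<tau> m = s" using ex[of s] mono[of _ m] \<tau>le(2)[of m] by (auto intro!: order.antisym)
  define idx where "idx = (\<lambda>r. SOME i. i \<le> m \<and> \<tau> i = r)"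
  have idx: "idx r \<le> m" "\<tau> (idx r) = r" if "r \<in> R" for r
    using someI_ex[of "\<lambda>i. i \<le> m \<and> \<tau> i = r"] ex[of r] that unfolding idx_def by auto
  have indep: "indep_vars (\<lambda>_. borel) X {..<Suc m}"
    unfolding X_def
  proof (rule indep_increments)
    show "\<forall>i<Suc m. \<tau> i \<le> \<tau> (Suc i)"
      using mono \<tau>t \<tau>m st by (auto simp: less_Suc_eq)
  qed (use \<tau>0 \<tau>t st in auto)
  have restr: "indep_var (PiM {..<m} (\<lambda>_. borel)) (\<lambda>\<omega>. \<lambda>i\<in>{..<m}. X i \<omega>)
      (PiM {m} (\<lambda>_. borel)) (\<lambda>\<omega>. \<lambda>i\<in>{m}. X i \<omega>)"
    by (rule indep_var_restrict[OF indep]) auto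
  \<comment> \<open>The cylinder event becomes a function of the increments with index below m, a
    block that is independent of increment m.\<close>
  define h where "h = (\<lambda>x. indicator {x. \<forall>r\<in>R. (\<Sum>i<idx r. x i) \<in> A r} x :: real)"
  have hm: "h \<in> borel_measurable (PiM {..<m} (\<lambda>_. borel))"
  proof -
    have *: "{x \<in> space (PiM {..<m} (\<lambda>_. borel)). \<forall>r\<in>R. (\<Sum>i<idx r. x i) \<in> A r} \<in> sets (PiM {..<m} (\<lambda>_. borel))"
    proof (rule sets.sets_Collect_finite_All)
      fix r assume r: "r \<in> R"
      have [measurable]: "A r \<in> sets borel" using R r by auto
      have "(\<lambda>x. \<Sum>i<idx r. x i :: real) \<in> borel_measurable (PiM {..<m} (\<lambda>_. borel))"
        using idx[OF r] by (intro borel_measurable_sum measurable_component_singleton) auto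
      from measurable_sets[OF this, of "A r"]
      show "{x \<in> space (PiM {..<m} (\<lambda>_. borel)). (\<Sum>i<idx r. x i) \<in> A r} \<in> sets (PiM {..<m} (\<lambda>_. borel))"
        by (simp add: vimage_def Int_def conj_commute)
    qed (use R in auto)
    show ?thesis unfolding h_def by (rule borel_measurable_indicator') (use * in simp)
  qed
  have ind: "indep_var borel (\<lambda>\<omega>. h (\<lambda>i\<in>{..<m}. X i \<omega>)) borel (\<lambda>\<omega>. X m \<omega>)"
    using indep_var_compose[OF restr hm, of "\<lambda>x. x m" borel] by (simp add: comp_def measurable_component_singleton)
  define C2 where "C2 = {\<omega>\<in>space M. \<forall>r\<in>R. (\<Sum>i<idx r. X i \<omega>) \<in> A r}"
  have heq: "h (\<lambda>i\<in>{..<m}. X i \<omega>) = indicator C2 \<omega>" if "\<omega> \<in> space M" for \<omega>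
  proof -
    have "(\<Sum>i<idx r. (\<lambda>i\<in>{..<m}. X i \<omega>) i) = (\<Sum>i<idx r. X i \<omega>)" if "r \<in> R" for r
      using idx(1)[OF that] by (intro sum.cong) auto
    then show ?thesis using that unfolding h_def C2_def by (auto simp: indicator_def)
  qed
  have "prob ((\<lambda>\<omega>. h (\<lambda>i\<in>{..<m}. X i \<omega>)) -` {1} \<inter> space M \<inter> (X m -` D \<inter> space M))
     = prob ((\<lambda>\<omega>. h (\<lambda>i\<in>{..<m}. X i \<omega>)) -` {1} \<inter> space M) * prob (X m -` D \<inter> space M)"
    using indep_varD[OF ind, of "{1}" D] D by (simp add: vimage_def Int_def conj_ac)
  moreover have "(\<lambda>\<omega>. h (\<lambda>i\<in>{..<m}. X i \<omega>)) -` {1} \<inter> space M = C2"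
    using heq by (auto simp: C2_def indicator_def split: if_splits)
  moreover have Xm: "X m = (\<lambda>\<omega>. B t \<omega> - B s \<omega>)" by (simp add: X_def \<tau>t \<tau>m)
  ultimately have main: "prob (C2 \<inter> (X m -` D \<inter> space M)) = prob C2 * prob (X m -` D \<inter> space M)"
    by simp
  have C2ev: "C2 \<in> events"
  proof -
    have rv: "random_variable borel (X i)" if "i < Suc m" for i
      using indep that unfolding indep_vars_def2 by auto
    show ?thesis unfolding C2_def
    proof (rule sets.sets_Collect_finite_All)
      fix r assume r: "r \<in> R"
      have "(\<lambda>\<omega>. \<Sum>i<idx r. X i \<omega>) \<in> borel_measurable M"
        using idx[OF r] rv by (intro borel_measurable_sum) auto
      from measurable_sets[OF this, of "A r"] R r
      show "{\<omega> \<in> space M. (\<Sum>i<idx r. X i \<omega>) \<in> A r} \<in> events"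
        by (simp add: vimage_def Int_def conj_commute)
    qed (use R in auto)
  qed
  have Cev: "C \<in> events" using C cylinders_subset[of s] st by auto
  have Dev: "X m -` D \<inter> space M \<in> events"
    using indep D unfolding indep_vars_def2 by (auto intro!: measurable_sets)
  have AE: "AE \<omega> in M. \<omega> \<in> C \<longleftrightarrow> \<omega> \<in> C2"
    using B_zero
  proof eventually_elim
    case (elim \<omega>)
    have "(\<Sum>i<idx r. X i \<omega>) = B r \<omega>" if "r \<in> R" for r
      unfolding X_def using sum_lessThan_telescope[of "\<lambda>i. B (\<tau> i) \<omega>" "idx r"] idx[OF that] \<tau>0 elim by simp
    then show ?case by (auto simp: C' C2_def)
  qed
  have "prob C = prob C2" using AE Cev C2ev by (intro measure_eq_AE) auto
  moreover have "prob (C \<inter> (X m -` D \<inter> space M)) = prob (C2 \<inter> (X m -` D \<inter> space M))"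
    using AE Cev C2ev Dev by (intro measure_eq_AE) (auto elim!: AE_mp)
  ultimately show ?thesis using main by (simp add: Xm)
qed

text \<open>Independence of cylinders and increment events extends to the generated sigma-algebras
  because both generators are stable under intersection. The null sets that augment the filtration
  can be added to the cylinders: they multiply trivially with every event and preserve
  stability.\<close>

lemma indep_filtration_increment:
  assumes st: "0 \<le> s" "s \<le> t" "t \<le> T" and Z: "Z \<in> borel_measurable (F s)"
  shows "indep_var borel Z borel (\<lambda>\<omega>. B t \<omega> - B s \<omega>)"
proof -
  let ?D = "{(\<lambda>\<omega>. B t \<omega> - B s \<omega>) -` A \<inter> space M | A. A \<in> sets borel}"
  have [measurable]: "B s \<in> borel_measurable M" "B t \<in> borel_measurable M"
    using measurable_B st by auto
  have Dsub: "?D \<subseteq> events" by auto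
  have "indep_set (cylinders s \<union> null_sets M) ?D"
    unfolding indep_sets2_eq
  proof (intro conjI ballI)
    show "cylinders s \<union> null_sets M \<subseteq> events" using cylinders_subset[of s] st by auto
    fix a b assume a: "a \<in> cylinders s \<union> null_sets M" and b: "b \<in> ?D"
    show "prob (a \<inter> b) = prob a * prob b"
    proof (cases "a \<in> null_sets M")
      case True
      then have "a \<inter> b \<in> null_sets M" using Dsub b by (auto intro: null_set_Int2)
      then show ?thesis using True by (simp add: measure_eq_0_null_sets)
    next
      case False
      then show ?thesis using a b indep_cylinder_increment[OF st] by auto
    qed
  qed (use Dsub in auto)
  then have I: "indep_set (sigma_sets (space M) (cylinders s \<union> null_sets M)) (sigma_sets (space M) ?D)"
  proof (rule indep_set_sigma_sets)
    show "Int_stable ?D"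
    proof (rule Int_stableI, clarify)
      fix A A' :: "real set" assume "A \<in> sets borel" "A' \<in> sets borel"
      then show "\<exists>A''. (\<lambda>\<omega>. B t \<omega> - B s \<omega>) -` A \<inter> space M \<inter> ((\<lambda>\<omega>. B t \<omega> - B s \<omega>) -` A' \<inter> space M)
        = (\<lambda>\<omega>. B t \<omega> - B s \<omega>) -` A'' \<inter> space M \<and> A'' \<in> sets borel"
        by (intro exI[of _ "A \<inter> A'"]) auto
    qed
  qed (use Int_stable_cylinders_null[of s] st in auto)
  have sub: "sets (F s) \<subseteq> sigma_sets (space M) (cylinders s \<union> null_sets M)"
    unfolding sets_natural_filtration
  proof (rule sigma_sets_mono')
    show "{B r -` A \<inter> space M | r A. r \<in> {0..s} \<and> A \<in> sets borel} \<union> null_sets M \<subseteq> cylinders s \<union> null_sets M"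
    proof (intro Un_mono subset_refl subsetI, clarify)
      fix r and A :: "real set" assume "r \<in> {0..s}" "A \<in> sets borel"
      then show "B r -` A \<inter> space M \<in> cylinders s"
        unfolding cylinders_def by (intro CollectI exI[of _ "{r}"] exI[of _ "\<lambda>_. A"]) auto
    qed
  qed
  have Zsub: "sigma_sets (space M) {Z -` A \<inter> space M | A. A \<in> sets borel} \<subseteq> sets (F s)"
    using measurable_sets[OF Z] by (intro sets.sigma_sets_subset[of _ "F s", simplified]) auto
  have "indep_set (sigma_sets (space M) {Z -` A \<inter> space M | A. A \<in> sets borel}) (sigma_sets (space M) ?D)"
    using I Zsub sub unfolding indep_sets2_eq by blast
  then show ?thesis unfolding indep_var_eq using measurable_filtrationD[OF Z] st by auto
qed

end

section \<open>Truncated moments of Ito integrals\<close>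

lemma nn_integral_powr_kernel:
  fixes \<theta> t :: real
  assumes "\<theta> > 0" "t \<ge> 0"
  shows "(\<integral>\<^sup>+s\<in>{0..t}. ennreal ((t - s) powr (\<theta> - 1)) \<partial>lborel) = ennreal (t powr \<theta> / \<theta>)"
proof -
  have "((\<lambda>x. x powr (\<theta> - 1)) has_integral (t powr \<theta> / \<theta>)) {0..t}"
    using has_integral_powr_from_0[of "\<theta> - 1" t] assms by simp
  then have "((\<lambda>x. if x \<in> {0..t} then x powr (\<theta> - 1) else 0) has_integral (t powr \<theta> / \<theta>)) UNIV"
    unfolding has_integral_restrict_UNIV .
  then have "((\<lambda>x. indicator {0..t} x * x powr (\<theta> - 1)) has_integral (t powr \<theta> / \<theta>)) UNIV"
    by (rule has_integral_eq[rotated]) (auto simp: indicator_def)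
  then have "(\<integral>\<^sup>+x. ennreal (indicator {0..t} x * x powr (\<theta> - 1)) \<partial>lborel) = ennreal (t powr \<theta> / \<theta>)"
    by (intro nn_integral_has_integral_lborel) auto
  also have "(\<integral>\<^sup>+x. ennreal (indicator {0..t} x * x powr (\<theta> - 1)) \<partial>lborel)
      = (\<integral>\<^sup>+s. ennreal (indicator {0..t} (t + (-1) * s) * (t + (-1) * s) powr (\<theta> - 1)) \<partial>lborel)"
    by (subst nn_integral_real_affine[where c="-1" and t=t]) auto
  also have "\<dots> = (\<integral>\<^sup>+s\<in>{0..t}. ennreal ((t - s) powr (\<theta> - 1)) \<partial>lborel)"
    by (intro nn_integral_cong) (auto simp: indicator_def)
  finally show ?thesis by simp
qed

text \<open>Each factor \<open>1 + a j\<close> is at most \<open>exp (a j)\<close>. Working in the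
  extended nonnegative reals, u and b may be infinite.\<close>

lemma discrete_gronwall_ennreal:
  fixes u b :: "nat \<Rightarrow> ennreal" and a :: "nat \<Rightarrow> real"
  assumes "u 0 = 0" "\<And>j. j < n \<Longrightarrow> u (Suc j) \<le> ennreal (1 + a j) * u j + b j" "\<And>j. j < n \<Longrightarrow> a j \<ge> 0"
  shows "u n \<le> ennreal (exp (\<Sum>j<n. a j)) * (\<Sum>j<n. b j)"
  using assms(2,3)
proof (induction n)
  case (Suc n)
  have ih: "u n \<le> ennreal (exp (\<Sum>j<n. a j)) * (\<Sum>j<n. b j)" using Suc by auto
  have "u (Suc n) \<le> ennreal (1 + a n) * u n + b n" using Suc.prems(1)[of n] by simp
  also have "\<dots> \<le> ennreal (exp (a n)) * (ennreal (exp (\<Sum>j<n. a j)) * (\<Sum>j<n. b j)) + ennreal (exp (\<Sum>j<Suc n. a j)) * b n"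
  proof (intro add_mono mult_mono ih ennreal_leI exp_ge_add_one_self)
    have "0 \<le> (\<Sum>j<Suc n. a j)" using Suc.prems(2) by (intro sum_nonneg) auto
    then have "1 \<le> ennreal (exp (\<Sum>j<Suc n. a j))" by (simp add: one_le_exp_iff ennreal_ge_1)
    then show "b n \<le> ennreal (exp (\<Sum>j<Suc n. a j)) * b n"
      using mult_right_mono[of 1 _ "b n"] by simp
  qed auto
  also have "\<dots> = ennreal (exp (\<Sum>j<Suc n. a j)) * (\<Sum>j<Suc n. b j)"
    by (simp add: exp_add ennreal_mult[symmetric] mult.assoc[symmetric] mult.commute distrib_left distrib_right)
  finally show ?case .
qed (simp add: assms(1))

text \<open>For a standard normal N this is the expectation of \<open>N^2 * (1 + N^2) ^ k\<close>,
  the factor that \<open>trunc_pow_scale\<close> produces when N is pulled out of a truncated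
  power.\<close>

definition normal_const :: "nat \<Rightarrow> real" where
  "normal_const k = (\<integral>x. std_normal_density x * (x\<^sup>2 * (1 + x\<^sup>2) ^ k) \<partial>lborel)"

lemma integrable_normal_const:
  "integrable lborel (\<lambda>x. std_normal_density x * (x\<^sup>2 * (1 + x\<^sup>2) ^ k))"
proof -
  have "x\<^sup>2 * (1 + x\<^sup>2) ^ k = (\<Sum>j\<le>k. real (k choose j) * x ^ (2 * (k - j) + 2))" for x :: real
    unfolding binomial_ring[of 1 "x\<^sup>2" k]
    by (simp only: sum_distrib_left power_add power_mult power_one) (simp add: mult_ac)
  then have "std_normal_density x * (x\<^sup>2 * (1 + x\<^sup>2) ^ k)
      = (\<Sum>j\<le>k. real (k choose j) * (std_normal_density x * x ^ (2 * (k - j) + 2)))" for x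
    by (simp add: sum_distrib_left mult_ac)
  moreover have "integrable lborel (\<lambda>x. \<Sum>j\<le>k. real (k choose j) * (std_normal_density x * x ^ (2 * (k - j) + 2)))"
    by (intro Bochner_Integration.integrable_sum integrable_mult_right integrable_std_normal_moment)
  ultimately show ?thesis by simp
qed

lemma normal_const_nonneg: "normal_const k \<ge> 0"
  unfolding normal_const_def by (intro integral_nonneg_AE) auto

context brownian_motion
begin

text \<open>S and \<xi> are known at time s, and the standardised increment N is independent of them
  with mean 0 and variance 1. In the Taylor expansion the linear term therefore has expectation 0,
  the term with the weight of S keeps only its factor known at time s, and in the term with the
  weight of the increment N is pulled out, which leaves \<open>normal_const\<close>. The square
  integrability of the sum is carried along because it makes all these terms integrable.\<close>

lemma trunc_pow_increment:
  assumes st: "0 \<le> s" "s < t" "t \<le> T" and e: "e > 0"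
    and S: "S \<in> borel_measurable (F s)" and \<xi>: "\<xi> \<in> borel_measurable (F s)"
    and bd: "\<And>\<omega>. \<omega> \<in> space M \<Longrightarrow> \<bar>\<xi> \<omega>\<bar> \<le> K"
    and S2: "integrable M (\<lambda>\<omega>. (S \<omega>)\<^sup>2)"
  defines "S' \<equiv> \<lambda>\<omega>. S \<omega> + \<xi> \<omega> * (B t \<omega> - B s \<omega>)" and "\<eta> \<equiv> \<lambda>\<omega>. \<xi> \<omega> * sqrt (t - s)"
  shows "integrable M (\<lambda>\<omega>. (S' \<omega>)\<^sup>2)"
    and "(\<integral>\<^sup>+\<omega>. ennreal (trunc_pow e k (S' \<omega>)) \<partial>M) \<le> (\<integral>\<^sup>+\<omega>. ennreal (trunc_pow e k (S \<omega>)) \<partial>M)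
      + ennreal (trunc_const k) * ((\<integral>\<^sup>+\<omega>. ennreal (trunc_wt e k (S \<omega>) * (\<eta> \<omega>)\<^sup>2) \<partial>M)
      + ennreal (normal_const k) * (\<integral>\<^sup>+\<omega>. ennreal (trunc_pow e k (\<eta> \<omega>)) \<partial>M))"
proof -
  define N where "N = (\<lambda>\<omega>. (B t \<omega> - B s \<omega>) / sqrt (t - s))"
  have pos: "sqrt (t - s) > 0" using st by simp
  have S'eq: "S' \<omega> = S \<omega> + \<eta> \<omega> * N \<omega>" for \<omega> using pos by (simp add: S'_def \<eta>_def N_def)
  have [measurable]: "B s \<in> borel_measurable M" "B t \<in> borel_measurable M"
    using measurable_B st by auto
  have [measurable]: "S \<in> borel_measurable M" "\<xi> \<in> borel_measurable M" "\<eta> \<in> borel_measurable M" "N \<in> borel_measurable M"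
    using measurable_filtrationD[OF S] measurable_filtrationD[OF \<xi>] st unfolding N_def \<eta>_def by auto
  have Nd: "distributed M lborel N std_normal_density"
    using normal_increments[of s t] normal_standard_normal_convert[OF pos, of _ 0] st by (simp add: N_def)
  have ind: "indep_var borel Z borel (\<lambda>\<omega>. h (N \<omega>))"
    if "Z \<in> borel_measurable (F s)" "h \<in> borel_measurable borel" for Z and h :: "real \<Rightarrow> real"
  proof -
    have "indep_var borel (id \<circ> Z) borel ((\<lambda>x. h (x / sqrt (t - s))) \<circ> (\<lambda>\<omega>. B t \<omega> - B s \<omega>))"
      by (rule indep_var_compose[OF indep_filtration_increment]) (use st that in auto)
    then show ?thesis by (simp add: comp_def N_def)
  qed
  have Nint: "integrable M (\<lambda>\<omega>. h (N \<omega>)) \<longleftrightarrow> integrable lborel (\<lambda>x. std_normal_density x * h x)"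
    and Nexp: "expectation (\<lambda>\<omega>. h (N \<omega>)) = (\<integral>x. std_normal_density x * h x \<partial>lborel)"
    if "h \<in> borel_measurable borel" for h :: "real \<Rightarrow> real"
    using distributed_integrable[OF Nd, of h] distributed_integral[OF Nd, of h] that by auto
  have N2int: "integrable M (\<lambda>\<omega>. (N \<omega>)\<^sup>2)"
    using Nint[of "\<lambda>x. x\<^sup>2"] integrable_std_normal_moment[of 2] by simp
  have N2: "expectation (\<lambda>\<omega>. (N \<omega>)\<^sup>2) = 1"
    using Nexp[of "\<lambda>x. x\<^sup>2"] integral_std_normal_moment_even[of 1] by simp
  have N1int: "integrable M N" using Nint[of "\<lambda>x. x"] integrable_std_normal_moment[of 1] by simp
  have N1: "expectation N = 0" using Nexp[of "\<lambda>x. x"] integral_std_normal_moment_odd[of 0] by simp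
  have \<eta>F: "\<eta> \<in> borel_measurable (F s)" unfolding \<eta>_def using \<xi> by measurable
  define K' where "K' = K * sqrt (t - s)"
  have \<eta>bd: "\<bar>\<eta> \<omega>\<bar> \<le> K'" if "\<omega> \<in> space M" for \<omega>
    using bd[OF that] pos unfolding \<eta>_def K'_def by (simp add: abs_mult mult_right_mono)
  have \<eta>2bd: "(\<eta> \<omega>)\<^sup>2 \<le> K'\<^sup>2" if "\<omega> \<in> space M" for \<omega>
    using \<eta>bd[OF that] by (metis abs_le_square_iff abs_ge_self order_trans)
  have \<eta>2: "integrable M (\<lambda>\<omega>. (\<eta> \<omega>)\<^sup>2)"
    by (rule integrable_const_bound[of _ "K'\<^sup>2"]) (use \<eta>2bd in auto)
  have \<eta>N2: "integrable M (\<lambda>\<omega>. (\<eta> \<omega>)\<^sup>2 * (N \<omega>)\<^sup>2)"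
    by (rule indep_var_integrable[OF ind]) (use \<eta>F \<eta>2 N2int in auto)
  show S'2: "integrable M (\<lambda>\<omega>. (S' \<omega>)\<^sup>2)"
  proof (rule Bochner_Integration.integrable_bound)
    show "integrable M (\<lambda>\<omega>. 2 * (S \<omega>)\<^sup>2 + 2 * ((\<eta> \<omega>)\<^sup>2 * (N \<omega>)\<^sup>2))" using S2 \<eta>N2 by auto
    show "AE \<omega> in M. norm ((S' \<omega>)\<^sup>2) \<le> norm (2 * (S \<omega>)\<^sup>2 + 2 * ((\<eta> \<omega>)\<^sup>2 * (N \<omega>)\<^sup>2))"
    proof (rule AE_I2)
      fix \<omega>
      have "(S' \<omega>)\<^sup>2 \<le> 2 * (S \<omega>)\<^sup>2 + 2 * ((\<eta> \<omega>)\<^sup>2 * (N \<omega>)\<^sup>2)"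
        unfolding S'eq using sum_squares_bound[of "S \<omega>" "\<eta> \<omega> * N \<omega>"]
        by (simp add: power2_sum power_mult_distrib mult_ac)
      then show "norm ((S' \<omega>)\<^sup>2) \<le> norm (2 * (S \<omega>)\<^sup>2 + 2 * ((\<eta> \<omega>)\<^sup>2 * (N \<omega>)\<^sup>2))" by simp
    qed
    show "(\<lambda>\<omega>. (S' \<omega>)\<^sup>2) \<in> borel_measurable M" unfolding S'eq[abs_def] by measurable
  qed
  have fint: "integrable M (\<lambda>\<omega>. trunc_pow e k (Z \<omega>))"
    if "integrable M (\<lambda>\<omega>. (Z \<omega>)\<^sup>2)" "Z \<in> borel_measurable M" for Z
  proof (rule Bochner_Integration.integrable_bound)
    show "integrable M (\<lambda>\<omega>. (1/e)^k * (Z \<omega>)\<^sup>2)" using that by auto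
    show "AE \<omega> in M. norm (trunc_pow e k (Z \<omega>)) \<le> norm ((1/e)^k * (Z \<omega>)\<^sup>2)"
      using trunc_pow_le_square[OF e] trunc_pow_nonneg[of e] e by auto
  qed (use that in measurable)
  have Sint: "integrable M S" and \<eta>int: "integrable M \<eta>"
    using S2 \<eta>2 by (auto intro: square_integrable_imp_integrable)
  have gF: "(\<lambda>\<omega>. trunc_deriv e k (S \<omega>) * \<eta> \<omega>) \<in> borel_measurable (F s)" using S \<eta>F by measurable
  have gint: "integrable M (\<lambda>\<omega>. trunc_deriv e k (S \<omega>) * \<eta> \<omega>)"
  proof (rule Bochner_Integration.integrable_bound)
    show "integrable M (\<lambda>\<omega>. 2 * (1 + real k) * (1 / e) ^ k * \<bar>S \<omega>\<bar> * K')" using Sint by auto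
    show "AE \<omega> in M. norm (trunc_deriv e k (S \<omega>) * \<eta> \<omega>) \<le> norm (2 * (1 + real k) * (1 / e) ^ k * \<bar>S \<omega>\<bar> * K')"
    proof (rule AE_I2)
      fix \<omega> assume "\<omega> \<in> space M"
      then have "\<bar>trunc_deriv e k (S \<omega>)\<bar> * \<bar>\<eta> \<omega>\<bar> \<le> 2 * (1 + real k) * (1 / e) ^ k * \<bar>S \<omega>\<bar> * K'"
        by (intro mult_mono trunc_deriv_le e \<eta>bd) (use e in auto)
      then show "norm (trunc_deriv e k (S \<omega>) * \<eta> \<omega>) \<le> norm (2 * (1 + real k) * (1 / e) ^ k * \<bar>S \<omega>\<bar> * K')"
        unfolding real_norm_def abs_mult[of "trunc_deriv e k (S \<omega>)"] by (rule order_trans[OF _ abs_ge_self])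
    qed
  qed measurable
  have g0: "expectation (\<lambda>\<omega>. trunc_deriv e k (S \<omega>) * \<eta> \<omega> * N \<omega>) = 0"
    and gNint: "integrable M (\<lambda>\<omega>. trunc_deriv e k (S \<omega>) * \<eta> \<omega> * N \<omega>)"
    using indep_var_lebesgue_integral[OF ind[OF gF, of "\<lambda>x. x"] gint]
      indep_var_integrable[OF ind[OF gF, of "\<lambda>x. x"] gint] N1int N1 by auto
  have wF: "(\<lambda>\<omega>. trunc_wt e k (S \<omega>) * (\<eta> \<omega>)\<^sup>2) \<in> borel_measurable (F s)" using S \<eta>F by measurable
  have wint: "integrable M (\<lambda>\<omega>. trunc_wt e k (S \<omega>) * (\<eta> \<omega>)\<^sup>2)"
    by (rule integrable_const_bound[of _ "(1/e)^k * K'\<^sup>2"])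
      (use e trunc_wt_le[OF e, of k] \<eta>2bd trunc_wt_nonneg[of e k] in
        \<open>auto simp: abs_mult intro!: mult_mono\<close>)
  have w1: "expectation (\<lambda>\<omega>. trunc_wt e k (S \<omega>) * (\<eta> \<omega>)\<^sup>2 * (N \<omega>)\<^sup>2) = expectation (\<lambda>\<omega>. trunc_wt e k (S \<omega>) * (\<eta> \<omega>)\<^sup>2)"
    and wNint: "integrable M (\<lambda>\<omega>. trunc_wt e k (S \<omega>) * (\<eta> \<omega>)\<^sup>2 * (N \<omega>)\<^sup>2)"
    using indep_var_lebesgue_integral[OF ind[OF wF, of "\<lambda>x. x\<^sup>2"] wint]
      indep_var_integrable[OF ind[OF wF, of "\<lambda>x. x\<^sup>2"] wint] N2int N2 by auto
  have fF: "(\<lambda>\<omega>. trunc_pow e k (\<eta> \<omega>)) \<in> borel_measurable (F s)" using \<eta>F by measurable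
  define nm :: "real \<Rightarrow> real" where "nm = (\<lambda>x. x\<^sup>2 * (1 + x\<^sup>2) ^ k)"
  have [measurable]: "nm \<in> borel_measurable borel" unfolding nm_def by measurable
  have nmint: "integrable M (\<lambda>\<omega>. nm (N \<omega>))" and nmexp: "expectation (\<lambda>\<omega>. nm (N \<omega>)) = normal_const k"
    using Nint[of nm] Nexp[of nm] integrable_normal_const[of k] by (auto simp: nm_def normal_const_def)
  have f1: "expectation (\<lambda>\<omega>. trunc_pow e k (\<eta> \<omega>) * nm (N \<omega>)) = expectation (\<lambda>\<omega>. trunc_pow e k (\<eta> \<omega>)) * normal_const k"
    and fNint: "integrable M (\<lambda>\<omega>. trunc_pow e k (\<eta> \<omega>) * nm (N \<omega>))"
    using indep_var_lebesgue_integral[OF ind[OF fF, of nm] fint[OF \<eta>2]]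
      indep_var_integrable[OF ind[OF fF, of nm] fint[OF \<eta>2]] nmint nmexp by auto
  \<comment> \<open>The Taylor expansion is applied with \<eta> N as the increment. Its last term is
    a truncated power of \<eta> N, to which \<open>trunc_pow_scale\<close> is applied at each
    \<omega> with the random factor N.\<close>
  have pw: "trunc_pow e k (S' \<omega>) \<le> trunc_pow e k (S \<omega>) + trunc_deriv e k (S \<omega>) * \<eta> \<omega> * N \<omega>
      + trunc_const k * (trunc_wt e k (S \<omega>) * (\<eta> \<omega>)\<^sup>2 * (N \<omega>)\<^sup>2 + trunc_pow e k (\<eta> \<omega>) * nm (N \<omega>))" for \<omega>
  proof -
    have "trunc_pow e k (S' \<omega>) \<le> trunc_pow e k (S \<omega>) + trunc_deriv e k (S \<omega>) * (\<eta> \<omega> * N \<omega>)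
      + trunc_const k * (trunc_wt e k (S \<omega>) * (\<eta> \<omega> * N \<omega>)\<^sup>2 + trunc_pow e k (\<eta> \<omega> * N \<omega>))"
      using trunc_pow_taylor[of e k "S \<omega>" "\<eta> \<omega> * N \<omega>"] e
      by (simp add: S'eq trunc_pow_def algebra_simps)
    also have "trunc_pow e k (\<eta> \<omega> * N \<omega>) \<le> trunc_pow e k (\<eta> \<omega>) * nm (N \<omega>)"
      using trunc_pow_scale[of e k "N \<omega>" "\<eta> \<omega>"] e by (simp add: nm_def mult_ac)
    finally show ?thesis using trunc_const_ge_1[of k]
      by (simp add: power_mult_distrib mult.assoc)
  qed
  have main: "expectation (\<lambda>\<omega>. trunc_pow e k (S' \<omega>)) \<le> expectation (\<lambda>\<omega>. trunc_pow e k (S \<omega>))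
     + trunc_const k * (expectation (\<lambda>\<omega>. trunc_wt e k (S \<omega>) * (\<eta> \<omega>)\<^sup>2)
     + normal_const k * expectation (\<lambda>\<omega>. trunc_pow e k (\<eta> \<omega>)))"
  proof -
    have S'm: "S' \<in> borel_measurable M" unfolding S'eq[abs_def] by measurable
    have "expectation (\<lambda>\<omega>. trunc_pow e k (S' \<omega>)) \<le> expectation (\<lambda>\<omega>. trunc_pow e k (S \<omega>) + trunc_deriv e k (S \<omega>) * \<eta> \<omega> * N \<omega>
      + trunc_const k * (trunc_wt e k (S \<omega>) * (\<eta> \<omega>)\<^sup>2 * (N \<omega>)\<^sup>2 + trunc_pow e k (\<eta> \<omega>) * nm (N \<omega>)))"
      by (intro integral_mono pw fint S'2 S'm Bochner_Integration.integrable_add S2 integrable_mult_right gNint wNint fNint) auto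
    also have "\<dots> = expectation (\<lambda>\<omega>. trunc_pow e k (S \<omega>)) + 0 + trunc_const k *
        (expectation (\<lambda>\<omega>. trunc_wt e k (S \<omega>) * (\<eta> \<omega>)\<^sup>2) + expectation (\<lambda>\<omega>. trunc_pow e k (\<eta> \<omega>)) * normal_const k)"
      using fint[OF S2] gNint wNint fNint by (simp add: g0 w1 f1)
    finally show ?thesis by (simp add: mult.commute)
  qed
  have nonneg: "expectation (\<lambda>\<omega>. trunc_wt e k (S \<omega>) * (\<eta> \<omega>)\<^sup>2) \<ge> 0" "expectation (\<lambda>\<omega>. trunc_pow e k (\<eta> \<omega>)) \<ge> 0"
     "expectation (\<lambda>\<omega>. trunc_pow e k (S \<omega>)) \<ge> 0"
    using trunc_wt_nonneg[of e k] trunc_pow_nonneg[of e k] e by (auto intro!: integral_nonneg_AE)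
  have conv: "(\<integral>\<^sup>+\<omega>. ennreal (h \<omega>) \<partial>M) = ennreal (expectation h)"
    if "integrable M h" "\<And>\<omega>. h \<omega> \<ge> 0" for h using that by (intro nn_integral_eq_integral) auto
  have S'm: "S' \<in> borel_measurable M" unfolding S'eq[abs_def] by measurable
  show "(\<integral>\<^sup>+\<omega>. ennreal (trunc_pow e k (S' \<omega>)) \<partial>M) \<le> (\<integral>\<^sup>+\<omega>. ennreal (trunc_pow e k (S \<omega>)) \<partial>M)
      + ennreal (trunc_const k) * ((\<integral>\<^sup>+\<omega>. ennreal (trunc_wt e k (S \<omega>) * (\<eta> \<omega>)\<^sup>2) \<partial>M)
      + ennreal (normal_const k) * (\<integral>\<^sup>+\<omega>. ennreal (trunc_pow e k (\<eta> \<omega>)) \<partial>M))"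
  proof -
    have "(\<integral>\<^sup>+\<omega>. ennreal (trunc_pow e k (S' \<omega>)) \<partial>M) = ennreal (expectation (\<lambda>\<omega>. trunc_pow e k (S' \<omega>)))"
      using e by (intro conv fint S'2 S'm trunc_pow_nonneg) auto
    also note ennreal_leI[OF main]
    also have "ennreal (expectation (\<lambda>\<omega>. trunc_pow e k (S \<omega>))
     + trunc_const k * (expectation (\<lambda>\<omega>. trunc_wt e k (S \<omega>) * (\<eta> \<omega>)\<^sup>2)
     + normal_const k * expectation (\<lambda>\<omega>. trunc_pow e k (\<eta> \<omega>)))) = ennreal (expectation (\<lambda>\<omega>. trunc_pow e k (S \<omega>)))
     + ennreal (trunc_const k) * (ennreal (expectation (\<lambda>\<omega>. trunc_wt e k (S \<omega>) * (\<eta> \<omega>)\<^sup>2))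
     + ennreal (normal_const k) * ennreal (expectation (\<lambda>\<omega>. trunc_pow e k (\<eta> \<omega>))))"
      using nonneg trunc_const_ge_1[of k] normal_const_nonneg[of k]
      by (simp add: ennreal_plus ennreal_mult)
    also have "ennreal (expectation (\<lambda>\<omega>. trunc_pow e k (S \<omega>))) = (\<integral>\<^sup>+\<omega>. ennreal (trunc_pow e k (S \<omega>)) \<partial>M)"
      using e by (intro conv[symmetric] fint S2 trunc_pow_nonneg) auto
    also have "ennreal (expectation (\<lambda>\<omega>. trunc_wt e k (S \<omega>) * (\<eta> \<omega>)\<^sup>2)) = (\<integral>\<^sup>+\<omega>. ennreal (trunc_wt e k (S \<omega>) * (\<eta> \<omega>)\<^sup>2) \<partial>M)"
      using e by (intro conv[symmetric] wint mult_nonneg_nonneg trunc_wt_nonneg) auto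
    also have "ennreal (expectation (\<lambda>\<omega>. trunc_pow e k (\<eta> \<omega>))) = (\<integral>\<^sup>+\<omega>. ennreal (trunc_pow e k (\<eta> \<omega>)) \<partial>M)"
      using e by (intro conv[symmetric] fint \<eta>2 trunc_pow_nonneg) auto
    finally show ?thesis .
  qed
qed

end

text \<open>For \<open>u > 0\<close> this is \<open>w\<^sup>2 * trunc_pow e k (x / w)\<close> with the weight \<open>w = u powr (g - 1)\<close>.\<close>

definition trunc_energy :: "real \<Rightarrow> nat \<Rightarrow> real \<Rightarrow> real \<Rightarrow> real \<Rightarrow> real" where
  "trunc_energy e k g u x = x\<^sup>2 * trunc_wt e k (x * u powr (1 - g))"

lemma trunc_energy_measurable [measurable (raw)]:
  assumes [measurable]: "f \<in> borel_measurable N" "h \<in> borel_measurable N"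
  shows "(\<lambda>x. trunc_energy e k g (f x) (h x)) \<in> borel_measurable N"
  unfolding trunc_energy_def by measurable

lemma trunc_energy_nonneg: "e \<ge> 0 \<Longrightarrow> 0 \<le> trunc_energy e k g u x"
  by (simp add: trunc_energy_def trunc_wt_nonneg)

lemma trunc_energy_eq:
  assumes "u > 0"
  shows "trunc_energy e k g u x = u powr (2 * g - 2) * trunc_pow e k (x * u powr (1 - g))"
proof -
  have "u powr (2 * g - 2) * (u powr (1 - g))\<^sup>2 = 1"
    using assms by (simp add: power2_eq_square powr_add[symmetric])
  then have "u powr (2 * g - 2) * (x * u powr (1 - g))\<^sup>2 = x\<^sup>2" by (simp add: power_mult_distrib mult_ac)
  then show ?thesis by (simp add: trunc_energy_def trunc_pow_def mult.assoc[symmetric])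
qed

lemma trunc_energy_le_square:
  assumes "e > 0"
  shows "trunc_energy e k g u x \<le> (1 / e) ^ k * x\<^sup>2"
  using mult_left_mono[OF trunc_wt_le[OF assms, of k "x * u powr (1 - g)"], of "x\<^sup>2"]
  by (simp add: trunc_energy_def mult_ac)

lemma trunc_energy_add:
  assumes "e \<ge> 0" "\<bar>z\<bar> \<le> \<bar>x\<bar> + \<bar>y\<bar>"
  shows "trunc_energy e k g u z \<le> 4 * 5 ^ k * (trunc_energy e k g u x + trunc_energy e k g u y)"
proof (cases "u = 0")
  case True
  \<comment> \<open>At u = 0 the weight is the constant \<open>trunc_wt e k 0\<close>, which is 1
    for k = 0 and 0 otherwise, and the inequality between the squares suffices. For all other u,
    negative ones included, \<open>u powr (1 - g)\<close> is positive and can be divided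
    out.\<close>
  define r where "r = trunc_wt e k 0"
  have r: "r \<ge> 0" using assms by (simp add: r_def trunc_wt_nonneg)
  have "z\<^sup>2 \<le> (\<bar>x\<bar> + \<bar>y\<bar>)\<^sup>2" using assms(2) by (simp add: abs_le_square_iff[symmetric])
  also have "\<dots> \<le> 2 * x\<^sup>2 + 2 * y\<^sup>2" using sum_squares_bound[of "\<bar>x\<bar>" "\<bar>y\<bar>"] by (simp add: power2_sum)
  also have "\<dots> \<le> (4 * 5 ^ k) * (x\<^sup>2 + y\<^sup>2)"
  proof -
    have "(5::real) ^ k \<ge> 1" by simp
    then have "(2::real) \<le> 4 * 5 ^ k" by linarith
    then have "2 * (x\<^sup>2 + y\<^sup>2) \<le> (4 * 5 ^ k) * (x\<^sup>2 + y\<^sup>2)" by (intro mult_right_mono) auto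
    then show ?thesis by simp
  qed
  finally have "z\<^sup>2 * r \<le> (4 * 5 ^ k) * (x\<^sup>2 + y\<^sup>2) * r" using r by (rule mult_right_mono)
  then show ?thesis using True by (simp add: trunc_energy_def r_def algebra_simps)
next
  case False
  define v where "v = u powr (1 - g)"
  have v: "u powr (1 - g) = v" "v > 0" using False by (auto simp: v_def powr_def)
  have sc: "trunc_energy e k g u a = trunc_pow e k (a * v) / v\<^sup>2" for a
    using v by (simp add: trunc_energy_def trunc_pow_def power_mult_distrib)
  have "\<bar>z * v\<bar> \<le> \<bar>x * v\<bar> + \<bar>y * v\<bar>"
    using assms(2) v mult_right_mono[OF assms(2), of v] by (simp add: abs_mult algebra_simps)
  from trunc_pow_add[OF assms(1) this, of k] show ?thesis
    using v unfolding sc by (simp add: divide_simps)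
qed

text \<open>This is \<open>trunc_wt_mult_square\<close> for y and x divided by
  \<open>u powr (g - 1)\<close>, multiplied by the square of that factor. The state y receives an
  integrable kernel, and the rest is the energy of x.\<close>

lemma trunc_wt_mult_square_le_energy:
  assumes "e \<ge> 0" "u > 0"
  shows "trunc_wt e k y * x\<^sup>2 \<le> u powr (2 * g - 2) * trunc_pow e k y + trunc_energy e k g u x"
proof -
  have "u powr (2 * g - 2) * (u powr (1 - g))\<^sup>2 = 1"
    using assms by (simp add: power2_eq_square powr_add[symmetric])
  then have "trunc_wt e k y * x\<^sup>2 = u powr (2 * g - 2) * (trunc_wt e k y * (x * u powr (1 - g))\<^sup>2)"
    by (simp add: power_mult_distrib mult_ac)
  also have "\<dots> \<le> u powr (2 * g - 2) * (trunc_pow e k y + trunc_pow e k (x * u powr (1 - g)))"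
    using assms by (intro mult_left_mono trunc_wt_mult_square) auto
  finally show ?thesis using assms by (simp add: trunc_energy_eq distrib_left)
qed

text \<open>The number whose reciprocal is squared is a lower bound for
  \<open>u powr (1 - g) / sqrt d\<close> when d / 2 \<le> u and d \<le> T; the outer form is the
  factor of \<open>trunc_wt_scale\<close>.\<close>

definition half_const :: "real \<Rightarrow> real \<Rightarrow> nat \<Rightarrow> real" where
  "half_const T g k = (1 + (1 / ((1/2) powr (1 - g) * T powr (1/2 - g)))\<^sup>2) ^ k"

text \<open>Used on the earlier half of a step of length \<open>d\<close> of a partition of \<open>[0,t]\<close>, where
  \<open>u = t - s\<close> is at least \<open>d / 2\<close>; the later half may contain the singularity \<open>s = t\<close>.\<close>

lemma trunc_pow_le_energy_half:
  assumes "e \<ge> 0" "0 < d" "d \<le> T" "d / 2 \<le> u" "1/2 < g" "g < 1"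
  shows "trunc_pow e k (x * sqrt d) / d \<le> half_const T g k * trunc_energy e k g u x"
proof -
  define c where "c = (1/2) powr (1 - g) * T powr (1/2 - g)"
  have c: "c > 0" using assms by (simp add: c_def)
  have "c * sqrt d \<le> (1/2) powr (1 - g) * d powr (1/2 - g) * sqrt d"
    unfolding c_def using assms by (intro mult_right_mono mult_left_mono powr_mono2') auto
  also have "\<dots> = (d / 2) powr (1 - g)"
    using assms by (simp add: powr_half_sqrt[symmetric] powr_add[symmetric] powr_divide)
  also have "\<dots> \<le> u powr (1 - g)" using assms by (intro powr_mono2) auto
  finally have le: "\<bar>c * (x * sqrt d)\<bar> \<le> \<bar>x * u powr (1 - g)\<bar>"
    using c assms mult_left_mono[of "c * sqrt d" "u powr (1 - g)" "\<bar>x\<bar>"] by (simp add: abs_mult mult_ac)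
  have "trunc_wt e k (x * sqrt d) = trunc_wt e k ((1 / c) * (c * (x * sqrt d)))" using c by simp
  also have "\<dots> \<le> (1 + (1 / c)\<^sup>2) ^ k * trunc_wt e k (c * (x * sqrt d))" by (rule trunc_wt_scale[OF assms(1)])
  also have "\<dots> \<le> (1 + (1 / c)\<^sup>2) ^ k * trunc_wt e k (x * u powr (1 - g))"
    by (intro mult_left_mono trunc_wt_mono assms le) auto
  finally have *: "trunc_wt e k (x * sqrt d) \<le> half_const T g k * trunc_wt e k (x * u powr (1 - g))"
    unfolding half_const_def c_def[symmetric] .
  have "trunc_pow e k (x * sqrt d) / d = x\<^sup>2 * trunc_wt e k (x * sqrt d)"
    using assms by (simp add: trunc_pow_def power_mult_distrib)
  also have "\<dots> \<le> x\<^sup>2 * (half_const T g k * trunc_wt e k (x * u powr (1 - g)))"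
    by (intro mult_left_mono *) auto
  finally show ?thesis by (simp add: trunc_energy_def mult_ac)
qed

lemma half_const_nonneg: "half_const T g k \<ge> 0"
  by (simp add: half_const_def)

section \<open>Truncated moments of integrals of simple processes\<close>

lemma partition_mono:
  fixes \<tau> :: "nat \<Rightarrow> real"
  assumes "\<And>i. i < n \<Longrightarrow> \<tau> i \<le> \<tau> (Suc i)" "i \<le> j" "j \<le> n"
  shows "\<tau> i \<le> \<tau> j"
  using assms(2,3) by (induction j) (use assms(1) in \<open>auto simp: le_Suc_eq intro: order_trans\<close>)

lemma sum_partition_indicator:
  fixes \<tau> :: "nat \<Rightarrow> real" and h :: "nat \<Rightarrow> 'b::semiring_1"
  assumes "\<And>i. i < n \<Longrightarrow> \<tau> i \<le> \<tau> (Suc i)" "j < n" "s \<in> {\<tau> j<..\<tau> (Suc j)}"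
  shows "(\<Sum>i<n. h i * indicator {\<tau> i<..\<tau> (Suc i)} s) = h j"
proof -
  have "s \<notin> {\<tau> i<..\<tau> (Suc i)}" if "i < n" "i \<noteq> j" for i
    using partition_mono[of n \<tau> "Suc i" j, OF assms(1)] partition_mono[of n \<tau> "Suc j" i, OF assms(1)] assms that
    by (cases "i < j") auto
  then have "(\<Sum>i<n. h i * indicator {\<tau> i<..\<tau> (Suc i)} s) = (\<Sum>i<n. if i = j then h j else 0)"
    using assms by (intro sum.cong) auto
  then show ?thesis using assms by simp
qed

lemma sum_partition_le:
  fixes \<tau> :: "nat \<Rightarrow> real" and h :: "nat \<Rightarrow> ennreal"
  assumes "\<And>i. i < n \<Longrightarrow> \<tau> i \<le> \<tau> (Suc i)" "0 \<le> \<tau> 0" "\<tau> n \<le> t"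
    and "\<And>j. j < n \<Longrightarrow> s \<in> {\<tau> j<..\<tau> (Suc j)} \<Longrightarrow> h j \<le> H"
  shows "(\<Sum>i<n. h i * indicator {\<tau> i<..\<tau> (Suc i)} s) \<le> H * indicator {0..t} s"
proof (cases "\<exists>j<n. s \<in> {\<tau> j<..\<tau> (Suc j)}")
  case True
  then obtain j where j: "j < n" "s \<in> {\<tau> j<..\<tau> (Suc j)}" by auto
  have "\<tau> 0 \<le> \<tau> j" "\<tau> (Suc j) \<le> \<tau> n"
    using j by (auto intro!: partition_mono[of n \<tau>, OF assms(1)])
  then have "s \<in> {0..t}" using assms j by auto
  moreover have "(\<Sum>i<n. h i * indicator {\<tau> i<..\<tau> (Suc i)} s) = h j"
    by (rule sum_partition_indicator[OF assms(1) j])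
  ultimately show ?thesis using assms(4)[OF j] by simp
qed auto

text \<open>The exponential is the Gronwall factor, with the kernel integral over [0,T] as the total
  of the coefficients; the other factor is what one step charges for its energy.\<close>

definition ito_const :: "real \<Rightarrow> real \<Rightarrow> nat \<Rightarrow> real" where
  "ito_const T g k = exp (trunc_const k * (T powr (2 * g - 1) / (2 * g - 1))) *
     (trunc_const k * (1 + normal_const k * (2 * half_const T g k)))"

lemma ito_const_nonneg: "ito_const T g k \<ge> 0"
  unfolding ito_const_def using trunc_const_ge_1[of k] normal_const_nonneg[of k] half_const_nonneg[of T g k]
  by (intro mult_nonneg_nonneg add_nonneg_nonneg) auto

context brownian_motion
begin

lemma simple_dataD:
  assumes "simple_data M F t n \<tau> \<xi>" "t \<le> T"
  shows "\<And>i. i < n \<Longrightarrow> \<tau> i \<le> \<tau> (Suc i)" "0 \<le> \<tau> 0" "\<tau> n \<le> t"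
    "\<And>i. i \<le> n \<Longrightarrow> \<tau> i \<in> {0..t}"
    "\<And>i. i < n \<Longrightarrow> \<xi> i \<in> borel_measurable (F (\<tau> i))"
    "\<And>i. i < n \<Longrightarrow> \<xi> i \<in> borel_measurable M"
    "\<And>i. i < n \<Longrightarrow> \<exists>K. \<forall>\<omega>\<in>space M. \<bar>\<xi> i \<omega>\<bar> \<le> K"
proof -
  show 1: "\<And>i. i < n \<Longrightarrow> \<tau> i \<le> \<tau> (Suc i)" "0 \<le> \<tau> 0" "\<tau> n \<le> t"
    "\<And>i. i < n \<Longrightarrow> \<xi> i \<in> borel_measurable (F (\<tau> i))"
    "\<And>i. i < n \<Longrightarrow> \<exists>K. \<forall>\<omega>\<in>space M. \<bar>\<xi> i \<omega>\<bar> \<le> K"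
    using assms(1) unfolding simple_data_def by auto
  show 2: "\<tau> i \<in> {0..t}" if "i \<le> n" for i
    using partition_mono[of n \<tau> 0 i, OF 1(1)] partition_mono[of n \<tau> i n, OF 1(1)] 1 that by auto
  show "\<xi> i \<in> borel_measurable M" if "i < n" for i
    using measurable_filtrationD[OF 1(4)] 2[of i] that assms by auto
qed

lemma measurable_simple_ito_integral_filtration:
  assumes "simple_data M F t n \<tau> \<xi>" "t \<le> T" "j \<le> n"
  shows "simple_ito_integral B j \<tau> \<xi> \<in> borel_measurable (F (\<tau> j))"
  unfolding simple_ito_integral_def[abs_def]
proof (intro borel_measurable_sum borel_measurable_times borel_measurable_diff)
  note d = simple_dataD[OF assms(1,2)]
  fix i assume "i \<in> {..<j}"
  then have i: "i < j" by simp
  have le: "\<tau> i \<le> \<tau> j" "\<tau> (Suc i) \<le> \<tau> j"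
    using i assms(3) by (auto intro!: partition_mono[of n \<tau>, OF d(1)])
  show "\<xi> i \<in> borel_measurable (F (\<tau> j))"
    using measurable_natural_filtration_mono[OF d(5) le(1)] i assms(3) by simp
  show "B (\<tau> (Suc i)) \<in> borel_measurable (F (\<tau> j))" "B (\<tau> i) \<in> borel_measurable (F (\<tau> j))"
    using d(4)[of "Suc i"] d(4)[of i] i assms(3) le by (auto intro!: measurable_natural_filtration_self)
qed

lemma measurable_simple_ito_integral:
  assumes "simple_data M F t n \<tau> \<xi>" "t \<le> T"
  shows "simple_ito_integral B n \<tau> \<xi> \<in> borel_measurable M"
  using measurable_filtrationD[OF measurable_simple_ito_integral_filtration[OF assms order_refl]]
    simple_dataD(3)[OF assms] assms(2) by simp

text \<open>The two terms left by \<open>trunc_pow_increment\<close> know the step only through its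
  length. Both are rewritten as integrals over the step, so that the time-dependent weight of
  \<open>trunc_energy\<close> can enter: W becomes a Gronwall coefficient and V the energy spent on
  the step.\<close>

lemma simple_ito_step:
  fixes k :: nat
  assumes sd: "simple_data M F t n \<tau> \<xi>" and t: "t \<in> {0..T}" and e: "e > 0" and g: "1/2 < g" "g < 1"
    and j: "j < n" and S2: "integrable M (\<lambda>\<omega>. (simple_ito_integral B j \<tau> \<xi> \<omega>)\<^sup>2)"
  defines "W \<equiv> (\<integral>\<^sup>+s. ennreal ((t - s) powr (2 * g - 2)) * indicator {\<tau> j<..\<tau> (Suc j)} s \<partial>lborel)"
    and "V \<equiv> (\<integral>\<^sup>+\<omega>. (\<integral>\<^sup>+s. ennreal (trunc_energy e k g (t - s) (\<xi> j \<omega>)) * indicator {\<tau> j<..\<tau> (Suc j)} s \<partial>lborel) \<partial>M)"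
    and "u \<equiv> \<lambda>j. (\<integral>\<^sup>+\<omega>. ennreal (trunc_pow e k (simple_ito_integral B j \<tau> \<xi> \<omega>)) \<partial>M)"
  shows "integrable M (\<lambda>\<omega>. (simple_ito_integral B (Suc j) \<tau> \<xi> \<omega>)\<^sup>2)"
    and "u (Suc j) \<le> (1 + ennreal (trunc_const k) * W) * u j
      + ennreal (trunc_const k * (1 + normal_const k * (2 * half_const T g k))) * V"
proof -
  note d = simple_dataD[OF sd]
  have T: "t \<le> T" using t by simp
  let ?S = "\<lambda>j. simple_ito_integral B j \<tau> \<xi>"
  let ?I = "{\<tau> j<..\<tau> (Suc j)}"
  have SSuc: "?S (Suc j) \<omega> = ?S j \<omega> + \<xi> j \<omega> * (B (\<tau> (Suc j)) \<omega> - B (\<tau> j) \<omega>)" for \<omega>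
    by (simp add: simple_ito_integral_def)
  have \<tau>j: "\<tau> j \<le> \<tau> (Suc j)" "0 \<le> \<tau> j" "\<tau> (Suc j) \<le> t" using d(1)[OF T j] d(4)[OF T, of j] d(4)[OF T, of "Suc j"] j by auto
  have SF: "?S j \<in> borel_measurable (F (\<tau> j))"
    using measurable_simple_ito_integral_filtration[OF sd T, of j] j by simp
  have \<xi>F: "\<xi> j \<in> borel_measurable (F (\<tau> j))" using d(5)[OF T j] .
  have [measurable]: "?S j \<in> borel_measurable M" "\<xi> j \<in> borel_measurable M"
    using measurable_filtrationD[OF SF] measurable_filtrationD[OF \<xi>F] \<tau>j T by auto
  obtain K where K: "\<And>\<omega>. \<omega> \<in> space M \<Longrightarrow> \<bar>\<xi> j \<omega>\<bar> \<le> K" using d(7)[OF T j] by auto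
  have "integrable M (\<lambda>\<omega>. (?S (Suc j) \<omega>)\<^sup>2) \<and> u (Suc j) \<le> (1 + ennreal (trunc_const k) * W) * u j
      + ennreal (trunc_const k * (1 + normal_const k * (2 * half_const T g k))) * V"
  proof (cases "\<tau> j = \<tau> (Suc j)")
    case True
    have "u j \<le> (1 + ennreal (trunc_const k) * W) * u j" using mult_right_mono[of 1 _ "u j"] by simp
    then show ?thesis using True S2 by (auto simp: u_def SSuc intro: add_increasing2)
  next
    case False
    define D where "D = \<tau> (Suc j) - \<tau> j"
    have D: "D > 0" "D \<le> T" using False \<tau>j T by (auto simp: D_def)
    define \<eta> where "\<eta> = (\<lambda>\<omega>. \<xi> j \<omega> * sqrt D)"
    define v where "v = (\<lambda>\<omega>. \<integral>\<^sup>+s. ennreal (trunc_energy e k g (t - s) (\<xi> j \<omega>)) * indicator ?I s \<partial>lborel)"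
    have [measurable]: "v \<in> borel_measurable M" unfolding v_def by measurable
    have inc: "integrable M (\<lambda>\<omega>. (?S (Suc j) \<omega>)\<^sup>2)"
      "u (Suc j) \<le> u j + ennreal (trunc_const k) * ((\<integral>\<^sup>+\<omega>. ennreal (trunc_wt e k (?S j \<omega>) * (\<eta> \<omega>)\<^sup>2) \<partial>M)
      + ennreal (normal_const k) * (\<integral>\<^sup>+\<omega>. ennreal (trunc_pow e k (\<eta> \<omega>)) \<partial>M))"
      using trunc_pow_increment(1)[of "\<tau> j" "\<tau> (Suc j)", OF _ _ _ e SF \<xi>F K S2]
        trunc_pow_increment(2)[where k=k, of "\<tau> j" "\<tau> (Suc j)", OF _ _ _ e SF \<xi>F K S2] \<tau>j False T
      unfolding SSuc[symmetric] D_def[symmetric] \<eta>_def u_def by auto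
    have em: "emeasure lborel ?I = ennreal D" using \<tau>j by (simp add: D_def)
    \<comment> \<open>A constant times the length of the step is the integral of that constant, so
      the weighted Young inequality can be applied at each time s separately. It needs t - s > 0,
      and s = t is a null set.\<close>
    have w: "ennreal (trunc_wt e k (?S j \<omega>) * (\<eta> \<omega>)\<^sup>2) \<le> W * ennreal (trunc_pow e k (?S j \<omega>)) + v \<omega>" for \<omega>
    proof -
      have "ennreal (trunc_wt e k (?S j \<omega>) * (\<eta> \<omega>)\<^sup>2) = ennreal (trunc_wt e k (?S j \<omega>) * (\<xi> j \<omega>)\<^sup>2) * ennreal D"
        using D trunc_wt_nonneg[of e k] e by (simp add: \<eta>_def power_mult_distrib ennreal_mult[symmetric] mult.assoc)
      also have "\<dots> = (\<integral>\<^sup>+s. ennreal (trunc_wt e k (?S j \<omega>) * (\<xi> j \<omega>)\<^sup>2) * indicator ?I s \<partial>lborel)"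
        by (simp add: nn_integral_cmult_indicator em)
      also have "\<dots> \<le> (\<integral>\<^sup>+s. ennreal ((t - s) powr (2 * g - 2)) * indicator ?I s * ennreal (trunc_pow e k (?S j \<omega>))
          + ennreal (trunc_energy e k g (t - s) (\<xi> j \<omega>)) * indicator ?I s \<partial>lborel)"
      proof (rule nn_integral_mono_AE)
        have "AE s in lborel. s \<noteq> t" by (rule AE_lborel_singleton)
        then show "AE s in lborel. ennreal (trunc_wt e k (?S j \<omega>) * (\<xi> j \<omega>)\<^sup>2) * indicator ?I s
          \<le> ennreal ((t - s) powr (2 * g - 2)) * indicator ?I s * ennreal (trunc_pow e k (?S j \<omega>))
          + ennreal (trunc_energy e k g (t - s) (\<xi> j \<omega>)) * indicator ?I s"
        proof eventually_elim
          case (elim s)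
          show ?case
          proof (cases "s \<in> ?I")
            case True
            then have "t - s > 0" using elim \<tau>j by auto
            from trunc_wt_mult_square_le_energy[of e, OF _ this, of k "?S j \<omega>" "\<xi> j \<omega>" g] e True
            show ?thesis using trunc_pow_nonneg[of e k] trunc_energy_nonneg[of e k]
              by (simp add: ennreal_mult[symmetric] ennreal_plus[symmetric] ennreal_leI del: ennreal_plus)
          qed simp
        qed
      qed
      also have "\<dots> = W * ennreal (trunc_pow e k (?S j \<omega>)) + v \<omega>"
        by (subst nn_integral_add) (auto simp: nn_integral_multc W_def v_def)
      finally show ?thesis .
    qed
    \<comment> \<open>The comparison is made on the first half of the step, where t - s is at least
      D / 2 because the step ends at or before t. The factor 2 compensates for the half that is left
      out.\<close>
    have f: "ennreal (trunc_pow e k (\<eta> \<omega>)) \<le> ennreal (2 * half_const T g k) * v \<omega>" for \<omega>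
    proof -
      let ?H = "{\<tau> j<..\<tau> j + D / 2}"
      have emH: "emeasure lborel ?H = ennreal (D / 2)" using D by simp
      have "ennreal (trunc_pow e k (\<eta> \<omega>)) = ennreal 2 * (ennreal (trunc_pow e k (\<eta> \<omega>) / D) * ennreal (D / 2))"
        using D trunc_pow_nonneg[of e k] e by (simp add: ennreal_mult[symmetric] del: ennreal_numeral)
      also have "\<dots> = ennreal 2 * (\<integral>\<^sup>+s. ennreal (trunc_pow e k (\<eta> \<omega>) / D) * indicator ?H s \<partial>lborel)"
        by (simp add: nn_integral_cmult_indicator emH)
      also have "\<dots> \<le> ennreal 2 * (\<integral>\<^sup>+s. ennreal (half_const T g k) * (ennreal (trunc_energy e k g (t - s) (\<xi> j \<omega>)) * indicator ?I s) \<partial>lborel)"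
      proof (intro mult_left_mono nn_integral_mono)
        fix s
        show "ennreal (trunc_pow e k (\<eta> \<omega>) / D) * indicator ?H s \<le> ennreal (half_const T g k) * (ennreal (trunc_energy e k g (t - s) (\<xi> j \<omega>)) * indicator ?I s)"
        proof (cases "s \<in> ?H")
          case True
          then have s: "s \<in> ?I" "D / 2 \<le> t - s" using \<tau>j by (auto simp: D_def field_simps)
          have "ennreal (trunc_pow e k (\<eta> \<omega>) / D) \<le> ennreal (half_const T g k * trunc_energy e k g (t - s) (\<xi> j \<omega>))"
            unfolding \<eta>_def using e D s g by (intro ennreal_leI trunc_pow_le_energy_half) auto
          then show ?thesis using True s half_const_nonneg[of T g k] trunc_energy_nonneg[of e k] e
            by (simp add: ennreal_mult)
        qed simp
      qed simp
      also have "\<dots> = ennreal 2 * (ennreal (half_const T g k) * v \<omega>)"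
        by (subst nn_integral_cmult) (auto simp: v_def)
      finally show ?thesis using half_const_nonneg[of T g k] by (simp add: ennreal_mult mult.assoc)
    qed
    have "(\<integral>\<^sup>+\<omega>. ennreal (trunc_wt e k (?S j \<omega>) * (\<eta> \<omega>)\<^sup>2) \<partial>M) \<le> (\<integral>\<^sup>+\<omega>. W * ennreal (trunc_pow e k (?S j \<omega>)) + v \<omega> \<partial>M)"
      by (intro nn_integral_mono w)
    also have "\<dots> = W * u j + V"
      by (subst nn_integral_add) (auto simp: nn_integral_cmult u_def V_def v_def)
    finally have A: "(\<integral>\<^sup>+\<omega>. ennreal (trunc_wt e k (?S j \<omega>) * (\<eta> \<omega>)\<^sup>2) \<partial>M) \<le> W * u j + V" .
    have "(\<integral>\<^sup>+\<omega>. ennreal (trunc_pow e k (\<eta> \<omega>)) \<partial>M) \<le> (\<integral>\<^sup>+\<omega>. ennreal (2 * half_const T g k) * v \<omega> \<partial>M)"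
      by (intro nn_integral_mono f)
    also have "\<dots> = ennreal (2 * half_const T g k) * V" by (subst nn_integral_cmult) (auto simp: V_def v_def)
    finally have Bd: "(\<integral>\<^sup>+\<omega>. ennreal (trunc_pow e k (\<eta> \<omega>)) \<partial>M) \<le> ennreal (2 * half_const T g k) * V" .
    have "u (Suc j) \<le> u j + ennreal (trunc_const k) * ((W * u j + V)
      + ennreal (normal_const k) * (ennreal (2 * half_const T g k) * V))"
      by (rule order_trans[OF inc(2)]) (intro add_mono mult_left_mono A Bd order_refl; simp)
    also have "\<dots> = (1 + ennreal (trunc_const k) * W) * u j
      + ennreal (trunc_const k * (1 + normal_const k * (2 * half_const T g k))) * V"
      using trunc_const_ge_1[of k] normal_const_nonneg[of k] half_const_nonneg[of T g k]
      by (simp add: ennreal_mult ennreal_plus algebra_simps)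
    finally show ?thesis using inc by simp
  qed
  then show "integrable M (\<lambda>\<omega>. (simple_ito_integral B (Suc j) \<tau> \<xi> \<omega>)\<^sup>2)"
    and "u (Suc j) \<le> (1 + ennreal (trunc_const k) * W) * u j
      + ennreal (trunc_const k * (1 + normal_const k * (2 * half_const T g k))) * V" by auto
qed

text \<open>The coefficients W sum to at most the kernel integral over [0,T], whatever the
  partition, so the Gronwall factor does not depend on the simple process. The energies V sum to at
  most the energy of the process, because on each step the process equals its value there.\<close>

lemma simple_ito_estimate:
  assumes sd: "simple_data M F t n \<tau> \<xi>" and t: "t \<in> {0..T}" and e: "e > 0" and g: "1/2 < g" "g < 1"
  shows "(\<integral>\<^sup>+\<omega>. ennreal (trunc_pow e k (simple_ito_integral B n \<tau> \<xi> \<omega>)) \<partial>M) \<le> ennreal (ito_const T g k) *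
    (\<integral>\<^sup>+\<omega>. (\<integral>\<^sup>+s\<in>{0..t}. ennreal (trunc_energy e k g (t - s) (simple_process n \<tau> \<xi> s \<omega>)) \<partial>lborel) \<partial>M)"
proof -
  have T: "t \<le> T" "0 \<le> t" using t by auto
  note d = simple_dataD[OF sd T(1)]
  let ?S = "\<lambda>j. simple_ito_integral B j \<tau> \<xi>"
  define c where "c = trunc_const k * (1 + normal_const k * (2 * half_const T g k))"
  define W where "W = (\<lambda>j. \<integral>\<^sup>+s. ennreal ((t - s) powr (2 * g - 2)) * indicator {\<tau> j<..\<tau> (Suc j)} s \<partial>lborel)"
  define V where "V = (\<lambda>j. \<integral>\<^sup>+\<omega>. (\<integral>\<^sup>+s. ennreal (trunc_energy e k g (t - s) (\<xi> j \<omega>)) * indicator {\<tau> j<..\<tau> (Suc j)} s \<partial>lborel) \<partial>M)"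
  define u where "u = (\<lambda>j. (\<integral>\<^sup>+\<omega>. ennreal (trunc_pow e k (?S j \<omega>)) \<partial>M))"
  have int: "integrable M (\<lambda>\<omega>. (?S j \<omega>)\<^sup>2)" if "j \<le> n" for j
    using that
  proof (induction j)
    case (Suc j)
    then show ?case using simple_ito_step(1)[OF sd t e g, of j] by simp
  qed (simp add: simple_ito_integral_def)
  have Wsum: "(\<Sum>j<n. W j) \<le> ennreal (T powr (2 * g - 1) / (2 * g - 1))"
  proof -
    have "(\<Sum>j<n. W j) = (\<integral>\<^sup>+s. (\<Sum>j<n. ennreal ((t - s) powr (2 * g - 2)) * indicator {\<tau> j<..\<tau> (Suc j)} s) \<partial>lborel)"
      unfolding W_def by (subst nn_integral_sum) auto
    also have "\<dots> \<le> (\<integral>\<^sup>+s. ennreal ((t - s) powr (2 * g - 2)) * indicator {0..t} s \<partial>lborel)"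
      by (intro nn_integral_mono sum_partition_le d) auto
    also have "\<dots> = ennreal (t powr (2 * g - 1) / (2 * g - 1))"
      using nn_integral_powr_kernel[of "2 * g - 1" t] g T by simp
    also have "\<dots> \<le> ennreal (T powr (2 * g - 1) / (2 * g - 1))"
      using g T by (intro ennreal_leI divide_right_mono powr_mono2) auto
    finally show ?thesis .
  qed
  have Wfin: "W j < \<top>" if "j < n" for j
  proof -
    have "W j \<le> (\<Sum>j<n. W j)" using that by (intro member_le_sum) auto
    also note Wsum
    also have "ennreal (T powr (2 * g - 1) / (2 * g - 1)) < \<top>" by simp
    finally show ?thesis .
  qed
  \<comment> \<open>The discrete Gronwall inequality takes real coefficients; W is finite as a part
    of the finite kernel integral.\<close>
  define a where "a = (\<lambda>j. trunc_const k * enn2real (W j))"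
  have a: "a j \<ge> 0" for j using trunc_const_ge_1[of k] by (simp add: a_def)
  have aW: "ennreal (a j) = ennreal (trunc_const k) * W j" if "j < n" for j
    using Wfin[OF that] trunc_const_ge_1[of k] by (simp add: a_def ennreal_mult)
  have asum: "(\<Sum>j<n. a j) \<le> trunc_const k * (T powr (2 * g - 1) / (2 * g - 1))"
  proof -
    have "ennreal (\<Sum>j<n. a j) = (\<Sum>j<n. ennreal (a j))" using a by (simp add: sum_ennreal)
    also have "\<dots> = ennreal (trunc_const k) * (\<Sum>j<n. W j)" by (simp add: aW sum_distrib_left)
    also have "\<dots> \<le> ennreal (trunc_const k) * ennreal (T powr (2 * g - 1) / (2 * g - 1))"
      by (intro mult_left_mono Wsum) auto
    also have "\<dots> = ennreal (trunc_const k * (T powr (2 * g - 1) / (2 * g - 1)))"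
      using trunc_const_ge_1[of k] g by (subst ennreal_mult[symmetric]) auto
    finally show ?thesis using trunc_const_ge_1[of k] g by (subst (asm) ennreal_le_iff) auto
  qed
  have "u n \<le> ennreal (exp (\<Sum>j<n. a j)) * (\<Sum>j<n. ennreal c * V j)"
  proof (rule discrete_gronwall_ennreal)
    show "u 0 = 0" by (simp add: u_def simple_ito_integral_def trunc_pow_def)
    fix j assume j: "j < n"
    show "u (Suc j) \<le> ennreal (1 + a j) * u j + ennreal c * V j"
      using simple_ito_step(2)[OF sd t e g j int, of k] j a[of j] aW[OF j]
      by (simp add: u_def W_def V_def c_def ennreal_plus)
  qed (use a in auto)
  also have "\<dots> \<le> ennreal (exp (trunc_const k * (T powr (2 * g - 1) / (2 * g - 1)))) * (\<Sum>j<n. ennreal c * V j)"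
    by (intro mult_right_mono ennreal_leI) (use asum in auto)
  also have "(\<Sum>j<n. ennreal c * V j) = ennreal c * (\<Sum>j<n. V j)" by (simp add: sum_distrib_left)
  also have "(\<Sum>j<n. V j) \<le> (\<integral>\<^sup>+\<omega>. (\<integral>\<^sup>+s\<in>{0..t}. ennreal (trunc_energy e k g (t - s) (simple_process n \<tau> \<xi> s \<omega>)) \<partial>lborel) \<partial>M)"
  proof -
    have [measurable]: "j < n \<Longrightarrow> \<xi> j \<in> borel_measurable M" for j using d by auto
    have "(\<Sum>j<n. V j) = (\<integral>\<^sup>+\<omega>. (\<Sum>j<n. \<integral>\<^sup>+s. ennreal (trunc_energy e k g (t - s) (\<xi> j \<omega>)) * indicator {\<tau> j<..\<tau> (Suc j)} s \<partial>lborel) \<partial>M)"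
      unfolding V_def by (subst nn_integral_sum) auto
    also have "\<dots> = (\<integral>\<^sup>+\<omega>. (\<integral>\<^sup>+s. (\<Sum>j<n. ennreal (trunc_energy e k g (t - s) (\<xi> j \<omega>)) * indicator {\<tau> j<..\<tau> (Suc j)} s) \<partial>lborel) \<partial>M)"
      by (intro nn_integral_cong nn_integral_sum[symmetric]) auto
    also have "\<dots> \<le> (\<integral>\<^sup>+\<omega>. (\<integral>\<^sup>+s. ennreal (trunc_energy e k g (t - s) (simple_process n \<tau> \<xi> s \<omega>)) * indicator {0..t} s \<partial>lborel) \<partial>M)"
    proof (intro nn_integral_mono sum_partition_le d)
      fix \<omega> s j assume "j < n" "s \<in> {\<tau> j<..\<tau> (Suc j)}"
      then have "simple_process n \<tau> \<xi> s \<omega> = \<xi> j \<omega>"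
        using sum_partition_indicator[of n \<tau> j s "\<lambda>i. \<xi> i \<omega>"] d(1) by (simp add: simple_process_def)
      then show "ennreal (trunc_energy e k g (t - s) (\<xi> j \<omega>)) \<le> ennreal (trunc_energy e k g (t - s) (simple_process n \<tau> \<xi> s \<omega>))"
        by simp
    qed auto
    finally show ?thesis .
  qed
  finally show ?thesis
    unfolding u_def c_def[symmetric] ito_const_def
    using trunc_const_ge_1[of k] normal_const_nonneg[of k] half_const_nonneg[of T g k]
    by (simp add: ennreal_mult c_def mult.assoc mult_left_mono)
qed

end

section \<open>Iterated integrals over time and over the probability space\<close>

lemma measurable_joint_compose:
  assumes "case_prod \<phi> \<in> borel_measurable (borel \<Otimes>\<^sub>M M)"
    "f \<in> borel_measurable N" "h \<in> measurable N M"
  shows "(\<lambda>x. \<phi> (f x) (h x)) \<in> borel_measurable N"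
  using measurable_compose[OF measurable_Pair[OF assms(2,3)] assms(1)] by simp

lemma double_nn_integral_add:
  fixes f h :: "real \<Rightarrow> 'a \<Rightarrow> ennreal"
  assumes f: "case_prod f \<in> borel_measurable (borel \<Otimes>\<^sub>M M)" and h: "case_prod h \<in> borel_measurable (borel \<Otimes>\<^sub>M M)"
    and [measurable]: "A \<in> sets borel"
  shows "(\<integral>\<^sup>+\<omega>. (\<integral>\<^sup>+s\<in>A. (f s \<omega> + h s \<omega>) \<partial>lborel) \<partial>M)
    = (\<integral>\<^sup>+\<omega>. (\<integral>\<^sup>+s\<in>A. f s \<omega> \<partial>lborel) \<partial>M) + (\<integral>\<^sup>+\<omega>. (\<integral>\<^sup>+s\<in>A. h s \<omega> \<partial>lborel) \<partial>M)"
proof -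
  note [measurable (raw)] = measurable_compose[OF measurable_Pair f] measurable_compose[OF measurable_Pair h]
  have [measurable]: "(\<lambda>(\<omega>, s). f s \<omega>) \<in> borel_measurable (M \<Otimes>\<^sub>M lborel)"
    "(\<lambda>(\<omega>, s). h s \<omega>) \<in> borel_measurable (M \<Otimes>\<^sub>M lborel)"
    using measurable_compose[OF measurable_Pair f, of snd "M \<Otimes>\<^sub>M lborel" fst]
      measurable_compose[OF measurable_Pair h, of snd "M \<Otimes>\<^sub>M lborel" fst]
    by (simp_all add: split_beta')
  have "(\<integral>\<^sup>+\<omega>. (\<integral>\<^sup>+s\<in>A. (f s \<omega> + h s \<omega>) \<partial>lborel) \<partial>M)
     = (\<integral>\<^sup>+\<omega>. ((\<integral>\<^sup>+s\<in>A. f s \<omega> \<partial>lborel) + (\<integral>\<^sup>+s\<in>A. h s \<omega> \<partial>lborel)) \<partial>M)"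
    by (intro nn_integral_cong) (simp add: distrib_right nn_integral_add)
  then show ?thesis by (simp add: nn_integral_add)
qed

lemma double_nn_integral_cmult:
  fixes f :: "real \<Rightarrow> 'a \<Rightarrow> ennreal"
  assumes f: "case_prod f \<in> borel_measurable (borel \<Otimes>\<^sub>M M)" and [measurable]: "A \<in> sets borel"
  shows "(\<integral>\<^sup>+\<omega>. (\<integral>\<^sup>+s\<in>A. (c * f s \<omega>) \<partial>lborel) \<partial>M) = c * (\<integral>\<^sup>+\<omega>. (\<integral>\<^sup>+s\<in>A. f s \<omega> \<partial>lborel) \<partial>M)"
proof -
  have [measurable]: "(\<lambda>(\<omega>, s). f s \<omega>) \<in> borel_measurable (M \<Otimes>\<^sub>M lborel)"
    using measurable_compose[OF measurable_Pair f, of snd "M \<Otimes>\<^sub>M lborel" fst]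
    by (simp add: split_beta')
  have "(\<integral>\<^sup>+\<omega>. (\<integral>\<^sup>+s\<in>A. (c * f s \<omega>) \<partial>lborel) \<partial>M) = (\<integral>\<^sup>+\<omega>. c * (\<integral>\<^sup>+s\<in>A. f s \<omega> \<partial>lborel) \<partial>M)"
    by (intro nn_integral_cong) (simp add: mult.assoc nn_integral_cmult)
  then show ?thesis by (simp add: nn_integral_cmult)
qed

section \<open>Linear combinations of simple processes and limits in square mean\<close>

lemma simple_process_cong_point:
  assumes "\<And>i. i < n \<Longrightarrow> s \<in> {\<tau> i<..\<tau> (Suc i)} \<longleftrightarrow> s' \<in> {\<tau> i<..\<tau> (Suc i)}"
  shows "simple_process n \<tau> \<xi> s \<omega> = simple_process n \<tau> \<xi> s' \<omega>"
  unfolding simple_process_def using assms by (intro sum.cong) (auto simp: indicator_def)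

context brownian_motion
begin

text \<open>Unlike \<^const>\<open>has_ito_integral\<close>, this does not ask for an adapted or square integrable
  integrand, but for joint measurability on the whole real line.\<close>

definition ito_limit :: "real \<Rightarrow> (real \<Rightarrow> 'a \<Rightarrow> real) \<Rightarrow> ('a \<Rightarrow> real) \<Rightarrow> bool" where
  "ito_limit t \<phi> I \<longleftrightarrow> case_prod \<phi> \<in> borel_measurable (borel \<Otimes>\<^sub>M M) \<and> I \<in> borel_measurable M \<and>
     (\<exists>n \<tau> \<xi>. (\<forall>k. simple_data M F t (n k) (\<tau> k) (\<xi> k)) \<and>
        (\<lambda>k. \<integral>\<^sup>+\<omega>. (\<integral>\<^sup>+s\<in>{0..t}.
            ennreal ((\<phi> s \<omega> - simple_process (n k) (\<tau> k) (\<xi> k) s \<omega>)\<^sup>2) \<partial>lborel) \<partial>M)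
          \<longlonglongrightarrow> 0 \<and>
        (\<lambda>k. \<integral>\<^sup>+\<omega>. ennreal ((I \<omega> - simple_ito_integral B (n k) (\<tau> k) (\<xi> k) \<omega>)\<^sup>2) \<partial>M)
          \<longlonglongrightarrow> 0)"

lemma has_ito_integral_imp_ito_limit:
  assumes "has_ito_integral M F B t \<phi> I"
    and "case_prod \<phi>' \<in> borel_measurable (borel \<Otimes>\<^sub>M M)"
    and "\<And>s \<omega>. s \<in> {0..t} \<Longrightarrow> \<omega> \<in> space M \<Longrightarrow> \<phi>' s \<omega> = \<phi> s \<omega>"
  shows "ito_limit t \<phi>' I"
proof -
  from assms(1) obtain n \<tau> \<xi> where a: "\<And>k. simple_data M F t (n k) (\<tau> k) (\<xi> k)"
    "(\<lambda>k. \<integral>\<^sup>+\<omega>. (\<integral>\<^sup>+s\<in>{0..t}. ennreal ((\<phi> s \<omega> - simple_process (n k) (\<tau> k) (\<xi> k) s \<omega>)\<^sup>2) \<partial>lborel) \<partial>M) \<longlonglongrightarrow> 0"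
    "(\<lambda>k. \<integral>\<^sup>+\<omega>. ennreal ((I \<omega> - simple_ito_integral B (n k) (\<tau> k) (\<xi> k) \<omega>)\<^sup>2) \<partial>M) \<longlonglongrightarrow> 0"
    and I: "I \<in> borel_measurable M"
    unfolding has_ito_integral_def by blast
  have "(\<integral>\<^sup>+\<omega>. (\<integral>\<^sup>+s\<in>{0..t}. ennreal ((\<phi>' s \<omega> - simple_process (n k) (\<tau> k) (\<xi> k) s \<omega>)\<^sup>2) \<partial>lborel) \<partial>M)
     = (\<integral>\<^sup>+\<omega>. (\<integral>\<^sup>+s\<in>{0..t}. ennreal ((\<phi> s \<omega> - simple_process (n k) (\<tau> k) (\<xi> k) s \<omega>)\<^sup>2) \<partial>lborel) \<partial>M)" for k
    by (intro nn_integral_cong) (auto simp: assms(3) indicator_def)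
  then show ?thesis unfolding ito_limit_def using a I assms(2)
    by (auto intro!: exI[of _ n] exI[of _ \<tau>] exI[of _ \<xi>])
qed

lemma simple_process_measurable [measurable (raw)]:
  assumes "simple_data M F t n \<tau> \<xi>" "t \<le> T"
    "f \<in> borel_measurable N" "h \<in> measurable N M"
  shows "(\<lambda>x. simple_process n \<tau> \<xi> (f x) (h x)) \<in> borel_measurable N"
  unfolding simple_process_def
proof (intro borel_measurable_sum borel_measurable_times)
  fix i assume "i \<in> {..<n}"
  then show "(\<lambda>x. \<xi> i (h x)) \<in> borel_measurable N"
    using measurable_compose[OF assms(4) simple_dataD(6)[OF assms(1,2)]] by auto
  show "(\<lambda>x. indicat_real {\<tau> i<..\<tau> (Suc i)} (f x)) \<in> borel_measurable N"
    using assms(3) by measurable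
qed

text \<open>Passing to a finer partition changes neither the process nor its integral; two simple
  processes can then be put on the same partition and combined value by value.\<close>

lemma simple_refinement:
  assumes sd: "simple_data M F t n \<tau> \<xi>" and t: "t \<le> T"
    and P: "finite P" "\<tau> ` {..n} \<subseteq> P" "P \<subseteq> {0..t}"
  defines "\<rho> \<equiv> \<lambda>i. sorted_list_of_set P ! i" and "N \<equiv> card P - 1"
  shows "\<exists>\<eta>. simple_data M F t N \<rho> \<eta> \<and> (\<forall>s \<omega>. simple_process N \<rho> \<eta> s \<omega> = simple_process n \<tau> \<xi> s \<omega>) \<and>
     (\<forall>\<omega>. simple_ito_integral B N \<rho> \<eta> \<omega> = simple_ito_integral B n \<tau> \<xi> \<omega>)"
proof -
  note d = simple_dataD[OF sd t]
  have "\<tau> 0 \<in> P" using P(2) by auto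
  then have cP: "card P > 0" using P(1) card_gt_0_iff by blast
  have len: "length (sorted_list_of_set P) = Suc N" using cP by (simp add: N_def)
  have strict: "\<rho> i < \<rho> j" if "i < j" "j \<le> N" for i j
    unfolding \<rho>_def using strict_sorted_list_of_set[of P] that len
    by (simp add: strict_sorted_iff sorted_wrt_iff_nth_less)
  have mono: "\<rho> i \<le> \<rho> j" if "i \<le> j" "j \<le> N" for i j
    using strict[of i j] that by (cases "i = j") auto
  have \<rho>P: "\<rho> i \<in> P" if "i \<le> N" for i
    unfolding \<rho>_def using nth_mem[of i "sorted_list_of_set P"] len that P(1) by simp
  have ex: "\<exists>a\<le>N. \<rho> a = \<tau> i" if "i \<le> n" for i
  proof -
    have "\<tau> i \<in> set (sorted_list_of_set P)" using that P by auto
    then obtain a where "a < length (sorted_list_of_set P)" "sorted_list_of_set P ! a = \<tau> i"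
      unfolding in_set_conv_nth by blast
    then show ?thesis using len by (auto simp: \<rho>_def intro!: exI[of _ a])
  qed
  \<comment> \<open>The value on a cell is read off at its right end, which belongs to the cell. It
    is nevertheless known at the left end \<open>\<rho> j\<close>: a step of the old partition that
    contains the right end starts at a point of P before it, hence no later than
    \<open>\<rho> j\<close>.\<close>
  define \<eta> where "\<eta> = (\<lambda>j \<omega>. simple_process n \<tau> \<xi> (\<rho> (Suc j)) \<omega>)"
  have le: "\<tau> i \<le> \<rho> j" if *: "\<tau> i < \<rho> (Suc j)" "i \<le> n" "j < N" for i j
  proof -
    obtain a where a: "a \<le> N" "\<rho> a = \<tau> i" using ex[OF *(2)] by auto
    have "a < Suc j"
    proof (rule ccontr)
      assume "\<not> a < Suc j"
      then show False using mono[of "Suc j" a] a * by auto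
    qed
    then show ?thesis using mono[of a j] a * by simp
  qed
  have iff: "s \<in> {\<tau> i<..\<tau> (Suc i)} \<longleftrightarrow> \<rho> (Suc j) \<in> {\<tau> i<..\<tau> (Suc i)}"
    if "i < n" "j < N" "s \<in> {\<rho> j<..\<rho> (Suc j)}" for i j s
  proof -
    have "\<tau> i < s \<longleftrightarrow> \<tau> i < \<rho> (Suc j)" using le[of i j] that by fastforce
    moreover have "s \<le> \<tau> (Suc i) \<longleftrightarrow> \<rho> (Suc j) \<le> \<tau> (Suc i)" using le[of "Suc i" j] that by fastforce
    ultimately show ?thesis by simp
  qed
  have sd': "simple_data M F t N \<rho> \<eta>"
    unfolding simple_data_def
  proof (intro conjI allI impI)
    show "0 \<le> \<rho> 0" "\<rho> N \<le> t" using \<rho>P[of 0] \<rho>P[of N] P by auto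
    fix j assume j: "j < N"
    show "\<rho> j \<le> \<rho> (Suc j)" using mono j by simp
    show "\<eta> j \<in> borel_measurable (F (\<rho> j))"
      unfolding \<eta>_def[abs_def] simple_process_def
    proof (rule borel_measurable_sum)
      fix i assume i: "i \<in> {..<n}"
      show "(\<lambda>\<omega>. \<xi> i \<omega> * indicator {\<tau> i<..\<tau> (Suc i)} (\<rho> (Suc j))) \<in> borel_measurable (F (\<rho> j))"
      proof (cases "\<tau> i < \<rho> (Suc j)")
        case True
        then have "\<xi> i \<in> borel_measurable (F (\<rho> j))"
          using le[of i j] i j d(5)[of i] by (auto intro: measurable_natural_filtration_mono)
        then show ?thesis by measurable
      qed simp
    qed
    obtain K where K: "\<And>i \<omega>. i < n \<Longrightarrow> \<omega> \<in> space M \<Longrightarrow> \<bar>\<xi> i \<omega>\<bar> \<le> K i" using d(7) by metis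
    show "\<exists>K. \<forall>\<omega>\<in>space M. \<bar>\<eta> j \<omega>\<bar> \<le> K"
    proof (intro exI ballI)
      fix \<omega> assume \<omega>: "\<omega> \<in> space M"
      have "\<bar>\<eta> j \<omega>\<bar> \<le> (\<Sum>i<n. \<bar>\<xi> i \<omega> * indicator {\<tau> i<..\<tau> (Suc i)} (\<rho> (Suc j))\<bar>)"
        unfolding \<eta>_def simple_process_def by (rule sum_abs)
      also have "\<dots> \<le> (\<Sum>i<n. K i)"
      proof (rule sum_mono)
        fix i assume "i \<in> {..<n}"
        then show "\<bar>\<xi> i \<omega> * indicator {\<tau> i<..\<tau> (Suc i)} (\<rho> (Suc j))\<bar> \<le> K i"
          using K[of i \<omega>] \<omega> abs_ge_zero[of "\<xi> i \<omega>"] by (auto simp: indicator_def)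
      qed
      finally show "\<bar>\<eta> j \<omega>\<bar> \<le> (\<Sum>i<n. K i)" .
    qed
  qed
  have proc: "simple_process N \<rho> \<eta> s \<omega> = simple_process n \<tau> \<xi> s \<omega>" for s \<omega>
  proof (cases "\<exists>j<N. s \<in> {\<rho> j<..\<rho> (Suc j)}")
    case True
    then obtain j where j: "j < N" "s \<in> {\<rho> j<..\<rho> (Suc j)}" by auto
    have "simple_process N \<rho> \<eta> s \<omega> = \<eta> j \<omega>"
      using sum_partition_indicator[of N \<rho> j s "\<lambda>i. \<eta> i \<omega>"] j mono by (simp add: simple_process_def)
    also have "\<dots> = simple_process n \<tau> \<xi> s \<omega>"
      unfolding \<eta>_def by (rule simple_process_cong_point) (rule iff[OF _ j, symmetric])
    finally show ?thesis .
  next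
    case False
    have "s \<notin> {\<tau> i<..\<tau> (Suc i)}" if i: "i < n" for i
    proof
      assume s: "s \<in> {\<tau> i<..\<tau> (Suc i)}"
      obtain a b where ab: "a \<le> N" "\<rho> a = \<tau> i" "b \<le> N" "\<rho> b = \<tau> (Suc i)" using ex[of i] ex[of "Suc i"] i by auto
      \<comment> \<open>The first point of the refinement that is not below s is the right end of
        the cell containing s; it is not the initial point because s lies strictly above \<tau>
        i.\<close>
      define m where "m = (LEAST m. s \<le> \<rho> m)"
      have sb: "s \<le> \<rho> b" using s ab by simp
      have m: "s \<le> \<rho> m" "m \<le> b"
        unfolding m_def using LeastI[of "\<lambda>m. s \<le> \<rho> m", OF sb] Least_le[of "\<lambda>m. s \<le> \<rho> m", OF sb] by auto
      have "m \<noteq> 0"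
      proof
        assume "m = 0"
        then have "s \<le> \<tau> i" using m mono[of 0 a] ab by auto
        then show False using s by auto
      qed
      then obtain m' where m': "m = Suc m'" by (cases m) auto
      have "\<not> s \<le> \<rho> m'" using not_less_Least[of m' "\<lambda>m. s \<le> \<rho> m"] m' by (auto simp: m_def)
      then show False using False m m' ab by auto
    qed
    then show ?thesis using False by (simp add: simple_process_def)
  qed
  have int: "simple_ito_integral B N \<rho> \<eta> \<omega> = simple_ito_integral B n \<tau> \<xi> \<omega>" for \<omega>
  proof -
    \<comment> \<open>The cells inside step i are those with index from a to b - 1, so their
      increments telescope.\<close>
    have tele: "(\<Sum>j<N. indicator {\<tau> i<..\<tau> (Suc i)} (\<rho> (Suc j)) * (B (\<rho> (Suc j)) \<omega> - B (\<rho> j) \<omega>))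
       = B (\<tau> (Suc i)) \<omega> - B (\<tau> i) \<omega>" if i: "i < n" for i
    proof -
      obtain a b where ab: "a \<le> N" "\<rho> a = \<tau> i" "b \<le> N" "\<rho> b = \<tau> (Suc i)" using ex[of i] ex[of "Suc i"] i by auto
      have "a \<le> b" using strict[of b a] ab d(1)[OF i] by (cases "b < a") auto
      have "\<rho> (Suc j) \<in> {\<tau> i<..\<tau> (Suc i)} \<longleftrightarrow> j \<in> {a..<b}" if "j < N" for j
      proof -
        have "\<rho> a < \<rho> (Suc j) \<longleftrightarrow> a \<le> j" using strict[of a "Suc j"] mono[of "Suc j" a] that ab by force
        moreover have "\<rho> (Suc j) \<le> \<rho> b \<longleftrightarrow> j < b" using strict[of b "Suc j"] mono[of "Suc j" b] that ab by force
        ultimately show ?thesis using ab by auto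
      qed
      then have "(\<Sum>j<N. indicator {\<tau> i<..\<tau> (Suc i)} (\<rho> (Suc j)) * (B (\<rho> (Suc j)) \<omega> - B (\<rho> j) \<omega>))
        = (\<Sum>j<N. if j \<in> {a..<b} then B (\<rho> (Suc j)) \<omega> - B (\<rho> j) \<omega> else 0)"
        by (intro sum.cong) (auto simp: indicator_def)
      also have "\<dots> = (\<Sum>j=a..<b. B (\<rho> (Suc j)) \<omega> - B (\<rho> j) \<omega>)"
        using ab by (subst sum.inter_restrict[symmetric]) (auto intro!: sum.cong)
      also have "\<dots> = B (\<rho> b) \<omega> - B (\<rho> a) \<omega>"
        using sum_Suc_diff'[OF \<open>a \<le> b\<close>, of "\<lambda>j. B (\<rho> j) \<omega>"] by simp
      finally show ?thesis using ab by simp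
    qed
    have "simple_ito_integral B N \<rho> \<eta> \<omega>
       = (\<Sum>j<N. \<Sum>i<n. \<xi> i \<omega> * (indicator {\<tau> i<..\<tau> (Suc i)} (\<rho> (Suc j)) * (B (\<rho> (Suc j)) \<omega> - B (\<rho> j) \<omega>)))"
      unfolding simple_ito_integral_def \<eta>_def simple_process_def by (simp only: sum_distrib_right mult.assoc)
    also have "\<dots> = (\<Sum>i<n. \<xi> i \<omega> * (\<Sum>j<N. indicator {\<tau> i<..\<tau> (Suc i)} (\<rho> (Suc j)) * (B (\<rho> (Suc j)) \<omega> - B (\<rho> j) \<omega>)))"
      by (subst sum.swap) (simp only: sum_distrib_left)
    also have "\<dots> = simple_ito_integral B n \<tau> \<xi> \<omega>"
      unfolding simple_ito_integral_def by (intro sum.cong refl) (simp only: tele lessThan_iff)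
    finally show ?thesis .
  qed
  show ?thesis using sd' proc int by auto
qed

lemma simple_linear_combination:
  assumes sd: "simple_data M F t n \<tau> \<xi>" "simple_data M F t n' \<tau>' \<xi>'" and t: "t \<le> T"
  shows "\<exists>N \<rho> \<eta>. simple_data M F t N \<rho> \<eta> \<and>
     (\<forall>s \<omega>. simple_process N \<rho> \<eta> s \<omega> = a * simple_process n \<tau> \<xi> s \<omega> + b * simple_process n' \<tau>' \<xi>' s \<omega>) \<and>
     (\<forall>\<omega>. simple_ito_integral B N \<rho> \<eta> \<omega> = a * simple_ito_integral B n \<tau> \<xi> \<omega> + b * simple_ito_integral B n' \<tau>' \<xi>' \<omega>)"
proof -
  define P where "P = \<tau> ` {..n} \<union> \<tau>' ` {..n'}"
  have P: "finite P" "\<tau> ` {..n} \<subseteq> P" "\<tau>' ` {..n'} \<subseteq> P" "P \<subseteq> {0..t}"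
    unfolding P_def using simple_dataD(4)[OF sd(1) t] simple_dataD(4)[OF sd(2) t] by auto
  define \<rho> where "\<rho> = (\<lambda>i. sorted_list_of_set P ! i)"
  define N where "N = card P - 1"
  obtain \<eta> where \<eta>: "simple_data M F t N \<rho> \<eta>" "\<And>s \<omega>. simple_process N \<rho> \<eta> s \<omega> = simple_process n \<tau> \<xi> s \<omega>"
     "\<And>\<omega>. simple_ito_integral B N \<rho> \<eta> \<omega> = simple_ito_integral B n \<tau> \<xi> \<omega>"
    using simple_refinement[OF sd(1) t P(1,2,4)] unfolding \<rho>_def N_def by auto
  obtain \<eta>' where \<eta>': "simple_data M F t N \<rho> \<eta>'" "\<And>s \<omega>. simple_process N \<rho> \<eta>' s \<omega> = simple_process n' \<tau>' \<xi>' s \<omega>"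
     "\<And>\<omega>. simple_ito_integral B N \<rho> \<eta>' \<omega> = simple_ito_integral B n' \<tau>' \<xi>' \<omega>"
    using simple_refinement[OF sd(2) t P(1,3,4)] unfolding \<rho>_def N_def by auto
  define \<zeta> where "\<zeta> = (\<lambda>i \<omega>. a * \<eta> i \<omega> + b * \<eta>' i \<omega>)"
  have "simple_data M F t N \<rho> \<zeta>"
    unfolding simple_data_def
  proof (intro conjI allI impI)
    fix i assume i: "i < N"
    show "\<zeta> i \<in> borel_measurable (F (\<rho> i))"
      unfolding \<zeta>_def using simple_dataD(5)[OF \<eta>(1) t i] simple_dataD(5)[OF \<eta>'(1) t i] by measurable
    obtain K K' where K: "\<forall>\<omega>\<in>space M. \<bar>\<eta> i \<omega>\<bar> \<le> K" "\<forall>\<omega>\<in>space M. \<bar>\<eta>' i \<omega>\<bar> \<le> K'"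
      using simple_dataD(7)[OF \<eta>(1) t i] simple_dataD(7)[OF \<eta>'(1) t i] by auto
    show "\<exists>K. \<forall>\<omega>\<in>space M. \<bar>\<zeta> i \<omega>\<bar> \<le> K"
    proof (intro exI ballI)
      fix \<omega> assume "\<omega> \<in> space M"
      then have "\<bar>a\<bar> * \<bar>\<eta> i \<omega>\<bar> + \<bar>b\<bar> * \<bar>\<eta>' i \<omega>\<bar> \<le> \<bar>a\<bar> * K + \<bar>b\<bar> * K'"
        using K by (intro add_mono mult_left_mono) auto
      then show "\<bar>\<zeta> i \<omega>\<bar> \<le> \<bar>a\<bar> * K + \<bar>b\<bar> * K'"
        unfolding \<zeta>_def abs_mult[symmetric] by (rule order_trans[OF abs_triangle_ineq])
    qed
  qed (use \<eta>(1) in \<open>auto simp: simple_data_def\<close>)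
  moreover have "simple_process N \<rho> \<zeta> s \<omega> = a * simple_process n \<tau> \<xi> s \<omega> + b * simple_process n' \<tau>' \<xi>' s \<omega>" for s \<omega>
    unfolding \<eta>(2)[symmetric] \<eta>'(2)[symmetric] unfolding simple_process_def \<zeta>_def
    by (simp only: sum_distrib_left sum.distrib[symmetric] distrib_right mult.assoc)
  moreover have "simple_ito_integral B N \<rho> \<zeta> \<omega> = a * simple_ito_integral B n \<tau> \<xi> \<omega> + b * simple_ito_integral B n' \<tau>' \<xi>' \<omega>" for \<omega>
    unfolding \<eta>(3)[symmetric] \<eta>'(3)[symmetric] unfolding simple_ito_integral_def \<zeta>_def
    by (simp only: sum_distrib_left sum.distrib[symmetric] distrib_right mult.assoc)
  ultimately show ?thesis by blast
qed

lemma square_linear_combination_le: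
  fixes a b x y :: real
  shows "(a * x + b * y)\<^sup>2 \<le> 2 * a\<^sup>2 * x\<^sup>2 + 2 * b\<^sup>2 * y\<^sup>2"
  using sum_squares_bound[of "a * x" "b * y"] by (simp add: power2_sum power_mult_distrib)

lemma tendsto_0_squeeze_combination:
  fixes x y z :: "nat \<Rightarrow> ennreal"
  assumes "x \<longlonglongrightarrow> 0" "y \<longlonglongrightarrow> 0" "\<And>k. z k \<le> ennreal a * x k + ennreal b * y k"
  shows "z \<longlonglongrightarrow> 0"
proof (rule tendsto_sandwich[of "\<lambda>_. 0" z sequentially "\<lambda>k. ennreal a * x k + ennreal b * y k"])
  have "(\<lambda>k. ennreal a * x k + ennreal b * y k) \<longlonglongrightarrow> ennreal a * 0 + ennreal b * 0"
    using assms by (intro tendsto_add ennreal_tendsto_cmult) auto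
  then show "(\<lambda>k. ennreal a * x k + ennreal b * y k) \<longlonglongrightarrow> 0" by simp
  show "(\<lambda>_. 0) \<longlonglongrightarrow> (0::ennreal)" by simp
qed (use assms(3) in auto)

lemma ito_limit_linear:
  assumes "ito_limit t \<phi> I" "ito_limit t \<psi> J" and t: "t \<le> T"
  shows "ito_limit t (\<lambda>s \<omega>. a * \<phi> s \<omega> + b * \<psi> s \<omega>) (\<lambda>\<omega>. a * I \<omega> + b * J \<omega>)"
proof -
  from assms(1) obtain n \<tau> \<xi> where x: "\<And>k. simple_data M F t (n k) (\<tau> k) (\<xi> k)"
    "(\<lambda>k. \<integral>\<^sup>+\<omega>. (\<integral>\<^sup>+s\<in>{0..t}. ennreal ((\<phi> s \<omega> - simple_process (n k) (\<tau> k) (\<xi> k) s \<omega>)\<^sup>2) \<partial>lborel) \<partial>M) \<longlonglongrightarrow> 0"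
    "(\<lambda>k. \<integral>\<^sup>+\<omega>. ennreal ((I \<omega> - simple_ito_integral B (n k) (\<tau> k) (\<xi> k) \<omega>)\<^sup>2) \<partial>M) \<longlonglongrightarrow> 0"
    and I[measurable]: "I \<in> borel_measurable M" and \<phi>[measurable]: "case_prod \<phi> \<in> borel_measurable (borel \<Otimes>\<^sub>M M)"
    unfolding ito_limit_def by blast
  from assms(2) obtain n' \<tau>' \<xi>' where y: "\<And>k. simple_data M F t (n' k) (\<tau>' k) (\<xi>' k)"
    "(\<lambda>k. \<integral>\<^sup>+\<omega>. (\<integral>\<^sup>+s\<in>{0..t}. ennreal ((\<psi> s \<omega> - simple_process (n' k) (\<tau>' k) (\<xi>' k) s \<omega>)\<^sup>2) \<partial>lborel) \<partial>M) \<longlonglongrightarrow> 0"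
    "(\<lambda>k. \<integral>\<^sup>+\<omega>. ennreal ((J \<omega> - simple_ito_integral B (n' k) (\<tau>' k) (\<xi>' k) \<omega>)\<^sup>2) \<partial>M) \<longlonglongrightarrow> 0"
    and J[measurable]: "J \<in> borel_measurable M" and \<psi>[measurable]: "case_prod \<psi> \<in> borel_measurable (borel \<Otimes>\<^sub>M M)"
    unfolding ito_limit_def by blast
  note [measurable (raw)] = measurable_joint_compose[OF \<phi>] measurable_joint_compose[OF \<psi>]
    simple_process_measurable[OF x(1) t] simple_process_measurable[OF y(1) t]
  note [measurable] = measurable_simple_ito_integral[OF x(1) t] measurable_simple_ito_integral[OF y(1) t]
  define Q where "Q = (\<lambda>k N \<rho> \<eta>. simple_data M F t N \<rho> \<eta> \<and>
     (\<forall>s \<omega>. simple_process N \<rho> \<eta> s \<omega> = a * simple_process (n k) (\<tau> k) (\<xi> k) s \<omega> + b * simple_process (n' k) (\<tau>' k) (\<xi>' k) s \<omega>) \<and>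
     (\<forall>\<omega>. simple_ito_integral B N \<rho> \<eta> \<omega> = a * simple_ito_integral B (n k) (\<tau> k) (\<xi> k) \<omega> + b * simple_ito_integral B (n' k) (\<tau>' k) (\<xi>' k) \<omega>))"
  have "\<forall>k. \<exists>N \<rho> \<eta>. Q k N \<rho> \<eta>"
    unfolding Q_def using simple_linear_combination[OF x(1) y(1) t] by blast
  then obtain N \<rho> \<eta> where "\<And>k. Q k (N k) (\<rho> k) (\<eta> k)" by metis
  then have z: "\<And>k. simple_data M F t (N k) (\<rho> k) (\<eta> k)"
     "\<And>k s \<omega>. simple_process (N k) (\<rho> k) (\<eta> k) s \<omega> = a * simple_process (n k) (\<tau> k) (\<xi> k) s \<omega> + b * simple_process (n' k) (\<tau>' k) (\<xi>' k) s \<omega>"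
     "\<And>k \<omega>. simple_ito_integral B (N k) (\<rho> k) (\<eta> k) \<omega> = a * simple_ito_integral B (n k) (\<tau> k) (\<xi> k) \<omega> + b * simple_ito_integral B (n' k) (\<tau>' k) (\<xi>' k) \<omega>"
    unfolding Q_def by auto
  have e1: "ennreal ((a * c + b * d - (a * c' + b * d'))\<^sup>2) \<le> ennreal (2 * a\<^sup>2) * ennreal ((c - c')\<^sup>2) + ennreal (2 * b\<^sup>2) * ennreal ((d - d')\<^sup>2)"
    for c d c' d' :: real
    using square_linear_combination_le[of a "c - c'" b "d - d'"]
    by (simp add: ennreal_mult[symmetric] ennreal_plus[symmetric] ennreal_leI algebra_simps del: ennreal_plus)
  have c1: "(\<lambda>k. \<integral>\<^sup>+\<omega>. (\<integral>\<^sup>+s\<in>{0..t}. ennreal ((a * \<phi> s \<omega> + b * \<psi> s \<omega> - simple_process (N k) (\<rho> k) (\<eta> k) s \<omega>)\<^sup>2) \<partial>lborel) \<partial>M) \<longlonglongrightarrow> 0"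
  proof (rule tendsto_0_squeeze_combination[OF x(2) y(2), where a = "2 * a\<^sup>2" and b = "2 * b\<^sup>2"])
    fix k
    have "(\<integral>\<^sup>+\<omega>. (\<integral>\<^sup>+s\<in>{0..t}. ennreal ((a * \<phi> s \<omega> + b * \<psi> s \<omega> - simple_process (N k) (\<rho> k) (\<eta> k) s \<omega>)\<^sup>2) \<partial>lborel) \<partial>M)
       \<le> (\<integral>\<^sup>+\<omega>. (\<integral>\<^sup>+s. (ennreal (2 * a\<^sup>2) * ennreal ((\<phi> s \<omega> - simple_process (n k) (\<tau> k) (\<xi> k) s \<omega>)\<^sup>2)
         + ennreal (2 * b\<^sup>2) * ennreal ((\<psi> s \<omega> - simple_process (n' k) (\<tau>' k) (\<xi>' k) s \<omega>)\<^sup>2)) * indicator {0..t} s \<partial>lborel) \<partial>M)"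
      unfolding z by (intro nn_integral_mono) (use e1 in \<open>auto simp: indicator_def\<close>)
    also have "\<dots> = ennreal (2 * a\<^sup>2) * (\<integral>\<^sup>+\<omega>. (\<integral>\<^sup>+s\<in>{0..t}. ennreal ((\<phi> s \<omega> - simple_process (n k) (\<tau> k) (\<xi> k) s \<omega>)\<^sup>2) \<partial>lborel) \<partial>M)
       + ennreal (2 * b\<^sup>2) * (\<integral>\<^sup>+\<omega>. (\<integral>\<^sup>+s\<in>{0..t}. ennreal ((\<psi> s \<omega> - simple_process (n' k) (\<tau>' k) (\<xi>' k) s \<omega>)\<^sup>2) \<partial>lborel) \<partial>M)"
      by (subst double_nn_integral_add, measurable, subst (1 2) double_nn_integral_cmult, measurable)
    finally show "(\<integral>\<^sup>+\<omega>. (\<integral>\<^sup>+s\<in>{0..t}. ennreal ((a * \<phi> s \<omega> + b * \<psi> s \<omega> - simple_process (N k) (\<rho> k) (\<eta> k) s \<omega>)\<^sup>2) \<partial>lborel) \<partial>M) \<le> \<dots>" .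
  qed
  have c2: "(\<lambda>k. \<integral>\<^sup>+\<omega>. ennreal ((a * I \<omega> + b * J \<omega> - simple_ito_integral B (N k) (\<rho> k) (\<eta> k) \<omega>)\<^sup>2) \<partial>M) \<longlonglongrightarrow> 0"
  proof (rule tendsto_0_squeeze_combination[OF x(3) y(3), where a = "2 * a\<^sup>2" and b = "2 * b\<^sup>2"])
    fix k
    have "(\<integral>\<^sup>+\<omega>. ennreal ((a * I \<omega> + b * J \<omega> - simple_ito_integral B (N k) (\<rho> k) (\<eta> k) \<omega>)\<^sup>2) \<partial>M)
       \<le> (\<integral>\<^sup>+\<omega>. ennreal (2 * a\<^sup>2) * ennreal ((I \<omega> - simple_ito_integral B (n k) (\<tau> k) (\<xi> k) \<omega>)\<^sup>2)
         + ennreal (2 * b\<^sup>2) * ennreal ((J \<omega> - simple_ito_integral B (n' k) (\<tau>' k) (\<xi>' k) \<omega>)\<^sup>2) \<partial>M)"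
      unfolding z by (intro nn_integral_mono e1)
    also have "\<dots> = ennreal (2 * a\<^sup>2) * (\<integral>\<^sup>+\<omega>. ennreal ((I \<omega> - simple_ito_integral B (n k) (\<tau> k) (\<xi> k) \<omega>)\<^sup>2) \<partial>M)
         + ennreal (2 * b\<^sup>2) * (\<integral>\<^sup>+\<omega>. ennreal ((J \<omega> - simple_ito_integral B (n' k) (\<tau>' k) (\<xi>' k) \<omega>)\<^sup>2) \<partial>M)"
      by (simp add: nn_integral_add nn_integral_cmult)
    finally show "(\<integral>\<^sup>+\<omega>. ennreal ((a * I \<omega> + b * J \<omega> - simple_ito_integral B (N k) (\<rho> k) (\<eta> k) \<omega>)\<^sup>2) \<partial>M) \<le> \<dots>" .
  qed
  have "case_prod (\<lambda>s \<omega>. a * \<phi> s \<omega> + b * \<psi> s \<omega>) \<in> borel_measurable (borel \<Otimes>\<^sub>M M)" by measurable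
  then show ?thesis unfolding ito_limit_def using z(1) c1 c2 by auto
qed

text \<open>For fixed e, truncated powers and energies are at most \<open>(1 / e) ^ k\<close> times
  squares, so the approximation errors vanish in the limit. The dependence on e sits on these errors
  only and disappears with them. The factor \<open>4 * 5 ^ k\<close> is paid twice: once for passing
  from I to the simple integral, once for passing from the simple process to \<phi>.\<close>

lemma ito_limit_estimate:
  assumes I: "ito_limit t \<phi> I" and t: "t \<in> {0..T}" and e: "e > 0" and g: "1/2 < g" "g < 1"
  shows "(\<integral>\<^sup>+\<omega>. ennreal (trunc_pow e k (I \<omega>)) \<partial>M) \<le> ennreal ((4 * 5 ^ k)\<^sup>2 * ito_const T g k) *
    (\<integral>\<^sup>+\<omega>. (\<integral>\<^sup>+s\<in>{0..t}. ennreal (trunc_energy e k g (t - s) (\<phi> s \<omega>)) \<partial>lborel) \<partial>M)"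
proof -
  have T: "t \<le> T" using t by simp
  from I obtain n \<tau> \<xi> where x: "\<And>k. simple_data M F t (n k) (\<tau> k) (\<xi> k)"
    "(\<lambda>k. \<integral>\<^sup>+\<omega>. (\<integral>\<^sup>+s\<in>{0..t}. ennreal ((\<phi> s \<omega> - simple_process (n k) (\<tau> k) (\<xi> k) s \<omega>)\<^sup>2) \<partial>lborel) \<partial>M) \<longlonglongrightarrow> 0"
    "(\<lambda>k. \<integral>\<^sup>+\<omega>. ennreal ((I \<omega> - simple_ito_integral B (n k) (\<tau> k) (\<xi> k) \<omega>)\<^sup>2) \<partial>M) \<longlonglongrightarrow> 0"
    and I[measurable]: "I \<in> borel_measurable M" and \<phi>[measurable]: "case_prod \<phi> \<in> borel_measurable (borel \<Otimes>\<^sub>M M)"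
    unfolding ito_limit_def by blast
  note [measurable (raw)] = measurable_joint_compose[OF \<phi>] simple_process_measurable[OF x(1) T]
  note [measurable] = measurable_simple_ito_integral[OF x(1) T]
  define A :: real where "A = 4 * 5 ^ k"
  have A: "A \<ge> 0" by (simp add: A_def)
  define Q where "Q = (1 / e) ^ k"
  have Q: "Q \<ge> 0" using e by (simp add: Q_def)
  define c where "c = ito_const T g k"
  have c: "c \<ge> 0" by (simp add: c_def ito_const_nonneg)
  define R where "R = (\<integral>\<^sup>+\<omega>. (\<integral>\<^sup>+s\<in>{0..t}. ennreal (trunc_energy e k g (t - s) (\<phi> s \<omega>)) \<partial>lborel) \<partial>M)"
  define X where "X = (\<lambda>j. \<integral>\<^sup>+\<omega>. (\<integral>\<^sup>+s\<in>{0..t}. ennreal ((\<phi> s \<omega> - simple_process (n j) (\<tau> j) (\<xi> j) s \<omega>)\<^sup>2) \<partial>lborel) \<partial>M)"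
  define Y where "Y = (\<lambda>j. \<integral>\<^sup>+\<omega>. ennreal ((I \<omega> - simple_ito_integral B (n j) (\<tau> j) (\<xi> j) \<omega>)\<^sup>2) \<partial>M)"
  have step: "(\<integral>\<^sup>+\<omega>. ennreal (trunc_pow e k (I \<omega>)) \<partial>M) \<le>
      ennreal (A\<^sup>2 * c) * R + (ennreal (A\<^sup>2 * c * Q) * X j + ennreal (A * Q) * Y j)" for j
  proof -
    let ?S = "simple_ito_integral B (n j) (\<tau> j) (\<xi> j)" and ?P = "simple_process (n j) (\<tau> j) (\<xi> j)"
    have 1: "ennreal (trunc_pow e k (I \<omega>)) \<le> ennreal A * ennreal (trunc_pow e k (?S \<omega>)) + ennreal (A * Q) * ennreal ((I \<omega> - ?S \<omega>)\<^sup>2)" for \<omega>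
    proof -
      have "trunc_pow e k (I \<omega>) \<le> A * (trunc_pow e k (?S \<omega>) + trunc_pow e k (I \<omega> - ?S \<omega>))"
        unfolding A_def using e by (intro trunc_pow_add) auto
      also have "\<dots> \<le> A * (trunc_pow e k (?S \<omega>) + Q * (I \<omega> - ?S \<omega>)\<^sup>2)"
        unfolding Q_def using A by (intro mult_left_mono add_left_mono trunc_pow_le_square e)
      finally show ?thesis using A Q trunc_pow_nonneg[of e k "?S \<omega>"] e
        by (simp add: ennreal_mult[symmetric] ennreal_plus[symmetric] ennreal_leI algebra_simps del: ennreal_plus)
    qed
    have 2: "ennreal (trunc_energy e k g (t - s) (?P s \<omega>)) \<le> ennreal A * ennreal (trunc_energy e k g (t - s) (\<phi> s \<omega>)) + ennreal (A * Q) * ennreal ((\<phi> s \<omega> - ?P s \<omega>)\<^sup>2)" for s \<omega>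
    proof -
      have "trunc_energy e k g (t - s) (?P s \<omega>) \<le> A * (trunc_energy e k g (t - s) (\<phi> s \<omega>) + trunc_energy e k g (t - s) (\<phi> s \<omega> - ?P s \<omega>))"
        unfolding A_def using e by (intro trunc_energy_add) auto
      also have "\<dots> \<le> A * (trunc_energy e k g (t - s) (\<phi> s \<omega>) + Q * (\<phi> s \<omega> - ?P s \<omega>)\<^sup>2)"
        unfolding Q_def using A by (intro mult_left_mono add_left_mono trunc_energy_le_square e)
      finally show ?thesis using A Q trunc_energy_nonneg[of e k g] e
        by (simp add: ennreal_mult[symmetric] ennreal_plus[symmetric] ennreal_leI algebra_simps del: ennreal_plus)
    qed
    have "(\<integral>\<^sup>+\<omega>. (\<integral>\<^sup>+s\<in>{0..t}. ennreal (trunc_energy e k g (t - s) (?P s \<omega>)) \<partial>lborel) \<partial>M)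
      \<le> (\<integral>\<^sup>+\<omega>. (\<integral>\<^sup>+s. (ennreal A * ennreal (trunc_energy e k g (t - s) (\<phi> s \<omega>))
          + ennreal (A * Q) * ennreal ((\<phi> s \<omega> - ?P s \<omega>)\<^sup>2)) * indicator {0..t} s \<partial>lborel) \<partial>M)"
      by (intro nn_integral_mono) (use 2 in \<open>auto simp: indicator_def\<close>)
    also have "\<dots> = ennreal A * R + ennreal (A * Q) * X j"
      unfolding R_def X_def
      by (subst double_nn_integral_add, measurable, subst (1 2) double_nn_integral_cmult, measurable)
    finally have 3: "(\<integral>\<^sup>+\<omega>. (\<integral>\<^sup>+s\<in>{0..t}. ennreal (trunc_energy e k g (t - s) (?P s \<omega>)) \<partial>lborel) \<partial>M) \<le> ennreal A * R + ennreal (A * Q) * X j" .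
    have "(\<integral>\<^sup>+\<omega>. ennreal (trunc_pow e k (I \<omega>)) \<partial>M) \<le> (\<integral>\<^sup>+\<omega>. ennreal A * ennreal (trunc_pow e k (?S \<omega>)) + ennreal (A * Q) * ennreal ((I \<omega> - ?S \<omega>)\<^sup>2) \<partial>M)"
      by (intro nn_integral_mono 1)
    also have "\<dots> = ennreal A * (\<integral>\<^sup>+\<omega>. ennreal (trunc_pow e k (?S \<omega>)) \<partial>M) + ennreal (A * Q) * Y j"
      by (simp add: nn_integral_add nn_integral_cmult Y_def)
    also have "\<dots> \<le> ennreal A * (ennreal c * (ennreal A * R + ennreal (A * Q) * X j)) + ennreal (A * Q) * Y j"
      by (intro add_right_mono mult_left_mono order_trans[OF simple_ito_estimate[OF x(1) t e g]] mult_left_mono 3[unfolded c_def])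
        (auto simp: c_def intro!: mult_left_mono 3)
    also have "\<dots> = ennreal (A\<^sup>2 * c) * R + (ennreal (A\<^sup>2 * c * Q) * X j + ennreal (A * Q) * Y j)"
      using A c Q by (simp add: ennreal_mult power2_eq_square algebra_simps)
    finally show ?thesis .
  qed
  have "(\<lambda>j. ennreal (A\<^sup>2 * c) * R + (ennreal (A\<^sup>2 * c * Q) * X j + ennreal (A * Q) * Y j)) \<longlonglongrightarrow> ennreal (A\<^sup>2 * c) * R + 0"
  proof (intro tendsto_add tendsto_const)
    show "(\<lambda>j. ennreal (A\<^sup>2 * c * Q) * X j + ennreal (A * Q) * Y j) \<longlonglongrightarrow> 0"
      by (rule tendsto_0_squeeze_combination[of X Y]) (use x(2,3) in \<open>auto simp: X_def Y_def\<close>)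
  qed
  then have "(\<integral>\<^sup>+\<omega>. ennreal (trunc_pow e k (I \<omega>)) \<partial>M) \<le> ennreal (A\<^sup>2 * c) * R"
    using step by (intro LIMSEQ_le_const) auto
  then show ?thesis by (simp add: A_def c_def R_def)
qed

end

section \<open>Moments of solutions of Volterra equations\<close>

lemma nn_integral_powr_reflect:
  fixes \<theta> T s :: real
  assumes "\<theta> > 0" "s \<le> T"
  shows "(\<integral>\<^sup>+t\<in>{s..T}. ennreal ((t - s) powr (\<theta> - 1)) \<partial>lborel) = ennreal ((T - s) powr \<theta> / \<theta>)"
proof -
  have "(\<integral>\<^sup>+t\<in>{s..T}. ennreal ((t - s) powr (\<theta> - 1)) \<partial>lborel)
     = (\<integral>\<^sup>+x. ennreal ((T + (-1) * x - s) powr (\<theta> - 1)) * indicator {s..T} (T + (-1) * x) \<partial>lborel)"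
    by (subst nn_integral_real_affine[where c="-1" and t=T]) auto
  also have "\<dots> = (\<integral>\<^sup>+x\<in>{0..T - s}. ennreal ((T - s - x) powr (\<theta> - 1)) \<partial>lborel)"
    by (intro nn_integral_cong) (auto simp: indicator_def algebra_simps)
  finally show ?thesis using nn_integral_powr_kernel[of \<theta> "T - s"] assms by simp
qed

lemma exp_minus_le_powr:
  fixes x a :: real
  assumes "x > 0" "0 \<le> a" "a \<le> 1"
  shows "exp (- x) \<le> x powr (- a)"
proof -
  have "x powr a \<le> 1 + x"
  proof (cases "x \<le> 1")
    case True
    then have "x powr a \<le> 1 powr a" using assms by (intro powr_mono2) auto
    then show ?thesis using assms by simp
  next
    case False
    then have "x powr a \<le> x powr 1" using assms by (intro powr_mono) auto
    then show ?thesis using assms by simp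
  qed
  also have "\<dots> \<le> exp x" by (rule exp_ge_add_one_self)
  finally show ?thesis using assms by (simp add: exp_minus powr_minus)
qed

text \<open>Half of the exponent \<theta> is spent on the decay in l, by
  \<open>exp_minus_le_powr\<close> with exponent \<theta> / 2; the other half keeps the kernel
  integrable.\<close>

lemma nn_integral_exp_kernel:
  fixes \<theta> T s l :: real
  assumes "0 < \<theta>" "\<theta> \<le> 1" "0 \<le> s" "s \<le> T" "l > 0"
  shows "(\<integral>\<^sup>+t\<in>{s..T}. ennreal (exp (- l * (t - s)) * (t - s) powr (\<theta> - 1)) \<partial>lborel)
    \<le> ennreal (l powr (- \<theta> / 2) * (T powr (\<theta> / 2) / (\<theta> / 2)))"
proof -
  have "(\<integral>\<^sup>+t\<in>{s..T}. ennreal (exp (- l * (t - s)) * (t - s) powr (\<theta> - 1)) \<partial>lborel)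
     \<le> (\<integral>\<^sup>+t. ennreal (l powr (- \<theta> / 2)) * (ennreal ((t - s) powr (\<theta> / 2 - 1)) * indicator {s..T} t) \<partial>lborel)"
  proof (rule nn_integral_mono)
    fix t
    show "ennreal (exp (- l * (t - s)) * (t - s) powr (\<theta> - 1)) * indicator {s..T} t
      \<le> ennreal (l powr (- \<theta> / 2)) * (ennreal ((t - s) powr (\<theta> / 2 - 1)) * indicator {s..T} t)"
    proof (cases "s < t \<and> t \<le> T")
      case True
      have "exp (- (l * (t - s))) \<le> (l * (t - s)) powr (- (\<theta> / 2))"
        using True assms by (intro exp_minus_le_powr) auto
      then have "exp (- l * (t - s)) * (t - s) powr (\<theta> - 1) \<le> (l * (t - s)) powr (- (\<theta> / 2)) * (t - s) powr (\<theta> - 1)"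
        by (intro mult_right_mono) auto
      also have "\<dots> = l powr (- \<theta> / 2) * (t - s) powr (\<theta> / 2 - 1)"
      proof -
        have "(t - s) powr (- (\<theta> / 2)) * (t - s) powr (\<theta> - 1) = (t - s) powr (\<theta> / 2 - 1)"
          by (subst powr_add[symmetric]) (simp add: field_simps)
        then show ?thesis using True assms by (simp add: powr_mult mult.assoc)
      qed
      finally show ?thesis using True by (simp add: ennreal_mult[symmetric] ennreal_leI)
    next
      case False
      then show ?thesis by (cases "t = s") (auto simp: indicator_def)
    qed
  qed
  also have "\<dots> = ennreal (l powr (- \<theta> / 2)) * ennreal ((T - s) powr (\<theta> / 2) / (\<theta> / 2))"
    using nn_integral_powr_reflect[of "\<theta> / 2" s T] assms by (subst nn_integral_cmult) auto
  also have "\<dots> \<le> ennreal (l powr (- \<theta> / 2)) * ennreal (T powr (\<theta> / 2) / (\<theta> / 2))"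
    using assms by (intro mult_left_mono ennreal_leI divide_right_mono powr_mono2) auto
  finally show ?thesis using assms by (subst ennreal_mult) auto
qed

lemma ennreal_absorb_half:
  fixes A G :: ennreal
  assumes "A \<le> G + ennreal (1 / 2) * A" "A < \<top>"
  shows "A \<le> 2 * G"
proof (cases "G = \<top>")
  case False
  obtain a where a: "A = ennreal a" "a \<ge> 0" using assms(2) by (cases A) auto
  obtain h where h: "G = ennreal h" "h \<ge> 0" using False by (cases G) auto
  have "ennreal (1 / 2) * ennreal a = ennreal (1 / 2 * a)" by (rule ennreal_mult[symmetric]) (use a in auto)
  moreover have "ennreal h + ennreal (1 / 2 * a) = ennreal (h + 1 / 2 * a)"
    by (rule ennreal_plus[symmetric]) (use a h in auto)
  ultimately have "ennreal a \<le> ennreal (h + 1 / 2 * a)" using assms(1) a h by simp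
  then have "a \<le> h + 1 / 2 * a" using a h by (subst (asm) ennreal_le_iff) auto
  then have "ennreal a \<le> ennreal (2 * h)" by (intro ennreal_leI) auto
  then show ?thesis using a h by (simp add: ennreal_mult)
qed (simp add: ennreal_mult_top)

text \<open>With the weight \<open>exp (- l * t)\<close> and \<open>l\<close> large, the convolution is at most half of the weighted
  integral of \<open>y\<close>. The a priori finiteness is what allows absorbing it.\<close>

lemma volterra_gronwall:
  fixes \<theta> C T :: real
  assumes \<theta>: "0 < \<theta>" "\<theta> \<le> 1" and C: "C \<ge> 0"
  shows "\<exists>D\<ge>0. \<forall>y g. y \<in> borel_measurable borel \<longrightarrow> g \<in> borel_measurable borel \<longrightarrow>
    (\<integral>\<^sup>+t\<in>{0..T}. y t \<partial>lborel) < \<top> \<longrightarrow>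
    (AE t in lborel. t \<in> {0..T} \<longrightarrow>
       y t \<le> g t + ennreal C * (\<integral>\<^sup>+s\<in>{0..t}. ennreal ((t - s) powr (\<theta> - 1)) * y s \<partial>lborel)) \<longrightarrow>
    (\<integral>\<^sup>+t\<in>{0..T}. y t \<partial>lborel) \<le> ennreal D * (\<integral>\<^sup>+t\<in>{0..T}. g t \<partial>lborel)"
proof -
  define q where "q = T powr (\<theta> / 2) / (\<theta> / 2)"
  have q: "q \<ge> 0" using \<theta> by (simp add: q_def)
  \<comment> \<open>Chosen so that \<open>l powr (- \<theta> / 2)\<close> is
    \<open>1 / (2 * C * q + 1)\<close>, which makes the factor of the convolution at most one
    half.\<close>
  define l where "l = (2 * C * q + 1) powr (2 / \<theta>)"
  have base: "2 * C * q + 1 > 0" using C q by (simp add: add_nonneg_pos)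
  have l: "l > 0" using base by (simp add: l_def)
  have "l powr (- \<theta> / 2) = 1 / (2 * C * q + 1)"
    unfolding l_def powr_powr using \<theta> base by (simp add: powr_minus_divide)
  then have half: "C * (l powr (- \<theta> / 2) * q) \<le> 1 / 2"
    using C q base by (simp add: divide_le_eq)
  have main: "(\<integral>\<^sup>+t\<in>{0..T}. y t \<partial>lborel) \<le> ennreal (2 * exp (l * T)) * (\<integral>\<^sup>+t\<in>{0..T}. g t \<partial>lborel)"
    if [measurable]: "y \<in> borel_measurable borel" "g \<in> borel_measurable borel"
    and fin: "(\<integral>\<^sup>+t\<in>{0..T}. y t \<partial>lborel) < \<top>"
    and ineq: "AE t in lborel. t \<in> {0..T} \<longrightarrow>
       y t \<le> g t + ennreal C * (\<integral>\<^sup>+s\<in>{0..t}. ennreal ((t - s) powr (\<theta> - 1)) * y s \<partial>lborel)" for y g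
  proof -
    define E where "E = (\<lambda>t. ennreal (exp (- l * t)))"
    have [measurable]: "E \<in> borel_measurable borel" unfolding E_def by measurable
    define A where "A = (\<integral>\<^sup>+t\<in>{0..T}. (E t * y t) \<partial>lborel)"
    have Ele: "E t \<le> 1" if "t \<ge> 0" for t using that l by (simp add: E_def)
    have "A \<le> (\<integral>\<^sup>+t\<in>{0..T}. y t \<partial>lborel)" unfolding A_def
      by (intro nn_integral_mono) (use Ele mult_right_mono[of "E _" 1] in \<open>auto simp: indicator_def\<close>)
    then have Afin: "A < \<top>" using fin by simp
    have "A \<le> (\<integral>\<^sup>+t. E t * g t * indicator {0..T} t + (\<integral>\<^sup>+s. ennreal C * (E t * ennreal ((t - s) powr (\<theta> - 1)) * y s * indicator {0..t} s * indicator {0..T} t) \<partial>lborel) \<partial>lborel)"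
      unfolding A_def
    proof (rule nn_integral_mono_AE)
      show "AE t in lborel. E t * y t * indicator {0..T} t \<le> E t * g t * indicator {0..T} t +
         (\<integral>\<^sup>+s. ennreal C * (E t * ennreal ((t - s) powr (\<theta> - 1)) * y s * indicator {0..t} s * indicator {0..T} t) \<partial>lborel)"
        using ineq
      proof eventually_elim
        case (elim t)
        show ?case
        proof (cases "t \<in> {0..T}")
          case True
          then have "E t * y t \<le> E t * (g t + ennreal C * (\<integral>\<^sup>+s\<in>{0..t}. ennreal ((t - s) powr (\<theta> - 1)) * y s \<partial>lborel))"
            using elim by (intro mult_left_mono) auto
          also have "\<dots> = E t * g t + (\<integral>\<^sup>+s. ennreal C * (E t * ennreal ((t - s) powr (\<theta> - 1)) * y s * indicator {0..t} s) \<partial>lborel)"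
            by (simp add: distrib_left nn_integral_cmult[symmetric] mult_ac)
          finally show ?thesis using True by simp
        qed simp
      qed
    qed
    also have "\<dots> = (\<integral>\<^sup>+t\<in>{0..T}. (E t * g t) \<partial>lborel) + (\<integral>\<^sup>+t. (\<integral>\<^sup>+s. ennreal C * (E t * ennreal ((t - s) powr (\<theta> - 1)) * y s * indicator {0..t} s * indicator {0..T} t) \<partial>lborel) \<partial>lborel)"
      unfolding indicator_def atLeastAtMost_iff by (intro nn_integral_add) measurable
    also have "(\<integral>\<^sup>+t. (\<integral>\<^sup>+s. ennreal C * (E t * ennreal ((t - s) powr (\<theta> - 1)) * y s * indicator {0..t} s * indicator {0..T} t) \<partial>lborel) \<partial>lborel)
       = (\<integral>\<^sup>+s. (\<integral>\<^sup>+t. ennreal C * (E t * ennreal ((t - s) powr (\<theta> - 1)) * y s * indicator {0..t} s * indicator {0..T} t) \<partial>lborel) \<partial>lborel)"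
      unfolding indicator_def atLeastAtMost_iff by (intro lborel_pair.Fubini') measurable
    also have "\<dots> \<le> (\<integral>\<^sup>+s. ennreal (1/2) * (E s * y s * indicator {0..T} s) \<partial>lborel)"
    proof (rule nn_integral_mono)
      fix s
      show "(\<integral>\<^sup>+t. ennreal C * (E t * ennreal ((t - s) powr (\<theta> - 1)) * y s * indicator {0..t} s * indicator {0..T} t) \<partial>lborel)
        \<le> ennreal (1/2) * (E s * y s * indicator {0..T} s)"
      proof (cases "s \<in> {0..T}")
        case True
        have Eeq: "E t = E s * ennreal (exp (- l * (t - s)))" for t
          unfolding E_def by (subst ennreal_mult[symmetric]) (auto simp: exp_add[symmetric] algebra_simps)
        have "(\<integral>\<^sup>+t. ennreal C * (E t * ennreal ((t - s) powr (\<theta> - 1)) * y s * indicator {0..t} s * indicator {0..T} t) \<partial>lborel)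
           \<le> (\<integral>\<^sup>+t. ennreal C * (E s * y s) * (ennreal (exp (- l * (t - s)) * (t - s) powr (\<theta> - 1)) * indicator {s..T} t) \<partial>lborel)"
        proof (rule nn_integral_mono)
          fix t
          show "ennreal C * (E t * ennreal ((t - s) powr (\<theta> - 1)) * y s * indicator {0..t} s * indicator {0..T} t)
            \<le> ennreal C * (E s * y s) * (ennreal (exp (- l * (t - s)) * (t - s) powr (\<theta> - 1)) * indicator {s..T} t)"
            unfolding Eeq[of t] by (auto simp: indicator_def ennreal_mult mult_ac)
        qed
        also have "\<dots> = ennreal C * (E s * y s) * (\<integral>\<^sup>+t\<in>{s..T}. ennreal (exp (- l * (t - s)) * (t - s) powr (\<theta> - 1)) \<partial>lborel)"
          by (rule nn_integral_cmult) simp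
        also have "\<dots> \<le> ennreal C * (E s * y s) * ennreal (l powr (- \<theta> / 2) * q)"
          unfolding q_def using True \<theta> l by (intro mult_left_mono nn_integral_exp_kernel) auto
        also have "\<dots> = ennreal (C * (l powr (- \<theta> / 2) * q)) * (E s * y s)"
          using C q by (simp add: ennreal_mult mult_ac)
        also have "\<dots> \<le> ennreal (1/2) * (E s * y s)"
          by (intro mult_right_mono ennreal_leI half) simp
        finally show ?thesis using True by simp
      next
        case False
        then have "(\<integral>\<^sup>+t. ennreal C * (E t * ennreal ((t - s) powr (\<theta> - 1)) * y s * indicator {0..t} s * indicator {0..T} t) \<partial>lborel)
            = (\<integral>\<^sup>+t. 0 \<partial>(lborel :: real measure))"
          by (intro nn_integral_cong) (auto simp: indicator_def)
        then show ?thesis by simp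
      qed
    qed
    also have "\<dots> = ennreal (1/2) * A" unfolding A_def by (rule nn_integral_cmult) simp
    finally have "A \<le> (\<integral>\<^sup>+t\<in>{0..T}. (E t * g t) \<partial>lborel) + ennreal (1/2) * A" by simp
    from ennreal_absorb_half[OF this Afin]
    have A2: "A \<le> 2 * (\<integral>\<^sup>+t\<in>{0..T}. (E t * g t) \<partial>lborel)" .
    have "(\<integral>\<^sup>+t\<in>{0..T}. y t \<partial>lborel) \<le> (\<integral>\<^sup>+t. ennreal (exp (l * T)) * (E t * y t * indicator {0..T} t) \<partial>lborel)"
    proof (rule nn_integral_mono)
      fix t
      show "y t * indicator {0..T} t \<le> ennreal (exp (l * T)) * (E t * y t * indicator {0..T} t)"
      proof (cases "t \<in> {0..T}")
        case True
        have "1 \<le> exp (l * T) * exp (- l * t)" using True l by (simp add: exp_add[symmetric])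
        then have "1 \<le> ennreal (exp (l * T)) * E t"
          unfolding E_def by (subst ennreal_mult[symmetric]) (auto simp: ennreal_ge_1)
        from mult_right_mono[OF this, of "y t"] show ?thesis using True by (simp add: mult.assoc)
      qed simp
    qed
    also have "\<dots> = ennreal (exp (l * T)) * A" unfolding A_def by (rule nn_integral_cmult) simp
    also have "\<dots> \<le> ennreal (exp (l * T)) * (2 * (\<integral>\<^sup>+t\<in>{0..T}. g t \<partial>lborel))"
    proof (rule mult_left_mono)
      have "(\<integral>\<^sup>+t\<in>{0..T}. (E t * g t) \<partial>lborel) \<le> (\<integral>\<^sup>+t\<in>{0..T}. g t \<partial>lborel)"
        by (intro nn_integral_mono) (use Ele mult_right_mono[of "E _" 1] in \<open>auto simp: indicator_def\<close>)
      then show "A \<le> 2 * (\<integral>\<^sup>+t\<in>{0..T}. g t \<partial>lborel)" using A2 by (meson order_trans mult_left_mono zero_le)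
    qed simp
    finally show ?thesis by (simp add: ennreal_mult mult_ac)
  qed
  show ?thesis by (rule exI[of _ "2 * exp (l * T)"]) (use main in auto)
qed

section \<open>Truncated powers of Lebesgue integrals\<close>

definition lebesgue_const :: "real \<Rightarrow> real \<Rightarrow> nat \<Rightarrow> real" where
  "lebesgue_const T g k = (let W = T powr g / g in 4 * W * (1 + 4 * W\<^sup>2) ^ k * T powr (1 - g))"

lemma trunc_wt_pos: "e \<ge> 0 \<Longrightarrow> x \<noteq> 0 \<Longrightarrow> trunc_wt e k x > 0"
  unfolding trunc_wt_def by (rule zero_less_power, rule divide_pos_pos) (auto intro: add_pos_nonneg)

text \<open>Beyond c the quotient of \<open>trunc_pow e k x\<close> by |x| is at least its value at
  c, since |x| times the weight increases with |x|; up to c the first summand is enough.\<close>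

lemma abs_le_truncated:
  assumes e: "e \<ge> 0" and c: "c > 0"
  shows "\<bar>x\<bar> \<le> c + c / trunc_pow e k c * trunc_pow e k x"
proof -
  have p: "trunc_pow e k c > 0" using trunc_wt_pos[OF e, of c k] c by (simp add: trunc_pow_def)
  show ?thesis
  proof (cases "\<bar>x\<bar> \<le> c")
    case True
    then show ?thesis using p c trunc_pow_nonneg[OF e, of k x] by (smt (verit) divide_nonneg_pos mult_nonneg_nonneg)
  next
    case False
    have "\<bar>x\<bar> * c * trunc_wt e k c \<le> \<bar>x\<bar> * \<bar>x\<bar> * trunc_wt e k x"
      using False c e by (intro mult_mono trunc_wt_mono mult_left_mono trunc_wt_nonneg) auto
    then have "\<bar>x\<bar> * trunc_pow e k c \<le> c * trunc_pow e k x"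
      using c by (simp add: trunc_pow_def power2_eq_square mult_ac mult_left_mono)
    then have "\<bar>x\<bar> \<le> c / trunc_pow e k c * trunc_pow e k x" using p by (simp add: field_simps)
    then show ?thesis using c by simp
  qed
qed

text \<open>A substitute for Jensen's inequality that does not need convexity: with \<open>\<psi> = \<phi> / w\<close> the
  part of \<open>\<integral> w |\<psi>|\<close> where \<open>|\<psi>|\<close> is at most \<open>c = z / (2 \<integral> w)\<close> contributes at most \<open>z / 2\<close>.\<close>

lemma trunc_pow_lebesgue:
  assumes g: "1/2 < g" "g < 1" and e: "e > 0" and t: "0 \<le> t" "t \<le> T"
    and [measurable]: "\<phi> \<in> borel_measurable borel" and z: "z \<ge> 0"
    and le: "ennreal z \<le> (\<integral>\<^sup>+s\<in>{0..t}. ennreal \<bar>\<phi> s\<bar> \<partial>lborel)"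
  shows "ennreal (trunc_pow e k z) \<le> ennreal (lebesgue_const T g k) * (\<integral>\<^sup>+s\<in>{0..t}. ennreal (trunc_energy e k g (t - s) (\<phi> s)) \<partial>lborel)"
proof (cases "z = 0")
  case False
  define W where "W = t powr g / g"
  define W0 where "W0 = T powr g / g"
  have tpos: "t > 0"
  proof (rule ccontr)
    assume "\<not> t > 0"
    then have "t = 0" using t by simp
    then have "(\<integral>\<^sup>+s\<in>{0..t}. ennreal \<bar>\<phi> s\<bar> \<partial>lborel) = (\<integral>\<^sup>+s. 0 \<partial>(lborel :: real measure))"
      using AE_lborel_singleton[of "0::real"] by (intro nn_integral_cong_AE) (auto simp: indicator_def)
    then show False using le False z by simp
  qed
  have W: "W > 0" using tpos g by (simp add: W_def)
  have WW0: "W \<le> W0" unfolding W_def W0_def using t g by (intro divide_right_mono powr_mono2) auto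
  define c where "c = z / (2 * W)"
  have c: "c > 0" using False z W by (simp add: c_def)
  define f where "f = trunc_pow e k c"
  have f: "f > 0" using trunc_wt_pos[of e c k] c e by (simp add: trunc_pow_def f_def)
  \<comment> \<open>The argument works with the weight w itself, whereas the energy carries w^2; the
    quotient \<open>u powr (1 - g)\<close> is at most \<open>T powr (1 - g)\<close>.\<close>
  define J where "J = (\<integral>\<^sup>+s\<in>{0..t}. ennreal ((t - s) powr (g - 1) * trunc_pow e k (\<phi> s * (t - s) powr (1 - g))) \<partial>lborel)"
  define R where "R = (\<integral>\<^sup>+s\<in>{0..t}. ennreal (trunc_energy e k g (t - s) (\<phi> s)) \<partial>lborel)"
  have AEt: "AE s in lborel. s \<noteq> t" by (rule AE_lborel_singleton)
  have "J \<le> (\<integral>\<^sup>+s. ennreal (T powr (1 - g)) * (ennreal (trunc_energy e k g (t - s) (\<phi> s)) * indicator {0..t} s) \<partial>lborel)"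
    unfolding J_def
  proof (rule nn_integral_mono_AE)
    show "AE s in lborel. ennreal ((t - s) powr (g - 1) * trunc_pow e k (\<phi> s * (t - s) powr (1 - g))) * indicator {0..t} s
      \<le> ennreal (T powr (1 - g)) * (ennreal (trunc_energy e k g (t - s) (\<phi> s)) * indicator {0..t} s)"
      using AEt
    proof eventually_elim
      case (elim s)
      show ?case
      proof (cases "s \<in> {0..t}")
        case True
        then have u: "t - s > 0" using elim by auto
        have "(t - s) powr (g - 1) = (t - s) powr (1 - g) * (t - s) powr (2 * g - 2)" by (simp add: powr_add[symmetric])
        also have "\<dots> \<le> T powr (1 - g) * (t - s) powr (2 * g - 2)"
          using u t True g by (intro mult_right_mono powr_mono2) auto
        finally have "(t - s) powr (g - 1) * trunc_pow e k (\<phi> s * (t - s) powr (1 - g))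
           \<le> T powr (1 - g) * trunc_energy e k g (t - s) (\<phi> s)"
          unfolding trunc_energy_eq[OF u] mult.assoc[symmetric] using e
          by (intro mult_right_mono trunc_pow_nonneg) auto
        then show ?thesis using True e by (simp add: ennreal_mult[symmetric] trunc_energy_nonneg ennreal_leI)
      qed simp
    qed
  qed
  also have "\<dots> = ennreal (T powr (1 - g)) * R" unfolding R_def by (rule nn_integral_cmult) simp
  finally have JR: "J \<le> ennreal (T powr (1 - g)) * R" .
  have "ennreal z \<le> (\<integral>\<^sup>+s. ennreal c * (ennreal ((t - s) powr (g - 1)) * indicator {0..t} s) +
      ennreal (c / f) * (ennreal ((t - s) powr (g - 1) * trunc_pow e k (\<phi> s * (t - s) powr (1 - g))) * indicator {0..t} s) \<partial>lborel)"
  proof (rule order_trans[OF le], rule nn_integral_mono_AE)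
    show "AE s in lborel. ennreal \<bar>\<phi> s\<bar> * indicator {0..t} s \<le> ennreal c * (ennreal ((t - s) powr (g - 1)) * indicator {0..t} s) +
      ennreal (c / f) * (ennreal ((t - s) powr (g - 1) * trunc_pow e k (\<phi> s * (t - s) powr (1 - g))) * indicator {0..t} s)"
      using AEt
    proof eventually_elim
      case (elim s)
      show ?case
      proof (cases "s \<in> {0..t}")
        case True
        then have u: "t - s > 0" using elim by auto
        let ?p = "\<phi> s * (t - s) powr (1 - g)" and ?w = "(t - s) powr (g - 1)"
        have "?w * (t - s) powr (1 - g) = 1" using u by (simp add: powr_add[symmetric])
        then have "\<bar>\<phi> s\<bar> = ?w * \<bar>?p\<bar>" by (simp add: abs_mult mult.left_commute)
        also have "\<dots> \<le> ?w * (c + c / f * trunc_pow e k ?p)"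
          unfolding f_def using e c by (intro mult_left_mono abs_le_truncated) auto
        finally have "ennreal \<bar>\<phi> s\<bar> \<le> ennreal (c * ?w + c / f * (?w * trunc_pow e k ?p))"
          by (intro ennreal_leI) (simp add: algebra_simps)
        then show ?thesis using True c f e
          by (simp add: ennreal_mult[symmetric] ennreal_plus[symmetric] trunc_pow_nonneg del: ennreal_plus)
      qed simp
    qed
  qed
  also have "\<dots> = ennreal c * (\<integral>\<^sup>+s\<in>{0..t}. ennreal ((t - s) powr (g - 1)) \<partial>lborel) + ennreal (c / f) * J"
    unfolding J_def by (subst nn_integral_add; (subst nn_integral_cmult)?) (auto simp: nn_integral_cmult)
  also have "(\<integral>\<^sup>+s\<in>{0..t}. ennreal ((t - s) powr (g - 1)) \<partial>lborel) = ennreal W"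
    unfolding W_def using nn_integral_powr_kernel[of g t] g t by simp
  also have "ennreal c * ennreal W = ennreal (z / 2)"
    using c W by (simp add: ennreal_mult[symmetric] c_def)
  finally have zJ: "ennreal z \<le> ennreal (z / 2) + ennreal (c / f) * J" .
  show ?thesis
  \<comment> \<open>The summand z / 2 can be subtracted when J is finite. Otherwise R is infinite as
    well, and since the constant in front of it is positive the bound is trivial.\<close>
  proof (cases "J = \<top>")
    case True
    then have "R = \<top>" using JR by (auto simp: ennreal_mult_eq_top_iff top_unique)
    moreover have "lebesgue_const T g k > 0"
      unfolding lebesgue_const_def Let_def using W WW0 g t tpos unfolding W0_def[symmetric]
      by (intro mult_pos_pos zero_less_power add_pos_nonneg) (auto simp: W0_def)
    ultimately show ?thesis unfolding R_def[symmetric] by (simp add: ennreal_mult_top)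
  next
    case False
    then obtain j where j: "J = ennreal j" "j \<ge> 0" by (cases J) auto
    have "ennreal z \<le> ennreal (z / 2 + c / f * j)"
      using zJ j z c f by (simp add: ennreal_mult[symmetric] ennreal_plus[symmetric] del: ennreal_plus)
    then have "z \<le> z / 2 + c / f * j" using j z c f by (subst (asm) ennreal_le_iff) auto
    moreover have "c * W = z / 2" using W by (simp add: c_def)
    ultimately have "c * W \<le> c / f * j" by linarith
    then have "f * W \<le> j" using c f by (simp add: field_simps)
    then have fW: "ennreal (f * W) \<le> ennreal (T powr (1 - g)) * R" using JR j by (metis ennreal_leI order_trans)
    \<comment> \<open>Scaling from c back to z = 2 W c costs
      \<open>(2 * W)^2 * (1 + (2 * W)^2) ^ k\<close>. One factor W stays with f, because f W is what
      the energy controls; this gives the shape of \<open>lebesgue_const\<close>.\<close>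
    have "trunc_pow e k z = trunc_pow e k ((2 * W) * c)" using W by (simp add: c_def)
    also have "\<dots> \<le> (2 * W)\<^sup>2 * (1 + (2 * W)\<^sup>2) ^ k * f" unfolding f_def using e by (intro trunc_pow_scale) auto
    also have "\<dots> = 4 * W * (1 + 4 * W\<^sup>2) ^ k * (f * W)" by (simp add: power2_eq_square)
    also have "\<dots> \<le> 4 * W0 * (1 + 4 * W0\<^sup>2) ^ k * (f * W)"
      using W WW0 f by (intro mult_right_mono mult_mono power_mono add_mono mult_left_mono) auto
    finally have "ennreal (trunc_pow e k z) \<le> ennreal (4 * W0 * (1 + 4 * W0\<^sup>2) ^ k) * ennreal (f * W)"
      using W WW0 f by (subst ennreal_mult[symmetric]) (auto intro!: ennreal_leI)
    also have "\<dots> \<le> ennreal (4 * W0 * (1 + 4 * W0\<^sup>2) ^ k) * (ennreal (T powr (1 - g)) * R)"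
      by (intro mult_left_mono fW) auto
    also have "\<dots> = ennreal (lebesgue_const T g k) * R"
      unfolding lebesgue_const_def Let_def W0_def[symmetric] using W WW0
      by (simp add: ennreal_mult[symmetric] mult.assoc[symmetric])
    finally show ?thesis unfolding R_def .
  qed
qed (simp add: trunc_pow_def)

section \<open>Convolution, Fubini, Fatou and Young inequalities\<close>

lemma nn_integral_convolution_le:
  fixes \<theta> T :: real and h :: "real \<Rightarrow> ennreal"
  assumes "0 < \<theta>" and [measurable]: "h \<in> borel_measurable borel"
  shows "(\<integral>\<^sup>+t\<in>{0..T}. (\<integral>\<^sup>+s\<in>{0..t}. (ennreal ((t - s) powr (\<theta> - 1)) * h s) \<partial>lborel) \<partial>lborel)
    \<le> ennreal (T powr \<theta> / \<theta>) * (\<integral>\<^sup>+s\<in>{0..T}. h s \<partial>lborel)"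
proof -
  have "(\<integral>\<^sup>+t\<in>{0..T}. (\<integral>\<^sup>+s\<in>{0..t}. (ennreal ((t - s) powr (\<theta> - 1)) * h s) \<partial>lborel) \<partial>lborel)
     = (\<integral>\<^sup>+t. (\<integral>\<^sup>+s. ennreal ((t - s) powr (\<theta> - 1)) * h s * indicator {0..t} s * indicator {0..T} t \<partial>lborel) \<partial>lborel)"
    by (intro nn_integral_cong nn_integral_multc[symmetric]) (simp add: indicator_def)
  also have "\<dots> = (\<integral>\<^sup>+s. (\<integral>\<^sup>+t. ennreal ((t - s) powr (\<theta> - 1)) * h s * indicator {0..t} s * indicator {0..T} t \<partial>lborel) \<partial>lborel)"
    unfolding indicator_def atLeastAtMost_iff by (intro lborel_pair.Fubini') measurable
  also have "\<dots> \<le> (\<integral>\<^sup>+s. ennreal (T powr \<theta> / \<theta>) * (h s * indicator {0..T} s) \<partial>lborel)"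
  proof (rule nn_integral_mono)
    fix s
    show "(\<integral>\<^sup>+t. ennreal ((t - s) powr (\<theta> - 1)) * h s * indicator {0..t} s * indicator {0..T} t \<partial>lborel)
      \<le> ennreal (T powr \<theta> / \<theta>) * (h s * indicator {0..T} s)"
    proof (cases "s \<in> {0..T}")
      case True
      have "(\<integral>\<^sup>+t. ennreal ((t - s) powr (\<theta> - 1)) * h s * indicator {0..t} s * indicator {0..T} t \<partial>lborel)
        \<le> (\<integral>\<^sup>+t. h s * (ennreal ((t - s) powr (\<theta> - 1)) * indicator {s..T} t) \<partial>lborel)"
        by (intro nn_integral_mono) (auto simp: indicator_def mult_ac)
      also have "\<dots> = h s * ennreal ((T - s) powr \<theta> / \<theta>)"
        using nn_integral_powr_reflect[of \<theta> s T] True assms by (subst nn_integral_cmult) auto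
      also have "\<dots> \<le> h s * ennreal (T powr \<theta> / \<theta>)"
        using True assms by (intro mult_left_mono ennreal_leI divide_right_mono powr_mono2) auto
      finally show ?thesis using True by (simp add: mult.commute)
    next
      case False
      then have "(\<integral>\<^sup>+t. ennreal ((t - s) powr (\<theta> - 1)) * h s * indicator {0..t} s * indicator {0..T} t \<partial>lborel)
         = (\<integral>\<^sup>+t. 0 \<partial>(lborel :: real measure))"
        by (intro nn_integral_cong) (auto simp: indicator_def)
      then show ?thesis by simp
    qed
  qed
  also have "\<dots> = ennreal (T powr \<theta> / \<theta>) * (\<integral>\<^sup>+s\<in>{0..T}. h s \<partial>lborel)"
    by (rule nn_integral_cmult) simp
  finally show ?thesis .
qed

lemma double_nn_integral_swap:
  fixes f :: "real \<Rightarrow> 'a \<Rightarrow> ennreal"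
  assumes "sigma_finite_measure M" and f: "case_prod f \<in> borel_measurable (borel \<Otimes>\<^sub>M M)" and [measurable]: "A \<in> sets borel"
  shows "(\<integral>\<^sup>+\<omega>. (\<integral>\<^sup>+s\<in>A. f s \<omega> \<partial>lborel) \<partial>M) = (\<integral>\<^sup>+s\<in>A. (\<integral>\<^sup>+\<omega>. f s \<omega> \<partial>M) \<partial>lborel)"
proof -
  interpret sigma_finite_measure M by fact
  interpret pair_sigma_finite lborel M ..
  have [measurable]: "case_prod f \<in> borel_measurable (lborel \<Otimes>\<^sub>M M)"
    using f by (simp cong: measurable_cong_sets sets_pair_measure_cong)
  have fs: "f s \<in> borel_measurable M" for s
    using measurable_compose[OF measurable_Pair1' f, of s] by simp
  have "(\<integral>\<^sup>+\<omega>. (\<integral>\<^sup>+s\<in>A. f s \<omega> \<partial>lborel) \<partial>M) = (\<integral>\<^sup>+s. (\<integral>\<^sup>+\<omega>. f s \<omega> * indicator A s \<partial>M) \<partial>lborel)"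
    by (rule Fubini') measurable
  also have "\<dots> = (\<integral>\<^sup>+s\<in>A. (\<integral>\<^sup>+\<omega>. f s \<omega> \<partial>M) \<partial>lborel)"
    using fs by (intro nn_integral_cong nn_integral_multc) auto
  finally show ?thesis .
qed

lemma double_nn_integral_Fatou:
  fixes f :: "nat \<Rightarrow> real \<Rightarrow> 'a \<Rightarrow> ennreal"
  assumes f: "\<And>n. case_prod (f n) \<in> borel_measurable (borel \<Otimes>\<^sub>M M)" and [measurable]: "A \<in> sets borel"
    and lim: "\<And>s \<omega>. (\<lambda>n. f n s \<omega>) \<longlonglongrightarrow> h s \<omega>"
    and le: "\<And>n. (\<integral>\<^sup>+\<omega>. (\<integral>\<^sup>+s\<in>A. f n s \<omega> \<partial>lborel) \<partial>M) \<le> D"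
  shows "(\<integral>\<^sup>+\<omega>. (\<integral>\<^sup>+s\<in>A. h s \<omega> \<partial>lborel) \<partial>M) \<le> D"
proof -
  have m[measurable]: "(\<lambda>(\<omega>, s). f n s \<omega>) \<in> borel_measurable (M \<Otimes>\<^sub>M lborel)" for n
    using measurable_compose[OF measurable_Pair f, of snd "M \<Otimes>\<^sub>M lborel" fst n]
    by (simp add: split_beta')
  have lim': "(\<lambda>n. f n s \<omega> * indicator A s) \<longlonglongrightarrow> h s \<omega> * indicator A s" for s \<omega>
    using lim by (cases "s \<in> A") auto
  have "(\<integral>\<^sup>+\<omega>. (\<integral>\<^sup>+s\<in>A. h s \<omega> \<partial>lborel) \<partial>M) = (\<integral>\<^sup>+\<omega>. (\<integral>\<^sup>+s. liminf (\<lambda>n. f n s \<omega> * indicator A s) \<partial>lborel) \<partial>M)"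
    using lim_imp_Liminf[OF _ lim'] by simp
  also have "\<dots> \<le> (\<integral>\<^sup>+\<omega>. liminf (\<lambda>n. \<integral>\<^sup>+s\<in>A. f n s \<omega> \<partial>lborel) \<partial>M)"
    by (intro nn_integral_mono nn_integral_liminf) simp
  also have "\<dots> \<le> liminf (\<lambda>n. \<integral>\<^sup>+\<omega>. (\<integral>\<^sup>+s\<in>A. f n s \<omega> \<partial>lborel) \<partial>M)"
    by (intro nn_integral_liminf) simp
  also have "\<dots> \<le> liminf (\<lambda>n::nat. D)" by (intro Liminf_mono) (simp add: le)
  finally show ?thesis by (simp add: Liminf_const)
qed

text \<open>Young's inequality for the conjugate exponents N / (N - 1) and N. Comparing a with
  \<open>b ^ (N - 1)\<close> decides which summand alone dominates the product.\<close>

lemma mult_le_powr_add_power: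
  fixes a b :: real
  assumes "a \<ge> 0" "b \<ge> 0" "N \<ge> (2::nat)"
  shows "a * b \<le> a powr (N / (N - 1)) + b ^ N"
proof (cases "a \<le> b ^ (N - 1)")
  case True
  then have "a * b \<le> b ^ (N - 1) * b" using assms by (intro mult_right_mono) auto
  also have "\<dots> = b ^ N" using assms by (cases N) auto
  finally show ?thesis by (simp add: add_increasing)
next
  case False
  then have apos: "a > 0" using assms zero_le_power[of b "N - 1"] by linarith
  have "b = (b ^ (N - 1)) powr (1 / (N - 1))"
  proof (cases "b = 0")
    case False
    then have "(b ^ (N - 1)) powr (1 / (N - 1)) = (b powr real (N - 1)) powr (1 / (N - 1))"
      using assms by (subst powr_realpow) auto
    also have "\<dots> = b" using assms False by (simp add: powr_powr of_nat_diff)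
    finally show ?thesis by simp
  qed (use assms in auto)
  also have "\<dots> \<le> a powr (1 / (N - 1))" using False assms by (intro powr_mono2) auto
  finally have "a * b \<le> a powr 1 * a powr (1 / (N - 1))" using assms by (simp add: mult_left_mono)
  also have "\<dots> = a powr (N / (N - 1))"
    using assms apos by (subst powr_add[symmetric]) (simp add: field_simps of_nat_diff)
  finally show ?thesis using assms by (simp add: add_increasing2)
qed

text \<open>Holds for every f: without integrability the left-hand side is the default value
  0.\<close>

lemma norm_set_integral_le_nn_integral:
  fixes f :: "real \<Rightarrow> real"
  shows "ennreal \<bar>LBINT s:A. f s\<bar> \<le> (\<integral>\<^sup>+s\<in>A. ennreal \<bar>f s\<bar> \<partial>lborel)"
proof -
  have "ennreal (norm (LBINT s:A. f s)) \<le> (\<integral>\<^sup>+s. ennreal (norm (indicator A s *\<^sub>R f s)) \<partial>lborel)"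
  proof (cases "integrable lborel (\<lambda>s. indicator A s *\<^sub>R f s)")
    case True
    then show ?thesis unfolding set_lebesgue_integral_def by (rule integral_norm_bound_ennreal)
  next
    case False
    then show ?thesis unfolding set_lebesgue_integral_def by (simp add: not_integrable_integral_eq)
  qed
  also have "\<dots> = (\<integral>\<^sup>+s\<in>A. ennreal \<bar>f s\<bar> \<partial>lborel)"
    by (intro nn_integral_cong) (auto simp: indicator_def)
  finally show ?thesis by simp
qed

section \<open>From a Volterra equation to moment bounds\<close>

definition energy_const :: "real \<Rightarrow> nat \<Rightarrow> real" where
  "energy_const K k = K\<^sup>2 * (1 + K\<^sup>2) ^ k * (4 * 5 ^ k)"

lemma energy_const_nonneg: "energy_const K k \<ge> 0"
  by (simp add: energy_const_def)

text \<open>The factor \<open>u powr (1 - g)\<close> inside the energy cancels the kernel of the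
  integrand exactly, so what remains in the weight is at most K (h + |z|). The kernel survives only
  as the square \<open>u powr (2 * g - 2)\<close>, whatever k is.\<close>

lemma trunc_energy_kernel_le:
  assumes "e \<ge> 0" "u > 0" "K \<ge> 0" "h \<ge> 0" "\<bar>x\<bar> \<le> K * u powr (g - 1) * (h + \<bar>z\<bar>)"
  shows "trunc_energy e k g u x \<le> energy_const K k * (u powr (2 * g - 2) * (trunc_pow e k h + trunc_pow e k z))"
proof -
  have "u powr (g - 1) * u powr (1 - g) = 1" using assms by (simp add: powr_add[symmetric])
  moreover have "\<bar>x\<bar> * u powr (1 - g) \<le> K * u powr (g - 1) * (h + \<bar>z\<bar>) * u powr (1 - g)"
    using assms by (intro mult_right_mono) auto
  ultimately have "\<bar>x * u powr (1 - g)\<bar> \<le> \<bar>K * (h + \<bar>z\<bar>)\<bar>"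
    using assms by (simp add: abs_mult mult_ac)
  then have "trunc_pow e k (x * u powr (1 - g)) \<le> trunc_pow e k (K * (h + \<bar>z\<bar>))"
    using assms by (intro trunc_pow_mono) auto
  also have "\<dots> \<le> K\<^sup>2 * (1 + K\<^sup>2) ^ k * trunc_pow e k (h + \<bar>z\<bar>)" by (rule trunc_pow_scale) fact
  also have "\<dots> \<le> K\<^sup>2 * (1 + K\<^sup>2) ^ k * (4 * 5 ^ k * (trunc_pow e k h + trunc_pow e k z))"
    using assms by (intro mult_left_mono trunc_pow_add) auto
  finally have "trunc_pow e k (x * u powr (1 - g)) \<le> energy_const K k * (trunc_pow e k h + trunc_pow e k z)"
    by (simp add: energy_const_def mult_ac)
  then have "u powr (2 * g - 2) * trunc_pow e k (x * u powr (1 - g)) \<le>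
     u powr (2 * g - 2) * (energy_const K k * (trunc_pow e k h + trunc_pow e k z))"
    by (intro mult_left_mono) auto
  then show ?thesis unfolding trunc_energy_eq[OF assms(2)] by (simp add: mult_ac)
qed

definition volterra_const :: "real \<Rightarrow> real \<Rightarrow> real \<Rightarrow> nat \<Rightarrow> real" where
  "volterra_const T g K k = 4 * 5 ^ k * K ^ (2 * k + 2) + (4 * 5 ^ k)\<^sup>2 *
     (lebesgue_const T g k + (4 * 5 ^ k)\<^sup>2 * ito_const T g k) * energy_const K k"

lemma lebesgue_const_nonneg: "0 < g \<Longrightarrow> lebesgue_const T g k \<ge> 0"
  unfolding lebesgue_const_def Let_def by (intro mult_nonneg_nonneg zero_le_power add_nonneg_nonneg) auto

context brownian_motion
begin

text \<open>The bounds are required for s < t only, because at s = t the value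
  \<open>0 powr (g - 1)\<close> is 0. The integrands may depend on t, as they do for convolution
  kernels.\<close>

definition volterra_process ::
  "real \<Rightarrow> real \<Rightarrow> real \<Rightarrow> (real \<Rightarrow> 'a \<Rightarrow> real) \<Rightarrow> (real \<Rightarrow> 'a \<Rightarrow> real) \<Rightarrow> bool" where
  "volterra_process g K c H Z \<longleftrightarrow> (\<forall>t\<in>{0..T}. \<exists>\<phi> \<psi> I.
     case_prod \<phi> \<in> borel_measurable (borel \<Otimes>\<^sub>M M) \<and> ito_limit t \<psi> I \<and>
     (AE \<omega> in M. Z t \<omega> = c + (LBINT s:{0..t}. \<phi> s \<omega>) + I \<omega>) \<and>
     (\<forall>s\<in>{0..<t}. \<forall>\<omega>\<in>space M. \<bar>\<phi> s \<omega>\<bar> \<le> K * (t - s) powr (g - 1) * (H s \<omega> + \<bar>Z s \<omega>\<bar>)) \<and>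
     (\<forall>s\<in>{0..<t}. \<forall>\<omega>\<in>space M. \<bar>\<psi> s \<omega>\<bar> \<le> K * (t - s) powr (g - 1) * (H s \<omega> + \<bar>Z s \<omega>\<bar>)))"

text \<open>The truncated power of Z t is split into those of c, of the drift and of the Ito
  integral. The last two are bounded by energies, through \<open>trunc_pow_lebesgue\<close> and
  \<open>ito_limit_estimate\<close>, and the energies by \<open>trunc_energy_kernel_le\<close>. The
  outcome is a linear inequality for expected truncated powers whose constant does not contain
  e.\<close>

lemma volterra_step:
  assumes vp: "volterra_process g K c H Z"
    and Z: "case_prod Z \<in> borel_measurable (borel \<Otimes>\<^sub>M M)" and H: "case_prod H \<in> borel_measurable (borel \<Otimes>\<^sub>M M)"
    and H0: "\<And>s \<omega>. H s \<omega> \<ge> 0" and c: "\<bar>c\<bar> \<le> K" and e: "e > 0" and t: "t \<in> {0..T}" and g: "1/2 < g" "g < 1"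
  shows "(\<integral>\<^sup>+\<omega>. ennreal (trunc_pow e k (Z t \<omega>)) \<partial>M) \<le> ennreal (volterra_const T g K k) *
    (1 + (\<integral>\<^sup>+\<omega>. (\<integral>\<^sup>+s\<in>{0..t}. (ennreal ((t - s) powr (2 * g - 2)) *
       (ennreal (trunc_pow e k (H s \<omega>)) + ennreal (trunc_pow e k (Z s \<omega>)))) \<partial>lborel) \<partial>M))"
proof -
  obtain \<phi> \<psi> I where \<phi>: "case_prod \<phi> \<in> borel_measurable (borel \<Otimes>\<^sub>M M)" and I: "ito_limit t \<psi> I"
    and eq: "AE \<omega> in M. Z t \<omega> = c + (LBINT s:{0..t}. \<phi> s \<omega>) + I \<omega>"
    and b\<phi>: "\<And>s \<omega>. s \<in> {0..<t} \<Longrightarrow> \<omega> \<in> space M \<Longrightarrow> \<bar>\<phi> s \<omega>\<bar> \<le> K * (t - s) powr (g - 1) * (H s \<omega> + \<bar>Z s \<omega>\<bar>)"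
    and b\<psi>: "\<And>s \<omega>. s \<in> {0..<t} \<Longrightarrow> \<omega> \<in> space M \<Longrightarrow> \<bar>\<psi> s \<omega>\<bar> \<le> K * (t - s) powr (g - 1) * (H s \<omega> + \<bar>Z s \<omega>\<bar>)"
    using vp t unfolding volterra_process_def by blast
  have K: "K \<ge> 0" using c by auto
  have [measurable]: "I \<in> borel_measurable M" and \<psi>: "case_prod \<psi> \<in> borel_measurable (borel \<Otimes>\<^sub>M M)"
    using I unfolding ito_limit_def by auto
  note [measurable (raw)] = measurable_joint_compose[OF \<phi>] measurable_joint_compose[OF \<psi>]
    measurable_joint_compose[OF Z] measurable_joint_compose[OF H]
  define A :: real where "A = 4 * 5 ^ k"
  have A: "A \<ge> 0" by (simp add: A_def)
  define f where "f = trunc_pow e k"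
  have [measurable]: "f \<in> borel_measurable borel" by (simp add: f_def)
  have f0: "f x \<ge> 0" for x unfolding f_def using e by (intro trunc_pow_nonneg) auto
  define R where "R = (\<integral>\<^sup>+\<omega>. (\<integral>\<^sup>+s\<in>{0..t}. (ennreal ((t - s) powr (2 * g - 2)) *
       (ennreal (f (H s \<omega>)) + ennreal (f (Z s \<omega>)))) \<partial>lborel) \<partial>M)"
  have en: "(\<integral>\<^sup>+\<omega>. (\<integral>\<^sup>+s\<in>{0..t}. ennreal (trunc_energy e k g (t - s) (v s \<omega>)) \<partial>lborel) \<partial>M) \<le> ennreal (energy_const K k) * R"
    if b: "\<And>s \<omega>. s \<in> {0..<t} \<Longrightarrow> \<omega> \<in> space M \<Longrightarrow> \<bar>v s \<omega>\<bar> \<le> K * (t - s) powr (g - 1) * (H s \<omega> + \<bar>Z s \<omega>\<bar>)" for v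
  proof -
    have "(\<integral>\<^sup>+\<omega>. (\<integral>\<^sup>+s\<in>{0..t}. ennreal (trunc_energy e k g (t - s) (v s \<omega>)) \<partial>lborel) \<partial>M)
      \<le> (\<integral>\<^sup>+\<omega>. (\<integral>\<^sup>+s\<in>{0..t}. (ennreal (energy_const K k) * (ennreal ((t - s) powr (2 * g - 2)) *
       (ennreal (f (H s \<omega>)) + ennreal (f (Z s \<omega>))))) \<partial>lborel) \<partial>M)"
    proof (rule nn_integral_mono, rule nn_integral_mono_AE)
      fix \<omega> assume \<omega>: "\<omega> \<in> space M"
      have "AE s in lborel. s \<noteq> t" by (rule AE_lborel_singleton)
      then show "AE s in lborel. ennreal (trunc_energy e k g (t - s) (v s \<omega>)) * indicator {0..t} s \<le>
         ennreal (energy_const K k) * (ennreal ((t - s) powr (2 * g - 2)) *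
         (ennreal (f (H s \<omega>)) + ennreal (f (Z s \<omega>)))) * indicator {0..t} s"
      proof eventually_elim
        case (elim s)
        show ?case
        proof (cases "s \<in> {0..t}")
          case True
          then have s: "s \<in> {0..<t}" using elim by auto
          have "trunc_energy e k g (t - s) (v s \<omega>) \<le> energy_const K k * ((t - s) powr (2 * g - 2) * (f (H s \<omega>) + f (Z s \<omega>)))"
            unfolding f_def using e s K H0 b[OF s \<omega>] by (intro trunc_energy_kernel_le) auto
          from ennreal_leI[OF this] show ?thesis using True f0 energy_const_nonneg[of K k]
            by (simp add: ennreal_mult ennreal_plus)
        qed simp
      qed
    qed
    also have "\<dots> = ennreal (energy_const K k) * R"
      unfolding R_def by (rule double_nn_integral_cmult) measurable
    finally show ?thesis .
  qed
  define Q where "Q = (\<lambda>\<omega>. \<integral>\<^sup>+s\<in>{0..t}. ennreal (trunc_energy e k g (t - s) (\<phi> s \<omega>)) \<partial>lborel)"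
  have [measurable]: "Q \<in> borel_measurable M" unfolding Q_def by measurable
  have Lb: "ennreal (f (LBINT s:{0..t}. \<phi> s \<omega>)) \<le> ennreal (lebesgue_const T g k) * Q \<omega>" if \<omega>: "\<omega> \<in> space M" for \<omega>
  proof -
    have [measurable]: "(\<lambda>s. \<phi> s \<omega>) \<in> borel_measurable borel" using \<omega> by measurable
    note norm_set_integral_le_nn_integral[of "{0..t}" "\<lambda>s. \<phi> s \<omega>"]
    from trunc_pow_lebesgue[OF g e _ _ _ _ this, of T k]
    show ?thesis using t unfolding f_def Q_def by simp
  qed
  have pw: "AE \<omega> in M. ennreal (f (Z t \<omega>)) \<le> ennreal (A * K ^ (2 * k + 2)) +
      (ennreal (A\<^sup>2 * lebesgue_const T g k) * Q \<omega> + ennreal (A\<^sup>2) * ennreal (f (I \<omega>)))"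
    using eq
  proof (rule AE_mp, intro AE_I2 impI)
    fix \<omega> assume \<omega>: "\<omega> \<in> space M" and eq: "Z t \<omega> = c + (LBINT s:{0..t}. \<phi> s \<omega>) + I \<omega>"
    let ?L = "LBINT s:{0..t}. \<phi> s \<omega>"
    have "f (Z t \<omega>) \<le> A * (f c + f (?L + I \<omega>))"
      unfolding f_def A_def eq using e abs_triangle_ineq[of c "?L + I \<omega>"] by (intro trunc_pow_add) (auto simp: add.assoc)
    also have "\<dots> \<le> A * (K ^ (2 * k + 2) + A * (f ?L + f (I \<omega>)))"
    proof (intro mult_left_mono add_mono A)
      have "f c \<le> \<bar>c\<bar> ^ (2 * k + 2)" unfolding f_def using e by (intro trunc_pow_le_power) auto
      also have "\<dots> \<le> K ^ (2 * k + 2)" using c by (intro power_mono) auto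
      finally show "f c \<le> K ^ (2 * k + 2)" .
      show "f (?L + I \<omega>) \<le> A * (f ?L + f (I \<omega>))"
        unfolding f_def A_def using e by (intro trunc_pow_add) auto
    qed
    also have "\<dots> = A * K ^ (2 * k + 2) + (A\<^sup>2 * f ?L + A\<^sup>2 * f (I \<omega>))"
      by (simp add: algebra_simps power2_eq_square)
    finally have "ennreal (f (Z t \<omega>)) \<le> ennreal (A * K ^ (2 * k + 2)) + (ennreal (A\<^sup>2) * ennreal (f ?L) + ennreal (A\<^sup>2) * ennreal (f (I \<omega>)))"
      using A K f0 by (simp add: ennreal_mult[symmetric] ennreal_plus[symmetric] ennreal_leI del: ennreal_plus)
    also have "\<dots> \<le> ennreal (A * K ^ (2 * k + 2)) + (ennreal (A\<^sup>2) * (ennreal (lebesgue_const T g k) * Q \<omega>) + ennreal (A\<^sup>2) * ennreal (f (I \<omega>)))"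
      by (intro add_mono mult_left_mono Lb \<omega>) auto
    finally show "ennreal (f (Z t \<omega>)) \<le> ennreal (A * K ^ (2 * k + 2)) +
      (ennreal (A\<^sup>2 * lebesgue_const T g k) * Q \<omega> + ennreal (A\<^sup>2) * ennreal (f (I \<omega>)))"
      using A lebesgue_const_nonneg[of g T k] g by (simp add: ennreal_mult mult.assoc)
  qed
  have "(\<integral>\<^sup>+\<omega>. ennreal (f (Z t \<omega>)) \<partial>M) \<le> (\<integral>\<^sup>+\<omega>. ennreal (A * K ^ (2 * k + 2)) +
      (ennreal (A\<^sup>2 * lebesgue_const T g k) * Q \<omega> + ennreal (A\<^sup>2) * ennreal (f (I \<omega>))) \<partial>M)"
    by (rule nn_integral_mono_AE[OF pw])
  also have "\<dots> = ennreal (A * K ^ (2 * k + 2)) + (ennreal (A\<^sup>2 * lebesgue_const T g k) * (\<integral>\<^sup>+\<omega>. Q \<omega> \<partial>M)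
     + ennreal (A\<^sup>2) * (\<integral>\<^sup>+\<omega>. ennreal (f (I \<omega>)) \<partial>M))"
    by (simp add: nn_integral_add nn_integral_cmult emeasure_space_1)
  also have "\<dots> \<le> ennreal (A * K ^ (2 * k + 2)) + (ennreal (A\<^sup>2 * lebesgue_const T g k) * (ennreal (energy_const K k) * R)
     + ennreal (A\<^sup>2) * (ennreal (A\<^sup>2 * ito_const T g k) * (ennreal (energy_const K k) * R)))"
  proof (intro add_left_mono add_mono mult_left_mono)
    show "(\<integral>\<^sup>+\<omega>. Q \<omega> \<partial>M) \<le> ennreal (energy_const K k) * R"
      unfolding Q_def by (rule en[OF b\<phi>])
    have "(\<integral>\<^sup>+\<omega>. ennreal (f (I \<omega>)) \<partial>M) \<le> ennreal (A\<^sup>2 * ito_const T g k) *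
       (\<integral>\<^sup>+\<omega>. (\<integral>\<^sup>+s\<in>{0..t}. ennreal (trunc_energy e k g (t - s) (\<psi> s \<omega>)) \<partial>lborel) \<partial>M)"
      unfolding f_def A_def by (rule ito_limit_estimate[OF I t e g])
    also have "\<dots> \<le> ennreal (A\<^sup>2 * ito_const T g k) * (ennreal (energy_const K k) * R)"
      by (intro mult_left_mono en[OF b\<psi>]) auto
    finally show "(\<integral>\<^sup>+\<omega>. ennreal (f (I \<omega>)) \<partial>M) \<le> ennreal (A\<^sup>2 * ito_const T g k) * (ennreal (energy_const K k) * R)" .
  qed auto
  also have "\<dots> = ennreal (A * K ^ (2 * k + 2)) + ennreal (A\<^sup>2 * (lebesgue_const T g k + A\<^sup>2 * ito_const T g k) * energy_const K k) * R"
    using lebesgue_const_nonneg[of g T k] ito_const_nonneg[of T g k] energy_const_nonneg[of K k] g A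
    by (simp add: ennreal_mult ennreal_plus algebra_simps power2_eq_square)
  also have "\<dots> \<le> ennreal (volterra_const T g K k) * (1 + R)"
  proof -
    have "ennreal (A * K ^ (2 * k + 2)) \<le> ennreal (volterra_const T g K k)"
      "ennreal (A\<^sup>2 * (lebesgue_const T g k + A\<^sup>2 * ito_const T g k) * energy_const K k) \<le> ennreal (volterra_const T g K k)"
      unfolding volterra_const_def A_def[symmetric]
      using lebesgue_const_nonneg[of g T k] ito_const_nonneg[of T g k] energy_const_nonneg[of K k] g A K
      by (auto intro!: ennreal_leI)
    then show ?thesis unfolding distrib_left by (intro add_mono mult_right_mono) auto
  qed
  finally show ?thesis unfolding R_def f_def .
qed

end

lemma volterra_const_nonneg: "0 < g \<Longrightarrow> K \<ge> 0 \<Longrightarrow> volterra_const T g K k \<ge> 0"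
  unfolding volterra_const_def
  using lebesgue_const_nonneg[of g T k] ito_const_nonneg[of T g k] energy_const_nonneg[of K k] by simp

text \<open>All orders are recorded together, because every product and every use of Young's
  inequality trades a moment for moments of higher order.\<close>

definition moments_le :: "'a measure \<Rightarrow> real \<Rightarrow> (nat \<Rightarrow> real) \<Rightarrow> (real \<Rightarrow> 'a \<Rightarrow> real) \<Rightarrow> bool" where
  "moments_le M T C H \<longleftrightarrow>
     (\<forall>n. (\<integral>\<^sup>+\<omega>. (\<integral>\<^sup>+s\<in>{0..T}. ennreal (\<bar>H s \<omega>\<bar> ^ n) \<partial>lborel) \<partial>M) \<le> ennreal (C n))"

text \<open>The probability space belongs to the predicate, so that the constants below can be quantified
  before it.\<close>

definition volterra_setup where
  "volterra_setup T g K C M B c H Z \<longleftrightarrow> brownian_motion M T B \<and>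
     case_prod Z \<in> borel_measurable (borel \<Otimes>\<^sub>M M) \<and> case_prod H \<in> borel_measurable (borel \<Otimes>\<^sub>M M) \<and>
     (\<forall>s \<omega>. (0::real) \<le> H s \<omega>) \<and> \<bar>c\<bar> \<le> K \<and> brownian_motion.volterra_process M T B g K c H Z \<and>
     moments_le M T C H \<and> (\<integral>\<^sup>+\<omega>. (\<integral>\<^sup>+s\<in>{0..T}. ennreal ((Z s \<omega>)\<^sup>2) \<partial>lborel) \<partial>M) < \<infinity>"

lemma volterra_even_moment:
  assumes g: "1/2 < g" "g < 1" and T: "T > 0" and C0: "\<And>n. C n \<ge> 0" and K: "K \<ge> 0"
  shows "\<exists>D\<ge>0. \<forall>(M::'a measure) B c H Z. volterra_setup T g K C M B c H Z \<longrightarrow>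
    (\<integral>\<^sup>+\<omega>. (\<integral>\<^sup>+s\<in>{0..T}. ennreal (\<bar>Z s \<omega>\<bar> ^ (2 * k + 2)) \<partial>lborel) \<partial>M) \<le> ennreal D"
proof -
  define V where "V = volterra_const T g K k"
  have V: "V \<ge> 0" unfolding V_def using g K by (intro volterra_const_nonneg) auto
  define q where "q = T powr (2 * g - 1) / (2 * g - 1)"
  have q: "q \<ge> 0" using g by (simp add: q_def)
  obtain D where D: "D \<ge> 0" and gronwall: "\<And>y h. y \<in> borel_measurable borel \<Longrightarrow> h \<in> borel_measurable borel \<Longrightarrow>
    (\<integral>\<^sup>+t\<in>{0..T}. y t \<partial>lborel) < \<top> \<Longrightarrow>
    (AE t in lborel. t \<in> {0..T} \<longrightarrow>
       y t \<le> h t + ennreal V * (\<integral>\<^sup>+s\<in>{0..t}. ennreal ((t - s) powr (2 * g - 1 - 1)) * y s \<partial>lborel)) \<Longrightarrow>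
    (\<integral>\<^sup>+t\<in>{0..T}. y t \<partial>lborel) \<le> ennreal D * (\<integral>\<^sup>+t\<in>{0..T}. h t \<partial>lborel)"
    using volterra_gronwall[of "2 * g - 1" V T] g V by auto
  define D' where "D' = D * (V * (T + q * C (2 * k + 2)))"
  have "(\<integral>\<^sup>+\<omega>. (\<integral>\<^sup>+s\<in>{0..T}. ennreal (\<bar>Z s \<omega>\<bar> ^ (2 * k + 2)) \<partial>lborel) \<partial>M) \<le> ennreal D'"
    if su: "volterra_setup T g K C M B c H Z" for M :: "'a measure" and B c H Z
  proof -
    interpret brownian_motion M T B using su by (simp add: volterra_setup_def)
    have Z: "case_prod Z \<in> borel_measurable (borel \<Otimes>\<^sub>M M)" and H: "case_prod H \<in> borel_measurable (borel \<Otimes>\<^sub>M M)"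
      and H0: "\<And>s \<omega>. 0 \<le> H s \<omega>" and c: "\<bar>c\<bar> \<le> K" and vp: "volterra_process g K c H Z"
      and mH: "moments_le M T C H" and fin: "(\<integral>\<^sup>+\<omega>. (\<integral>\<^sup>+s\<in>{0..T}. ennreal ((Z s \<omega>)\<^sup>2) \<partial>lborel) \<partial>M) < \<infinity>"
      using su by (auto simp: volterra_setup_def)
    note [measurable (raw)] = measurable_joint_compose[OF Z] measurable_joint_compose[OF H]
    have sf: "sigma_finite_measure M" ..
    have bound: "(\<integral>\<^sup>+\<omega>. (\<integral>\<^sup>+s\<in>{0..T}. ennreal (trunc_pow e k (Z s \<omega>)) \<partial>lborel) \<partial>M) \<le> ennreal D'" if e: "e > 0" for e
    proof -
      define y where "y = (\<lambda>t. \<integral>\<^sup>+\<omega>. ennreal (trunc_pow e k (Z t \<omega>)) \<partial>M)"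
      define h where "h = (\<lambda>t. \<integral>\<^sup>+\<omega>. ennreal (trunc_pow e k (H t \<omega>)) \<partial>M)"
      have [measurable]: "y \<in> borel_measurable borel" "h \<in> borel_measurable borel"
        unfolding y_def h_def by measurable
      define G where "G = (\<lambda>t. ennreal V * (1 + (\<integral>\<^sup>+s\<in>{0..t}. ennreal ((t - s) powr (2 * g - 1 - 1)) * h s \<partial>lborel)))"
      have [measurable]: "G \<in> borel_measurable borel"
        unfolding G_def indicator_def atLeastAtMost_iff by measurable
      have yint: "(\<integral>\<^sup>+\<omega>. (\<integral>\<^sup>+s\<in>{0..T}. ennreal (trunc_pow e k (Z s \<omega>)) \<partial>lborel) \<partial>M) = (\<integral>\<^sup>+t\<in>{0..T}. y t \<partial>lborel)"
        unfolding y_def by (rule double_nn_integral_swap[OF sf]) measurable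
      \<comment> \<open>The a priori finiteness for Gronwall's inequality: for fixed e the truncated
        power is at most a multiple of the square of Z.\<close>
      have yfin: "(\<integral>\<^sup>+t\<in>{0..T}. y t \<partial>lborel) < \<top>"
      proof -
        have "(\<integral>\<^sup>+t\<in>{0..T}. y t \<partial>lborel) \<le> (\<integral>\<^sup>+\<omega>. (\<integral>\<^sup>+s\<in>{0..T}. (ennreal ((1 / e) ^ k) * ennreal ((Z s \<omega>)\<^sup>2)) \<partial>lborel) \<partial>M)"
          unfolding yint[symmetric] using trunc_pow_le_square[OF e, of k] e
          by (intro nn_integral_mono mult_right_mono) (auto simp: ennreal_mult[symmetric] ennreal_leI)
        also have "\<dots> = ennreal ((1 / e) ^ k) * (\<integral>\<^sup>+\<omega>. (\<integral>\<^sup>+s\<in>{0..T}. ennreal ((Z s \<omega>)\<^sup>2) \<partial>lborel) \<partial>M)"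
          by (rule double_nn_integral_cmult) measurable
        also have "\<dots> < \<top>" using fin by (simp add: ennreal_mult_less_top)
        finally show ?thesis .
      qed
      have step: "y t \<le> G t + ennreal V * (\<integral>\<^sup>+s\<in>{0..t}. ennreal ((t - s) powr (2 * g - 1 - 1)) * y s \<partial>lborel)" if t: "t \<in> {0..T}" for t
      proof -
        have "y t \<le> ennreal V * (1 + (\<integral>\<^sup>+\<omega>. (\<integral>\<^sup>+s\<in>{0..t}. (ennreal ((t - s) powr (2 * g - 2)) *
            (ennreal (trunc_pow e k (H s \<omega>)) + ennreal (trunc_pow e k (Z s \<omega>)))) \<partial>lborel) \<partial>M))"
          unfolding y_def V_def by (rule volterra_step[OF vp Z H H0 c e t g])
        also have "(\<integral>\<^sup>+\<omega>. (\<integral>\<^sup>+s\<in>{0..t}. (ennreal ((t - s) powr (2 * g - 2)) *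
            (ennreal (trunc_pow e k (H s \<omega>)) + ennreal (trunc_pow e k (Z s \<omega>)))) \<partial>lborel) \<partial>M)
          = (\<integral>\<^sup>+s\<in>{0..t}. (\<integral>\<^sup>+\<omega>. (ennreal ((t - s) powr (2 * g - 2)) *
            (ennreal (trunc_pow e k (H s \<omega>)) + ennreal (trunc_pow e k (Z s \<omega>)))) \<partial>M) \<partial>lborel)"
          by (rule double_nn_integral_swap[OF sf]) measurable
        also have "\<dots> = (\<integral>\<^sup>+s\<in>{0..t}. (ennreal ((t - s) powr (2 * g - 1 - 1)) * h s + ennreal ((t - s) powr (2 * g - 1 - 1)) * y s) \<partial>lborel)"
          by (intro nn_integral_cong) (simp add: nn_integral_cmult nn_integral_add distrib_left y_def h_def)
        also have "\<dots> = (\<integral>\<^sup>+s\<in>{0..t}. ennreal ((t - s) powr (2 * g - 1 - 1)) * h s \<partial>lborel) + (\<integral>\<^sup>+s\<in>{0..t}. ennreal ((t - s) powr (2 * g - 1 - 1)) * y s \<partial>lborel)"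
          unfolding distrib_right by (rule nn_integral_add) measurable
        finally show ?thesis by (simp add: G_def distrib_left add_ac)
      qed
      have "(\<integral>\<^sup>+t\<in>{0..T}. y t \<partial>lborel) \<le> ennreal D * (\<integral>\<^sup>+t\<in>{0..T}. G t \<partial>lborel)"
        by (rule gronwall) (use yfin step in auto)
      also have "(\<integral>\<^sup>+t\<in>{0..T}. G t \<partial>lborel) \<le> ennreal (V * (T + q * C (2 * k + 2)))"
      proof -
        have "(\<integral>\<^sup>+t\<in>{0..T}. G t \<partial>lborel) = ennreal V * ((\<integral>\<^sup>+t. indicator {0..T} t \<partial>lborel) +
            (\<integral>\<^sup>+t\<in>{0..T}. (\<integral>\<^sup>+s\<in>{0..t}. (ennreal ((t - s) powr (2 * g - 1 - 1)) * h s) \<partial>lborel) \<partial>lborel))"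
        proof -
          have "(\<integral>\<^sup>+t\<in>{0..T}. G t \<partial>lborel) = (\<integral>\<^sup>+t. ennreal V * (indicator {0..T} t + (\<integral>\<^sup>+s\<in>{0..t}. (ennreal ((t - s) powr (2 * g - 1 - 1)) * h s) \<partial>lborel) * indicator {0..T} t) \<partial>lborel)"
            by (intro nn_integral_cong) (simp add: G_def distrib_right mult.assoc)
          also have "\<dots> = ennreal V * (\<integral>\<^sup>+t. (indicator {0..T} t + (\<integral>\<^sup>+s\<in>{0..t}. (ennreal ((t - s) powr (2 * g - 1 - 1)) * h s) \<partial>lborel) * indicator {0..T} t) \<partial>lborel)"
            unfolding indicator_def atLeastAtMost_iff by (rule nn_integral_cmult) measurable
          finally show ?thesis
            unfolding indicator_def atLeastAtMost_iff by (subst (asm) nn_integral_add) measurable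
        qed
        also have "\<dots> \<le> ennreal V * (ennreal T + ennreal q * (\<integral>\<^sup>+s\<in>{0..T}. h s \<partial>lborel))"
          unfolding q_def using T g by (intro mult_left_mono add_mono nn_integral_convolution_le) auto
        also have "(\<integral>\<^sup>+s\<in>{0..T}. h s \<partial>lborel) \<le> ennreal (C (2 * k + 2))"
        proof -
          have "(\<integral>\<^sup>+s\<in>{0..T}. h s \<partial>lborel) = (\<integral>\<^sup>+\<omega>. (\<integral>\<^sup>+s\<in>{0..T}. ennreal (trunc_pow e k (H s \<omega>)) \<partial>lborel) \<partial>M)"
            unfolding h_def by (rule double_nn_integral_swap[OF sf, symmetric]) measurable
          also have "\<dots> \<le> (\<integral>\<^sup>+\<omega>. (\<integral>\<^sup>+s\<in>{0..T}. ennreal (\<bar>H s \<omega>\<bar> ^ (2 * k + 2)) \<partial>lborel) \<partial>M)"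
            using e by (intro nn_integral_mono mult_right_mono ennreal_leI trunc_pow_le_power) auto
          also have "\<dots> \<le> ennreal (C (2 * k + 2))" by (rule mH[unfolded moments_le_def, rule_format])
          finally show ?thesis .
        qed
        also have "ennreal V * (ennreal T + ennreal q * ennreal (C (2 * k + 2))) = ennreal (V * (T + q * C (2 * k + 2)))"
          using V T q C0[of "2 * k + 2"] by (simp add: ennreal_mult ennreal_plus)
        finally show ?thesis by (simp add: mult_left_mono add_left_mono)
      qed
      also have "ennreal D * ennreal (V * (T + q * C (2 * k + 2))) = ennreal D'"
        using D V T q C0[of "2 * k + 2"] by (simp add: D'_def ennreal_mult)
      finally show ?thesis unfolding yint by (simp add: mult_left_mono)
    qed
    \<comment> \<open>The bound D' is the same for every e > 0, so Fatou's lemma along e = 1 / (n +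
      1) removes the truncation.\<close>
    show ?thesis
    proof (rule double_nn_integral_Fatou[where f="\<lambda>n s \<omega>. ennreal (trunc_pow (1 / real (Suc n)) k (Z s \<omega>))"])
      show "(\<lambda>n. ennreal (trunc_pow (1 / real (Suc n)) k (Z s \<omega>))) \<longlonglongrightarrow> ennreal (\<bar>Z s \<omega>\<bar> ^ (2 * k + 2))" for s \<omega>
        by (intro tendsto_ennrealI trunc_pow_tendsto)
    qed (use bound in measurable)
  qed
  then show ?thesis using D V T q C0[of "2 * k + 2"] by (intro exI[of _ D']) (auto simp: D'_def)
qed

text \<open>Moments integrated over time do not control an integral against the singular kernel at
  the same order. Young's inequality with a large N raises the kernel to the power N / (N - 1),
  close enough to 1 to stay integrable, and H to the power m N.\<close>

lemma kernel_moment_bound: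
  fixes g T :: real
  assumes g: "1/2 < g" "g < 1" and T: "T > 0" and C0: "\<And>n. C n \<ge> 0"
  shows "\<exists>S. (\<forall>m. S m \<ge> 0) \<and> (\<forall>(M::'a measure) H t m. moments_le M T C H \<longrightarrow> prob_space M \<longrightarrow>
     case_prod H \<in> borel_measurable (borel \<Otimes>\<^sub>M M) \<longrightarrow> t \<in> {0..T} \<longrightarrow>
     (\<integral>\<^sup>+\<omega>. (\<integral>\<^sup>+s\<in>{0..t}. (ennreal ((t - s) powr (2 * g - 2)) * ennreal (\<bar>H s \<omega>\<bar> ^ m)) \<partial>lborel) \<partial>M) \<le> ennreal (S m))"
proof -
  obtain N0 :: nat where N0: "1 / (2 * g - 1) < N0" using reals_Archimedean2 by blast
  define N where "N = max 2 N0"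
  have N: "N \<ge> 2" "1 / (2 * g - 1) < N" using N0 by (auto simp: N_def)
  define r where "r = (2 * g - 2) * (N / (N - 1)) + 1"
  have "1 < N * (2 * g - 1)" using N g by (simp add: divide_less_eq)
  then have "(2 - 2 * g) * N < N - 1" by (simp add: algebra_simps)
  then have "(2 - 2 * g) * (N / (N - 1)) < 1" using N by (simp add: divide_less_eq)
  then have r: "r > 0" by (simp add: r_def algebra_simps)
  define S where "S = (\<lambda>m. T powr r / r + C (m * N))"
  have "(\<integral>\<^sup>+\<omega>. (\<integral>\<^sup>+s\<in>{0..t}. (ennreal ((t - s) powr (2 * g - 2)) * ennreal (\<bar>H s \<omega>\<bar> ^ m)) \<partial>lborel) \<partial>M) \<le> ennreal (S m)"
    if mH: "moments_le M T C H" and pM: "prob_space M" and H: "case_prod H \<in> borel_measurable (borel \<Otimes>\<^sub>M M)" and t: "t \<in> {0..T}"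
    for M :: "'a measure" and H t m
  proof -
    interpret prob_space M by fact
    note [measurable (raw)] = measurable_joint_compose[OF H]
    have "(\<integral>\<^sup>+\<omega>. (\<integral>\<^sup>+s\<in>{0..t}. (ennreal ((t - s) powr (2 * g - 2)) * ennreal (\<bar>H s \<omega>\<bar> ^ m)) \<partial>lborel) \<partial>M)
      \<le> (\<integral>\<^sup>+\<omega>. (\<integral>\<^sup>+s\<in>{0..t}. (ennreal ((t - s) powr (r - 1)) + ennreal (\<bar>H s \<omega>\<bar> ^ (m * N))) \<partial>lborel) \<partial>M)"
    proof (intro nn_integral_mono mult_right_mono)
      fix \<omega> s
      have "(t - s) powr (2 * g - 2) * \<bar>H s \<omega>\<bar> ^ m \<le> ((t - s) powr (2 * g - 2)) powr (N / (N - 1)) + (\<bar>H s \<omega>\<bar> ^ m) ^ N"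
        using N mult_le_powr_add_power[of "(t - s) powr (2 * g - 2)" "\<bar>H s \<omega>\<bar> ^ m" N] by (simp add: of_nat_diff)
      also have "\<dots> = (t - s) powr (r - 1) + \<bar>H s \<omega>\<bar> ^ (m * N)"
        by (simp add: powr_powr r_def power_mult)
      finally show "ennreal ((t - s) powr (2 * g - 2)) * ennreal (\<bar>H s \<omega>\<bar> ^ m) \<le> ennreal ((t - s) powr (r - 1)) + ennreal (\<bar>H s \<omega>\<bar> ^ (m * N))"
        by (simp add: ennreal_mult[symmetric] ennreal_plus[symmetric] ennreal_leI del: ennreal_plus)
    qed simp
    also have "\<dots> = (\<integral>\<^sup>+\<omega>. (\<integral>\<^sup>+s\<in>{0..t}. ennreal ((t - s) powr (r - 1)) \<partial>lborel) \<partial>M)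
       + (\<integral>\<^sup>+\<omega>. (\<integral>\<^sup>+s\<in>{0..t}. ennreal (\<bar>H s \<omega>\<bar> ^ (m * N)) \<partial>lborel) \<partial>M)"
      by (rule double_nn_integral_add) measurable
    also have "\<dots> \<le> ennreal (T powr r / r) + ennreal (C (m * N))"
    proof (rule add_mono)
      have "(\<integral>\<^sup>+s\<in>{0..t}. ennreal ((t - s) powr (r - 1)) \<partial>lborel) \<le> ennreal (T powr r / r)"
        using nn_integral_powr_kernel[of r t] r t by (auto intro!: ennreal_leI divide_right_mono powr_mono2)
      then show "(\<integral>\<^sup>+\<omega>. (\<integral>\<^sup>+s\<in>{0..t}. ennreal ((t - s) powr (r - 1)) \<partial>lborel) \<partial>M) \<le> ennreal (T powr r / r)"
        by (simp add: emeasure_space_1)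
      have "(\<integral>\<^sup>+\<omega>. (\<integral>\<^sup>+s\<in>{0..t}. ennreal (\<bar>H s \<omega>\<bar> ^ (m * N)) \<partial>lborel) \<partial>M)
         \<le> (\<integral>\<^sup>+\<omega>. (\<integral>\<^sup>+s\<in>{0..T}. ennreal (\<bar>H s \<omega>\<bar> ^ (m * N)) \<partial>lborel) \<partial>M)"
        using t by (intro nn_integral_mono mult_left_mono) (auto simp: indicator_def)
      also have "\<dots> \<le> ennreal (C (m * N))" by (rule mH[unfolded moments_le_def, rule_format])
      finally show "(\<integral>\<^sup>+\<omega>. (\<integral>\<^sup>+s\<in>{0..t}. ennreal (\<bar>H s \<omega>\<bar> ^ (m * N)) \<partial>lborel) \<partial>M) \<le> ennreal (C (m * N))" .
    qed
    also have "\<dots> = ennreal (S m)" unfolding S_def using r C0 by (subst ennreal_plus) auto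
    finally show ?thesis .
  qed
  then show ?thesis using r C0 by (intro exI[of _ S]) (auto simp: S_def)
qed

lemma abs_power_le_even:
  fixes x :: real
  shows "\<bar>x\<bar> ^ n \<le> 1 + \<bar>x\<bar> ^ (2 * n + 2)"
proof (cases "\<bar>x\<bar> \<le> 1")
  case True
  then show ?thesis using power_le_one[of "\<bar>x\<bar>" n] zero_le_power[of "\<bar>x\<bar>" "2 * n + 2"] by linarith
next
  case False
  then have "\<bar>x\<bar> ^ n \<le> \<bar>x\<bar> ^ (2 * n + 2)" by (intro power_increasing) auto
  then show ?thesis by simp
qed

lemma volterra_time_moments:
  assumes g: "1/2 < g" "g < 1" and T: "T > 0" and C0: "\<And>n. C n \<ge> 0" and K: "K \<ge> 0"
  shows "\<exists>D. (\<forall>n. D n \<ge> 0) \<and> (\<forall>(M::'a measure) B c H Z. volterra_setup T g K C M B c H Z \<longrightarrow> moments_le M T D Z)"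
proof -
  \<comment> \<open>Naming the statement quantified over all probability spaces allows one constant
    to be chosen for each k.\<close>
  define P where "P = (\<lambda>k D. \<forall>(M::'a measure) B c H Z. volterra_setup T g K C M B c H Z \<longrightarrow>
    (\<integral>\<^sup>+\<omega>. (\<integral>\<^sup>+s\<in>{0..T}. ennreal (\<bar>Z s \<omega>\<bar> ^ (2 * k + 2)) \<partial>lborel) \<partial>M) \<le> ennreal D)"
  have "\<exists>D\<ge>0. P k D" for k
    unfolding P_def by (rule volterra_even_moment[where ?'a='a and C=C, OF g T C0 K])
  then obtain E where "\<And>k. E k \<ge> 0 \<and> P k (E k)" by metis
  then have E: "\<And>k. E k \<ge> 0" and le: "\<And>k (M::'a measure) B c H Z. volterra_setup T g K C M B c H Z \<Longrightarrow>
    (\<integral>\<^sup>+\<omega>. (\<integral>\<^sup>+s\<in>{0..T}. ennreal (\<bar>Z s \<omega>\<bar> ^ (2 * k + 2)) \<partial>lborel) \<partial>M) \<le> ennreal (E k)"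
    unfolding P_def by blast+
  have "moments_le M T (\<lambda>n. T + E n) Z" if su: "volterra_setup T g K C M B c H Z" for M :: "'a measure" and B c H Z
    unfolding moments_le_def
  proof
    fix n
    interpret brownian_motion M T B using su by (simp add: volterra_setup_def)
    have Z: "case_prod Z \<in> borel_measurable (borel \<Otimes>\<^sub>M M)" using su by (simp add: volterra_setup_def)
    note [measurable (raw)] = measurable_joint_compose[OF Z]
    have "(\<integral>\<^sup>+\<omega>. (\<integral>\<^sup>+s\<in>{0..T}. ennreal (\<bar>Z s \<omega>\<bar> ^ n) \<partial>lborel) \<partial>M)
       \<le> (\<integral>\<^sup>+\<omega>. (\<integral>\<^sup>+s\<in>{0..T}. (1 + ennreal (\<bar>Z s \<omega>\<bar> ^ (2 * n + 2))) \<partial>lborel) \<partial>M)"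
    proof (intro nn_integral_mono mult_right_mono)
      fix \<omega> s
      from abs_power_le_even[of "Z s \<omega>" n]
      show "ennreal (\<bar>Z s \<omega>\<bar> ^ n) \<le> 1 + ennreal (\<bar>Z s \<omega>\<bar> ^ (2 * n + 2))"
        by (simp add: ennreal_1[symmetric] ennreal_plus[symmetric] ennreal_leI del: ennreal_plus ennreal_1)
    qed simp
    also have "\<dots> = (\<integral>\<^sup>+\<omega>. (\<integral>\<^sup>+s\<in>{0..T}. 1 \<partial>lborel) \<partial>M) + (\<integral>\<^sup>+\<omega>. (\<integral>\<^sup>+s\<in>{0..T}. ennreal (\<bar>Z s \<omega>\<bar> ^ (2 * n + 2)) \<partial>lborel) \<partial>M)"
      by (rule double_nn_integral_add) measurable
    also have "\<dots> \<le> ennreal T + ennreal (E n)"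
      using T by (intro add_mono le[OF su]) (simp add: emeasure_space_1)
    finally show "(\<integral>\<^sup>+\<omega>. (\<integral>\<^sup>+s\<in>{0..T}. ennreal (\<bar>Z s \<omega>\<bar> ^ n) \<partial>lborel) \<partial>M) \<le> ennreal (T + E n)"
      using T E by simp
  qed
  then show ?thesis using T E by (intro exI[of _ "\<lambda>n. T + E n"]) (auto simp: add_nonneg_nonneg)
qed

text \<open>Bounds integrated over time become bounds at each fixed time by one more application of
  \<open>volterra_step\<close>: its right-hand side now contains only kernel integrals of moments of
  H and Z, which \<open>kernel_moment_bound\<close> controls.\<close>

lemma volterra_moments:
  assumes g: "1/2 < g" "g < 1" and T: "T > 0" and C0: "\<And>n. C n \<ge> 0" and K: "K \<ge> 0"
  shows "\<exists>D. (\<forall>n. D n \<ge> 0) \<and> (\<forall>(M::'a measure) B c H Z. volterra_setup T g K C M B c H Z \<longrightarrow>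
     moments_le M T D Z \<and> (\<forall>t\<in>{0..T}. \<forall>n. (\<integral>\<^sup>+\<omega>. ennreal (\<bar>Z t \<omega>\<bar> ^ n) \<partial>M) \<le> ennreal (D n)))"
proof -
  obtain E where E: "\<And>n. E n \<ge> 0" and mZ: "\<And>(M::'a measure) B c H Z. volterra_setup T g K C M B c H Z \<Longrightarrow> moments_le M T E Z"
    using volterra_time_moments[where ?'a='a and C=C, OF g T C0 K] by blast
  obtain S1 where S1: "\<And>m. S1 m \<ge> 0" and S1le: "\<And>m (M::'a measure) H t. moments_le M T C H \<Longrightarrow> prob_space M \<Longrightarrow>
     case_prod H \<in> borel_measurable (borel \<Otimes>\<^sub>M M) \<Longrightarrow> t \<in> {0..T} \<Longrightarrow>
     (\<integral>\<^sup>+\<omega>. (\<integral>\<^sup>+s\<in>{0..t}. (ennreal ((t - s) powr (2 * g - 2)) * ennreal (\<bar>H s \<omega>\<bar> ^ m)) \<partial>lborel) \<partial>M) \<le> ennreal (S1 m)"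
    using kernel_moment_bound[where ?'a='a and C=C, OF g T C0] by blast
  obtain S2 where S2: "\<And>m. S2 m \<ge> 0" and S2le: "\<And>m (M::'a measure) H t. moments_le M T E H \<Longrightarrow> prob_space M \<Longrightarrow>
     case_prod H \<in> borel_measurable (borel \<Otimes>\<^sub>M M) \<Longrightarrow> t \<in> {0..T} \<Longrightarrow>
     (\<integral>\<^sup>+\<omega>. (\<integral>\<^sup>+s\<in>{0..t}. (ennreal ((t - s) powr (2 * g - 2)) * ennreal (\<bar>H s \<omega>\<bar> ^ m)) \<partial>lborel) \<partial>M) \<le> ennreal (S2 m)"
    using kernel_moment_bound[where ?'a='a and C=E, OF g T E] by blast
  define V where "V = (\<lambda>k. volterra_const T g K k)"
  have V: "V k \<ge> 0" for k unfolding V_def using g K by (intro volterra_const_nonneg) auto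
  define F where "F = (\<lambda>k. V k * (1 + (S1 (2 * k + 2) + S2 (2 * k + 2))))"
  have F: "F k \<ge> 0" for k unfolding F_def using V S1 S2 by (intro mult_nonneg_nonneg add_nonneg_nonneg) auto
  define D where "D = (\<lambda>n. E n + (1 + F n))"
  have "moments_le M T D Z \<and> (\<forall>t\<in>{0..T}. \<forall>n. (\<integral>\<^sup>+\<omega>. ennreal (\<bar>Z t \<omega>\<bar> ^ n) \<partial>M) \<le> ennreal (D n))"
    if su: "volterra_setup T g K C M B c H Z" for M :: "'a measure" and B c H Z
  proof
    have mE: "moments_le M T E Z" by (rule mZ[OF su])
    show "moments_le M T D Z" unfolding moments_le_def
    proof
      fix n
      have "ennreal (E n) \<le> ennreal (D n)" using F[of n] by (intro ennreal_leI) (simp add: D_def)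
      then show "(\<integral>\<^sup>+\<omega>. (\<integral>\<^sup>+s\<in>{0..T}. ennreal (\<bar>Z s \<omega>\<bar> ^ n) \<partial>lborel) \<partial>M) \<le> ennreal (D n)"
        using mE[unfolded moments_le_def, rule_format, of n] by (rule order_trans[rotated])
    qed
    interpret brownian_motion M T B using su by (simp add: volterra_setup_def)
    have Z: "case_prod Z \<in> borel_measurable (borel \<Otimes>\<^sub>M M)" and H: "case_prod H \<in> borel_measurable (borel \<Otimes>\<^sub>M M)"
      and H0: "\<And>s \<omega>. 0 \<le> H s \<omega>" and c: "\<bar>c\<bar> \<le> K" and vp: "volterra_process g K c H Z"
      and mH: "moments_le M T C H"
      using su by (auto simp: volterra_setup_def)
    note [measurable (raw)] = measurable_joint_compose[OF Z] measurable_joint_compose[OF H]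
    have pM: "prob_space M" by unfold_locales
    show "\<forall>t\<in>{0..T}. \<forall>n. (\<integral>\<^sup>+\<omega>. ennreal (\<bar>Z t \<omega>\<bar> ^ n) \<partial>M) \<le> ennreal (D n)"
    proof (intro ballI allI)
      fix t k assume t: "t \<in> {0..T}"
      have bound: "(\<integral>\<^sup>+\<omega>. ennreal (trunc_pow e k (Z t \<omega>)) \<partial>M) \<le> ennreal (F k)" if e: "e > 0" for e
      proof -
        let ?m = "2 * k + 2"
        have "(\<integral>\<^sup>+\<omega>. ennreal (trunc_pow e k (Z t \<omega>)) \<partial>M) \<le> ennreal (V k) * (1 + (\<integral>\<^sup>+\<omega>. (\<integral>\<^sup>+s\<in>{0..t}. (ennreal ((t - s) powr (2 * g - 2)) *
            (ennreal (trunc_pow e k (H s \<omega>)) + ennreal (trunc_pow e k (Z s \<omega>)))) \<partial>lborel) \<partial>M))"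
          unfolding V_def by (rule volterra_step[OF vp Z H H0 c e t g])
        also have "\<dots> \<le> ennreal (V k) * (1 + (\<integral>\<^sup>+\<omega>. (\<integral>\<^sup>+s\<in>{0..t}. (ennreal ((t - s) powr (2 * g - 2)) * ennreal (\<bar>H s \<omega>\<bar> ^ ?m) +
             ennreal ((t - s) powr (2 * g - 2)) * ennreal (\<bar>Z s \<omega>\<bar> ^ ?m)) \<partial>lborel) \<partial>M))"
          unfolding distrib_left[of "ennreal ((t - _) powr (2 * g - 2))"] using e
          by (intro mult_left_mono add_left_mono nn_integral_mono mult_right_mono add_mono ennreal_leI trunc_pow_le_power) auto
        also have "\<dots> = ennreal (V k) * (1 + ((\<integral>\<^sup>+\<omega>. (\<integral>\<^sup>+s\<in>{0..t}. (ennreal ((t - s) powr (2 * g - 2)) * ennreal (\<bar>H s \<omega>\<bar> ^ ?m)) \<partial>lborel) \<partial>M)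
           + (\<integral>\<^sup>+\<omega>. (\<integral>\<^sup>+s\<in>{0..t}. (ennreal ((t - s) powr (2 * g - 2)) * ennreal (\<bar>Z s \<omega>\<bar> ^ ?m)) \<partial>lborel) \<partial>M)))"
          by (subst double_nn_integral_add) measurable
        also have "\<dots> \<le> ennreal (V k) * (1 + (ennreal (S1 ?m) + ennreal (S2 ?m)))"
          by (intro mult_left_mono add_left_mono add_mono S1le[OF mH pM H t] S2le[OF mE pM Z t]) auto
        also have "\<dots> = ennreal (V k) * ennreal (1 + (S1 ?m + S2 ?m))"
          using S1[of ?m] S2[of ?m] by (simp only: ennreal_plus ennreal_1 zero_le_one add_nonneg_nonneg)
        also have "\<dots> = ennreal (F k)"
          unfolding F_def using V[of k] S1[of ?m] S2[of ?m] by (intro ennreal_mult[symmetric]) auto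
        finally show ?thesis .
      qed
      have "(\<integral>\<^sup>+\<omega>. ennreal (\<bar>Z t \<omega>\<bar> ^ (2 * k + 2)) \<partial>M) \<le> ennreal (F k)"
      proof -
        have "(\<lambda>n. ennreal (trunc_pow (1 / real (Suc n)) k (Z t \<omega>))) \<longlonglongrightarrow> ennreal (\<bar>Z t \<omega>\<bar> ^ (2 * k + 2))" for \<omega>
          by (intro tendsto_ennrealI trunc_pow_tendsto)
        then have "(\<integral>\<^sup>+\<omega>. ennreal (\<bar>Z t \<omega>\<bar> ^ (2 * k + 2)) \<partial>M) = (\<integral>\<^sup>+\<omega>. liminf (\<lambda>n. ennreal (trunc_pow (1 / real (Suc n)) k (Z t \<omega>))) \<partial>M)"
          using lim_imp_Liminf[OF sequentially_bot] by metis
        also have "\<dots> \<le> liminf (\<lambda>n. \<integral>\<^sup>+\<omega>. ennreal (trunc_pow (1 / real (Suc n)) k (Z t \<omega>)) \<partial>M)"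
          by (intro nn_integral_liminf) measurable
        also have "\<dots> \<le> liminf (\<lambda>n::nat. ennreal (F k))" by (intro Liminf_mono) (simp add: bound)
        finally show ?thesis by (simp add: Liminf_const)
      qed
      moreover have "(\<integral>\<^sup>+\<omega>. ennreal (\<bar>Z t \<omega>\<bar> ^ k) \<partial>M) \<le> (\<integral>\<^sup>+\<omega>. 1 + ennreal (\<bar>Z t \<omega>\<bar> ^ (2 * k + 2)) \<partial>M)"
      proof (rule nn_integral_mono)
        fix \<omega>
        from abs_power_le_even[of "Z t \<omega>" k]
        show "ennreal (\<bar>Z t \<omega>\<bar> ^ k) \<le> 1 + ennreal (\<bar>Z t \<omega>\<bar> ^ (2 * k + 2))"
          by (simp add: ennreal_1[symmetric] ennreal_plus[symmetric] ennreal_leI del: ennreal_plus ennreal_1)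
      qed
      moreover have "\<dots> = 1 + (\<integral>\<^sup>+\<omega>. ennreal (\<bar>Z t \<omega>\<bar> ^ (2 * k + 2)) \<partial>M)"
        by (subst nn_integral_add) (auto simp: emeasure_space_1)
      ultimately have "(\<integral>\<^sup>+\<omega>. ennreal (\<bar>Z t \<omega>\<bar> ^ k) \<partial>M) \<le> 1 + ennreal (F k)"
        by (metis add_left_mono order_trans)
      also have "\<dots> = ennreal (1 + F k)" using F[of k] by simp
      also have "\<dots> \<le> ennreal (D k)" unfolding D_def using E[of k] by (intro ennreal_leI) simp
      finally show "(\<integral>\<^sup>+\<omega>. ennreal (\<bar>Z t \<omega>\<bar> ^ k) \<partial>M) \<le> ennreal (D k)" .
    qed
  qed
  then show ?thesis using E F by (intro exI[of _ D]) (auto simp: D_def add_nonneg_nonneg)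
qed

section \<open>Square integrability of solutions\<close>

text \<open>Two Cauchy-Schwarz splittings of the same integral, as 1 times f h and as sqrt h times f
  sqrt h. The first needs the square of h, the second only h itself.\<close>

lemma nn_integral_mult_square_le:
  fixes f h :: "real \<Rightarrow> real"
  assumes [measurable]: "f \<in> borel_measurable borel" "h \<in> borel_measurable borel" and "0 \<le> t" "\<And>s. f s \<ge> 0" "\<And>s. h s \<ge> 0"
  shows "(\<integral>\<^sup>+s\<in>{0..t}. ennreal (f s * h s) \<partial>lborel)\<^sup>2 \<le> ennreal t * (\<integral>\<^sup>+s\<in>{0..t}. ennreal ((f s)\<^sup>2 * (h s)\<^sup>2) \<partial>lborel)"
    and "(\<integral>\<^sup>+s\<in>{0..t}. ennreal (f s * h s) \<partial>lborel)\<^sup>2 \<le>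
      (\<integral>\<^sup>+s\<in>{0..t}. ennreal (h s) \<partial>lborel) * (\<integral>\<^sup>+s\<in>{0..t}. ennreal ((f s)\<^sup>2 * h s) \<partial>lborel)"
proof -
  have "(\<integral>\<^sup>+s\<in>{0..t}. ennreal (f s * h s) \<partial>lborel)\<^sup>2 = (\<integral>\<^sup>+s. indicator {0..t} s * ennreal (f s * h s) \<partial>lborel)\<^sup>2"
    by (simp add: mult.commute)
  also have "\<dots> = (\<integral>\<^sup>+s. indicator {0..t} s * (ennreal (f s * h s) * indicator {0..t} s) \<partial>lborel)\<^sup>2"
    by (intro arg_cong[where f="\<lambda>x. x\<^sup>2"] nn_integral_cong) (auto simp: indicator_def)
  also have "\<dots> \<le> (\<integral>\<^sup>+s. (indicator {0..t} s)\<^sup>2 \<partial>lborel) * (\<integral>\<^sup>+s. (ennreal (f s * h s) * indicator {0..t} s)\<^sup>2 \<partial>lborel)"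
    by (rule Cauchy_Schwarz_nn_integral) auto
  also have "(\<integral>\<^sup>+s. (indicator {0..t} s)\<^sup>2 \<partial>lborel) = (\<integral>\<^sup>+s. indicator {0..t} s \<partial>lborel)"
    by (intro nn_integral_cong) (auto simp: indicator_def)
  also have "\<dots> = ennreal t" using assms by simp
  also have "(\<integral>\<^sup>+s. (ennreal (f s * h s) * indicator {0..t} s)\<^sup>2 \<partial>lborel) = (\<integral>\<^sup>+s\<in>{0..t}. ennreal ((f s)\<^sup>2 * (h s)\<^sup>2) \<partial>lborel)"
    using assms by (intro nn_integral_cong) (auto simp: indicator_def ennreal_power power_mult_distrib)
  finally show "(\<integral>\<^sup>+s\<in>{0..t}. ennreal (f s * h s) \<partial>lborel)\<^sup>2 \<le> ennreal t * (\<integral>\<^sup>+s\<in>{0..t}. ennreal ((f s)\<^sup>2 * (h s)\<^sup>2) \<partial>lborel)" .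
  have "(\<integral>\<^sup>+s\<in>{0..t}. ennreal (f s * h s) \<partial>lborel)\<^sup>2 =
     (\<integral>\<^sup>+s. (ennreal (sqrt (h s)) * indicator {0..t} s) * (ennreal (f s * sqrt (h s)) * indicator {0..t} s) \<partial>lborel)\<^sup>2"
    using assms by (intro arg_cong[where f="\<lambda>x. x\<^sup>2"] nn_integral_cong)
      (auto simp: indicator_def ennreal_mult[symmetric] mult.left_commute)
  also have "\<dots> \<le> (\<integral>\<^sup>+s. (ennreal (sqrt (h s)) * indicator {0..t} s)\<^sup>2 \<partial>lborel) * (\<integral>\<^sup>+s. (ennreal (f s * sqrt (h s)) * indicator {0..t} s)\<^sup>2 \<partial>lborel)"
    by (rule Cauchy_Schwarz_nn_integral) auto
  also have "(\<integral>\<^sup>+s. (ennreal (sqrt (h s)) * indicator {0..t} s)\<^sup>2 \<partial>lborel) = (\<integral>\<^sup>+s\<in>{0..t}. ennreal (h s) \<partial>lborel)"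
    using assms by (intro nn_integral_cong) (auto simp: indicator_def ennreal_power)
  also have "(\<integral>\<^sup>+s. (ennreal (f s * sqrt (h s)) * indicator {0..t} s)\<^sup>2 \<partial>lborel) = (\<integral>\<^sup>+s\<in>{0..t}. ennreal ((f s)\<^sup>2 * h s) \<partial>lborel)"
    using assms by (intro nn_integral_cong) (auto simp: indicator_def ennreal_power power_mult_distrib)
  finally show "(\<integral>\<^sup>+s\<in>{0..t}. ennreal (f s * h s) \<partial>lborel)\<^sup>2 \<le>
      (\<integral>\<^sup>+s\<in>{0..t}. ennreal (h s) \<partial>lborel) * (\<integral>\<^sup>+s\<in>{0..t}. ennreal ((f s)\<^sup>2 * h s) \<partial>lborel)" .
qed

lemma ennreal_square_sum3_le:
  fixes a b c :: ennreal
  shows "(a + b + c)\<^sup>2 \<le> 3 * (a\<^sup>2 + b\<^sup>2 + c\<^sup>2)"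
proof (cases "a = \<top> \<or> b = \<top> \<or> c = \<top>")
  case True
  then have "a\<^sup>2 + b\<^sup>2 + c\<^sup>2 = \<top>" by (auto simp: power2_eq_square ennreal_top_mult)
  then have "3 * (a\<^sup>2 + b\<^sup>2 + c\<^sup>2) = \<top>" by (simp only: ennreal_mult_top) simp
  then show ?thesis by (simp only: top_greatest)
next
  case False
  then obtain x y z where [simp]: "a = ennreal x" "x \<ge> 0" "b = ennreal y" "y \<ge> 0" "c = ennreal z" "z \<ge> 0"
    by (cases a; cases b; cases c) auto
  have "(x + y + z)\<^sup>2 \<le> 3 * (x\<^sup>2 + y\<^sup>2 + z\<^sup>2)"
    using zero_le_power2[of "x - y"] zero_le_power2[of "y - z"] zero_le_power2[of "x - z"]
    by (simp add: power2_eq_square algebra_simps)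
  then have "ennreal ((x + y + z)\<^sup>2) \<le> ennreal (3 * (x\<^sup>2 + y\<^sup>2 + z\<^sup>2))" by (rule ennreal_leI)
  moreover have "(a + b + c)\<^sup>2 = ennreal ((x + y + z)\<^sup>2)"
  proof -
    have "a + b + c = ennreal (x + y + z)" by simp
    then show ?thesis by (simp only: ennreal_power add_nonneg_nonneg \<open>x \<ge> 0\<close> \<open>y \<ge> 0\<close> \<open>z \<ge> 0\<close>)
  qed
  ultimately show ?thesis by (simp add: ennreal_mult ennreal_power)
qed

lemma moments_le_finite:
  assumes "moments_le M T C H"
  shows "(\<integral>\<^sup>+\<omega>. (\<integral>\<^sup>+s\<in>{0..T}. ennreal (\<bar>H s \<omega>\<bar> ^ n) \<partial>lborel) \<partial>M) < \<top>"
  using assms[unfolded moments_le_def, rule_format, of n] by (rule le_less_trans) simp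

context brownian_motion
begin

text \<open>A solution is only assumed to have pathwise integrable drift, so square integrability is
  obtained pathwise first: \<open>Z\<close> lies in \<open>L\<^sup>1\<close>, then in \<open>L\<^sup>2\<close> of time, and Gronwall's inequality along
  each path bounds its \<open>L\<^sup>2\<close> norm by quantities with finite expectation.\<close>

lemma volterra_square_integrable:
  fixes A A' H Z :: "real \<Rightarrow> 'a \<Rightarrow> real"
  assumes g: "1/2 < g" "g < 1" and T: "T > 0" and K: "K \<ge> 0" and a: "a \<le> 1"
    and C0: "\<And>n. C n \<ge> 0" and mH: "moments_le M T C H"
    and Z: "case_prod Z \<in> borel_measurable (borel \<Otimes>\<^sub>M M)" and H: "case_prod H \<in> borel_measurable (borel \<Otimes>\<^sub>M M)"
    and A: "case_prod A \<in> borel_measurable (borel \<Otimes>\<^sub>M M)" and A': "case_prod A' \<in> borel_measurable (borel \<Otimes>\<^sub>M M)"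
    and H0: "\<And>s \<omega>. H s \<omega> \<ge> 0"
    and Ale: "\<And>s \<omega>. s \<in> {0..T} \<Longrightarrow> \<omega> \<in> space M \<Longrightarrow> \<bar>A s \<omega>\<bar> \<le> K * (H s \<omega> + \<bar>Z s \<omega>\<bar>)"
    and ker: "\<And>u. 0 < u \<Longrightarrow> u \<le> T \<Longrightarrow> u powr (a - 1) \<le> K * u powr (g - 1)"
    and eq: "\<And>t. t \<in> {0..T} \<Longrightarrow> \<exists>\<phi> \<psi> I. case_prod \<phi> \<in> borel_measurable (borel \<Otimes>\<^sub>M M) \<and> ito_limit t \<psi> I \<and>
      (AE \<omega> in M. Z t \<omega> = c + (LBINT s:{0..t}. \<phi> s \<omega>) + I \<omega>) \<and>
      (\<forall>s\<in>{0..<t}. \<forall>\<omega>\<in>space M. \<bar>\<phi> s \<omega> - (t - s) powr (a - 1) * A s \<omega>\<bar> \<le> K * (t - s) powr (g - 1) * H s \<omega>) \<and>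
      (\<forall>s\<in>{0..<t}. \<forall>\<omega>\<in>space M. \<bar>\<psi> s \<omega> - (t - s) powr (a - 1) * A' s \<omega>\<bar> \<le> K * (t - s) powr (g - 1) * H s \<omega>) \<and>
      (AE \<omega> in M. set_integrable lborel {0..t} (\<lambda>s. \<phi> s \<omega>)) \<and>
      (\<integral>\<^sup>+\<omega>. (\<integral>\<^sup>+s\<in>{0..t}. ennreal ((\<psi> s \<omega>)\<^sup>2) \<partial>lborel) \<partial>M) < \<infinity>"
  shows "(\<integral>\<^sup>+\<omega>. (\<integral>\<^sup>+s\<in>{0..T}. ennreal ((Z s \<omega>)\<^sup>2) \<partial>lborel) \<partial>M) < \<infinity>"
proof -
  note [measurable (raw)] = measurable_joint_compose[OF Z] measurable_joint_compose[OF H]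
    measurable_joint_compose[OF A] measurable_joint_compose[OF A']
  have pM: "prob_space M" and sf: "sigma_finite_measure M" by unfold_locales
  define \<kappa> where "\<kappa> = (\<lambda>u::real. u powr (2 * g - 2))"
  have [measurable]: "\<kappa> \<in> borel_measurable borel" unfolding \<kappa>_def by measurable
  have \<kappa>0: "\<kappa> u \<ge> 0" for u by (simp add: \<kappa>_def)
  have \<kappa>sq: "(u powr (g - 1))\<^sup>2 = \<kappa> u" for u by (simp add: \<kappa>_def power2_eq_square powr_add[symmetric])
  define q where "q = T powr (2 * g - 1) / (2 * g - 1)"
  have q: "q \<ge> 0" using g by (simp add: q_def)
  have conv: "(\<integral>\<^sup>+t\<in>{0..T}. (\<integral>\<^sup>+s\<in>{0..t}. (ennreal (\<kappa> (t - s)) * h s) \<partial>lborel) \<partial>lborel) \<le> ennreal q * (\<integral>\<^sup>+s\<in>{0..T}. h s \<partial>lborel)"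
    if "h \<in> borel_measurable borel" for h
    unfolding \<kappa>_def q_def using g nn_integral_convolution_le[of "2 * g - 1" h T] that by simp
  obtain S where S: "\<And>m. S m \<ge> 0" and Sle0: "\<And>(M::'a measure) H t m. moments_le M T C H \<Longrightarrow> prob_space M \<Longrightarrow>
     case_prod H \<in> borel_measurable (borel \<Otimes>\<^sub>M M) \<Longrightarrow> t \<in> {0..T} \<Longrightarrow>
     (\<integral>\<^sup>+\<omega>. (\<integral>\<^sup>+s\<in>{0..t}. (ennreal ((t - s) powr (2 * g - 2)) * ennreal (\<bar>H s \<omega>\<bar> ^ m)) \<partial>lborel) \<partial>M) \<le> ennreal (S m)"
    using kernel_moment_bound[where ?'a='a and C=C, OF g T C0] by blast
  have Sle: "\<And>t m. t \<in> {0..T} \<Longrightarrow>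
     (\<integral>\<^sup>+\<omega>. (\<integral>\<^sup>+s\<in>{0..t}. (ennreal (\<kappa> (t - s)) * ennreal (\<bar>H s \<omega>\<bar> ^ m)) \<partial>lborel) \<partial>M) \<le> ennreal (S m)"
    unfolding \<kappa>_def by (rule Sle0[OF mH pM H])
  have AEne: "AE s in lborel. s \<noteq> t" for t :: real by (rule AE_lborel_singleton)
  \<comment> \<open>The kernel with end point T is bounded below, since a \<le> 1. Hence
    integrability of an integrand at the single time T transfers to the coefficient A or A'
    alone.\<close>
  have lower: "\<bar>x\<bar> \<le> T powr (1 - a) * \<bar>(T - s) powr (a - 1) * x\<bar>" if "0 \<le> s" "s < T" for s x
  proof -
    have "1 = T powr (1 - a) * T powr (a - 1)" using T by (simp add: powr_add[symmetric])
    also have "\<dots> \<le> T powr (1 - a) * (T - s) powr (a - 1)"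
      using that a by (intro mult_left_mono powr_mono2') auto
    finally have "1 * \<bar>x\<bar> \<le> T powr (1 - a) * (T - s) powr (a - 1) * \<bar>x\<bar>" by (intro mult_right_mono) auto
    then show ?thesis by (simp add: abs_mult mult.assoc)
  qed

  \<comment> \<open>The diffusion coefficient is square integrable before anything is known about Z:
    this is read off from the Ito integrand at time T, after removing the kernel by
    \<open>lower\<close>.\<close>
  have A'fin: "(\<integral>\<^sup>+\<omega>. (\<integral>\<^sup>+s\<in>{0..T}. ennreal ((A' s \<omega>)\<^sup>2) \<partial>lborel) \<partial>M) < \<top>"
  proof -
    obtain \<psi> I where I: "ito_limit T \<psi> I"
      and b: "\<And>s \<omega>. s \<in> {0..<T} \<Longrightarrow> \<omega> \<in> space M \<Longrightarrow> \<bar>\<psi> s \<omega> - (T - s) powr (a - 1) * A' s \<omega>\<bar> \<le> K * (T - s) powr (g - 1) * H s \<omega>"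
      and fin: "(\<integral>\<^sup>+\<omega>. (\<integral>\<^sup>+s\<in>{0..T}. ennreal ((\<psi> s \<omega>)\<^sup>2) \<partial>lborel) \<partial>M) < \<infinity>"
      using eq[of T] T by auto
    have \<psi>: "case_prod \<psi> \<in> borel_measurable (borel \<Otimes>\<^sub>M M)" using I by (simp add: ito_limit_def)
    note [measurable (raw)] = measurable_joint_compose[OF \<psi>]
    define c1 where "c1 = 2 * (T powr (1 - a))\<^sup>2"
    have c1: "c1 \<ge> 0" by (simp add: c1_def)
    have "(\<integral>\<^sup>+\<omega>. (\<integral>\<^sup>+s\<in>{0..T}. ennreal ((A' s \<omega>)\<^sup>2) \<partial>lborel) \<partial>M)
      \<le> (\<integral>\<^sup>+\<omega>. (\<integral>\<^sup>+s\<in>{0..T}. (ennreal c1 * ennreal ((\<psi> s \<omega>)\<^sup>2) + ennreal (c1 * K\<^sup>2) * (ennreal (\<kappa> (T - s)) * ennreal (\<bar>H s \<omega>\<bar> ^ 2))) \<partial>lborel) \<partial>M)"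
    proof (rule nn_integral_mono, rule nn_integral_mono_AE)
      fix \<omega> assume \<omega>: "\<omega> \<in> space M"
      show "AE s in lborel. ennreal ((A' s \<omega>)\<^sup>2) * indicator {0..T} s \<le>
         (ennreal c1 * ennreal ((\<psi> s \<omega>)\<^sup>2) + ennreal (c1 * K\<^sup>2) * (ennreal (\<kappa> (T - s)) * ennreal (\<bar>H s \<omega>\<bar> ^ 2))) * indicator {0..T} s"
        using AEne[of T]
      proof eventually_elim
        case (elim s)
        show ?case
        proof (cases "s \<in> {0..T}")
          case True
          then have s: "s \<in> {0..<T}" using elim by auto
          let ?w = "K * (T - s) powr (g - 1) * H s \<omega>"
          have "\<bar>A' s \<omega>\<bar> \<le> T powr (1 - a) * \<bar>(T - s) powr (a - 1) * A' s \<omega>\<bar>" using s by (intro lower) auto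
          also have "\<dots> \<le> T powr (1 - a) * (\<bar>\<psi> s \<omega>\<bar> + ?w)"
            using b[OF s \<omega>] by (intro mult_left_mono) auto
          finally have "\<bar>A' s \<omega>\<bar>\<^sup>2 \<le> (T powr (1 - a) * (\<bar>\<psi> s \<omega>\<bar> + ?w))\<^sup>2" by (intro power_mono) auto
          also have "\<dots> \<le> (T powr (1 - a))\<^sup>2 * (2 * (\<psi> s \<omega>)\<^sup>2 + 2 * ?w\<^sup>2)"
            unfolding power_mult_distrib[of "T powr (1 - a)"] using sum_squares_bound[of "\<bar>\<psi> s \<omega>\<bar>" ?w]
            by (intro mult_left_mono) (auto simp: power2_sum)
          also have "\<dots> = c1 * (\<psi> s \<omega>)\<^sup>2 + c1 * K\<^sup>2 * (\<kappa> (T - s) * \<bar>H s \<omega>\<bar> ^ 2)"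
            by (simp add: c1_def power_mult_distrib \<kappa>sq algebra_simps)
          finally show ?thesis using True c1 \<kappa>0
            by (simp add: ennreal_mult[symmetric] ennreal_plus[symmetric] ennreal_leI del: ennreal_plus)
        qed simp
      qed
    qed
    also have "\<dots> = ennreal c1 * (\<integral>\<^sup>+\<omega>. (\<integral>\<^sup>+s\<in>{0..T}. ennreal ((\<psi> s \<omega>)\<^sup>2) \<partial>lborel) \<partial>M)
       + ennreal (c1 * K\<^sup>2) * (\<integral>\<^sup>+\<omega>. (\<integral>\<^sup>+s\<in>{0..T}. (ennreal (\<kappa> (T - s)) * ennreal (\<bar>H s \<omega>\<bar> ^ 2)) \<partial>lborel) \<partial>M)"
      by (subst double_nn_integral_add, measurable, subst (1 2) double_nn_integral_cmult, measurable)
    also have "\<dots> < \<top>"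
      using fin le_less_trans[OF Sle[of T 2]] T by (simp add: ennreal_mult_less_top)
    finally show ?thesis .
  qed
  define y' where "y' = (\<lambda>s. \<integral>\<^sup>+\<omega>. ennreal ((A' s \<omega>)\<^sup>2) \<partial>M)"
  have [measurable]: "y' \<in> borel_measurable borel" unfolding y'_def by measurable
  have y'fin: "(\<integral>\<^sup>+s\<in>{0..T}. y' s \<partial>lborel) < \<top>"
    using A'fin unfolding y'_def by (subst (asm) double_nn_integral_swap[OF sf]) measurable

  define Q where "Q = (\<lambda>t \<omega>. \<integral>\<^sup>+s\<in>{0..t}. ennreal ((t - s) powr (g - 1) * (\<bar>A s \<omega>\<bar> + H s \<omega>)) \<partial>lborel)"
  have Qm: "case_prod Q \<in> borel_measurable (borel \<Otimes>\<^sub>M M)"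
    unfolding Q_def indicator_def atLeastAtMost_iff by measurable
  note [measurable (raw)] = measurable_compose[OF measurable_Pair Qm, simplified]
  \<comment> \<open>The Ito integral comes as a separate random variable for each t, without joint
    measurability in t. J replaces it: a jointly measurable lower bound for its absolute value,
    obtained by a subtraction cut off at 0. By definition |Z| is at most |c| + K Q + J for all t and
    \<omega>, with no null set depending on t.\<close>
  define J where "J = (\<lambda>t \<omega>. ennreal \<bar>Z t \<omega>\<bar> - (ennreal \<bar>c\<bar> + ennreal K * Q t \<omega>))"
  have Jm: "case_prod J \<in> borel_measurable (borel \<Otimes>\<^sub>M M)"
    unfolding J_def by measurable
  note [measurable (raw)] = measurable_compose[OF measurable_Pair Jm, simplified]
  \<comment> \<open>For k = 0 truncated power and energy are plain squares, so
    \<open>ito_limit_estimate\<close> is an inequality in square mean; 16 is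
    \<open>(4 * 5 ^ 0)^2\<close>.\<close>
  define ci where "ci = ito_const T g 0 * 16"
  have ci: "ci \<ge> 0" using ito_const_nonneg[of T g 0] by (simp add: ci_def)
  have JI: "(\<integral>\<^sup>+\<omega>. (J t \<omega>)\<^sup>2 \<partial>M) \<le> ennreal (ci * (2 * K\<^sup>2)) * ((\<integral>\<^sup>+s\<in>{0..t}. (ennreal (\<kappa> (t - s)) * y' s) \<partial>lborel) + ennreal (S 2))"
    if t: "t \<in> {0..T}" for t
  proof -
    obtain \<phi> \<psi> I where \<phi>: "case_prod \<phi> \<in> borel_measurable (borel \<Otimes>\<^sub>M M)" and I: "ito_limit t \<psi> I"
      and Zeq: "AE \<omega> in M. Z t \<omega> = c + (LBINT s:{0..t}. \<phi> s \<omega>) + I \<omega>"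
      and b: "\<And>s \<omega>. s \<in> {0..<t} \<Longrightarrow> \<omega> \<in> space M \<Longrightarrow> \<bar>\<phi> s \<omega> - (t - s) powr (a - 1) * A s \<omega>\<bar> \<le> K * (t - s) powr (g - 1) * H s \<omega>"
      and b': "\<And>s \<omega>. s \<in> {0..<t} \<Longrightarrow> \<omega> \<in> space M \<Longrightarrow> \<bar>\<psi> s \<omega> - (t - s) powr (a - 1) * A' s \<omega>\<bar> \<le> K * (t - s) powr (g - 1) * H s \<omega>"
      using eq[OF t] by blast
    have \<psi>: "case_prod \<psi> \<in> borel_measurable (borel \<Otimes>\<^sub>M M)" and [measurable]: "I \<in> borel_measurable M" using I by (auto simp: ito_limit_def)
    note [measurable (raw)] = measurable_joint_compose[OF \<psi>]
    have "AE \<omega> in M. (J t \<omega>)\<^sup>2 \<le> ennreal ((I \<omega>)\<^sup>2)"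
      using Zeq
    proof (rule AE_mp, intro AE_I2 impI)
      fix \<omega> assume \<omega>: "\<omega> \<in> space M" and Zeq: "Z t \<omega> = c + (LBINT s:{0..t}. \<phi> s \<omega>) + I \<omega>"
      have mA: "(\<lambda>s. A s \<omega>) \<in> borel_measurable borel" "(\<lambda>s. H s \<omega>) \<in> borel_measurable borel"
        using \<omega> by measurable
      note [measurable] = mA
      have "ennreal \<bar>LBINT s:{0..t}. \<phi> s \<omega>\<bar> \<le> (\<integral>\<^sup>+s\<in>{0..t}. ennreal \<bar>\<phi> s \<omega>\<bar> \<partial>lborel)"
        by (rule norm_set_integral_le_nn_integral)
      also have "\<dots> \<le> (\<integral>\<^sup>+s. ennreal K * (ennreal ((t - s) powr (g - 1) * (\<bar>A s \<omega>\<bar> + H s \<omega>)) * indicator {0..t} s) \<partial>lborel)"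
      proof (rule nn_integral_mono_AE)
        show "AE s in lborel. ennreal \<bar>\<phi> s \<omega>\<bar> * indicator {0..t} s \<le> ennreal K * (ennreal ((t - s) powr (g - 1) * (\<bar>A s \<omega>\<bar> + H s \<omega>)) * indicator {0..t} s)"
          using AEne[of t]
        proof eventually_elim
          case (elim s)
          show ?case
          proof (cases "s \<in> {0..t}")
            case True
            then have s: "s \<in> {0..<t}" using elim by auto
            have "\<bar>\<phi> s \<omega>\<bar> \<le> \<bar>(t - s) powr (a - 1) * A s \<omega>\<bar> + K * (t - s) powr (g - 1) * H s \<omega>"
              using b[OF s \<omega>] by linarith
            also have "\<bar>(t - s) powr (a - 1) * A s \<omega>\<bar> \<le> K * (t - s) powr (g - 1) * \<bar>A s \<omega>\<bar>"
              unfolding abs_mult using ker[of "t - s"] s t by (intro mult_right_mono) auto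
            finally have "\<bar>\<phi> s \<omega>\<bar> \<le> K * ((t - s) powr (g - 1) * (\<bar>A s \<omega>\<bar> + H s \<omega>))" by (simp add: algebra_simps)
            then show ?thesis using True K H0 by (simp add: ennreal_mult[symmetric] ennreal_leI)
          qed simp
        qed
      qed
      also have "\<dots> = ennreal K * Q t \<omega>" unfolding Q_def by (rule nn_integral_cmult) measurable
      finally have L: "ennreal \<bar>LBINT s:{0..t}. \<phi> s \<omega>\<bar> \<le> ennreal K * Q t \<omega>" .
      have "ennreal \<bar>Z t \<omega>\<bar> \<le> ennreal (\<bar>c\<bar> + \<bar>LBINT s:{0..t}. \<phi> s \<omega>\<bar> + \<bar>I \<omega>\<bar>)"
        unfolding Zeq by (intro ennreal_leI) (simp add: abs_triangle_ineq4)
      also have "\<dots> = ennreal \<bar>c\<bar> + ennreal \<bar>LBINT s:{0..t}. \<phi> s \<omega>\<bar> + ennreal \<bar>I \<omega>\<bar>" by simp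
      also have "\<dots> \<le> ennreal \<bar>c\<bar> + ennreal K * Q t \<omega> + ennreal \<bar>I \<omega>\<bar>" by (intro add_mono L) auto
      finally have "J t \<omega> \<le> ennreal \<bar>I \<omega>\<bar>" unfolding J_def by (simp add: ennreal_minus_le_iff)
      then have "(J t \<omega>)\<^sup>2 \<le> (ennreal \<bar>I \<omega>\<bar>)\<^sup>2" by (intro power_mono) auto
      then show "(J t \<omega>)\<^sup>2 \<le> ennreal ((I \<omega>)\<^sup>2)" by (simp add: ennreal_power)
    qed
    then have "(\<integral>\<^sup>+\<omega>. (J t \<omega>)\<^sup>2 \<partial>M) \<le> (\<integral>\<^sup>+\<omega>. ennreal ((I \<omega>)\<^sup>2) \<partial>M)" by (rule nn_integral_mono_AE)
    also have "\<dots> \<le> ennreal ci * (\<integral>\<^sup>+\<omega>. (\<integral>\<^sup>+s\<in>{0..t}. ennreal ((\<psi> s \<omega>)\<^sup>2) \<partial>lborel) \<partial>M)"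
      using ito_limit_estimate[OF I t zero_less_one g, of 0]
      by (simp add: trunc_pow_def trunc_energy_def trunc_wt_def ci_def mult.commute)
    also have "(\<integral>\<^sup>+\<omega>. (\<integral>\<^sup>+s\<in>{0..t}. ennreal ((\<psi> s \<omega>)\<^sup>2) \<partial>lborel) \<partial>M)
      \<le> (\<integral>\<^sup>+\<omega>. (\<integral>\<^sup>+s\<in>{0..t}. (ennreal (2 * K\<^sup>2) * (ennreal (\<kappa> (t - s)) * ennreal ((A' s \<omega>)\<^sup>2) + ennreal (\<kappa> (t - s)) * ennreal (\<bar>H s \<omega>\<bar> ^ 2))) \<partial>lborel) \<partial>M)"
    proof (rule nn_integral_mono, rule nn_integral_mono_AE)
      fix \<omega> assume \<omega>: "\<omega> \<in> space M"
      show "AE s in lborel. ennreal ((\<psi> s \<omega>)\<^sup>2) * indicator {0..t} s \<le>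
         ennreal (2 * K\<^sup>2) * (ennreal (\<kappa> (t - s)) * ennreal ((A' s \<omega>)\<^sup>2) + ennreal (\<kappa> (t - s)) * ennreal (\<bar>H s \<omega>\<bar> ^ 2)) * indicator {0..t} s"
        using AEne[of t]
      proof eventually_elim
        case (elim s)
        show ?case
        proof (cases "s \<in> {0..t}")
          case True
          then have s: "s \<in> {0..<t}" using elim by auto
          have "\<bar>\<psi> s \<omega>\<bar> \<le> \<bar>(t - s) powr (a - 1) * A' s \<omega>\<bar> + K * (t - s) powr (g - 1) * H s \<omega>"
            using b'[OF s \<omega>] by linarith
          also have "\<bar>(t - s) powr (a - 1) * A' s \<omega>\<bar> \<le> K * (t - s) powr (g - 1) * \<bar>A' s \<omega>\<bar>"
            unfolding abs_mult using ker[of "t - s"] s t by (intro mult_right_mono) auto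
          finally have "\<bar>\<psi> s \<omega>\<bar> \<le> K * (t - s) powr (g - 1) * (\<bar>A' s \<omega>\<bar> + H s \<omega>)" by (simp add: algebra_simps)
          then have "\<bar>\<psi> s \<omega>\<bar>\<^sup>2 \<le> (K * (t - s) powr (g - 1) * (\<bar>A' s \<omega>\<bar> + H s \<omega>))\<^sup>2" by (intro power_mono) auto
          also have "\<dots> = K\<^sup>2 * \<kappa> (t - s) * (\<bar>A' s \<omega>\<bar> + H s \<omega>)\<^sup>2" by (simp add: power_mult_distrib \<kappa>sq)
          also have "\<dots> \<le> K\<^sup>2 * \<kappa> (t - s) * (2 * (A' s \<omega>)\<^sup>2 + 2 * (H s \<omega>)\<^sup>2)"
            using sum_squares_bound[of "\<bar>A' s \<omega>\<bar>" "H s \<omega>"] \<kappa>0 by (intro mult_left_mono) (auto simp: power2_sum)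
          also have "\<dots> = 2 * K\<^sup>2 * (\<kappa> (t - s) * (A' s \<omega>)\<^sup>2 + \<kappa> (t - s) * \<bar>H s \<omega>\<bar> ^ 2)" by (simp add: algebra_simps)
          finally show ?thesis using True \<kappa>0
            by (simp add: ennreal_mult[symmetric] ennreal_plus[symmetric] ennreal_leI del: ennreal_plus)
        qed simp
      qed
    qed
    also have "\<dots> = ennreal (2 * K\<^sup>2) * ((\<integral>\<^sup>+\<omega>. (\<integral>\<^sup>+s\<in>{0..t}. (ennreal (\<kappa> (t - s)) * ennreal ((A' s \<omega>)\<^sup>2)) \<partial>lborel) \<partial>M)
       + (\<integral>\<^sup>+\<omega>. (\<integral>\<^sup>+s\<in>{0..t}. (ennreal (\<kappa> (t - s)) * ennreal (\<bar>H s \<omega>\<bar> ^ 2)) \<partial>lborel) \<partial>M))"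
      by (subst double_nn_integral_cmult, measurable, subst double_nn_integral_add, measurable)
    also have "(\<integral>\<^sup>+\<omega>. (\<integral>\<^sup>+s\<in>{0..t}. (ennreal (\<kappa> (t - s)) * ennreal ((A' s \<omega>)\<^sup>2)) \<partial>lborel) \<partial>M)
        = (\<integral>\<^sup>+s\<in>{0..t}. (\<integral>\<^sup>+\<omega>. (ennreal (\<kappa> (t - s)) * ennreal ((A' s \<omega>)\<^sup>2)) \<partial>M) \<partial>lborel)"
      by (rule double_nn_integral_swap[OF sf]) measurable
    also have "\<dots> = (\<integral>\<^sup>+s\<in>{0..t}. (ennreal (\<kappa> (t - s)) * y' s) \<partial>lborel)"
      unfolding y'_def by (intro nn_integral_cong) (simp add: nn_integral_cmult)
    finally have "(\<integral>\<^sup>+\<omega>. (J t \<omega>)\<^sup>2 \<partial>M) \<le> ennreal ci * (ennreal (2 * K\<^sup>2) * ((\<integral>\<^sup>+s\<in>{0..t}. (ennreal (\<kappa> (t - s)) * y' s) \<partial>lborel)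
       + (\<integral>\<^sup>+\<omega>. (\<integral>\<^sup>+s\<in>{0..t}. (ennreal (\<kappa> (t - s)) * ennreal (\<bar>H s \<omega>\<bar> ^ 2)) \<partial>lborel) \<partial>M)))"
      by (simp add: mult_left_mono)
    also have "\<dots> \<le> ennreal ci * (ennreal (2 * K\<^sup>2) * ((\<integral>\<^sup>+s\<in>{0..t}. (ennreal (\<kappa> (t - s)) * y' s) \<partial>lborel) + ennreal (S 2)))"
      by (intro mult_left_mono add_left_mono Sle t) auto
    finally show ?thesis using ci by (simp add: ennreal_mult mult.assoc)
  qed
  have Jfin: "(\<integral>\<^sup>+\<omega>. (\<integral>\<^sup>+t\<in>{0..T}. (J t \<omega>)\<^sup>2 \<partial>lborel) \<partial>M) < \<top>"
  proof -
    have "(\<integral>\<^sup>+\<omega>. (\<integral>\<^sup>+t\<in>{0..T}. (J t \<omega>)\<^sup>2 \<partial>lborel) \<partial>M) = (\<integral>\<^sup>+t\<in>{0..T}. (\<integral>\<^sup>+\<omega>. (J t \<omega>)\<^sup>2 \<partial>M) \<partial>lborel)"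
      by (rule double_nn_integral_swap[OF sf]) measurable
    also have "\<dots> \<le> (\<integral>\<^sup>+t. ennreal (ci * (2 * K\<^sup>2)) * ((\<integral>\<^sup>+s\<in>{0..t}. (ennreal (\<kappa> (t - s)) * y' s) \<partial>lborel) * indicator {0..T} t + ennreal (S 2) * indicator {0..T} t) \<partial>lborel)"
    proof (rule nn_integral_mono)
      fix t
      show "(\<integral>\<^sup>+\<omega>. (J t \<omega>)\<^sup>2 \<partial>M) * indicator {0..T} t \<le> ennreal (ci * (2 * K\<^sup>2)) * ((\<integral>\<^sup>+s\<in>{0..t}. (ennreal (\<kappa> (t - s)) * y' s) \<partial>lborel) * indicator {0..T} t + ennreal (S 2) * indicator {0..T} t)"
        using JI[of t] by (cases "t \<in> {0..T}") auto
    qed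
    also have "\<dots> = ennreal (ci * (2 * K\<^sup>2)) * ((\<integral>\<^sup>+t\<in>{0..T}. (\<integral>\<^sup>+s\<in>{0..t}. (ennreal (\<kappa> (t - s)) * y' s) \<partial>lborel) \<partial>lborel) + ennreal (S 2) * ennreal T)"
    proof -
      have m: "(\<lambda>t. (\<integral>\<^sup>+s\<in>{0..t}. (ennreal (\<kappa> (t - s)) * y' s) \<partial>lborel) * indicator {0..T} t) \<in> borel_measurable lborel"
        unfolding indicator_def atLeastAtMost_iff by measurable
      show ?thesis using T m by (subst nn_integral_cmult) (auto simp: nn_integral_add nn_integral_cmult_indicator)
    qed
    also have "\<dots> \<le> ennreal (ci * (2 * K\<^sup>2)) * (ennreal q * (\<integral>\<^sup>+s\<in>{0..T}. y' s \<partial>lborel) + ennreal (S 2) * ennreal T)"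
      by (intro mult_left_mono add_right_mono conv) auto
    also have "\<dots> < \<top>" using y'fin by (simp add: ennreal_mult_less_top)
    finally show ?thesis .
  qed

  \<comment> \<open>The factor 3 K^2 comes from squaring the bound of |Z| by three terms, T from
    Cauchy-Schwarz in \<open>Q2b\<close>, and 2 (K + 1)^2 from |A| + H \<le> (K + 1) (H +
    |Z|).\<close>
  define C1 where "C1 = 6 * K\<^sup>2 * T * (K + 1)\<^sup>2"
  have C1: "C1 \<ge> 0" using T by (simp add: C1_def)
  have eq2: "2 * g - 1 - 1 = 2 * g - 2" by simp
  obtain D where D: "D \<ge> 0" and gronwall: "\<And>y h. y \<in> borel_measurable borel \<Longrightarrow> h \<in> borel_measurable borel \<Longrightarrow>
    (\<integral>\<^sup>+t\<in>{0..T}. y t \<partial>lborel) < \<top> \<Longrightarrow>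
    (AE t in lborel. t \<in> {0..T} \<longrightarrow>
       y t \<le> h t + ennreal C1 * (\<integral>\<^sup>+s\<in>{0..t}. ennreal (\<kappa> (t - s)) * y s \<partial>lborel)) \<Longrightarrow>
    (\<integral>\<^sup>+t\<in>{0..T}. y t \<partial>lborel) \<le> ennreal D * (\<integral>\<^sup>+t\<in>{0..T}. h t \<partial>lborel)"
    using volterra_gronwall[of "2 * g - 1" C1 T, unfolded eq2] g C1 unfolding \<kappa>_def by auto
  define R where "R = (\<lambda>\<omega>. ennreal D * (3 * (\<integral>\<^sup>+t\<in>{0..T}. (J t \<omega>)\<^sup>2 \<partial>lborel) + ennreal (3 * c\<^sup>2 * T) + ennreal (C1 * q) * (\<integral>\<^sup>+t\<in>{0..T}. ennreal (\<bar>H t \<omega>\<bar> ^ 2) \<partial>lborel)))"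
  have [measurable]: "(\<lambda>\<omega>. \<integral>\<^sup>+t\<in>{0..T}. (J t \<omega>)\<^sup>2 \<partial>lborel) \<in> borel_measurable M"
    "(\<lambda>\<omega>. \<integral>\<^sup>+t\<in>{0..T}. ennreal (\<bar>H t \<omega>\<bar> ^ n) \<partial>lborel) \<in> borel_measurable M"
    "(\<lambda>\<omega>. \<integral>\<^sup>+s\<in>{0..T}. (ennreal (\<kappa> (T - s)) * ennreal (\<bar>H s \<omega>\<bar> ^ n)) \<partial>lborel) \<in> borel_measurable M" for n
    by measurable
  have aeJ: "AE \<omega> in M. (\<integral>\<^sup>+t\<in>{0..T}. (J t \<omega>)\<^sup>2 \<partial>lborel) \<noteq> \<infinity>"
    using Jfin by (intro nn_integral_PInf_AE) auto
  have aeH: "AE \<omega> in M. (\<integral>\<^sup>+t\<in>{0..T}. ennreal (\<bar>H t \<omega>\<bar> ^ 1) \<partial>lborel) \<noteq> \<infinity>"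
    using moments_le_finite[OF mH, of 1] by (intro nn_integral_PInf_AE) auto
  have aeH\<kappa>: "AE \<omega> in M. (\<integral>\<^sup>+s\<in>{0..T}. (ennreal (\<kappa> (T - s)) * ennreal (\<bar>H s \<omega>\<bar> ^ 1)) \<partial>lborel) \<noteq> \<infinity>"
    using Sle[of T 1] T le_less_trans[OF Sle[of T 1], of \<infinity>] by (intro nn_integral_PInf_AE) auto
  obtain \<phi>T where \<phi>T: "case_prod \<phi>T \<in> borel_measurable (borel \<Otimes>\<^sub>M M)"
    and bT: "\<And>s \<omega>. s \<in> {0..<T} \<Longrightarrow> \<omega> \<in> space M \<Longrightarrow> \<bar>\<phi>T s \<omega> - (T - s) powr (a - 1) * A s \<omega>\<bar> \<le> K * (T - s) powr (g - 1) * H s \<omega>"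
    and ae\<phi>: "AE \<omega> in M. set_integrable lborel {0..T} (\<lambda>s. \<phi>T s \<omega>)"
    using eq[of T] T by auto
  note [measurable (raw)] = measurable_joint_compose[OF \<phi>T]

  have path: "(\<integral>\<^sup>+t\<in>{0..T}. ennreal ((Z t \<omega>)\<^sup>2) \<partial>lborel) \<le> R \<omega>"
    if \<omega>: "\<omega> \<in> space M" and fJ: "(\<integral>\<^sup>+t\<in>{0..T}. (J t \<omega>)\<^sup>2 \<partial>lborel) \<noteq> \<infinity>"
    and fH: "(\<integral>\<^sup>+t\<in>{0..T}. ennreal (\<bar>H t \<omega>\<bar> ^ 1) \<partial>lborel) \<noteq> \<infinity>"
    and fH\<kappa>: "(\<integral>\<^sup>+s\<in>{0..T}. (ennreal (\<kappa> (T - s)) * ennreal (\<bar>H s \<omega>\<bar> ^ 1)) \<partial>lborel) \<noteq> \<infinity>"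
    and f\<phi>: "set_integrable lborel {0..T} (\<lambda>s. \<phi>T s \<omega>)" for \<omega>
  proof -
    have m: "(\<lambda>s. A s \<omega>) \<in> borel_measurable borel" "(\<lambda>s. H s \<omega>) \<in> borel_measurable borel"
      "(\<lambda>s. Z s \<omega>) \<in> borel_measurable borel" "(\<lambda>s. \<phi>T s \<omega>) \<in> borel_measurable borel"
      "(\<lambda>s. J s \<omega>) \<in> borel_measurable borel" "(\<lambda>s. Q s \<omega>) \<in> borel_measurable borel"
      using \<omega> by measurable
    note [measurable] = m
    define n where "n = (\<lambda>s. \<bar>A s \<omega>\<bar> + H s \<omega>)"
    have [measurable]: "n \<in> borel_measurable borel" unfolding n_def by measurable
    have n0: "n s \<ge> 0" for s using H0 by (simp add: n_def)
    have Qn: "Q t \<omega> = (\<integral>\<^sup>+s\<in>{0..t}. ennreal ((t - s) powr (g - 1) * n s) \<partial>lborel)" for t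
      by (simp add: Q_def n_def)
    have Zle: "ennreal \<bar>Z t \<omega>\<bar> \<le> J t \<omega> + ennreal \<bar>c\<bar> + ennreal K * Q t \<omega>" for t
    proof -
      have "ennreal \<bar>Z t \<omega>\<bar> \<le> (ennreal \<bar>c\<bar> + ennreal K * Q t \<omega>) + J t \<omega>"
        unfolding J_def by (metis ennreal_minus_le_iff order_refl ennreal_neq_top)
      then show ?thesis by (simp add: add_ac)
    qed
    have \<phi>fin: "(\<integral>\<^sup>+s\<in>{0..T}. ennreal \<bar>\<phi>T s \<omega>\<bar> \<partial>lborel) < \<top>"
    proof -
      have "(\<integral>\<^sup>+s. ennreal (norm (indicator {0..T} s *\<^sub>R \<phi>T s \<omega>)) \<partial>lborel) < \<infinity>"
        using f\<phi> unfolding set_integrable_def integrable_iff_bounded by auto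
      also have "(\<integral>\<^sup>+s. ennreal (norm (indicator {0..T} s *\<^sub>R \<phi>T s \<omega>)) \<partial>lborel) = (\<integral>\<^sup>+s\<in>{0..T}. ennreal \<bar>\<phi>T s \<omega>\<bar> \<partial>lborel)"
        by (intro nn_integral_cong) (auto simp: indicator_def)
      finally show ?thesis by simp
    qed
    \<comment> \<open>First level of regularity along a path: the drift integrand at time T is
      integrable, and removing its kernel by \<open>lower\<close> leaves an integrable A.\<close>
    have nfin: "(\<integral>\<^sup>+s\<in>{0..T}. ennreal (n s) \<partial>lborel) < \<top>"
    proof -
      define c2 where "c2 = T powr (1 - a) * K * T powr (1 - g)"
      have c2: "c2 \<ge> 0" using K by (simp add: c2_def)
      have "(\<integral>\<^sup>+s\<in>{0..T}. ennreal (n s) \<partial>lborel) \<le> (\<integral>\<^sup>+s. ennreal (T powr (1 - a)) * (ennreal \<bar>\<phi>T s \<omega>\<bar> * indicator {0..T} s)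
          + (ennreal c2 * (ennreal (\<kappa> (T - s)) * ennreal (\<bar>H s \<omega>\<bar> ^ 1) * indicator {0..T} s) + ennreal (\<bar>H s \<omega>\<bar> ^ 1) * indicator {0..T} s) \<partial>lborel)"
      proof (rule nn_integral_mono_AE)
        show "AE s in lborel. ennreal (n s) * indicator {0..T} s \<le> ennreal (T powr (1 - a)) * (ennreal \<bar>\<phi>T s \<omega>\<bar> * indicator {0..T} s)
          + (ennreal c2 * (ennreal (\<kappa> (T - s)) * ennreal (\<bar>H s \<omega>\<bar> ^ 1) * indicator {0..T} s) + ennreal (\<bar>H s \<omega>\<bar> ^ 1) * indicator {0..T} s)"
          using AEne[of T]
        proof eventually_elim
          case (elim s)
          show ?case
          proof (cases "s \<in> {0..T}")
            case True
            then have s: "s \<in> {0..<T}" using elim by auto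
            have "\<bar>A s \<omega>\<bar> \<le> T powr (1 - a) * \<bar>(T - s) powr (a - 1) * A s \<omega>\<bar>" using s by (intro lower) auto
            also have "\<dots> \<le> T powr (1 - a) * (\<bar>\<phi>T s \<omega>\<bar> + K * (T - s) powr (g - 1) * H s \<omega>)"
              using bT[OF s \<omega>] by (intro mult_left_mono) auto
            also have "(T - s) powr (g - 1) = (T - s) powr (1 - g) * \<kappa> (T - s)"
              unfolding \<kappa>_def by (simp add: powr_add[symmetric])
            also have "T powr (1 - a) * (\<bar>\<phi>T s \<omega>\<bar> + K * ((T - s) powr (1 - g) * \<kappa> (T - s)) * H s \<omega>)
               \<le> T powr (1 - a) * (\<bar>\<phi>T s \<omega>\<bar> + K * (T powr (1 - g) * \<kappa> (T - s)) * H s \<omega>)"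
              using K H0 \<kappa>0 s g by (intro mult_left_mono add_left_mono mult_right_mono powr_mono2) auto
            finally have "n s \<le> T powr (1 - a) * \<bar>\<phi>T s \<omega>\<bar> + (c2 * (\<kappa> (T - s) * \<bar>H s \<omega>\<bar> ^ 1) + \<bar>H s \<omega>\<bar> ^ 1)"
              using H0[of s \<omega>] by (simp add: n_def c2_def algebra_simps)
            then show ?thesis using True c2 \<kappa>0 by (simp add: ennreal_mult[symmetric] ennreal_plus[symmetric] ennreal_leI del: ennreal_plus)
          qed simp
        qed
      qed
      also have "\<dots> = ennreal (T powr (1 - a)) * (\<integral>\<^sup>+s\<in>{0..T}. ennreal \<bar>\<phi>T s \<omega>\<bar> \<partial>lborel)
         + (ennreal c2 * (\<integral>\<^sup>+s\<in>{0..T}. (ennreal (\<kappa> (T - s)) * ennreal (\<bar>H s \<omega>\<bar> ^ 1)) \<partial>lborel) + (\<integral>\<^sup>+s\<in>{0..T}. ennreal (\<bar>H s \<omega>\<bar> ^ 1) \<partial>lborel))"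
        by (simp add: nn_integral_add nn_integral_cmult)
      also have "\<dots> < \<top>" using \<phi>fin fH fH\<kappa> by (simp add: ennreal_mult_eq_top_iff less_top[symmetric])
      finally show ?thesis .
    qed
    \<comment> \<open>Uses only integrability of n. Its constant is random, so it serves to show
      that the path of Z is square integrable in time, without a bound.\<close>
    have Q2a: "(Q t \<omega>)\<^sup>2 \<le> (\<integral>\<^sup>+s\<in>{0..T}. ennreal (n s) \<partial>lborel) * (\<integral>\<^sup>+s\<in>{0..t}. (ennreal (\<kappa> (t - s)) * ennreal (n s)) \<partial>lborel)" if t: "t \<in> {0..T}" for t
    proof -
      have "(Q t \<omega>)\<^sup>2 \<le> (\<integral>\<^sup>+s\<in>{0..t}. ennreal (n s) \<partial>lborel) * (\<integral>\<^sup>+s\<in>{0..t}. ennreal (((t - s) powr (g - 1))\<^sup>2 * n s) \<partial>lborel)"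
        unfolding Qn using t n0 by (intro nn_integral_mult_square_le(2)) auto
      also have "\<dots> \<le> (\<integral>\<^sup>+s\<in>{0..T}. ennreal (n s) \<partial>lborel) * (\<integral>\<^sup>+s\<in>{0..t}. (ennreal (\<kappa> (t - s)) * ennreal (n s)) \<partial>lborel)"
        unfolding \<kappa>sq using t n0 \<kappa>0
        by (intro mult_mono nn_integral_mono mult_left_mono) (auto simp: indicator_def ennreal_mult)
      finally show ?thesis .
    qed
    \<comment> \<open>Has the deterministic constant T and involves n^2. This is the version for
      Gronwall's inequality, once finiteness has been secured by \<open>Q2a\<close>.\<close>
    have Q2b: "(Q t \<omega>)\<^sup>2 \<le> ennreal T * (\<integral>\<^sup>+s\<in>{0..t}. (ennreal (\<kappa> (t - s)) * ennreal ((n s)\<^sup>2)) \<partial>lborel)" if t: "t \<in> {0..T}" for t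
    proof -
      have "(Q t \<omega>)\<^sup>2 \<le> ennreal t * (\<integral>\<^sup>+s\<in>{0..t}. ennreal (((t - s) powr (g - 1))\<^sup>2 * (n s)\<^sup>2) \<partial>lborel)"
        unfolding Qn using t n0 by (intro nn_integral_mult_square_le(1)) auto
      also have "\<dots> \<le> ennreal T * (\<integral>\<^sup>+s\<in>{0..t}. (ennreal (\<kappa> (t - s)) * ennreal ((n s)\<^sup>2)) \<partial>lborel)"
        unfolding \<kappa>sq using t \<kappa>0
        by (intro mult_mono nn_integral_mono mult_right_mono) (auto simp: ennreal_mult ennreal_leI)
      finally show ?thesis .
    qed
    have Z2: "ennreal ((Z t \<omega>)\<^sup>2) \<le> 3 * (J t \<omega>)\<^sup>2 + ennreal (3 * c\<^sup>2) + ennreal (3 * K\<^sup>2) * (Q t \<omega>)\<^sup>2" for t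
    proof -
      have "(ennreal \<bar>Z t \<omega>\<bar>)\<^sup>2 \<le> (J t \<omega> + ennreal \<bar>c\<bar> + ennreal K * Q t \<omega>)\<^sup>2" by (intro power_mono Zle) auto
      also have "\<dots> \<le> 3 * ((J t \<omega>)\<^sup>2 + (ennreal \<bar>c\<bar>)\<^sup>2 + (ennreal K * Q t \<omega>)\<^sup>2)" by (rule ennreal_square_sum3_le)
      also have "\<dots> = 3 * (J t \<omega>)\<^sup>2 + ennreal (3 * c\<^sup>2) + ennreal (3 * K\<^sup>2) * (Q t \<omega>)\<^sup>2"
        using K by (simp add: distrib_left ennreal_power ennreal_mult power_mult_distrib mult.assoc)
      finally show ?thesis by (simp add: ennreal_power)
    qed
    have Q2fin: "(\<integral>\<^sup>+t\<in>{0..T}. (Q t \<omega>)\<^sup>2 \<partial>lborel) < \<top>"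
    proof -
      define nn where "nn = (\<integral>\<^sup>+s\<in>{0..T}. ennreal (n s) \<partial>lborel)"
      have "(\<integral>\<^sup>+t\<in>{0..T}. (Q t \<omega>)\<^sup>2 \<partial>lborel) \<le> (\<integral>\<^sup>+t. nn * ((\<integral>\<^sup>+s\<in>{0..t}. (ennreal (\<kappa> (t - s)) * ennreal (n s)) \<partial>lborel) * indicator {0..T} t) \<partial>lborel)"
      proof (rule nn_integral_mono)
        fix t
        show "(Q t \<omega>)\<^sup>2 * indicator {0..T} t \<le> nn * ((\<integral>\<^sup>+s\<in>{0..t}. (ennreal (\<kappa> (t - s)) * ennreal (n s)) \<partial>lborel) * indicator {0..T} t)"
          using Q2a[of t] unfolding nn_def by (cases "t \<in> {0..T}") auto
      qed
      also have "\<dots> = nn * (\<integral>\<^sup>+t\<in>{0..T}. (\<integral>\<^sup>+s\<in>{0..t}. (ennreal (\<kappa> (t - s)) * ennreal (n s)) \<partial>lborel) \<partial>lborel)"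
        unfolding indicator_def atLeastAtMost_iff by (rule nn_integral_cmult) measurable
      also have "\<dots> \<le> nn * (ennreal q * nn)" unfolding nn_def by (intro mult_left_mono conv) auto
      also have "\<dots> < \<top>" using nfin unfolding nn_def[symmetric] by (simp add: ennreal_mult_less_top)
      finally show ?thesis .
    qed
    have Zfin: "(\<integral>\<^sup>+t\<in>{0..T}. ennreal ((Z t \<omega>)\<^sup>2) \<partial>lborel) < \<top>"
    proof -
      have "(\<integral>\<^sup>+t\<in>{0..T}. ennreal ((Z t \<omega>)\<^sup>2) \<partial>lborel) \<le> (\<integral>\<^sup>+t. 3 * ((J t \<omega>)\<^sup>2 * indicator {0..T} t) + (ennreal (3 * c\<^sup>2) * indicator {0..T} t + ennreal (3 * K\<^sup>2) * ((Q t \<omega>)\<^sup>2 * indicator {0..T} t)) \<partial>lborel)"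
        using Z2 by (intro nn_integral_mono) (auto simp: indicator_def add.assoc)
      also have "\<dots> = 3 * (\<integral>\<^sup>+t\<in>{0..T}. (J t \<omega>)\<^sup>2 \<partial>lborel) + (ennreal (3 * c\<^sup>2) * ennreal T + ennreal (3 * K\<^sup>2) * (\<integral>\<^sup>+t\<in>{0..T}. (Q t \<omega>)\<^sup>2 \<partial>lborel))"
        using T by (simp add: nn_integral_add nn_integral_cmult nn_integral_cmult_indicator)
      also have "\<dots> < \<top>" using fJ Q2fin by (simp add: ennreal_mult_eq_top_iff less_top[symmetric])
      finally show ?thesis .
    qed
    define G where "G = (\<lambda>t. 3 * (J t \<omega>)\<^sup>2 + ennreal (3 * c\<^sup>2) + ennreal C1 * (\<integral>\<^sup>+s\<in>{0..t}. (ennreal (\<kappa> (t - s)) * ennreal (\<bar>H s \<omega>\<bar> ^ 2)) \<partial>lborel))"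
    have Gm[measurable]: "G \<in> borel_measurable borel"
      unfolding G_def indicator_def atLeastAtMost_iff by measurable
    have step: "ennreal ((Z t \<omega>)\<^sup>2) \<le> G t + ennreal C1 * (\<integral>\<^sup>+s\<in>{0..t}. ennreal (\<kappa> (t - s)) * ennreal ((Z s \<omega>)\<^sup>2) \<partial>lborel)" if t: "t \<in> {0..T}" for t
    proof -
      have "(\<integral>\<^sup>+s\<in>{0..t}. (ennreal (\<kappa> (t - s)) * ennreal ((n s)\<^sup>2)) \<partial>lborel)
        \<le> (\<integral>\<^sup>+s. ennreal (2 * (K + 1)\<^sup>2) * (ennreal (\<kappa> (t - s)) * ennreal (\<bar>H s \<omega>\<bar> ^ 2) * indicator {0..t} s + ennreal (\<kappa> (t - s)) * ennreal ((Z s \<omega>)\<^sup>2) * indicator {0..t} s) \<partial>lborel)"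
      proof (rule nn_integral_mono)
        fix s
        show "ennreal (\<kappa> (t - s)) * ennreal ((n s)\<^sup>2) * indicator {0..t} s \<le> ennreal (2 * (K + 1)\<^sup>2) * (ennreal (\<kappa> (t - s)) * ennreal (\<bar>H s \<omega>\<bar> ^ 2) * indicator {0..t} s + ennreal (\<kappa> (t - s)) * ennreal ((Z s \<omega>)\<^sup>2) * indicator {0..t} s)"
        proof (cases "s \<in> {0..t}")
          case True
          have "n s \<le> (K + 1) * (H s \<omega> + \<bar>Z s \<omega>\<bar>)"
            using Ale[of s \<omega>] True t \<omega> by (simp add: n_def algebra_simps)
          then have "(n s)\<^sup>2 \<le> ((K + 1) * (H s \<omega> + \<bar>Z s \<omega>\<bar>))\<^sup>2" using n0 by (intro power_mono) auto
          also have "\<dots> \<le> (K + 1)\<^sup>2 * (2 * (H s \<omega>)\<^sup>2 + 2 * (Z s \<omega>)\<^sup>2)"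
            unfolding power_mult_distrib using sum_squares_bound[of "H s \<omega>" "\<bar>Z s \<omega>\<bar>"]
            by (intro mult_left_mono) (auto simp: power2_sum[of "H s \<omega>"])
          finally have "\<kappa> (t - s) * (n s)\<^sup>2 \<le> \<kappa> (t - s) * ((K + 1)\<^sup>2 * (2 * (H s \<omega>)\<^sup>2 + 2 * (Z s \<omega>)\<^sup>2))"
            using \<kappa>0 by (intro mult_left_mono) auto
          also have "\<dots> = 2 * (K + 1)\<^sup>2 * (\<kappa> (t - s) * \<bar>H s \<omega>\<bar> ^ 2 + \<kappa> (t - s) * (Z s \<omega>)\<^sup>2)" by (simp add: algebra_simps)
          finally show ?thesis using True \<kappa>0
            by (simp add: ennreal_mult[symmetric] ennreal_plus[symmetric] ennreal_leI del: ennreal_plus)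
        qed simp
      qed
      also have "\<dots> = ennreal (2 * (K + 1)\<^sup>2) * ((\<integral>\<^sup>+s\<in>{0..t}. (ennreal (\<kappa> (t - s)) * ennreal (\<bar>H s \<omega>\<bar> ^ 2)) \<partial>lborel) + (\<integral>\<^sup>+s\<in>{0..t}. (ennreal (\<kappa> (t - s)) * ennreal ((Z s \<omega>)\<^sup>2)) \<partial>lborel))"
        by (simp add: nn_integral_add nn_integral_cmult)
      finally have nle: "(\<integral>\<^sup>+s\<in>{0..t}. (ennreal (\<kappa> (t - s)) * ennreal ((n s)\<^sup>2)) \<partial>lborel) \<le> \<dots>" .
      have "ennreal ((Z t \<omega>)\<^sup>2) \<le> 3 * (J t \<omega>)\<^sup>2 + ennreal (3 * c\<^sup>2) + ennreal (3 * K\<^sup>2) * (ennreal T * (ennreal (2 * (K + 1)\<^sup>2) *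
          ((\<integral>\<^sup>+s\<in>{0..t}. (ennreal (\<kappa> (t - s)) * ennreal (\<bar>H s \<omega>\<bar> ^ 2)) \<partial>lborel) + (\<integral>\<^sup>+s\<in>{0..t}. (ennreal (\<kappa> (t - s)) * ennreal ((Z s \<omega>)\<^sup>2)) \<partial>lborel))))"
        by (rule order_trans[OF Z2], intro add_left_mono mult_left_mono order_trans[OF Q2b[OF t]] nle) auto
      also have "\<dots> = 3 * (J t \<omega>)\<^sup>2 + ennreal (3 * c\<^sup>2) + ennreal C1 *
          ((\<integral>\<^sup>+s\<in>{0..t}. (ennreal (\<kappa> (t - s)) * ennreal (\<bar>H s \<omega>\<bar> ^ 2)) \<partial>lborel) + (\<integral>\<^sup>+s\<in>{0..t}. (ennreal (\<kappa> (t - s)) * ennreal ((Z s \<omega>)\<^sup>2)) \<partial>lborel))"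
      proof -
        have "ennreal C1 = ennreal (3 * K\<^sup>2) * (ennreal T * ennreal (2 * (K + 1)\<^sup>2))"
          unfolding C1_def using T by (simp add: ennreal_mult[symmetric] mult_ac)
        then show ?thesis by (simp only: mult.assoc)
      qed
      finally show ?thesis unfolding G_def by (simp add: distrib_left add_ac)
    qed
    have "(\<integral>\<^sup>+t\<in>{0..T}. ennreal ((Z t \<omega>)\<^sup>2) \<partial>lborel) \<le> ennreal D * (\<integral>\<^sup>+t\<in>{0..T}. G t \<partial>lborel)"
      by (rule gronwall) (use Zfin step in auto)
    also have "(\<integral>\<^sup>+t\<in>{0..T}. G t \<partial>lborel) \<le> 3 * (\<integral>\<^sup>+t\<in>{0..T}. (J t \<omega>)\<^sup>2 \<partial>lborel) + ennreal (3 * c\<^sup>2 * T) + ennreal (C1 * q) * (\<integral>\<^sup>+t\<in>{0..T}. ennreal (\<bar>H t \<omega>\<bar> ^ 2) \<partial>lborel)"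
    proof -
      have mm: "(\<lambda>t. (\<integral>\<^sup>+s\<in>{0..t}. (ennreal (\<kappa> (t - s)) * ennreal (\<bar>H s \<omega>\<bar> ^ 2)) \<partial>lborel) * indicator {0..T} t) \<in> borel_measurable lborel"
        unfolding indicator_def atLeastAtMost_iff by measurable
      have "(\<integral>\<^sup>+t\<in>{0..T}. G t \<partial>lborel) = (\<integral>\<^sup>+t. 3 * ((J t \<omega>)\<^sup>2 * indicator {0..T} t) + ennreal (3 * c\<^sup>2) * indicator {0..T} t
          + ennreal C1 * ((\<integral>\<^sup>+s\<in>{0..t}. (ennreal (\<kappa> (t - s)) * ennreal (\<bar>H s \<omega>\<bar> ^ 2)) \<partial>lborel) * indicator {0..T} t) \<partial>lborel)"
        unfolding G_def by (intro nn_integral_cong) (simp add: distrib_right mult.assoc)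
      also have "\<dots> = 3 * (\<integral>\<^sup>+t\<in>{0..T}. (J t \<omega>)\<^sup>2 \<partial>lborel) + ennreal (3 * c\<^sup>2) * ennreal T +
         ennreal C1 * (\<integral>\<^sup>+t\<in>{0..T}. (\<integral>\<^sup>+s\<in>{0..t}. (ennreal (\<kappa> (t - s)) * ennreal (\<bar>H s \<omega>\<bar> ^ 2)) \<partial>lborel) \<partial>lborel)"
        using mm T by (subst nn_integral_add) (auto simp: nn_integral_add nn_integral_cmult nn_integral_cmult_indicator)
      also have "\<dots> \<le> 3 * (\<integral>\<^sup>+t\<in>{0..T}. (J t \<omega>)\<^sup>2 \<partial>lborel) + ennreal (3 * c\<^sup>2) * ennreal T +
         ennreal C1 * (ennreal q * (\<integral>\<^sup>+t\<in>{0..T}. ennreal (\<bar>H t \<omega>\<bar> ^ 2) \<partial>lborel))"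
        by (intro add_left_mono mult_left_mono conv) auto
      finally show ?thesis using C1 q T by (simp add: ennreal_mult mult.assoc)
    qed
    finally show ?thesis unfolding R_def by (simp add: mult_left_mono)
  qed
  have "(\<integral>\<^sup>+\<omega>. (\<integral>\<^sup>+s\<in>{0..T}. ennreal ((Z s \<omega>)\<^sup>2) \<partial>lborel) \<partial>M) \<le> (\<integral>\<^sup>+\<omega>. R \<omega> \<partial>M)"
  proof (rule nn_integral_mono_AE)
    show "AE \<omega> in M. (\<integral>\<^sup>+s\<in>{0..T}. ennreal ((Z s \<omega>)\<^sup>2) \<partial>lborel) \<le> R \<omega>"
      using aeJ aeH aeH\<kappa> ae\<phi> AE_space
    proof eventually_elim
      case (elim \<omega>)
      show ?case by (rule path) (use elim in auto)
    qed
  qed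
  also have "\<dots> = ennreal D * (3 * (\<integral>\<^sup>+\<omega>. (\<integral>\<^sup>+t\<in>{0..T}. (J t \<omega>)\<^sup>2 \<partial>lborel) \<partial>M) + ennreal (3 * c\<^sup>2 * T)
     + ennreal (C1 * q) * (\<integral>\<^sup>+\<omega>. (\<integral>\<^sup>+t\<in>{0..T}. ennreal (\<bar>H t \<omega>\<bar> ^ 2) \<partial>lborel) \<partial>M))"
    unfolding R_def by (subst nn_integral_cmult, measurable, subst nn_integral_add, measurable, subst nn_integral_add)
      (auto simp: nn_integral_cmult emeasure_space_1)
  also have "\<dots> < \<infinity>"
    using Jfin moments_le_finite[OF mH, of 2] by (simp add: ennreal_mult_less_top)
  finally show ?thesis .
qed

end

section \<open>The fractional kernel and its derivative in the order\<close>

definition frac_kernel :: "real \<Rightarrow> real \<Rightarrow> real" where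
  "frac_kernel \<alpha> u = u powr (\<alpha> - 1) / Gamma \<alpha>"

text \<open>The derivative in the order: the logarithmic derivative of
  \<open>u powr (\<alpha> - 1) / Gamma \<alpha>\<close> is
  \<open>ln u - Digamma \<alpha>\<close>.\<close>

definition frac_kernel_deriv :: "real \<Rightarrow> real \<Rightarrow> real" where
  "frac_kernel_deriv \<alpha> u = frac_kernel \<alpha> u * (ln u - Digamma \<alpha>)"

lemma frac_kernel_measurable [measurable]: "frac_kernel \<alpha> \<in> borel_measurable borel"
  unfolding frac_kernel_def[abs_def] by measurable

lemma frac_kernel_deriv_measurable [measurable]: "frac_kernel_deriv \<alpha> \<in> borel_measurable borel"
  unfolding frac_kernel_deriv_def[abs_def] by measurable

lemma not_nonpos_Int_pos: "x > 0 \<Longrightarrow> (x::real) \<notin> \<int>\<^sub>\<le>\<^sub>0"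
  by (auto elim!: nonpos_Ints_cases)

lemma frac_kernel_has_derivative:
  assumes "u > 0" "\<alpha> > 0"
  shows "((\<lambda>\<alpha>. frac_kernel \<alpha> u) has_real_derivative frac_kernel_deriv \<alpha> u) (at \<alpha>)"
proof -
  have nz: "Gamma \<alpha> \<noteq> 0" using Gamma_real_pos[OF assms(2)] by simp
  have "((\<lambda>\<alpha>. u powr (\<alpha> - 1) / Gamma \<alpha>) has_real_derivative
     (u powr (\<alpha> - 1) * ln u * Gamma \<alpha> - u powr (\<alpha> - 1) * (Gamma \<alpha> * Digamma \<alpha>)) / (Gamma \<alpha> * Gamma \<alpha>)) (at \<alpha>)"
    using assms nz not_nonpos_Int_pos[OF assms(2)] by (auto intro!: derivative_eq_intros)
  then show ?thesis using nz unfolding frac_kernel_def frac_kernel_deriv_def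
    by (auto simp: field_simps elim!: DERIV_cong)
qed

lemma frac_kernel_deriv_has_derivative:
  assumes "u > 0" "\<alpha> > 0"
  shows "((\<lambda>\<alpha>. frac_kernel_deriv \<alpha> u) has_real_derivative
    frac_kernel \<alpha> u * ((ln u - Digamma \<alpha>)\<^sup>2 - Polygamma 1 \<alpha>)) (at \<alpha>)"
proof -
  have "((\<lambda>\<alpha>. ln u - Digamma \<alpha>) has_real_derivative - Polygamma 1 \<alpha>) (at \<alpha>)"
    using not_nonpos_Int_pos[OF assms(2)] by (auto intro!: derivative_eq_intros)
  from DERIV_mult[OF frac_kernel_has_derivative[OF assms] this]
  show ?thesis unfolding frac_kernel_deriv_def
    by (auto simp: algebra_simps power2_eq_square frac_kernel_deriv_def elim!: DERIV_cong)
qed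

text \<open>The mean value theorem without an order between a and b. The clause on the distance of z
  from b lets a second mean value step gain another factor |a - b|.\<close>

lemma mean_value_between:
  fixes f f' :: "real \<Rightarrow> real"
  assumes "\<And>x. lo \<le> x \<Longrightarrow> x \<le> hi \<Longrightarrow> (f has_real_derivative f' x) (at x)" "a \<in> {lo..hi}" "b \<in> {lo..hi}"
  shows "\<exists>z\<in>{lo..hi}. \<bar>z - b\<bar> \<le> \<bar>a - b\<bar> \<and> f a - f b = (a - b) * f' z"
proof -
  consider "a < b" | "a = b" | "b < a" by linarith
  then show ?thesis
  proof cases
    case 1
    obtain z where "a < z" "z < b" "f b - f a = (b - a) * f' z"
      using MVT2[OF 1, of f f'] assms by auto
    then show ?thesis using assms by (intro bexI[of _ z]) (auto simp: algebra_simps)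
  next
    case 3
    obtain z where "b < z" "z < a" "f a - f b = (a - b) * f' z"
      using MVT2[OF 3, of f f'] assms by auto
    then show ?thesis using assms by (intro bexI[of _ z]) auto
  qed (use assms in auto)
qed

text \<open>Near 0 the square of the logarithm is at most \<open>4 / e^2 * u powr (- e)\<close>,
  which the power absorbs; above 1 everything is bounded by its value at max 1 T. The bound is
  uniform for exponents in [e,1].\<close>

lemma powr_ln_square_le:
  fixes u T e :: real
  assumes "0 < u" "u \<le> T" "0 < e" "e \<le> r" "r \<le> 1"
  shows "u powr r * (1 + (ln u)\<^sup>2) \<le> (1 + 4 / e\<^sup>2) + (max 1 T) * (1 + (ln (max 1 T))\<^sup>2)"
proof (cases "u \<le> 1")
  case True
  define l where "l = ln (1 / u)"
  have l: "l \<ge> 0" "(ln u)\<^sup>2 = l\<^sup>2" using True assms by (auto simp: l_def ln_div)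
  have "l \<le> (1 / u) powr (e / 2) / (e / 2)"
    unfolding l_def using True assms by (intro ln_powr_bound) auto
  then have "l\<^sup>2 \<le> ((1 / u) powr (e / 2) / (e / 2))\<^sup>2" using l by (intro power_mono) auto
  also have "\<dots> = u powr (- e) * (4 / e\<^sup>2)"
    using assms by (simp add: power_divide power2_eq_square powr_add[symmetric] powr_divide powr_minus_divide)
  finally have l2: "l\<^sup>2 \<le> u powr (- e) * (4 / e\<^sup>2)" .
  have "u powr r * (1 + (ln u)\<^sup>2) \<le> u powr e * (1 + (ln u)\<^sup>2)"
    using True assms by (intro mult_right_mono powr_mono') auto
  also have "\<dots> \<le> u powr e * (1 + u powr (- e) * (4 / e\<^sup>2))"
    unfolding l(2) by (intro mult_left_mono add_left_mono l2) auto
  also have "\<dots> = u powr e + 4 / e\<^sup>2" using assms by (simp add: distrib_left powr_minus)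
  also have "u powr e \<le> 1" using True assms by (intro powr_le1) auto
  finally show ?thesis by (smt (verit) max.cobounded1 mult_nonneg_nonneg zero_le_power2)
next
  case False
  have "u powr r * (1 + (ln u)\<^sup>2) \<le> u powr 1 * (1 + (ln u)\<^sup>2)"
    using False assms by (intro mult_right_mono powr_mono) auto
  also have "\<dots> \<le> max 1 T * (1 + (ln (max 1 T))\<^sup>2)"
    using False assms by (intro mult_mono add_left_mono power_mono) auto
  finally show ?thesis using assms by (smt (verit) divide_nonneg_nonneg zero_le_power2)
qed

lemma bounded_on_Icc:
  fixes f :: "real \<Rightarrow> real"
  assumes "continuous_on {a..b} f"
  shows "\<exists>D\<ge>0. \<forall>x\<in>{a..b}. \<bar>f x\<bar> \<le> D"
proof -
  have "bounded (f ` {a..b})" using assms by (intro compact_imp_bounded compact_continuous_image) auto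
  then obtain D where "\<forall>y\<in>f ` {a..b}. norm y \<le> D" unfolding bounded_iff by blast
  then show ?thesis by (intro exI[of _ "max 0 D"]) force
qed

text \<open>Up to logarithmic factors all these functions are \<open>u powr (\<alpha> - 1)\<close>
  with \<alpha> \<ge> a > g. The surplus power pays for the logarithms, and Gamma and its
  logarithmic derivatives are bounded on the compact interval [a,1].\<close>

lemma frac_kernel_bounds:
  fixes a T :: real
  assumes a: "a \<in> {1/2<..1}" and T: "T > 0"
  shows "\<exists>g K. 1/2 < g \<and> g < 1 \<and> K > 0 \<and> (\<forall>\<alpha>\<in>{a..1}. 1 / Gamma \<alpha> \<le> K \<and> (\<forall>u. 0 < u \<longrightarrow> u \<le> T \<longrightarrow>
     u powr (\<alpha> - 1) \<le> K * u powr (g - 1) \<and>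
     \<bar>frac_kernel \<alpha> u\<bar> \<le> K * u powr (g - 1) \<and> \<bar>frac_kernel_deriv \<alpha> u\<bar> \<le> K * u powr (g - 1) \<and>
     (\<forall>\<beta>\<in>{a..1}. \<bar>frac_kernel \<alpha> u - frac_kernel \<beta> u\<bar> \<le> K * u powr (g - 1) * \<bar>\<alpha> - \<beta>\<bar> \<and>
       \<bar>frac_kernel \<alpha> u - frac_kernel \<beta> u - (\<alpha> - \<beta>) * frac_kernel_deriv \<beta> u\<bar> \<le> K * u powr (g - 1) * \<bar>\<alpha> - \<beta>\<bar>\<^sup>2)))"
proof -
  have a': "1/2 < a" "a \<le> 1" using a by auto
  have ni: "x \<notin> \<int>\<^sub>\<le>\<^sub>0" if "x \<in> {a..1}" for x using that a' by (intro not_nonpos_Int_pos) auto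
  have Gpos: "Gamma x > 0" if "x \<in> {a..1}" for x using that a' by (intro Gamma_real_pos) auto
  have disj: "{a..1} \<inter> \<int>\<^sub>\<le>\<^sub>0 = {}" using ni by auto
  obtain D1 where D1: "D1 \<ge> 0" "\<And>x. x \<in> {a..1} \<Longrightarrow> \<bar>Digamma x\<bar> \<le> D1"
    using bounded_on_Icc[OF continuous_on_Polygamma[OF disj]] by blast
  obtain D2 where D2: "D2 \<ge> 0" "\<And>x. x \<in> {a..1} \<Longrightarrow> \<bar>Polygamma 1 x\<bar> \<le> D2"
    using bounded_on_Icc[OF continuous_on_Polygamma[OF disj]] by blast
  have "continuous_on {a..1} (\<lambda>x::real. 1 / Gamma x)"
    using ni Gpos by (intro continuous_intros) force+
  from bounded_on_Icc[OF this] obtain D3 where D3: "D3 \<ge> 0" "\<And>x. x \<in> {a..1} \<Longrightarrow> \<bar>1 / Gamma x\<bar> \<le> D3" by blast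
  \<comment> \<open>Halfway between 1/2 and a: above 1/2 to keep the squared kernel integrable,
    below a to leave the surplus e for the logarithms.\<close>
  define g where "g = (a + 1/2) / 2"
  define e where "e = a - g"
  have g: "1/2 < g" "g < a" "g < 1" and e: "e > 0" using a' by (auto simp: g_def e_def)
  define P where "P = (1 + 4 / e\<^sup>2) + (max 1 T) * (1 + (ln (max 1 T))\<^sup>2)"
  have P1: "P \<ge> 1" using e T unfolding P_def
    by (smt (verit) divide_nonneg_nonneg max.cobounded1 mult_nonneg_nonneg zero_le_power2)
  have ln: "u powr (\<alpha> - 1) * (1 + (ln u)\<^sup>2) \<le> P * u powr (g - 1)" if "0 < u" "u \<le> T" "\<alpha> \<in> {a..1}" for u \<alpha>
  proof -
    have "u powr (\<alpha> - g) * (1 + (ln u)\<^sup>2) \<le> P"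
      unfolding P_def using that g e a' by (intro powr_ln_square_le) (auto simp: e_def)
    then have "u powr (\<alpha> - g) * (1 + (ln u)\<^sup>2) * u powr (g - 1) \<le> P * u powr (g - 1)" by (intro mult_right_mono) auto
    moreover have "u powr (\<alpha> - g) * u powr (g - 1) = u powr (\<alpha> - 1)" by (simp add: powr_add[symmetric])
    ultimately show ?thesis by (metis mult.assoc mult.commute)
  qed
  \<comment> \<open>One constant for the three factors that multiply the kernel below: 1, the
    logarithmic derivative, and the factor of the second derivative in the order. Each is at most Q
    times 1 + (ln u)^2.\<close>
  define Q where "Q = 2 + D1 + 2 * D1\<^sup>2 + D2"
  have Q: "Q \<ge> 1" using D1 D2 by (simp add: Q_def add_nonneg_nonneg)
  define K where "K = (D3 + 1) * Q * P"
  have K: "K \<ge> (D3 + 1) * P" "K \<ge> P" "K \<ge> D3" "K > 0"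
  proof -
    have "(D3 + 1) * 1 * P \<le> K" unfolding K_def using D3 Q P1 by (intro mult_right_mono mult_left_mono) auto
    then show 1: "K \<ge> (D3 + 1) * P" by simp
    have "1 * P \<le> (D3 + 1) * P" by (rule mult_right_mono) (use D3 P1 in auto)
    moreover have "D3 * 1 \<le> (D3 + 1) * P" by (rule mult_mono) (use D3 P1 in auto)
    ultimately show "K \<ge> P" "K \<ge> D3" "K > 0" using 1 P1 by linarith+
  qed
  have gen: "\<bar>frac_kernel \<alpha> u * q\<bar> \<le> K * u powr (g - 1)"
    if u: "0 < u" "u \<le> T" and \<alpha>: "\<alpha> \<in> {a..1}" and q: "\<bar>q\<bar> \<le> Q * (1 + (ln u)\<^sup>2)" for u \<alpha> q
  proof -
    have "\<bar>frac_kernel \<alpha> u * q\<bar> = \<bar>1 / Gamma \<alpha>\<bar> * (u powr (\<alpha> - 1) * \<bar>q\<bar>)"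
      by (simp add: frac_kernel_def abs_mult)
    also have "\<dots> \<le> D3 * (u powr (\<alpha> - 1) * (Q * (1 + (ln u)\<^sup>2)))"
      using D3 \<alpha> q by (intro mult_mono mult_left_mono) auto
    also have "\<dots> = D3 * Q * (u powr (\<alpha> - 1) * (1 + (ln u)\<^sup>2))" by (simp add: mult_ac)
    also have "\<dots> \<le> (D3 + 1) * Q * (P * u powr (g - 1))"
      by (rule mult_mono[OF _ ln[OF u \<alpha>]]) (use D3 Q in \<open>auto simp: distrib_right\<close>)
    finally show ?thesis by (simp add: K_def mult_ac)
  qed
  have absln: "\<bar>ln u\<bar> \<le> 1 + (ln u)\<^sup>2" for u :: real
    using zero_le_power2[of "\<bar>ln u\<bar> - 1"] zero_le_power2[of "ln u"] by (simp add: power2_diff)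
  have k0: "\<bar>frac_kernel \<alpha> u\<bar> \<le> K * u powr (g - 1)" if u: "0 < u" "u \<le> T" and \<alpha>: "\<alpha> \<in> {a..1}" for u \<alpha>
  proof -
    have "1 * 1 \<le> Q * (1 + (ln u)\<^sup>2)" using Q by (intro mult_mono) auto
    then show ?thesis using gen[OF u \<alpha>, of 1] by simp
  qed
  have k1: "\<bar>frac_kernel_deriv \<alpha> u\<bar> \<le> K * u powr (g - 1)" if u: "0 < u" "u \<le> T" and \<alpha>: "\<alpha> \<in> {a..1}" for u \<alpha>
    unfolding frac_kernel_deriv_def
  proof (rule gen[OF u \<alpha>])
    have "\<bar>ln u - Digamma \<alpha>\<bar> \<le> (1 + (ln u)\<^sup>2) + D1 * (1 + (ln u)\<^sup>2)"
      using absln[of u] D1(2)[OF \<alpha>] mult_left_mono[of 1 "1 + (ln u)\<^sup>2" D1] D1(1) by simp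
    also have "\<dots> = (1 + D1) * (1 + (ln u)\<^sup>2)" by (simp add: distrib_right)
    also have "\<dots> \<le> Q * (1 + (ln u)\<^sup>2)" using D1 D2 by (intro mult_right_mono) (auto simp: Q_def)
    finally show "\<bar>ln u - Digamma \<alpha>\<bar> \<le> Q * (1 + (ln u)\<^sup>2)" .
  qed
  have k2: "\<bar>frac_kernel \<alpha> u * ((ln u - Digamma \<alpha>)\<^sup>2 - Polygamma 1 \<alpha>)\<bar> \<le> K * u powr (g - 1)"
    if u: "0 < u" "u \<le> T" and \<alpha>: "\<alpha> \<in> {a..1}" for u \<alpha>
  proof (rule gen[OF u \<alpha>])
    have "(ln u - Digamma \<alpha>)\<^sup>2 \<le> 2 * (ln u)\<^sup>2 + 2 * (Digamma \<alpha>)\<^sup>2"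
      using zero_le_power2[of "ln u + Digamma \<alpha>"] by (simp add: power2_sum power2_diff)
    moreover have "(Digamma \<alpha>)\<^sup>2 \<le> D1\<^sup>2" using D1(2)[OF \<alpha>] by (metis abs_le_square_iff abs_of_nonneg D1(1))
    ultimately have "\<bar>(ln u - Digamma \<alpha>)\<^sup>2 - Polygamma 1 \<alpha>\<bar> \<le> 2 * (ln u)\<^sup>2 + (2 * D1\<^sup>2 + D2)"
      using D2(2)[OF \<alpha>] zero_le_power2[of "ln u - Digamma \<alpha>"] zero_le_power2[of "ln u"] by linarith
    also have "\<dots> \<le> 2 * (1 + (ln u)\<^sup>2) + (2 * D1\<^sup>2 + D2) * (1 + (ln u)\<^sup>2)"
      using mult_left_mono[of 1 "1 + (ln u)\<^sup>2" "2 * D1\<^sup>2 + D2"] D2(1) by (intro add_mono) auto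
    also have "\<dots> = (2 + 2 * D1\<^sup>2 + D2) * (1 + (ln u)\<^sup>2)" by (simp add: algebra_simps)
    also have "\<dots> \<le> Q * (1 + (ln u)\<^sup>2)" using D1 D2 by (intro mult_right_mono) (auto simp: Q_def)
    finally show "\<bar>(ln u - Digamma \<alpha>)\<^sup>2 - Polygamma 1 \<alpha>\<bar> \<le> Q * (1 + (ln u)\<^sup>2)" .
  qed
  have pw: "u powr (\<alpha> - 1) \<le> K * u powr (g - 1)" if u: "0 < u" "u \<le> T" and \<alpha>: "\<alpha> \<in> {a..1}" for u \<alpha>
  proof -
    have "u powr (\<alpha> - 1) * 1 \<le> u powr (\<alpha> - 1) * (1 + (ln u)\<^sup>2)" by (intro mult_left_mono) auto
    also have "\<dots> \<le> P * u powr (g - 1)" by (rule ln[OF u \<alpha>])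
    also have "\<dots> \<le> K * u powr (g - 1)" using K by (intro mult_right_mono) auto
    finally show ?thesis by simp
  qed
  \<comment> \<open>Two mean value steps: the difference of kernels is the derivative at some z, and
    the derivatives at z and \<beta> differ by the second derivative times z - \<beta>, which is at
    most |\<alpha> - \<beta>|.\<close>
  have diff: "\<bar>frac_kernel \<alpha> u - frac_kernel \<beta> u\<bar> \<le> K * u powr (g - 1) * \<bar>\<alpha> - \<beta>\<bar>"
    and diff2: "\<bar>frac_kernel \<alpha> u - frac_kernel \<beta> u - (\<alpha> - \<beta>) * frac_kernel_deriv \<beta> u\<bar> \<le> K * u powr (g - 1) * \<bar>\<alpha> - \<beta>\<bar>\<^sup>2"
    if u: "0 < u" "u \<le> T" and \<alpha>: "\<alpha> \<in> {a..1}" and \<beta>: "\<beta> \<in> {a..1}" for u \<alpha> \<beta>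
  proof -
    obtain z where z: "z \<in> {a..1}" "\<bar>z - \<beta>\<bar> \<le> \<bar>\<alpha> - \<beta>\<bar>" "frac_kernel \<alpha> u - frac_kernel \<beta> u = (\<alpha> - \<beta>) * frac_kernel_deriv z u"
      using mean_value_between[of a 1 "\<lambda>\<alpha>. frac_kernel \<alpha> u" "\<lambda>\<alpha>. frac_kernel_deriv \<alpha> u" \<alpha> \<beta>]
        frac_kernel_has_derivative[OF u(1)] a' \<alpha> \<beta> by auto
    show "\<bar>frac_kernel \<alpha> u - frac_kernel \<beta> u\<bar> \<le> K * u powr (g - 1) * \<bar>\<alpha> - \<beta>\<bar>"
      unfolding z(3) abs_mult using mult_right_mono[OF k1[OF u z(1)], of "\<bar>\<alpha> - \<beta>\<bar>"] by (simp add: mult.commute)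
    obtain v where v: "v \<in> {a..1}" "frac_kernel_deriv z u - frac_kernel_deriv \<beta> u = (z - \<beta>) * (frac_kernel v u * ((ln u - Digamma v)\<^sup>2 - Polygamma 1 v))"
      using mean_value_between[of a 1 "\<lambda>\<alpha>. frac_kernel_deriv \<alpha> u" "\<lambda>v. frac_kernel v u * ((ln u - Digamma v)\<^sup>2 - Polygamma 1 v)" z \<beta>]
        frac_kernel_deriv_has_derivative[OF u(1)] a' z(1) \<beta> by auto
    have "\<bar>frac_kernel \<alpha> u - frac_kernel \<beta> u - (\<alpha> - \<beta>) * frac_kernel_deriv \<beta> u\<bar>
       = \<bar>(\<alpha> - \<beta>) * (frac_kernel_deriv z u - frac_kernel_deriv \<beta> u)\<bar>" unfolding z(3) by (simp add: algebra_simps)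
    also have "\<dots> = \<bar>\<alpha> - \<beta>\<bar> * (\<bar>z - \<beta>\<bar> * \<bar>frac_kernel v u * ((ln u - Digamma v)\<^sup>2 - Polygamma 1 v)\<bar>)"
      unfolding v(2) abs_mult ..
    also have "\<dots> \<le> \<bar>\<alpha> - \<beta>\<bar> * (\<bar>\<alpha> - \<beta>\<bar> * (K * u powr (g - 1)))"
      using z(2) k2[OF u v(1)] by (intro mult_left_mono mult_mono) auto
    finally show "\<bar>frac_kernel \<alpha> u - frac_kernel \<beta> u - (\<alpha> - \<beta>) * frac_kernel_deriv \<beta> u\<bar> \<le> K * u powr (g - 1) * \<bar>\<alpha> - \<beta>\<bar>\<^sup>2"
      by (simp add: power2_eq_square mult_ac)
  qed
  show ?thesis
  proof (rule exI[of _ g], rule exI[of _ K], intro conjI ballI allI impI)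
    fix \<alpha> assume \<alpha>: "\<alpha> \<in> {a..1}"
    show "1 / Gamma \<alpha> \<le> K" using D3(2)[OF \<alpha>] K(3) by linarith
  qed (use g K k0 k1 pw diff diff2 in auto)
qed

section \<open>The equations of the solution, its derivative and the remainder\<close>

lemma moments_le_mono:
  assumes "moments_le M T C H" "\<And>s \<omega>. s \<in> {0..T} \<Longrightarrow> \<omega> \<in> space M \<Longrightarrow> \<bar>H' s \<omega>\<bar> \<le> \<bar>H s \<omega>\<bar>"
  shows "moments_le M T C H'"
  unfolding moments_le_def
proof
  fix n
  have "(\<integral>\<^sup>+\<omega>. (\<integral>\<^sup>+s\<in>{0..T}. ennreal (\<bar>H' s \<omega>\<bar> ^ n) \<partial>lborel) \<partial>M) \<le> (\<integral>\<^sup>+\<omega>. (\<integral>\<^sup>+s\<in>{0..T}. ennreal (\<bar>H s \<omega>\<bar> ^ n) \<partial>lborel) \<partial>M)"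
    using assms(2) by (intro nn_integral_mono) (auto simp: indicator_def intro!: ennreal_leI power_mono)
  also have "\<dots> \<le> ennreal (C n)" by (rule assms(1)[unfolded moments_le_def, rule_format])
  finally show "(\<integral>\<^sup>+\<omega>. (\<integral>\<^sup>+s\<in>{0..T}. ennreal (\<bar>H' s \<omega>\<bar> ^ n) \<partial>lborel) \<partial>M) \<le> ennreal (C n)" .
qed

lemma moments_le_const:
  assumes "prob_space M" "T \<ge> 0"
  shows "moments_le M T (\<lambda>n. \<bar>c\<bar> ^ n * T) (\<lambda>s \<omega>. c)"
proof -
  interpret prob_space M by fact
  show ?thesis unfolding moments_le_def
    using assms by (simp add: nn_integral_cmult_indicator emeasure_space_1 ennreal_mult)
qed

lemma moments_le_add:
  assumes "moments_le M T C H" "moments_le M T C' H'" "\<And>n. C n \<ge> 0" "\<And>n. C' n \<ge> 0"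
    and H: "case_prod H \<in> borel_measurable (borel \<Otimes>\<^sub>M M)" and H': "case_prod H' \<in> borel_measurable (borel \<Otimes>\<^sub>M M)"
  shows "moments_le M T (\<lambda>n. 2 ^ n * (C n + C' n)) (\<lambda>s \<omega>. H s \<omega> + H' s \<omega>)"
  unfolding moments_le_def
proof
  fix n
  note [measurable (raw)] = measurable_joint_compose[OF H] measurable_joint_compose[OF H']
  have "(\<integral>\<^sup>+\<omega>. (\<integral>\<^sup>+s\<in>{0..T}. ennreal (\<bar>H s \<omega> + H' s \<omega>\<bar> ^ n) \<partial>lborel) \<partial>M)
    \<le> (\<integral>\<^sup>+\<omega>. (\<integral>\<^sup>+s\<in>{0..T}. (ennreal (2 ^ n) * (ennreal (\<bar>H s \<omega>\<bar> ^ n) + ennreal (\<bar>H' s \<omega>\<bar> ^ n))) \<partial>lborel) \<partial>M)"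
  proof (intro nn_integral_mono mult_right_mono)
    fix \<omega> s
    define m where "m = max \<bar>H s \<omega>\<bar> \<bar>H' s \<omega>\<bar>"
    have "\<bar>H s \<omega> + H' s \<omega>\<bar> ^ n \<le> (2 * m) ^ n" by (intro power_mono) (auto simp: m_def)
    also have "\<dots> \<le> 2 ^ n * (\<bar>H s \<omega>\<bar> ^ n + \<bar>H' s \<omega>\<bar> ^ n)"
      unfolding power_mult_distrib by (intro mult_left_mono) (auto simp: m_def max_def)
    finally show "ennreal (\<bar>H s \<omega> + H' s \<omega>\<bar> ^ n) \<le> ennreal (2 ^ n) * (ennreal (\<bar>H s \<omega>\<bar> ^ n) + ennreal (\<bar>H' s \<omega>\<bar> ^ n))"
      by (simp add: ennreal_mult[symmetric] ennreal_plus[symmetric] ennreal_leI del: ennreal_plus)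
  qed simp
  also have "\<dots> = ennreal (2 ^ n) * ((\<integral>\<^sup>+\<omega>. (\<integral>\<^sup>+s\<in>{0..T}. ennreal (\<bar>H s \<omega>\<bar> ^ n) \<partial>lborel) \<partial>M) + (\<integral>\<^sup>+\<omega>. (\<integral>\<^sup>+s\<in>{0..T}. ennreal (\<bar>H' s \<omega>\<bar> ^ n) \<partial>lborel) \<partial>M))"
    by (subst double_nn_integral_cmult, measurable, subst double_nn_integral_add, measurable)
  also have "\<dots> \<le> ennreal (2 ^ n) * (ennreal (C n) + ennreal (C' n))"
    using assms(1,2) unfolding moments_le_def by (intro mult_left_mono add_mono) auto
  also have "\<dots> = ennreal (2 ^ n * (C n + C' n))" using assms(3)[of n] assms(4)[of n] by (simp add: ennreal_mult)
  finally show "(\<integral>\<^sup>+\<omega>. (\<integral>\<^sup>+s\<in>{0..T}. ennreal (\<bar>H s \<omega> + H' s \<omega>\<bar> ^ n) \<partial>lborel) \<partial>M) \<le> ennreal (2 ^ n * (C n + C' n))" .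
qed

text \<open>The product of n-th powers is at most the sum of their squares, hence the doubled
  order.\<close>

lemma moments_le_mult:
  assumes "moments_le M T C H" "moments_le M T C' H'" "\<And>n. C n \<ge> 0" "\<And>n. C' n \<ge> 0"
    and H: "case_prod H \<in> borel_measurable (borel \<Otimes>\<^sub>M M)" and H': "case_prod H' \<in> borel_measurable (borel \<Otimes>\<^sub>M M)"
  shows "moments_le M T (\<lambda>n. C (2 * n) + C' (2 * n)) (\<lambda>s \<omega>. H s \<omega> * H' s \<omega>)"
  unfolding moments_le_def
proof
  fix n
  note [measurable (raw)] = measurable_joint_compose[OF H] measurable_joint_compose[OF H']
  have "(\<integral>\<^sup>+\<omega>. (\<integral>\<^sup>+s\<in>{0..T}. ennreal (\<bar>H s \<omega> * H' s \<omega>\<bar> ^ n) \<partial>lborel) \<partial>M)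
    \<le> (\<integral>\<^sup>+\<omega>. (\<integral>\<^sup>+s\<in>{0..T}. (ennreal (\<bar>H s \<omega>\<bar> ^ (2 * n)) + ennreal (\<bar>H' s \<omega>\<bar> ^ (2 * n))) \<partial>lborel) \<partial>M)"
  proof (intro nn_integral_mono mult_right_mono)
    fix \<omega> s
    have "\<bar>H s \<omega> * H' s \<omega>\<bar> ^ n = \<bar>H s \<omega>\<bar> ^ n * \<bar>H' s \<omega>\<bar> ^ n" by (simp add: abs_mult power_mult_distrib)
    also have "\<dots> \<le> (\<bar>H s \<omega>\<bar> ^ n)\<^sup>2 + (\<bar>H' s \<omega>\<bar> ^ n)\<^sup>2"
    proof -
      have "0 \<le> \<bar>H s \<omega>\<bar> ^ n * \<bar>H' s \<omega>\<bar> ^ n" by simp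
      then show ?thesis using sum_squares_bound[of "\<bar>H s \<omega>\<bar> ^ n" "\<bar>H' s \<omega>\<bar> ^ n"] by linarith
    qed
    also have "\<dots> = \<bar>H s \<omega>\<bar> ^ (2 * n) + \<bar>H' s \<omega>\<bar> ^ (2 * n)" by (simp add: power_mult[symmetric] mult.commute)
    finally show "ennreal (\<bar>H s \<omega> * H' s \<omega>\<bar> ^ n) \<le> ennreal (\<bar>H s \<omega>\<bar> ^ (2 * n)) + ennreal (\<bar>H' s \<omega>\<bar> ^ (2 * n))"
      by (simp add: ennreal_plus[symmetric] ennreal_leI del: ennreal_plus)
  qed simp
  also have "\<dots> = (\<integral>\<^sup>+\<omega>. (\<integral>\<^sup>+s\<in>{0..T}. ennreal (\<bar>H s \<omega>\<bar> ^ (2 * n)) \<partial>lborel) \<partial>M) + (\<integral>\<^sup>+\<omega>. (\<integral>\<^sup>+s\<in>{0..T}. ennreal (\<bar>H' s \<omega>\<bar> ^ (2 * n)) \<partial>lborel) \<partial>M)"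
    by (rule double_nn_integral_add) measurable
  also have "\<dots> \<le> ennreal (C (2 * n)) + ennreal (C' (2 * n))"
    using assms(1,2) unfolding moments_le_def by (intro add_mono) auto
  also have "\<dots> = ennreal (C (2 * n) + C' (2 * n))" using assms(3)[of "2 * n"] assms(4)[of "2 * n"] by simp
  finally show "(\<integral>\<^sup>+\<omega>. (\<integral>\<^sup>+s\<in>{0..T}. ennreal (\<bar>H s \<omega> * H' s \<omega>\<bar> ^ n) \<partial>lborel) \<partial>M) \<le> ennreal (C (2 * n) + C' (2 * n))" .
qed

lemma moments_le_power:
  assumes "moments_le M T C H"
  shows "moments_le M T (\<lambda>n. C (N * n)) (\<lambda>s \<omega>. H s \<omega> ^ N)"
  using assms unfolding moments_le_def by (simp add: power_abs power_mult[symmetric] flip: power_mult)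

section \<open>Extension of processes and coefficients to the whole time line\<close>

lemma measurable_extend_process:
  fixes X :: "real \<Rightarrow> 'a \<Rightarrow> real" and T :: real
  assumes "(\<lambda>(t, \<omega>). X t \<omega>) \<in> borel_measurable (restrict_space borel {0..T} \<Otimes>\<^sub>M M)"
  shows "case_prod (\<lambda>t \<omega>. if t \<in> {0..T} then X t \<omega> else (0::real)) \<in> borel_measurable (borel \<Otimes>\<^sub>M M)"
proof -
  let ?R = "restrict_space (borel \<Otimes>\<^sub>M M) {x. fst x \<in> {0..T::real}}"
  have sets: "{x \<in> space (borel \<Otimes>\<^sub>M M). fst x \<in> {0..T::real}} \<in> sets (borel \<Otimes>\<^sub>M M)" by measurable
  have "fst \<in> measurable ?R (restrict_space borel {0..T})"
    by (rule measurable_restrict_space2)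
      (auto simp: space_restrict_space intro: measurable_restrict_space1)
  moreover have "snd \<in> measurable ?R M" by (intro measurable_restrict_space1) simp
  ultimately have "(\<lambda>x. (fst x, snd x)) \<in> measurable ?R (restrict_space borel {0..T} \<Otimes>\<^sub>M M)"
    by (rule measurable_Pair)
  from measurable_compose[OF this assms]
  have "(\<lambda>x. X (fst x) (snd x)) \<in> borel_measurable ?R" by (simp add: case_prod_beta)
  then have "(\<lambda>x. if fst x \<in> {0..T} then X (fst x) (snd x) else 0) \<in> borel_measurable (borel \<Otimes>\<^sub>M M)"
    using sets by (subst measurable_If_restrict_space_iff) auto
  then show ?thesis by (simp add: split_beta')
qed

lemma measurable_extend_coefficient:
  fixes b :: "real \<Rightarrow> real \<Rightarrow> real"
  assumes "(\<lambda>(t, x). b t x) \<in> borel_measurable (restrict_space borel ({0..T} \<times> UNIV))"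
  shows "case_prod (\<lambda>t x. if t \<in> {0..T} then b t x else 0) \<in> borel_measurable (borel \<Otimes>\<^sub>M borel)"
proof -
  have sets: "{x \<in> space (borel \<Otimes>\<^sub>M (borel::real measure)). fst x \<in> {0..T::real}} \<in> sets (borel \<Otimes>\<^sub>M borel)" by measurable
  have eq: "{0..T} \<times> (UNIV :: real set) = {x. fst x \<in> {0..T}}" by auto
  have "(\<lambda>x. b (fst x) (snd x)) \<in> borel_measurable (restrict_space (borel \<Otimes>\<^sub>M borel) {x. fst x \<in> {0..T}})"
    using assms unfolding eq borel_prod by (simp add: split_beta')
  then have "(\<lambda>x. if fst x \<in> {0..T} then b (fst x) (snd x) else 0) \<in> borel_measurable (borel \<Otimes>\<^sub>M borel)"
    using sets by (subst measurable_If_restrict_space_iff) auto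
  then show ?thesis by (simp add: split_beta')
qed

text \<open>Along this sequence the derivative in x becomes a limit of measurable functions bounded
  by the Lipschitz constant; its joint measurability and its bound by L are derived in this
  way.\<close>

lemma difference_quotient_tendsto:
  fixes f :: "real \<Rightarrow> real"
  assumes "(f has_real_derivative d) (at x)"
  shows "(\<lambda>n. (f (x + 1 / real (Suc n)) - f x) * real (Suc n)) \<longlonglongrightarrow> d"
proof -
  have "(\<lambda>h. (f (x + h) - f x) / h) \<midarrow>0\<rightarrow> d" using assms by (simp add: DERIV_def)
  moreover have "(\<lambda>n. 1 / real (Suc n)) \<longlonglongrightarrow> 0"
    using LIMSEQ_inverse_real_of_nat by (simp add: inverse_eq_divide)
  then have "filterlim (\<lambda>n. 1 / real (Suc n)) (at 0) sequentially"
    by (intro filterlim_atI) auto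
  ultimately have "(\<lambda>n. (f (x + 1 / real (Suc n)) - f x) / (1 / real (Suc n))) \<longlonglongrightarrow> d"
    by (rule filterlim_compose)
  then show ?thesis by simp
qed

text \<open>The form in which the hypotheses on b and \<sigma> are used. It holds for all times
  because the coefficients are extended by 0, and the last clause is the first-order Taylor
  remainder implied by the Hoelder condition on the derivative.\<close>

definition smooth_coefficient ::
  "real \<Rightarrow> real \<Rightarrow> real \<Rightarrow> (real \<Rightarrow> real \<Rightarrow> real) \<Rightarrow> (real \<Rightarrow> real \<Rightarrow> real) \<Rightarrow> bool" where
  "smooth_coefficient L \<nu> \<delta> f f' \<longleftrightarrow>
     case_prod f \<in> borel_measurable (borel \<Otimes>\<^sub>M borel) \<and> case_prod f' \<in> borel_measurable (borel \<Otimes>\<^sub>M borel) \<and>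
     (\<forall>t x y. \<bar>f t x - f t y\<bar> \<le> L * \<bar>x - y\<bar>) \<and> (\<forall>t x. \<bar>f t x\<bar> \<le> L * (1 + \<bar>x\<bar>)) \<and> (\<forall>t x. \<bar>f' t x\<bar> \<le> L) \<and>
     (\<forall>t x y. \<bar>f t x - f t y - f' t y * (x - y)\<bar> \<le> L * (1 + 2 * (\<bar>x\<bar> + \<bar>y\<bar>) powr \<nu>) * \<bar>x - y\<bar> powr \<delta> * \<bar>x - y\<bar>)"

text \<open>For the Taylor remainder the increment is the derivative at an intermediate z times x -
  y. The Hoelder condition between z and y then applies, with |z| and |y| both at most |x| + |y| and
  |z - y| at most |x - y|.\<close>

lemma smooth_coefficient_extend:
  fixes b :: "real \<Rightarrow> real \<Rightarrow> real"
  assumes L: "L > 0" and \<nu>: "\<nu> > 0" and \<delta>: "\<delta> > 0"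
    and meas: "(\<lambda>(t, x). b t x) \<in> borel_measurable (restrict_space borel ({0..T} \<times> UNIV))"
    and lip: "\<And>t x y. t \<in> {0..T} \<Longrightarrow> \<bar>b t x - b t y\<bar> \<le> L * \<bar>x - y\<bar>"
    and growth: "\<And>t x. t \<in> {0..T} \<Longrightarrow> \<bar>b t x\<bar> \<le> L * (1 + \<bar>x\<bar>)"
    and diff: "\<And>t x. t \<in> {0..T} \<Longrightarrow> b t field_differentiable at x"
    and holder: "\<And>t x y. t \<in> {0..T} \<Longrightarrow> \<bar>deriv (b t) x - deriv (b t) y\<bar> \<le> L * (1 + \<bar>x\<bar> powr \<nu> + \<bar>y\<bar> powr \<nu>) * \<bar>x - y\<bar> powr \<delta>"
  shows "smooth_coefficient L \<nu> \<delta> (\<lambda>t x. if t \<in> {0..T} then b t x else 0) (\<lambda>t x. if t \<in> {0..T} then deriv (b t) x else 0)"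
proof -
  let ?f = "\<lambda>t x. if t \<in> {0..T} then b t x else 0" and ?f' = "\<lambda>t x. if t \<in> {0..T} then deriv (b t) x else 0"
  have fm: "case_prod ?f \<in> borel_measurable (borel \<Otimes>\<^sub>M borel)" by (rule measurable_extend_coefficient[OF meas])
  have der: "(b t has_real_derivative deriv (b t) x) (at x)" if "t \<in> {0..T}" for t x
    using diff[OF that] by (simp add: DERIV_deriv_iff_field_differentiable)
  have lim: "(\<lambda>n. (?f t (x + 1 / real (Suc n)) - ?f t x) * real (Suc n)) \<longlonglongrightarrow> ?f' t x" for t x
    using difference_quotient_tendsto[OF der[of t x]] by auto
  have f'm: "case_prod ?f' \<in> borel_measurable (borel \<Otimes>\<^sub>M borel)"
  proof (rule borel_measurable_LIMSEQ_real)
    fix n :: nat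
    show "(\<lambda>z. (?f (fst z) (snd z + 1 / real (Suc n)) - ?f (fst z) (snd z)) * real (Suc n)) \<in> borel_measurable (borel \<Otimes>\<^sub>M borel)"
      by (intro borel_measurable_times borel_measurable_diff measurable_joint_compose[OF fm]) auto
  next
    fix z :: "real \<times> real"
    show "(\<lambda>n. (?f (fst z) (snd z + 1 / real (Suc n)) - ?f (fst z) (snd z)) * real (Suc n)) \<longlonglongrightarrow> case_prod ?f' z"
      using lim[of "fst z" "snd z"] by (simp add: split_beta)
  qed
  have f'le: "\<bar>?f' t x\<bar> \<le> L" for t x
  proof (rule LIMSEQ_le_const2[OF tendsto_rabs[OF lim[of t x]]], intro exI allI impI)
    fix n :: nat
    have step: "\<bar>?f t (x + 1 / real (Suc n)) - ?f t x\<bar> \<le> L * (1 / real (Suc n))"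
      using lip[of t "x + 1 / real (Suc n)" x] L by auto
    show "\<bar>(?f t (x + 1 / real (Suc n)) - ?f t x) * real (Suc n)\<bar> \<le> L"
      unfolding abs_mult using mult_right_mono[OF step, of "real (Suc n)"] by (simp del: of_nat_Suc)
  qed
  have rem: "\<bar>?f t x - ?f t y - ?f' t y * (x - y)\<bar> \<le> L * (1 + 2 * (\<bar>x\<bar> + \<bar>y\<bar>) powr \<nu>) * \<bar>x - y\<bar> powr \<delta> * \<bar>x - y\<bar>" for t x y
  proof (cases "t \<in> {0..T}")
    case True
    obtain z where z: "z \<in> {min x y..max x y}" "\<bar>z - y\<bar> \<le> \<bar>x - y\<bar>" "b t x - b t y = (x - y) * deriv (b t) z"
      using mean_value_between[of "min x y" "max x y" "b t" "deriv (b t)" x y] der[OF True] by auto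
    have zle: "\<bar>z\<bar> \<le> \<bar>x\<bar> + \<bar>y\<bar>" using z(1) by (auto simp: min_def max_def split: if_splits)
    have "b t x - b t y - deriv (b t) y * (x - y) = (x - y) * (deriv (b t) z - deriv (b t) y)"
      unfolding z(3) by (simp add: algebra_simps)
    then have "\<bar>b t x - b t y - deriv (b t) y * (x - y)\<bar> = \<bar>x - y\<bar> * \<bar>deriv (b t) z - deriv (b t) y\<bar>" by (simp add: abs_mult)
    also have "\<dots> \<le> \<bar>x - y\<bar> * (L * (1 + \<bar>z\<bar> powr \<nu> + \<bar>y\<bar> powr \<nu>) * \<bar>z - y\<bar> powr \<delta>)"
      by (intro mult_left_mono holder True) auto
    also have "\<dots> \<le> \<bar>x - y\<bar> * (L * (1 + (\<bar>x\<bar> + \<bar>y\<bar>) powr \<nu> + (\<bar>x\<bar> + \<bar>y\<bar>) powr \<nu>) * \<bar>x - y\<bar> powr \<delta>)"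
      using L \<nu> \<delta> z(2) zle by (intro mult_left_mono mult_mono add_mono powr_mono2 mult_nonneg_nonneg) auto
    finally show ?thesis using True by (simp add: mult_ac add_ac)
  qed (use L in auto)
  have "\<bar>?f t x - ?f t y\<bar> \<le> L * \<bar>x - y\<bar>" "\<bar>?f t x\<bar> \<le> L * (1 + \<bar>x\<bar>)" for t x y
    using lip[of t x y] growth[of t x] L by auto
  then show ?thesis unfolding smooth_coefficient_def using fm f'm f'le rem by blast
qed

section \<open>Bounds for the integrands of the difference quotient and of the remainder\<close>

lemma powr_le_one_plus_power:
  fixes x \<nu> :: real
  assumes "x \<ge> 0" "0 < \<nu>" "\<nu> \<le> real N"
  shows "x powr \<nu> \<le> 1 + x ^ N"
proof (cases "x \<le> 1")
  case True
  then have "x powr \<nu> \<le> 1 powr \<nu>" using assms by (intro powr_mono2) auto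
  then have "x powr \<nu> \<le> 1" by simp
  then show ?thesis using zero_le_power[OF assms(1), of N] by linarith
next
  case False
  then have "x powr \<nu> \<le> x powr real N" using assms by (intro powr_mono) auto
  also have "\<dots> = x ^ N" using False by (simp add: powr_realpow)
  finally show ?thesis by simp
qed

text \<open>The difference is split by inserting \<open>kb * f s x\<close>: a kernel increment meets
  the linear growth of f, and the kernel meets its Lipschitz bound. W stands for
  \<open>K * (t - s) powr (g - 1)\<close>.\<close>

lemma coefficient_difference_bound:
  assumes sc: "smooth_coefficient L \<nu> \<delta> f f'" and L: "L > 0" and h: "\<alpha> \<noteq> \<beta>" and W: "W \<ge> 0"
    and k: "\<bar>kb\<bar> \<le> W" "\<bar>ka - kb\<bar> \<le> W * \<bar>\<alpha> - \<beta>\<bar>"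
  shows "\<bar>(ka * f s x - kb * f s y) / (\<alpha> - \<beta>)\<bar> \<le> W * L * ((1 + \<bar>x\<bar>) + \<bar>(x - y) / (\<alpha> - \<beta>)\<bar>)"
proof -
  define h where "h = \<bar>\<alpha> - \<beta>\<bar>"
  have h: "h > 0" using assms by (simp add: h_def)
  have "\<bar>ka * f s x - kb * f s y\<bar> = \<bar>(ka - kb) * f s x + kb * (f s x - f s y)\<bar>" by (simp add: algebra_simps)
  also have "\<dots> \<le> \<bar>ka - kb\<bar> * \<bar>f s x\<bar> + \<bar>kb\<bar> * \<bar>f s x - f s y\<bar>"
    unfolding abs_mult[symmetric] by (rule abs_triangle_ineq)
  also have "\<dots> \<le> (W * h) * (L * (1 + \<bar>x\<bar>)) + W * (L * \<bar>x - y\<bar>)"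
    using sc k W h unfolding smooth_coefficient_def h_def by (intro add_mono mult_mono) auto
  finally have "\<bar>ka * f s x - kb * f s y\<bar> / h \<le> ((W * h) * (L * (1 + \<bar>x\<bar>)) + W * (L * \<bar>x - y\<bar>)) / h"
    using h by (intro divide_right_mono) auto
  also have "\<dots> = W * L * ((1 + \<bar>x\<bar>) + \<bar>x - y\<bar> / h)" using h by (simp add: field_simps)
  finally show ?thesis by (simp add: abs_divide h_def)
qed

text \<open>The summands come from the second-order error of the kernel, from the kernel derivative
  times the increment of f, and from the Taylor remainder of f. Real powers are replaced by
  \<open>1 + (\<bar>x\<bar> + \<bar>y\<bar>) ^ N\<close> and \<open>1 + \<bar>d\<bar>\<close>, which
  turns 1 + 2 (...) into 3 + 2 (...).\<close>

definition remainder_bound :: "nat \<Rightarrow> real \<Rightarrow> real \<Rightarrow> real \<Rightarrow> real" where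
  "remainder_bound N x y d = (1 + \<bar>x\<bar>) + (\<bar>d\<bar> + (3 + 2 * (\<bar>x\<bar> + \<bar>y\<bar>) ^ N) * ((1 + \<bar>d\<bar>) * \<bar>d\<bar>))"

lemma remainder_bound_nonneg: "remainder_bound N x y d \<ge> 0"
  unfolding remainder_bound_def by (intro add_nonneg_nonneg mult_nonneg_nonneg) auto

text \<open>With h = |\<alpha> - \<beta>|, the errors of the kernel are of order h and the Taylor
  error of f is of order h^(1+\<delta>) before division, hence h^\<delta> after it. Since h \<le> 1,
  all are of order h^\<delta>, which the factor c cancels. The bound depends on the orders only
  through d and the rescaled remainder itself.\<close>

lemma coefficient_remainder_bound:
  fixes \<alpha> \<beta> x y z :: real
  assumes sc: "smooth_coefficient L \<nu> \<delta> f f'" and L: "L > 0" and W: "W \<ge> 0"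
    and \<nu>: "0 < \<nu>" "\<nu> \<le> real N" and \<delta>: "0 < \<delta>" "\<delta> \<le> 1"
    and h: "\<alpha> \<noteq> \<beta>" "\<bar>\<alpha> - \<beta>\<bar> \<le> 1"
    and k: "\<bar>kb\<bar> \<le> W" "\<bar>kd\<bar> \<le> W" "\<bar>ka - kb - (\<alpha> - \<beta>) * kd\<bar> \<le> W * \<bar>\<alpha> - \<beta>\<bar>\<^sup>2"
  defines "d \<equiv> (x - y) / (\<alpha> - \<beta>)" and "c \<equiv> \<bar>\<alpha> - \<beta>\<bar> powr (- \<delta>)"
  shows "\<bar>c * ((ka * f s x - kb * f s y) / (\<alpha> - \<beta>) - (kd * f s y + kb * (f' s y * z)))\<bar>
    \<le> W * L * (remainder_bound N x y d + \<bar>c * (d - z)\<bar>)"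
proof -
  define h where "h = \<bar>\<alpha> - \<beta>\<bar>"
  have h: "0 < h" "h \<le> 1" using assms by (auto simp: h_def)
  have ch: "c * h powr \<delta> = 1" "c > 0" using h by (auto simp: c_def h_def[symmetric] powr_add[symmetric])
  have hle: "h \<le> h powr \<delta>" using powr_mono'[of \<delta> 1 h] h \<delta> by simp
  have xy: "x - y = (\<alpha> - \<beta>) * d" "\<bar>x - y\<bar> = h * \<bar>d\<bar>"
    using h by (auto simp: d_def h_def abs_divide)
  have sc': "\<bar>f s x - f s y\<bar> \<le> L * \<bar>x - y\<bar>" "\<bar>f s x\<bar> \<le> L * (1 + \<bar>x\<bar>)" "\<bar>f' s y\<bar> \<le> L"
     "\<bar>f s x - f s y - f' s y * (x - y)\<bar> \<le> L * (1 + 2 * (\<bar>x\<bar> + \<bar>y\<bar>) powr \<nu>) * \<bar>x - y\<bar> powr \<delta> * \<bar>x - y\<bar>"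
    using sc unfolding smooth_coefficient_def by auto
  \<comment> \<open>The four sources: t1 is the kernel beyond its first-order expansion, t2 the
    kernel derivative with f evaluated at x instead of y, t3 the Taylor remainder of f, and t4 the
    linear term in d - z that feeds Gronwall's inequality.\<close>
  define t1 where "t1 = (ka - kb - (\<alpha> - \<beta>) * kd) / (\<alpha> - \<beta>) * f s x"
  define t2 where "t2 = kd * (f s x - f s y)"
  define t3 where "t3 = kb * ((f s x - f s y - f' s y * (x - y)) / (\<alpha> - \<beta>))"
  define t4 where "t4 = kb * (f' s y * (d - z))"
  have "(ka * f s x - kb * f s y) / (\<alpha> - \<beta>) - (kd * f s y + kb * (f' s y * z)) = t1 + t2 + t3 + t4"
  proof -
    have ne: "\<alpha> - \<beta> \<noteq> 0" using assms by simp
    have "t1 = (ka * f s x - kb * f s x) / (\<alpha> - \<beta>) - kd * f s x"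
      unfolding t1_def using ne by (simp add: field_simps)
    moreover have "t3 = (kb * f s x - kb * f s y) / (\<alpha> - \<beta>) - kb * (f' s y * d)"
      unfolding t3_def d_def by (simp add: diff_divide_distrib add_divide_distrib algebra_simps)
    ultimately show ?thesis unfolding t2_def t4_def by (simp add: diff_divide_distrib add_divide_distrib algebra_simps)
  qed
  then have le: "\<bar>c * ((ka * f s x - kb * f s y) / (\<alpha> - \<beta>) - (kd * f s y + kb * (f' s y * z)))\<bar> \<le> c * (\<bar>t1\<bar> + \<bar>t2\<bar> + \<bar>t3\<bar> + \<bar>t4\<bar>)"
    using ch(2) by (simp add: abs_mult)
  have "\<bar>t1\<bar> = \<bar>ka - kb - (\<alpha> - \<beta>) * kd\<bar> / h * \<bar>f s x\<bar>" by (simp add: t1_def abs_mult abs_divide h_def)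
  also have "\<dots> \<le> (W * h\<^sup>2) / h * (L * (1 + \<bar>x\<bar>))"
    using k(3) sc'(2) h W unfolding h_def[symmetric] by (intro mult_mono divide_right_mono) auto
  also have "\<dots> = W * L * (1 + \<bar>x\<bar>) * h" using h by (simp add: power2_eq_square)
  also have "\<dots> \<le> W * L * (1 + \<bar>x\<bar>) * h powr \<delta>" using W L by (intro mult_left_mono hle) auto
  finally have t1: "\<bar>t1\<bar> \<le> W * L * (1 + \<bar>x\<bar>) * h powr \<delta>" .
  have "\<bar>t2\<bar> \<le> W * (L * (h * \<bar>d\<bar>))"
    unfolding t2_def abs_mult using k(2) sc'(1) W unfolding xy(2) by (intro mult_mono) auto
  also have "\<dots> \<le> W * (L * (h powr \<delta> * \<bar>d\<bar>))" using W L by (intro mult_left_mono mult_right_mono hle) auto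
  finally have t2: "\<bar>t2\<bar> \<le> W * L * \<bar>d\<bar> * h powr \<delta>" by (simp add: mult_ac)
  define r where "r = (3 + 2 * (\<bar>x\<bar> + \<bar>y\<bar>) ^ N) * ((1 + \<bar>d\<bar>) * \<bar>d\<bar>)"
  have "\<bar>t3\<bar> = \<bar>kb\<bar> * (\<bar>f s x - f s y - f' s y * (x - y)\<bar> / h)" by (simp add: t3_def abs_mult abs_divide h_def)
  also have "\<dots> \<le> W * ((L * (1 + 2 * (\<bar>x\<bar> + \<bar>y\<bar>) powr \<nu>) * \<bar>x - y\<bar> powr \<delta> * \<bar>x - y\<bar>) / h)"
    using k(1) sc'(4) h W by (intro mult_mono divide_right_mono) auto
  also have "\<dots> = W * (L * (1 + 2 * (\<bar>x\<bar> + \<bar>y\<bar>) powr \<nu>) * (h powr \<delta> * \<bar>d\<bar> powr \<delta> * \<bar>d\<bar>))"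
    unfolding xy(2) using h by (simp add: powr_mult)
  also have "\<dots> \<le> W * (L * (3 + 2 * (\<bar>x\<bar> + \<bar>y\<bar>) ^ N) * (h powr \<delta> * (1 + \<bar>d\<bar>) * \<bar>d\<bar>))"
    using W L powr_le_one_plus_power[of "\<bar>x\<bar> + \<bar>y\<bar>" \<nu> N] powr_le_one_plus_power[of "\<bar>d\<bar>" \<delta> 1] \<nu> \<delta> h
    by (intro mult_left_mono mult_mono mult_right_mono mult_nonneg_nonneg add_nonneg_nonneg) auto
  finally have t3: "\<bar>t3\<bar> \<le> W * L * r * h powr \<delta>" by (simp add: r_def mult_ac)
  have t4: "\<bar>t4\<bar> \<le> W * (L * \<bar>d - z\<bar>)"
    unfolding t4_def abs_mult using k(1) sc'(3) W by (intro mult_mono) auto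
  have "c * (\<bar>t1\<bar> + \<bar>t2\<bar> + \<bar>t3\<bar> + \<bar>t4\<bar>) \<le> c * (W * L * (1 + \<bar>x\<bar>) * h powr \<delta> + W * L * \<bar>d\<bar> * h powr \<delta> + W * L * r * h powr \<delta> + W * (L * \<bar>d - z\<bar>))"
    using ch(2) by (intro mult_left_mono add_mono t1 t2 t3 t4) auto
  also have "\<dots> = (c * h powr \<delta>) * (W * L * ((1 + \<bar>x\<bar>) + (\<bar>d\<bar> + r))) + W * L * (c * \<bar>d - z\<bar>)" by (simp add: algebra_simps)
  also have "\<dots> = W * L * (remainder_bound N x y d + \<bar>c * (d - z)\<bar>)"
  proof -
    have "c * \<bar>d - z\<bar> = \<bar>c * (d - z)\<bar>" using ch by (simp add: abs_mult)
    then show ?thesis unfolding ch(1) remainder_bound_def r_def by (simp only: distrib_left mult_1_left mult_1)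
  qed
  finally show ?thesis using le by linarith
qed

section \<open>The Volterra equations satisfied by X and Y\<close>

context brownian_motion
begin

definition square_ito_limit :: "real \<Rightarrow> (real \<Rightarrow> 'a \<Rightarrow> real) \<Rightarrow> ('a \<Rightarrow> real) \<Rightarrow> bool" where
  "square_ito_limit t \<phi> I \<longleftrightarrow> ito_limit t \<phi> I \<and>
     (\<integral>\<^sup>+\<omega>. (\<integral>\<^sup>+s\<in>{0..t}. ennreal ((\<phi> s \<omega>)\<^sup>2) \<partial>lborel) \<partial>M) < \<infinity>"

lemma square_finite_linear:
  fixes \<phi> \<psi> :: "real \<Rightarrow> 'a \<Rightarrow> real"
  assumes \<phi>: "case_prod \<phi> \<in> borel_measurable (borel \<Otimes>\<^sub>M M)" and \<psi>: "case_prod \<psi> \<in> borel_measurable (borel \<Otimes>\<^sub>M M)"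
    and fin: "(\<integral>\<^sup>+\<omega>. (\<integral>\<^sup>+s\<in>{0..t}. ennreal ((\<phi> s \<omega>)\<^sup>2) \<partial>lborel) \<partial>M) < \<infinity>"
      "(\<integral>\<^sup>+\<omega>. (\<integral>\<^sup>+s\<in>{0..t}. ennreal ((\<psi> s \<omega>)\<^sup>2) \<partial>lborel) \<partial>M) < \<infinity>"
  shows "(\<integral>\<^sup>+\<omega>. (\<integral>\<^sup>+s\<in>{0..t}. ennreal ((a * \<phi> s \<omega> + b * \<psi> s \<omega>)\<^sup>2) \<partial>lborel) \<partial>M) < \<infinity>"
proof -
  note [measurable (raw)] = measurable_joint_compose[OF \<phi>] measurable_joint_compose[OF \<psi>]
  have "(\<integral>\<^sup>+\<omega>. (\<integral>\<^sup>+s\<in>{0..t}. ennreal ((a * \<phi> s \<omega> + b * \<psi> s \<omega>)\<^sup>2) \<partial>lborel) \<partial>M)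
     \<le> (\<integral>\<^sup>+\<omega>. (\<integral>\<^sup>+s\<in>{0..t}. (ennreal (2 * a\<^sup>2) * ennreal ((\<phi> s \<omega>)\<^sup>2) + ennreal (2 * b\<^sup>2) * ennreal ((\<psi> s \<omega>)\<^sup>2)) \<partial>lborel) \<partial>M)"
    using square_linear_combination_le
    by (intro nn_integral_mono mult_right_mono)
      (simp_all add: ennreal_mult[symmetric] ennreal_plus[symmetric] ennreal_leI del: ennreal_plus)
  also have "\<dots> = ennreal (2 * a\<^sup>2) * (\<integral>\<^sup>+\<omega>. (\<integral>\<^sup>+s\<in>{0..t}. ennreal ((\<phi> s \<omega>)\<^sup>2) \<partial>lborel) \<partial>M)
     + ennreal (2 * b\<^sup>2) * (\<integral>\<^sup>+\<omega>. (\<integral>\<^sup>+s\<in>{0..t}. ennreal ((\<psi> s \<omega>)\<^sup>2) \<partial>lborel) \<partial>M)"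
    by (subst double_nn_integral_add, measurable, subst (1 2) double_nn_integral_cmult, measurable)
  also have "\<dots> < \<infinity>" using fin by (simp add: ennreal_mult_less_top)
  finally show ?thesis .
qed

lemma square_ito_limit_linear:
  assumes "square_ito_limit t \<phi> I" "square_ito_limit t \<psi> J" "t \<le> T"
  shows "square_ito_limit t (\<lambda>s \<omega>. a * \<phi> s \<omega> + b * \<psi> s \<omega>) (\<lambda>\<omega>. a * I \<omega> + b * J \<omega>)"
  using assms square_finite_linear[of \<phi> \<psi> t a b] ito_limit_linear[of t \<phi> I \<psi> J a b]
  unfolding square_ito_limit_def by (auto simp: ito_limit_def)

text \<open>The Ito integral is an arbitrary choice among almost surely equal versions; all that is
  used of it is that it is one of them.\<close>

lemma ito_integrable_square_ito_limit:
  assumes "ito_integrable M F B t \<phi>"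
    and "case_prod \<phi>' \<in> borel_measurable (borel \<Otimes>\<^sub>M M)"
    and eq: "\<And>s \<omega>. s \<in> {0..t} \<Longrightarrow> \<omega> \<in> space M \<Longrightarrow> \<phi>' s \<omega> = \<phi> s \<omega>"
  shows "square_ito_limit t \<phi>' (ito_integral M F B t \<phi>)"
proof -
  have has: "has_ito_integral M F B t \<phi> (ito_integral M F B t \<phi>)"
    using assms(1) unfolding ito_integrable_def ito_integral_def by (rule someI_ex)
  then have "(\<integral>\<^sup>+\<omega>. (\<integral>\<^sup>+s\<in>{0..t}. ennreal ((\<phi> s \<omega>)\<^sup>2) \<partial>lborel) \<partial>M) < \<infinity>"
    unfolding has_ito_integral_def ito_integrand_def by auto
  also have "(\<integral>\<^sup>+\<omega>. (\<integral>\<^sup>+s\<in>{0..t}. ennreal ((\<phi> s \<omega>)\<^sup>2) \<partial>lborel) \<partial>M) = (\<integral>\<^sup>+\<omega>. (\<integral>\<^sup>+s\<in>{0..t}. ennreal ((\<phi>' s \<omega>)\<^sup>2) \<partial>lborel) \<partial>M)"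
    by (intro nn_integral_cong) (auto simp: eq indicator_def)
  finally show ?thesis
    unfolding square_ito_limit_def using has_ito_integral_imp_ito_limit[OF has assms(2) eq] by auto
qed

text \<open>Keeps the exact integrands, where \<open>volterra_process\<close> keeps only bounds. The
  relation is linear in all four arguments, so the difference quotient and the remainder inherit
  their equations. Integrability of the drift is included so that integrals of sums can be
  split.\<close>

definition volterra_eq ::
  "real \<Rightarrow> (real \<Rightarrow> real \<Rightarrow> 'a \<Rightarrow> real) \<Rightarrow> (real \<Rightarrow> real \<Rightarrow> 'a \<Rightarrow> real) \<Rightarrow> (real \<Rightarrow> 'a \<Rightarrow> real) \<Rightarrow> bool" where
  "volterra_eq c \<phi> \<psi> Z \<longleftrightarrow> (\<forall>t\<in>{0..T}. case_prod (\<phi> t) \<in> borel_measurable (borel \<Otimes>\<^sub>M M) \<and>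
     (AE \<omega> in M. set_integrable lborel {0..t} (\<lambda>s. \<phi> t s \<omega>)) \<and>
     (\<exists>I. square_ito_limit t (\<psi> t) I \<and> (AE \<omega> in M. Z t \<omega> = c + (LBINT s:{0..t}. \<phi> t s \<omega>) + I \<omega>)))"

lemma volterra_eq_linear:
  assumes "volterra_eq c \<phi> \<psi> Z" "volterra_eq c' \<phi>' \<psi>' Z'"
  shows "volterra_eq (a * c + b * c') (\<lambda>t s \<omega>. a * \<phi> t s \<omega> + b * \<phi>' t s \<omega>)
    (\<lambda>t s \<omega>. a * \<psi> t s \<omega> + b * \<psi>' t s \<omega>) (\<lambda>t \<omega>. a * Z t \<omega> + b * Z' t \<omega>)"
  unfolding volterra_eq_def
proof (intro ballI conjI)
  fix t assume t: "t \<in> {0..T}"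
  obtain I where \<phi>: "case_prod (\<phi> t) \<in> borel_measurable (borel \<Otimes>\<^sub>M M)"
    and int: "AE \<omega> in M. set_integrable lborel {0..t} (\<lambda>s. \<phi> t s \<omega>)" and I: "square_ito_limit t (\<psi> t) I"
    and eq: "AE \<omega> in M. Z t \<omega> = c + (LBINT s:{0..t}. \<phi> t s \<omega>) + I \<omega>"
    using assms(1) t unfolding volterra_eq_def by blast
  obtain I' where \<phi>': "case_prod (\<phi>' t) \<in> borel_measurable (borel \<Otimes>\<^sub>M M)"
    and int': "AE \<omega> in M. set_integrable lborel {0..t} (\<lambda>s. \<phi>' t s \<omega>)" and I': "square_ito_limit t (\<psi>' t) I'"
    and eq': "AE \<omega> in M. Z' t \<omega> = c' + (LBINT s:{0..t}. \<phi>' t s \<omega>) + I' \<omega>"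
    using assms(2) t unfolding volterra_eq_def by blast
  note [measurable (raw)] = measurable_joint_compose[OF \<phi>] measurable_joint_compose[OF \<phi>']
  show "case_prod (\<lambda>s \<omega>. a * \<phi> t s \<omega> + b * \<phi>' t s \<omega>) \<in> borel_measurable (borel \<Otimes>\<^sub>M M)" by measurable
  show "AE \<omega> in M. set_integrable lborel {0..t} (\<lambda>s. a * \<phi> t s \<omega> + b * \<phi>' t s \<omega>)"
    using int int' by eventually_elim (intro set_integral_add set_integrable_mult_right; simp)
  show "\<exists>I. square_ito_limit t (\<lambda>s \<omega>. a * \<psi> t s \<omega> + b * \<psi>' t s \<omega>) I \<and>
    (AE \<omega> in M. a * Z t \<omega> + b * Z' t \<omega> = a * c + b * c' + (LBINT s:{0..t}. a * \<phi> t s \<omega> + b * \<phi>' t s \<omega>) + I \<omega>)"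
  proof (intro exI conjI)
    show "square_ito_limit t (\<lambda>s \<omega>. a * \<psi> t s \<omega> + b * \<psi>' t s \<omega>) (\<lambda>\<omega>. a * I \<omega> + b * I' \<omega>)"
      using square_ito_limit_linear[OF I I'] t by simp
    show "AE \<omega> in M. a * Z t \<omega> + b * Z' t \<omega> = a * c + b * c' + (LBINT s:{0..t}. a * \<phi> t s \<omega> + b * \<phi>' t s \<omega>) + (a * I \<omega> + b * I' \<omega>)"
      using int int' eq eq'
    proof eventually_elim
      case (elim \<omega>)
      have "(LBINT s:{0..t}. a * \<phi> t s \<omega> + b * \<phi>' t s \<omega>) = a * (LBINT s:{0..t}. \<phi> t s \<omega>) + b * (LBINT s:{0..t}. \<phi>' t s \<omega>)"
        using elim(1,2) by (subst set_integral_add(2)) auto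
      then show ?case using elim(3,4) by (simp add: algebra_simps)
    qed
  qed
qed

lemma volterra_eq_imp_process:
  assumes "volterra_eq c \<phi> \<psi> Z"
    and "\<And>t s \<omega>. t \<in> {0..T} \<Longrightarrow> s \<in> {0..<t} \<Longrightarrow> \<omega> \<in> space M \<Longrightarrow> \<bar>\<phi> t s \<omega>\<bar> \<le> K * (t - s) powr (g - 1) * (H s \<omega> + \<bar>Z s \<omega>\<bar>)"
    and "\<And>t s \<omega>. t \<in> {0..T} \<Longrightarrow> s \<in> {0..<t} \<Longrightarrow> \<omega> \<in> space M \<Longrightarrow> \<bar>\<psi> t s \<omega>\<bar> \<le> K * (t - s) powr (g - 1) * (H s \<omega> + \<bar>Z s \<omega>\<bar>)"
  shows "volterra_process g K c H Z"
  unfolding volterra_process_def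
proof
  fix t assume t: "t \<in> {0..T}"
  obtain I where "case_prod (\<phi> t) \<in> borel_measurable (borel \<Otimes>\<^sub>M M)" "ito_limit t (\<psi> t) I"
    "AE \<omega> in M. Z t \<omega> = c + (LBINT s:{0..t}. \<phi> t s \<omega>) + I \<omega>"
    using assms(1) t unfolding volterra_eq_def square_ito_limit_def by blast
  then show "\<exists>\<phi> \<psi> I. case_prod \<phi> \<in> borel_measurable (borel \<Otimes>\<^sub>M M) \<and> ito_limit t \<psi> I \<and>
     (AE \<omega> in M. Z t \<omega> = c + (LBINT s:{0..t}. \<phi> s \<omega>) + I \<omega>) \<and>
     (\<forall>s\<in>{0..<t}. \<forall>\<omega>\<in>space M. \<bar>\<phi> s \<omega>\<bar> \<le> K * (t - s) powr (g - 1) * (H s \<omega> + \<bar>Z s \<omega>\<bar>)) \<and>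
     (\<forall>s\<in>{0..<t}. \<forall>\<omega>\<in>space M. \<bar>\<psi> s \<omega>\<bar> \<le> K * (t - s) powr (g - 1) * (H s \<omega> + \<bar>Z s \<omega>\<bar>))"
    using assms(2,3)[OF t] by (intro exI[of _ "\<phi> t"] exI[of _ "\<psi> t"] exI[of _ I]) auto
qed

lemma caputo_volterra_eq:
  assumes sol: "caputo_fsde_solution M T B b \<sigma> x\<^sub>0 \<alpha> X"
    and f: "smooth_coefficient L \<nu> \<delta> f f'" "\<And>s x. s \<in> {0..T} \<Longrightarrow> f s x = b s x"
    and h: "smooth_coefficient L \<nu> \<delta> h h'" "\<And>s x. s \<in> {0..T} \<Longrightarrow> h s x = \<sigma> s x"
    and Z: "case_prod Z \<in> borel_measurable (borel \<Otimes>\<^sub>M M)" "\<And>s \<omega>. s \<in> {0..T} \<Longrightarrow> Z s \<omega> = X s \<omega>"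
  shows "volterra_eq x\<^sub>0 (\<lambda>t s \<omega>. frac_kernel \<alpha> (t - s) * f s (Z s \<omega>)) (\<lambda>t s \<omega>. frac_kernel \<alpha> (t - s) * h s (Z s \<omega>)) Z"
  unfolding volterra_eq_def
proof (intro ballI conjI)
  fix t assume t: "t \<in> {0..T}"
  have fm: "case_prod f \<in> borel_measurable (borel \<Otimes>\<^sub>M borel)" and hm: "case_prod h \<in> borel_measurable (borel \<Otimes>\<^sub>M borel)"
    using f(1) h(1) by (auto simp: smooth_coefficient_def)
  note [measurable (raw)] = measurable_joint_compose[OF fm] measurable_joint_compose[OF hm] measurable_joint_compose[OF Z(1)]
  let ?\<phi> = "\<lambda>s \<omega>. (t - s) powr (\<alpha> - 1) * b s (X s \<omega>)" and ?\<psi> = "\<lambda>s \<omega>. (t - s) powr (\<alpha> - 1) * \<sigma> s (X s \<omega>)"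
  have int: "AE \<omega> in M. set_integrable lborel {0..t} (\<lambda>s. ?\<phi> s \<omega>)"
    and ito: "ito_integrable M F B t ?\<psi>"
    and eq: "AE \<omega> in M. X t \<omega> = x\<^sub>0 + 1 / Gamma \<alpha> * ((LBINT s:{0..t}. ?\<phi> s \<omega>) + ito_integral M F B t ?\<psi> \<omega>)"
    using sol t unfolding caputo_fsde_solution_def Let_def by auto
  have \<phi>eq: "frac_kernel \<alpha> (t - s) * f s (Z s \<omega>) = 1 / Gamma \<alpha> * ?\<phi> s \<omega>" if "s \<in> {0..t}" for s \<omega>
    using that t f(2) Z(2) by (simp add: frac_kernel_def)
  show "case_prod (\<lambda>s \<omega>. frac_kernel \<alpha> (t - s) * f s (Z s \<omega>)) \<in> borel_measurable (borel \<Otimes>\<^sub>M M)" by measurable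
  show "AE \<omega> in M. set_integrable lborel {0..t} (\<lambda>s. frac_kernel \<alpha> (t - s) * f s (Z s \<omega>))"
    using int
  proof eventually_elim
    case (elim \<omega>)
    then have "set_integrable lborel {0..t} (\<lambda>s. 1 / Gamma \<alpha> * ?\<phi> s \<omega>)" by (intro set_integrable_mult_right) simp
    also have "set_integrable lborel {0..t} (\<lambda>s. 1 / Gamma \<alpha> * ?\<phi> s \<omega>) \<longleftrightarrow> ?case"
      by (intro set_integrable_cong refl \<phi>eq[symmetric])
    finally show ?case .
  qed
  let ?I = "ito_integral M F B t ?\<psi>"
  have I: "square_ito_limit t (\<lambda>s \<omega>. (t - s) powr (\<alpha> - 1) * h s (Z s \<omega>)) ?I"
  proof (rule ito_integrable_square_ito_limit[OF ito])
    show "case_prod (\<lambda>s \<omega>. (t - s) powr (\<alpha> - 1) * h s (Z s \<omega>)) \<in> borel_measurable (borel \<Otimes>\<^sub>M M)" by measurable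
  qed (use t h(2) Z(2) in auto)
  \<comment> \<open>Multiplication by a constant is obtained as a linear combination whose second
    coefficient is 0.\<close>
  have "square_ito_limit t (\<lambda>s \<omega>. frac_kernel \<alpha> (t - s) * h s (Z s \<omega>)) (\<lambda>\<omega>. 1 / Gamma \<alpha> * ?I \<omega>)"
    using square_ito_limit_linear[OF I I, of "1 / Gamma \<alpha>" 0] t by (simp add: frac_kernel_def)
  moreover have "AE \<omega> in M. Z t \<omega> = x\<^sub>0 + (LBINT s:{0..t}. frac_kernel \<alpha> (t - s) * f s (Z s \<omega>)) + 1 / Gamma \<alpha> * ?I \<omega>"
    using eq
  proof eventually_elim
    case (elim \<omega>)
    have "(LBINT s:{0..t}. frac_kernel \<alpha> (t - s) * f s (Z s \<omega>)) = (LBINT s:{0..t}. 1 / Gamma \<alpha> * ?\<phi> s \<omega>)"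
      by (intro set_lebesgue_integral_cong) (use \<phi>eq in auto)
    also have "\<dots> = 1 / Gamma \<alpha> * (LBINT s:{0..t}. ?\<phi> s \<omega>)" by (rule set_integral_mult_right)
    finally show ?case using elim Z(2)[OF t] by (simp add: algebra_simps)
  qed
  ultimately show "\<exists>I. square_ito_limit t (\<lambda>s \<omega>. frac_kernel \<alpha> (t - s) * h s (Z s \<omega>)) I \<and>
      (AE \<omega> in M. Z t \<omega> = x\<^sub>0 + (LBINT s:{0..t}. frac_kernel \<alpha> (t - s) * f s (Z s \<omega>)) + I \<omega>)" by blast
qed

text \<open>The derivative of Gamma is Gamma times Digamma. The first bracket in the equation of Y
  therefore carries the coefficient \<open>- Digamma \<beta> / Gamma \<beta>\<close> and combines
  with the logarithmic terms into the derivative of the kernel.\<close>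

lemma derivative_volterra_eq:
  assumes sol: "order_derivative_process M T B b \<sigma> \<beta> X Y" and \<beta>: "\<beta> > 0"
    and f: "smooth_coefficient L \<nu> \<delta> f f'" "\<And>s x. s \<in> {0..T} \<Longrightarrow> f s x = b s x" "\<And>s x. s \<in> {0..T} \<Longrightarrow> f' s x = deriv (b s) x"
    and h: "smooth_coefficient L \<nu> \<delta> h h'" "\<And>s x. s \<in> {0..T} \<Longrightarrow> h s x = \<sigma> s x" "\<And>s x. s \<in> {0..T} \<Longrightarrow> h' s x = deriv (\<sigma> s) x"
    and Z: "case_prod Z \<in> borel_measurable (borel \<Otimes>\<^sub>M M)" "\<And>s \<omega>. s \<in> {0..T} \<Longrightarrow> Z s \<omega> = X s \<omega>"
    and U: "case_prod U \<in> borel_measurable (borel \<Otimes>\<^sub>M M)" "\<And>s \<omega>. s \<in> {0..T} \<Longrightarrow> U s \<omega> = Y s \<omega>"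
  shows "volterra_eq 0
    (\<lambda>t s \<omega>. frac_kernel_deriv \<beta> (t - s) * f s (Z s \<omega>) + frac_kernel \<beta> (t - s) * (f' s (Z s \<omega>) * U s \<omega>))
    (\<lambda>t s \<omega>. frac_kernel_deriv \<beta> (t - s) * h s (Z s \<omega>) + frac_kernel \<beta> (t - s) * (h' s (Z s \<omega>) * U s \<omega>)) U"
  unfolding volterra_eq_def
proof (intro ballI conjI)
  fix t assume t: "t \<in> {0..T}"
  have fm: "case_prod f \<in> borel_measurable (borel \<Otimes>\<^sub>M borel)" "case_prod f' \<in> borel_measurable (borel \<Otimes>\<^sub>M borel)"
    and hm: "case_prod h \<in> borel_measurable (borel \<Otimes>\<^sub>M borel)" "case_prod h' \<in> borel_measurable (borel \<Otimes>\<^sub>M borel)"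
    using f(1) h(1) by (auto simp: smooth_coefficient_def)
  note [measurable (raw)] = measurable_joint_compose[OF fm(1)] measurable_joint_compose[OF hm(1)]
    measurable_joint_compose[OF fm(2)] measurable_joint_compose[OF hm(2)]
    measurable_joint_compose[OF Z(1)] measurable_joint_compose[OF U(1)]
  let ?p = "\<lambda>s. (t - s) powr (\<beta> - 1)"
  let ?\<phi> = "\<lambda>s \<omega>. ?p s * b s (X s \<omega>)" and ?\<psi> = "\<lambda>s \<omega>. ?p s * \<sigma> s (X s \<omega>)"
  let ?\<phi>' = "\<lambda>s \<omega>. ?p s * (ln (t - s) * b s (X s \<omega>) + deriv (b s) (X s \<omega>) * Y s \<omega>)"
  let ?\<psi>' = "\<lambda>s \<omega>. ?p s * (ln (t - s) * \<sigma> s (X s \<omega>) + deriv (\<sigma> s) (X s \<omega>) * Y s \<omega>)"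
  have int: "AE \<omega> in M. set_integrable lborel {0..t} (\<lambda>s. ?\<phi> s \<omega>)"
    and int': "AE \<omega> in M. set_integrable lborel {0..t} (\<lambda>s. ?\<phi>' s \<omega>)"
    and ito: "ito_integrable M F B t ?\<psi>" and ito': "ito_integrable M F B t ?\<psi>'"
    and eq: "AE \<omega> in M. Y t \<omega> = - (deriv Gamma \<beta> / (Gamma \<beta>)\<^sup>2) * ((LBINT s:{0..t}. ?\<phi> s \<omega>) + ito_integral M F B t ?\<psi> \<omega>)
       + 1 / Gamma \<beta> * (LBINT s:{0..t}. ?\<phi>' s \<omega>) + 1 / Gamma \<beta> * ito_integral M F B t ?\<psi>' \<omega>"
    using sol t unfolding order_derivative_process_def Let_def by auto
  define c1 where "c1 = - (deriv Gamma \<beta> / (Gamma \<beta>)\<^sup>2)"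
  define c2 where "c2 = 1 / Gamma \<beta>"
  have Gpos: "Gamma \<beta> > 0" using \<beta> by (rule Gamma_real_pos)
  have "deriv Gamma \<beta> = Gamma \<beta> * Digamma \<beta>"
    by (intro DERIV_imp_deriv has_field_derivative_Gamma not_nonpos_Int_pos \<beta>)
  then have c1: "c1 = - c2 * Digamma \<beta>" using Gpos by (simp add: c1_def c2_def power2_eq_square)
  have comb: "frac_kernel_deriv \<beta> u * x + frac_kernel \<beta> u * (y * z) = c1 * (u powr (\<beta> - 1) * x) + c2 * (u powr (\<beta> - 1) * (ln u * x + y * z))" for u x y z
    unfolding c1 by (simp add: frac_kernel_deriv_def frac_kernel_def c2_def diff_divide_distrib algebra_simps)
  have \<phi>eq: "frac_kernel_deriv \<beta> (t - s) * f s (Z s \<omega>) + frac_kernel \<beta> (t - s) * (f' s (Z s \<omega>) * U s \<omega>) = c1 * ?\<phi> s \<omega> + c2 * ?\<phi>' s \<omega>"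
    if "s \<in> {0..t}" for s \<omega>
    unfolding comb using that t f(2,3) Z(2) U(2) by simp
  show "case_prod (\<lambda>s \<omega>. frac_kernel_deriv \<beta> (t - s) * f s (Z s \<omega>) + frac_kernel \<beta> (t - s) * (f' s (Z s \<omega>) * U s \<omega>)) \<in> borel_measurable (borel \<Otimes>\<^sub>M M)"
    by measurable
  show "AE \<omega> in M. set_integrable lborel {0..t} (\<lambda>s. frac_kernel_deriv \<beta> (t - s) * f s (Z s \<omega>) + frac_kernel \<beta> (t - s) * (f' s (Z s \<omega>) * U s \<omega>))"
    using int int'
  proof eventually_elim
    case (elim \<omega>)
    then have "set_integrable lborel {0..t} (\<lambda>s. c1 * ?\<phi> s \<omega> + c2 * ?\<phi>' s \<omega>)"
      by (intro set_integral_add set_integrable_mult_right) simp_all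
    also have "set_integrable lborel {0..t} (\<lambda>s. c1 * ?\<phi> s \<omega> + c2 * ?\<phi>' s \<omega>) \<longleftrightarrow> ?case"
      by (intro set_integrable_cong refl \<phi>eq[symmetric])
    finally show ?case .
  qed
  let ?I = "ito_integral M F B t ?\<psi>" and ?I' = "ito_integral M F B t ?\<psi>'"
  have I: "square_ito_limit t (\<lambda>s \<omega>. ?p s * h s (Z s \<omega>)) ?I"
  proof (rule ito_integrable_square_ito_limit[OF ito])
    show "case_prod (\<lambda>s \<omega>. ?p s * h s (Z s \<omega>)) \<in> borel_measurable (borel \<Otimes>\<^sub>M M)" by measurable
  qed (use t h(2) Z(2) in auto)
  have I': "square_ito_limit t (\<lambda>s \<omega>. ?p s * (ln (t - s) * h s (Z s \<omega>) + h' s (Z s \<omega>) * U s \<omega>)) ?I'"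
  proof (rule ito_integrable_square_ito_limit[OF ito'])
    show "case_prod (\<lambda>s \<omega>. ?p s * (ln (t - s) * h s (Z s \<omega>) + h' s (Z s \<omega>) * U s \<omega>)) \<in> borel_measurable (borel \<Otimes>\<^sub>M M)" by measurable
  qed (use t h(2,3) Z(2) U(2) in auto)
  have "square_ito_limit t (\<lambda>s \<omega>. frac_kernel_deriv \<beta> (t - s) * h s (Z s \<omega>) + frac_kernel \<beta> (t - s) * (h' s (Z s \<omega>) * U s \<omega>)) (\<lambda>\<omega>. c1 * ?I \<omega> + c2 * ?I' \<omega>)"
    unfolding comb using square_ito_limit_linear[OF I I', of c1 c2] t by simp
  moreover have "AE \<omega> in M. U t \<omega> = 0 + (LBINT s:{0..t}. frac_kernel_deriv \<beta> (t - s) * f s (Z s \<omega>) + frac_kernel \<beta> (t - s) * (f' s (Z s \<omega>) * U s \<omega>)) + (c1 * ?I \<omega> + c2 * ?I' \<omega>)"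
    using eq int int'
  proof eventually_elim
    case (elim \<omega>)
    have "(LBINT s:{0..t}. frac_kernel_deriv \<beta> (t - s) * f s (Z s \<omega>) + frac_kernel \<beta> (t - s) * (f' s (Z s \<omega>) * U s \<omega>)) = (LBINT s:{0..t}. c1 * ?\<phi> s \<omega> + c2 * ?\<phi>' s \<omega>)"
      by (intro set_lebesgue_integral_cong) (use \<phi>eq in auto)
    also have "\<dots> = (LBINT s:{0..t}. c1 * ?\<phi> s \<omega>) + (LBINT s:{0..t}. c2 * ?\<phi>' s \<omega>)"
      by (intro set_integral_add set_integrable_mult_right) (use elim(2,3) in simp_all)
    also have "\<dots> = c1 * (LBINT s:{0..t}. ?\<phi> s \<omega>) + c2 * (LBINT s:{0..t}. ?\<phi>' s \<omega>)"
      by (simp only: set_integral_mult_right)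
    finally show ?case using elim(1) U(2)[OF t] unfolding c1_def[symmetric] c2_def[symmetric] by (simp add: algebra_simps)
  qed
  ultimately show "\<exists>I. square_ito_limit t (\<lambda>s \<omega>. frac_kernel_deriv \<beta> (t - s) * h s (Z s \<omega>) + frac_kernel \<beta> (t - s) * (h' s (Z s \<omega>) * U s \<omega>)) I \<and>
      (AE \<omega> in M. U t \<omega> = 0 + (LBINT s:{0..t}. frac_kernel_deriv \<beta> (t - s) * f s (Z s \<omega>) + frac_kernel \<beta> (t - s) * (f' s (Z s \<omega>) * U s \<omega>)) + I \<omega>)"
    by blast
qed

end

section \<open>Moment constants and the setups for solution, derivative, quotient and
  remainder\<close>

definition add_moments :: "(nat \<Rightarrow> real) \<Rightarrow> (nat \<Rightarrow> real) \<Rightarrow> nat \<Rightarrow> real" where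
  "add_moments C C' n = 2 ^ n * (C n + C' n)"

definition mult_moments :: "(nat \<Rightarrow> real) \<Rightarrow> (nat \<Rightarrow> real) \<Rightarrow> nat \<Rightarrow> real" where
  "mult_moments C C' n = C (2 * n) + C' (2 * n)"

definition const_moments :: "real \<Rightarrow> real \<Rightarrow> nat \<Rightarrow> real" where
  "const_moments T c n = \<bar>c\<bar> ^ n * T"

text \<open>Follows the construction of \<open>remainder_bound\<close> term by term, with C for the
  two solutions and C' for the difference quotient. As a closed expression it can be fixed before
  the probability space.\<close>

definition remainder_moments :: "real \<Rightarrow> nat \<Rightarrow> (nat \<Rightarrow> real) \<Rightarrow> (nat \<Rightarrow> real) \<Rightarrow> nat \<Rightarrow> real" where
  "remainder_moments T N C C' = add_moments (add_moments (const_moments T 1) C)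
     (add_moments C' (mult_moments
       (add_moments (const_moments T 3) (mult_moments (const_moments T 2) (\<lambda>n. add_moments C C (N * n))))
       (mult_moments (add_moments (const_moments T 1) C') C')))"

lemma moments_nonneg:
  "(\<And>n. C n \<ge> 0) \<Longrightarrow> (\<And>n. C' n \<ge> 0) \<Longrightarrow> add_moments C C' n \<ge> 0"
  "(\<And>n. C n \<ge> 0) \<Longrightarrow> (\<And>n. C' n \<ge> 0) \<Longrightarrow> mult_moments C C' n \<ge> 0"
  "T \<ge> 0 \<Longrightarrow> const_moments T c n \<ge> 0"
  by (auto simp: add_moments_def mult_moments_def const_moments_def)

lemma moments_le_abs: "moments_le M T C H \<Longrightarrow> moments_le M T C (\<lambda>s \<omega>. \<bar>H s \<omega>\<bar>)"
  by (rule moments_le_mono) auto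

lemma moments_le_one_plus:
  assumes pM: "prob_space M" and T: "T > 0" and X: "moments_le M T C X" and C: "\<And>n. C n \<ge> 0"
    and m: "case_prod X \<in> borel_measurable (borel \<Otimes>\<^sub>M M)"
  shows "moments_le M T (add_moments (const_moments T 1) C) (\<lambda>s \<omega>. 1 + \<bar>X s \<omega>\<bar>)"
proof -
  note [measurable (raw)] = measurable_joint_compose[OF m]
  have "moments_le M T (\<lambda>n. 2 ^ n * (\<bar>1\<bar> ^ n * T + C n)) (\<lambda>s \<omega>. 1 + \<bar>X s \<omega>\<bar>)"
    by (rule moments_le_add[OF moments_le_const[OF pM] moments_le_abs[OF X]]) (use T C in auto)
  then show ?thesis by (simp add: add_moments_def[abs_def] const_moments_def)
qed

lemma moments_le_remainder:
  assumes pM: "prob_space M" and T: "T > 0" and C: "\<And>n. C n \<ge> 0" and C': "\<And>n. C' n \<ge> 0"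
    and X: "moments_le M T C X" and Y: "moments_le M T C Y" and D: "moments_le M T C' D"
    and m: "case_prod X \<in> borel_measurable (borel \<Otimes>\<^sub>M M)" "case_prod Y \<in> borel_measurable (borel \<Otimes>\<^sub>M M)"
      "case_prod D \<in> borel_measurable (borel \<Otimes>\<^sub>M M)"
  shows "moments_le M T (remainder_moments T N C C') (\<lambda>s \<omega>. remainder_bound N (X s \<omega>) (Y s \<omega>) (D s \<omega>))"
proof -
  note [measurable (raw)] = measurable_joint_compose[OF m(1)] measurable_joint_compose[OF m(2)] measurable_joint_compose[OF m(3)]
  have T0: "T \<ge> 0" using T by simp
  have add: "moments_le M T (add_moments A A') (\<lambda>s \<omega>. H s \<omega> + H' s \<omega>)"
    if "moments_le M T A H" "moments_le M T A' H'" "\<And>n. A n \<ge> 0" "\<And>n. A' n \<ge> 0"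
    "case_prod H \<in> borel_measurable (borel \<Otimes>\<^sub>M M)" "case_prod H' \<in> borel_measurable (borel \<Otimes>\<^sub>M M)" for A A' H H'
    using moments_le_add[OF that] by (simp add: add_moments_def[abs_def])
  have mult: "moments_le M T (mult_moments A A') (\<lambda>s \<omega>. H s \<omega> * H' s \<omega>)"
    if "moments_le M T A H" "moments_le M T A' H'" "\<And>n. A n \<ge> 0" "\<And>n. A' n \<ge> 0"
    "case_prod H \<in> borel_measurable (borel \<Otimes>\<^sub>M M)" "case_prod H' \<in> borel_measurable (borel \<Otimes>\<^sub>M M)" for A A' H H'
    using moments_le_mult[OF that] by (simp add: mult_moments_def[abs_def])
  have const: "moments_le M T (const_moments T c) (\<lambda>s \<omega>. c)" for c
    using moments_le_const[OF pM T0, of c] by (simp add: const_moments_def[abs_def])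
  note nn = moments_nonneg(1,2) moments_nonneg(3)[OF T0] C C'
  note abs = moments_le_abs[OF X] moments_le_abs[OF Y] moments_le_abs[OF D]
  show ?thesis
    unfolding remainder_bound_def remainder_moments_def
    by (intro add mult const abs nn moments_le_power[where C="add_moments C C"]; measurable)
qed

lemma square_moment_finite:
  assumes "moments_le M T C H"
  shows "(\<integral>\<^sup>+\<omega>. (\<integral>\<^sup>+s\<in>{0..T}. ennreal ((H s \<omega>)\<^sup>2) \<partial>lborel) \<partial>M) < \<infinity>"
  using moments_le_finite[OF assms, of 2] by simp

text \<open>The kernel bounds are assumed for given g and K rather than derived here, so that these
  numbers can be chosen before the probability space. X and Y stand for the processes extended to
  all times.\<close>

locale fractional_data = brownian_motion M T B for M :: "'a measure" and T B +
  fixes L \<nu> \<delta> g K a x\<^sub>0 :: real and f f' h h' :: "real \<Rightarrow> real \<Rightarrow> real" and X Y :: "real \<Rightarrow> real \<Rightarrow> 'a \<Rightarrow> real"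
  assumes L: "L > 0" and T: "T > 0" and a: "a \<in> {1/2<..1}" and g: "1/2 < g" "g < 1" and K: "K > 0"
    and f: "smooth_coefficient L \<nu> \<delta> f f'" and h: "smooth_coefficient L \<nu> \<delta> h h'"
    and Xm: "\<And>\<alpha>. \<alpha> \<in> {a..1} \<Longrightarrow> case_prod (X \<alpha>) \<in> borel_measurable (borel \<Otimes>\<^sub>M M)"
    and Ym: "\<And>\<alpha>. \<alpha> \<in> {a..1} \<Longrightarrow> case_prod (Y \<alpha>) \<in> borel_measurable (borel \<Otimes>\<^sub>M M)"
    and Xeq: "\<And>\<alpha>. \<alpha> \<in> {a..1} \<Longrightarrow> volterra_eq x\<^sub>0 (\<lambda>t s \<omega>. frac_kernel \<alpha> (t - s) * f s (X \<alpha> s \<omega>))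
      (\<lambda>t s \<omega>. frac_kernel \<alpha> (t - s) * h s (X \<alpha> s \<omega>)) (X \<alpha>)"
    and Yeq: "\<And>\<alpha>. \<alpha> \<in> {a..1} \<Longrightarrow> volterra_eq 0
      (\<lambda>t s \<omega>. frac_kernel_deriv \<alpha> (t - s) * f s (X \<alpha> s \<omega>) + frac_kernel \<alpha> (t - s) * (f' s (X \<alpha> s \<omega>) * Y \<alpha> s \<omega>))
      (\<lambda>t s \<omega>. frac_kernel_deriv \<alpha> (t - s) * h s (X \<alpha> s \<omega>) + frac_kernel \<alpha> (t - s) * (h' s (X \<alpha> s \<omega>) * Y \<alpha> s \<omega>)) (Y \<alpha>)"
    and Gle: "\<And>\<alpha>. \<alpha> \<in> {a..1} \<Longrightarrow> 1 / Gamma \<alpha> \<le> K"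
    and ple: "\<And>\<alpha> u. \<alpha> \<in> {a..1} \<Longrightarrow> 0 < u \<Longrightarrow> u \<le> T \<Longrightarrow> u powr (\<alpha> - 1) \<le> K * u powr (g - 1)"
    and kle: "\<And>\<alpha> u. \<alpha> \<in> {a..1} \<Longrightarrow> 0 < u \<Longrightarrow> u \<le> T \<Longrightarrow> \<bar>frac_kernel \<alpha> u\<bar> \<le> K * u powr (g - 1)"
    and dle: "\<And>\<alpha> u. \<alpha> \<in> {a..1} \<Longrightarrow> 0 < u \<Longrightarrow> u \<le> T \<Longrightarrow> \<bar>frac_kernel_deriv \<alpha> u\<bar> \<le> K * u powr (g - 1)"
    and kdiff: "\<And>\<alpha> \<beta> u. \<alpha> \<in> {a..1} \<Longrightarrow> \<beta> \<in> {a..1} \<Longrightarrow> 0 < u \<Longrightarrow> u \<le> T \<Longrightarrow>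
      \<bar>frac_kernel \<alpha> u - frac_kernel \<beta> u\<bar> \<le> K * u powr (g - 1) * \<bar>\<alpha> - \<beta>\<bar>"
    and kdiff2: "\<And>\<alpha> \<beta> u. \<alpha> \<in> {a..1} \<Longrightarrow> \<beta> \<in> {a..1} \<Longrightarrow> 0 < u \<Longrightarrow> u \<le> T \<Longrightarrow>
      \<bar>frac_kernel \<alpha> u - frac_kernel \<beta> u - (\<alpha> - \<beta>) * frac_kernel_deriv \<beta> u\<bar> \<le> K * u powr (g - 1) * \<bar>\<alpha> - \<beta>\<bar>\<^sup>2"
begin

text \<open>One constant above K, K L and |x0|: the first and the second bound kernels and
  integrands, the third is the starting value.\<close>

definition "K' = K * (L + 1) + \<bar>x\<^sub>0\<bar>"

lemma K': "K' \<ge> 0" "K \<le> K'" "K * L \<le> K'" "\<bar>x\<^sub>0\<bar> \<le> K'"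
  using K L by (auto simp: K'_def distrib_left intro!: add_nonneg_nonneg add_increasing2)

lemma coeff:
  "\<bar>f s x\<bar> \<le> L * (1 + \<bar>x\<bar>)" "\<bar>h s x\<bar> \<le> L * (1 + \<bar>x\<bar>)" "\<bar>f' s x\<bar> \<le> L" "\<bar>h' s x\<bar> \<le> L"
  using f h by (auto simp: smooth_coefficient_def)

lemma coeff_measurable:
  "case_prod f \<in> borel_measurable (borel \<Otimes>\<^sub>M borel)" "case_prod f' \<in> borel_measurable (borel \<Otimes>\<^sub>M borel)"
  "case_prod h \<in> borel_measurable (borel \<Otimes>\<^sub>M borel)" "case_prod h' \<in> borel_measurable (borel \<Otimes>\<^sub>M borel)"
  using f h by (auto simp: smooth_coefficient_def)

lemma prob_space_M: "prob_space M" by unfold_locales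

lemma brownian_motion_M: "brownian_motion M T B" by unfold_locales

lemma weaken_constant:
  assumes "\<bar>v\<bar> \<le> K * (t - s) powr (g - 1) * L * r" "r \<ge> 0"
  shows "\<bar>v\<bar> \<le> K' * (t - s) powr (g - 1) * r"
proof -
  have "K * (t - s) powr (g - 1) * L * r = (K * L) * ((t - s) powr (g - 1) * r)" by (simp add: mult_ac)
  also have "\<dots> \<le> K' * ((t - s) powr (g - 1) * r)" using K' assms(2) by (intro mult_right_mono) auto
  finally show ?thesis using assms(1) by (simp add: mult.assoc)
qed

lemma X_bound:
  assumes "\<alpha> \<in> {a..1}" "t \<in> {0..T}" "s \<in> {0..<t}" "\<bar>v\<bar> \<le> L * (1 + \<bar>x\<bar>)"
  shows "\<bar>frac_kernel \<alpha> (t - s) * v\<bar> \<le> K' * (t - s) powr (g - 1) * (1 + \<bar>x\<bar>)"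
proof (rule weaken_constant)
  have "\<bar>frac_kernel \<alpha> (t - s) * v\<bar> \<le> (K * (t - s) powr (g - 1)) * (L * (1 + \<bar>x\<bar>))"
    unfolding abs_mult using kle[of \<alpha> "t - s"] assms K by (intro mult_mono) auto
  then show "\<bar>frac_kernel \<alpha> (t - s) * v\<bar> \<le> K * (t - s) powr (g - 1) * L * (1 + \<bar>x\<bar>)" by (simp add: mult.assoc)
qed auto

text \<open>The integrands are exactly \<open>(t - s) powr (\<alpha> - 1)\<close> times the
  coefficients divided by Gamma, so in the criterion for square integrability the error terms
  vanish. The inhomogeneity 1 comes from linear growth.\<close>

lemma X_setup:
  assumes \<alpha>: "\<alpha> \<in> {a..1}"
  shows "volterra_setup T g K' (const_moments T 1) M B x\<^sub>0 (\<lambda>s \<omega>. 1) (X \<alpha>)"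
proof -
  note [measurable (raw)] = measurable_joint_compose[OF Xm[OF \<alpha>]] measurable_joint_compose[OF coeff_measurable(1)]
    measurable_joint_compose[OF coeff_measurable(3)]
  have mom: "moments_le M T (const_moments T 1) (\<lambda>s \<omega>. 1)"
    using moments_le_const[OF prob_space_M, of T 1] T by (simp add: const_moments_def[abs_def])
  have \<alpha>pos: "Gamma \<alpha> > 0" using \<alpha> a by (intro Gamma_real_pos) auto
  have A: "\<bar>1 / Gamma \<alpha> * v\<bar> \<le> K' * (1 + \<bar>x\<bar>)" if "\<bar>v\<bar> \<le> L * (1 + \<bar>x\<bar>)" for v x
  proof -
    have "\<bar>1 / Gamma \<alpha> * v\<bar> \<le> K * (L * (1 + \<bar>x\<bar>))"
      unfolding abs_mult using that Gle[OF \<alpha>] \<alpha>pos K by (intro mult_mono) auto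
    also have "\<dots> = K * L * (1 + \<bar>x\<bar>)" by (simp add: mult.assoc)
    also have "\<dots> \<le> K' * (1 + \<bar>x\<bar>)" using K' by (intro mult_right_mono) auto
    finally show ?thesis .
  qed
  have fin: "(\<integral>\<^sup>+\<omega>. (\<integral>\<^sup>+s\<in>{0..T}. ennreal ((X \<alpha> s \<omega>)\<^sup>2) \<partial>lborel) \<partial>M) < \<infinity>"
  proof (rule volterra_square_integrable[where a=\<alpha> and A="\<lambda>s \<omega>. 1 / Gamma \<alpha> * f s (X \<alpha> s \<omega>)" and A'="\<lambda>s \<omega>. 1 / Gamma \<alpha> * h s (X \<alpha> s \<omega>)"
      and H="\<lambda>s \<omega>. 1" and K=K' and C="const_moments T 1" and c=x\<^sub>0, OF g T K'(1) _ moments_nonneg(3) mom Xm[OF \<alpha>]])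
    show "case_prod (\<lambda>s \<omega>. 1 / Gamma \<alpha> * f s (X \<alpha> s \<omega>)) \<in> borel_measurable (borel \<Otimes>\<^sub>M M)"
      "case_prod (\<lambda>s \<omega>. 1 / Gamma \<alpha> * h s (X \<alpha> s \<omega>)) \<in> borel_measurable (borel \<Otimes>\<^sub>M M)" by measurable
    show "\<bar>1 / Gamma \<alpha> * f s (X \<alpha> s \<omega>)\<bar> \<le> K' * (1 + \<bar>X \<alpha> s \<omega>\<bar>)" for s \<omega> by (rule A[OF coeff(1)])
    show "u powr (\<alpha> - 1) \<le> K' * u powr (g - 1)" if "0 < u" "u \<le> T" for u
      using ple[OF \<alpha> that] mult_right_mono[OF K'(2), of "u powr (g - 1)"] by simp
  next
    fix t assume t: "t \<in> {0..T}"
    let ?\<phi> = "\<lambda>s \<omega>. frac_kernel \<alpha> (t - s) * f s (X \<alpha> s \<omega>)" and ?\<psi> = "\<lambda>s \<omega>. frac_kernel \<alpha> (t - s) * h s (X \<alpha> s \<omega>)"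
    obtain I where I: "case_prod ?\<phi> \<in> borel_measurable (borel \<Otimes>\<^sub>M M)" "AE \<omega> in M. set_integrable lborel {0..t} (\<lambda>s. ?\<phi> s \<omega>)"
      "square_ito_limit t ?\<psi> I" "AE \<omega> in M. X \<alpha> t \<omega> = x\<^sub>0 + (LBINT s:{0..t}. ?\<phi> s \<omega>) + I \<omega>"
      using Xeq[OF \<alpha>] t unfolding volterra_eq_def by blast
    show "\<exists>\<phi> \<psi> I. case_prod \<phi> \<in> borel_measurable (borel \<Otimes>\<^sub>M M) \<and> ito_limit t \<psi> I \<and>
      (AE \<omega> in M. X \<alpha> t \<omega> = x\<^sub>0 + (LBINT s:{0..t}. \<phi> s \<omega>) + I \<omega>) \<and>
      (\<forall>s\<in>{0..<t}. \<forall>\<omega>\<in>space M. \<bar>\<phi> s \<omega> - (t - s) powr (\<alpha> - 1) * (1 / Gamma \<alpha> * f s (X \<alpha> s \<omega>))\<bar> \<le> K' * (t - s) powr (g - 1) * 1) \<and>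
      (\<forall>s\<in>{0..<t}. \<forall>\<omega>\<in>space M. \<bar>\<psi> s \<omega> - (t - s) powr (\<alpha> - 1) * (1 / Gamma \<alpha> * h s (X \<alpha> s \<omega>))\<bar> \<le> K' * (t - s) powr (g - 1) * 1) \<and>
      (AE \<omega> in M. set_integrable lborel {0..t} (\<lambda>s. \<phi> s \<omega>)) \<and>
      (\<integral>\<^sup>+\<omega>. (\<integral>\<^sup>+s\<in>{0..t}. ennreal ((\<psi> s \<omega>)\<^sup>2) \<partial>lborel) \<partial>M) < \<infinity>"
    proof (rule exI[of _ ?\<phi>], rule exI[of _ ?\<psi>], rule exI[of _ I], intro conjI)
      show "ito_limit t ?\<psi> I" "(\<integral>\<^sup>+\<omega>. (\<integral>\<^sup>+s\<in>{0..t}. ennreal ((?\<psi> s \<omega>)\<^sup>2) \<partial>lborel) \<partial>M) < \<infinity>"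
        using I(3) unfolding square_ito_limit_def by auto
    qed (use I K' in \<open>auto simp: frac_kernel_def\<close>)
  qed (use \<alpha> T in auto)
  have proc: "volterra_process g K' x\<^sub>0 (\<lambda>s \<omega>. 1) (X \<alpha>)"
    by (rule volterra_eq_imp_process[OF Xeq[OF \<alpha>]]) (intro X_bound \<alpha> coeff; assumption)+
  show ?thesis unfolding volterra_setup_def
    using brownian_motion_M Xm[OF \<alpha>] K' proc mom fin by auto
qed

text \<open>Only the term containing Y is treated as the coefficient A in the criterion for square
  integrability. The term with the derivative of the kernel has a logarithm; it is the error term
  there, bounded by means of X, whose moments are already known.\<close>

lemma Y_setup:
  assumes \<alpha>: "\<alpha> \<in> {a..1}" and mX: "moments_le M T C (X \<alpha>)" and C: "\<And>n. C n \<ge> 0"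
  shows "volterra_setup T g K' (add_moments (const_moments T 1) C) M B 0 (\<lambda>s \<omega>. 1 + \<bar>X \<alpha> s \<omega>\<bar>) (Y \<alpha>)"
proof -
  note [measurable (raw)] = measurable_joint_compose[OF Xm[OF \<alpha>]] measurable_joint_compose[OF Ym[OF \<alpha>]]
    measurable_joint_compose[OF coeff_measurable(1)] measurable_joint_compose[OF coeff_measurable(2)]
    measurable_joint_compose[OF coeff_measurable(3)] measurable_joint_compose[OF coeff_measurable(4)]
  let ?C = "add_moments (const_moments T 1) C"
  let ?H = "\<lambda>s \<omega>. 1 + \<bar>X \<alpha> s \<omega>\<bar>"
  have mom: "moments_le M T ?C ?H"
    by (rule moments_le_one_plus[OF prob_space_M T mX C Xm[OF \<alpha>]])
  have Hm: "case_prod ?H \<in> borel_measurable (borel \<Otimes>\<^sub>M M)" by measurable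
  have C0: "?C n \<ge> 0" for n using T C by (intro moments_nonneg) auto
  have \<alpha>pos: "Gamma \<alpha> > 0" using \<alpha> a by (intro Gamma_real_pos) auto
  have A: "\<bar>1 / Gamma \<alpha> * (v * y)\<bar> \<le> K' * ((1 + \<bar>x\<bar>) + \<bar>y\<bar>)" if "\<bar>v\<bar> \<le> L" for v x y
  proof -
    have "\<bar>1 / Gamma \<alpha> * (v * y)\<bar> \<le> K * (L * \<bar>y\<bar>)"
      unfolding abs_mult using that Gle[OF \<alpha>] \<alpha>pos K by (intro mult_mono) auto
    also have "\<dots> = K * L * \<bar>y\<bar>" by (simp add: mult.assoc)
    also have "\<dots> \<le> K' * ((1 + \<bar>x\<bar>) + \<bar>y\<bar>)" using K' by (intro mult_mono) auto
    finally show ?thesis .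
  qed
  have D: "\<bar>frac_kernel_deriv \<alpha> (t - s) * v\<bar> \<le> K' * (t - s) powr (g - 1) * (1 + \<bar>x\<bar>)"
    if t: "t \<in> {0..T}" "s \<in> {0..<t}" and v: "\<bar>v\<bar> \<le> L * (1 + \<bar>x\<bar>)" for t s v x
  proof (rule weaken_constant)
    have "\<bar>frac_kernel_deriv \<alpha> (t - s) * v\<bar> \<le> (K * (t - s) powr (g - 1)) * (L * (1 + \<bar>x\<bar>))"
      unfolding abs_mult using dle[OF \<alpha>, of "t - s"] t v K by (intro mult_mono) auto
    then show "\<bar>frac_kernel_deriv \<alpha> (t - s) * v\<bar> \<le> K * (t - s) powr (g - 1) * L * (1 + \<bar>x\<bar>)" by (simp add: mult.assoc)
  qed auto
  have E: "\<bar>frac_kernel_deriv \<alpha> (t - s) * v + frac_kernel \<alpha> (t - s) * (v' * y)\<bar> \<le> K' * (t - s) powr (g - 1) * ((1 + \<bar>x\<bar>) + \<bar>y\<bar>)"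
    if t: "t \<in> {0..T}" "s \<in> {0..<t}" and v: "\<bar>v\<bar> \<le> L * (1 + \<bar>x\<bar>)" "\<bar>v'\<bar> \<le> L" for t s v v' x y
  proof -
    have "\<bar>frac_kernel \<alpha> (t - s) * (v' * y)\<bar> \<le> K' * (t - s) powr (g - 1) * \<bar>y\<bar>"
    proof (rule weaken_constant)
      have "\<bar>frac_kernel \<alpha> (t - s) * (v' * y)\<bar> \<le> (K * (t - s) powr (g - 1)) * (L * \<bar>y\<bar>)"
        unfolding abs_mult using kle[OF \<alpha>, of "t - s"] t v K by (intro mult_mono) auto
      then show "\<bar>frac_kernel \<alpha> (t - s) * (v' * y)\<bar> \<le> K * (t - s) powr (g - 1) * L * \<bar>y\<bar>" by (simp add: mult.assoc)
    qed auto
    then show ?thesis using D[OF t v(1)] abs_triangle_ineq[of "frac_kernel_deriv \<alpha> (t - s) * v" "frac_kernel \<alpha> (t - s) * (v' * y)"]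
      unfolding distrib_left[of "K' * (t - s) powr (g - 1)" "1 + \<bar>x\<bar>"] by linarith
  qed
  have fin: "(\<integral>\<^sup>+\<omega>. (\<integral>\<^sup>+s\<in>{0..T}. ennreal ((Y \<alpha> s \<omega>)\<^sup>2) \<partial>lborel) \<partial>M) < \<infinity>"
  proof (rule volterra_square_integrable[where a=\<alpha> and A="\<lambda>s \<omega>. 1 / Gamma \<alpha> * (f' s (X \<alpha> s \<omega>) * Y \<alpha> s \<omega>)" and A'="\<lambda>s \<omega>. 1 / Gamma \<alpha> * (h' s (X \<alpha> s \<omega>) * Y \<alpha> s \<omega>)"
      and H="?H" and K=K' and C="?C" and c=0, OF g T K'(1) _ C0 mom Ym[OF \<alpha>] Hm])
    show "case_prod (\<lambda>s \<omega>. 1 / Gamma \<alpha> * (f' s (X \<alpha> s \<omega>) * Y \<alpha> s \<omega>)) \<in> borel_measurable (borel \<Otimes>\<^sub>M M)"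
      "case_prod (\<lambda>s \<omega>. 1 / Gamma \<alpha> * (h' s (X \<alpha> s \<omega>) * Y \<alpha> s \<omega>)) \<in> borel_measurable (borel \<Otimes>\<^sub>M M)" by measurable
    show "\<bar>1 / Gamma \<alpha> * (f' s (X \<alpha> s \<omega>) * Y \<alpha> s \<omega>)\<bar> \<le> K' * ((1 + \<bar>X \<alpha> s \<omega>\<bar>) + \<bar>Y \<alpha> s \<omega>\<bar>)" for s \<omega> by (rule A[OF coeff(3)])
    show "u powr (\<alpha> - 1) \<le> K' * u powr (g - 1)" if "0 < u" "u \<le> T" for u
      using ple[OF \<alpha> that] mult_right_mono[OF K'(2), of "u powr (g - 1)"] by simp
  next
    fix t assume t: "t \<in> {0..T}"
    let ?\<phi> = "\<lambda>s \<omega>. frac_kernel_deriv \<alpha> (t - s) * f s (X \<alpha> s \<omega>) + frac_kernel \<alpha> (t - s) * (f' s (X \<alpha> s \<omega>) * Y \<alpha> s \<omega>)"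
      and ?\<psi> = "\<lambda>s \<omega>. frac_kernel_deriv \<alpha> (t - s) * h s (X \<alpha> s \<omega>) + frac_kernel \<alpha> (t - s) * (h' s (X \<alpha> s \<omega>) * Y \<alpha> s \<omega>)"
    obtain I where I: "case_prod ?\<phi> \<in> borel_measurable (borel \<Otimes>\<^sub>M M)" "AE \<omega> in M. set_integrable lborel {0..t} (\<lambda>s. ?\<phi> s \<omega>)"
      "square_ito_limit t ?\<psi> I" "AE \<omega> in M. Y \<alpha> t \<omega> = 0 + (LBINT s:{0..t}. ?\<phi> s \<omega>) + I \<omega>"
      using Yeq[OF \<alpha>] t unfolding volterra_eq_def by blast
    show "\<exists>\<phi> \<psi> I. case_prod \<phi> \<in> borel_measurable (borel \<Otimes>\<^sub>M M) \<and> ito_limit t \<psi> I \<and>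
      (AE \<omega> in M. Y \<alpha> t \<omega> = 0 + (LBINT s:{0..t}. \<phi> s \<omega>) + I \<omega>) \<and>
      (\<forall>s\<in>{0..<t}. \<forall>\<omega>\<in>space M. \<bar>\<phi> s \<omega> - (t - s) powr (\<alpha> - 1) * (1 / Gamma \<alpha> * (f' s (X \<alpha> s \<omega>) * Y \<alpha> s \<omega>))\<bar> \<le> K' * (t - s) powr (g - 1) * (1 + \<bar>X \<alpha> s \<omega>\<bar>)) \<and>
      (\<forall>s\<in>{0..<t}. \<forall>\<omega>\<in>space M. \<bar>\<psi> s \<omega> - (t - s) powr (\<alpha> - 1) * (1 / Gamma \<alpha> * (h' s (X \<alpha> s \<omega>) * Y \<alpha> s \<omega>))\<bar> \<le> K' * (t - s) powr (g - 1) * (1 + \<bar>X \<alpha> s \<omega>\<bar>)) \<and>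
      (AE \<omega> in M. set_integrable lborel {0..t} (\<lambda>s. \<phi> s \<omega>)) \<and>
      (\<integral>\<^sup>+\<omega>. (\<integral>\<^sup>+s\<in>{0..t}. ennreal ((\<psi> s \<omega>)\<^sup>2) \<partial>lborel) \<partial>M) < \<infinity>"
    proof (rule exI[of _ ?\<phi>], rule exI[of _ ?\<psi>], rule exI[of _ I], intro conjI ballI)
      show "ito_limit t ?\<psi> I" "(\<integral>\<^sup>+\<omega>. (\<integral>\<^sup>+s\<in>{0..t}. ennreal ((?\<psi> s \<omega>)\<^sup>2) \<partial>lborel) \<partial>M) < \<infinity>"
        using I(3) unfolding square_ito_limit_def by auto
      fix s \<omega> assume s: "s \<in> {0..<t}"
      show "\<bar>?\<phi> s \<omega> - (t - s) powr (\<alpha> - 1) * (1 / Gamma \<alpha> * (f' s (X \<alpha> s \<omega>) * Y \<alpha> s \<omega>))\<bar> \<le> K' * (t - s) powr (g - 1) * (1 + \<bar>X \<alpha> s \<omega>\<bar>)"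
        "\<bar>?\<psi> s \<omega> - (t - s) powr (\<alpha> - 1) * (1 / Gamma \<alpha> * (h' s (X \<alpha> s \<omega>) * Y \<alpha> s \<omega>))\<bar> \<le> K' * (t - s) powr (g - 1) * (1 + \<bar>X \<alpha> s \<omega>\<bar>)"
        using D[OF t s coeff(1)] D[OF t s coeff(2)] by (auto simp: frac_kernel_def)
    qed (use I in auto)
  qed (use \<alpha> in auto)
  have proc: "volterra_process g K' 0 ?H (Y \<alpha>)"
    by (rule volterra_eq_imp_process[OF Yeq[OF \<alpha>]]) (intro E coeff; assumption)+
  show ?thesis unfolding volterra_setup_def
    using brownian_motion_M Ym[OF \<alpha>] Hm K'(1) proc mom fin by auto
qed

context
  fixes \<alpha> \<beta> :: real
  assumes \<alpha>: "\<alpha> \<in> {a..1}" and \<beta>: "\<beta> \<in> {a..1}" and ne: "\<alpha> \<noteq> \<beta>"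
begin

text \<open>The quotient is spelled out as a linear combination so that
  \<open>volterra_eq_linear\<close> applies literally; the same holds for R.\<close>

definition "D s \<omega> = 1 / (\<alpha> - \<beta>) * X \<alpha> s \<omega> + (- (1 / (\<alpha> - \<beta>))) * X \<beta> s \<omega>"

lemma D_eq: "D s \<omega> = (X \<alpha> s \<omega> - X \<beta> s \<omega>) / (\<alpha> - \<beta>)"
  by (simp add: D_def diff_divide_distrib)

definition "rescale = \<bar>\<alpha> - \<beta>\<bar> powr (- \<delta>)"

definition "R s \<omega> = rescale * D s \<omega> + (- rescale) * Y \<beta> s \<omega>"

lemma R_eq: "R s \<omega> = rescale * (D s \<omega> - Y \<beta> s \<omega>)"
  by (simp add: R_def right_diff_distrib)

lemma D_measurable: "case_prod D \<in> borel_measurable (borel \<Otimes>\<^sub>M M)"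
proof -
  note [measurable (raw)] = measurable_joint_compose[OF Xm[OF \<alpha>]] measurable_joint_compose[OF Xm[OF \<beta>]]
  show ?thesis unfolding D_def by measurable
qed

lemma R_measurable: "case_prod R \<in> borel_measurable (borel \<Otimes>\<^sub>M M)"
proof -
  note [measurable (raw)] = measurable_joint_compose[OF D_measurable] measurable_joint_compose[OF Ym[OF \<beta>]]
  show ?thesis unfolding R_def by measurable
qed

lemma D_volterra_eq: "volterra_eq 0
    (\<lambda>t s \<omega>. (frac_kernel \<alpha> (t - s) * f s (X \<alpha> s \<omega>) - frac_kernel \<beta> (t - s) * f s (X \<beta> s \<omega>)) / (\<alpha> - \<beta>))
    (\<lambda>t s \<omega>. (frac_kernel \<alpha> (t - s) * h s (X \<alpha> s \<omega>) - frac_kernel \<beta> (t - s) * h s (X \<beta> s \<omega>)) / (\<alpha> - \<beta>)) D"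
  using volterra_eq_linear[OF Xeq[OF \<alpha>] Xeq[OF \<beta>], of "1 / (\<alpha> - \<beta>)" "- (1 / (\<alpha> - \<beta>))"]
  by (simp add: D_def[abs_def] diff_divide_distrib)

lemma R_volterra_eq: "volterra_eq 0
    (\<lambda>t s \<omega>. rescale * ((frac_kernel \<alpha> (t - s) * f s (X \<alpha> s \<omega>) - frac_kernel \<beta> (t - s) * f s (X \<beta> s \<omega>)) / (\<alpha> - \<beta>)
       - (frac_kernel_deriv \<beta> (t - s) * f s (X \<beta> s \<omega>) + frac_kernel \<beta> (t - s) * (f' s (X \<beta> s \<omega>) * Y \<beta> s \<omega>))))
    (\<lambda>t s \<omega>. rescale * ((frac_kernel \<alpha> (t - s) * h s (X \<alpha> s \<omega>) - frac_kernel \<beta> (t - s) * h s (X \<beta> s \<omega>)) / (\<alpha> - \<beta>)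
       - (frac_kernel_deriv \<beta> (t - s) * h s (X \<beta> s \<omega>) + frac_kernel \<beta> (t - s) * (h' s (X \<beta> s \<omega>) * Y \<beta> s \<omega>)))) R"
  using volterra_eq_linear[OF D_volterra_eq Yeq[OF \<beta>], of rescale "- rescale"]
  by (simp add: R_def[abs_def] right_diff_distrib)

text \<open>Square integrability is inherited from the two solutions. Its value may blow up as
  \<beta> approaches \<alpha>, but it enters the moment bounds only through its finiteness, so they
  remain uniform in the two orders.\<close>

lemma D_setup:
  assumes mX: "\<And>\<alpha>. \<alpha> \<in> {a..1} \<Longrightarrow> moments_le M T C (X \<alpha>)" and C: "\<And>n. C n \<ge> 0"
  shows "volterra_setup T g K' (add_moments (const_moments T 1) C) M B 0 (\<lambda>s \<omega>. 1 + \<bar>X \<alpha> s \<omega>\<bar>) D"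
proof -
  note [measurable (raw)] = measurable_joint_compose[OF Xm[OF \<alpha>]]
  let ?H = "\<lambda>s \<omega>. 1 + \<bar>X \<alpha> s \<omega>\<bar>"
  have mom: "moments_le M T (add_moments (const_moments T 1) C) ?H"
    by (rule moments_le_one_plus[OF prob_space_M T mX[OF \<alpha>] C Xm[OF \<alpha>]])
  have Hm: "case_prod ?H \<in> borel_measurable (borel \<Otimes>\<^sub>M M)" by measurable
  have fin: "(\<integral>\<^sup>+\<omega>. (\<integral>\<^sup>+s\<in>{0..T}. ennreal ((D s \<omega>)\<^sup>2) \<partial>lborel) \<partial>M) < \<infinity>"
    unfolding D_def by (rule square_finite_linear[OF Xm[OF \<alpha>] Xm[OF \<beta>] square_moment_finite[OF mX[OF \<alpha>]] square_moment_finite[OF mX[OF \<beta>]]])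
  have bound: "\<bar>(frac_kernel \<alpha> (t - s) * F s (X \<alpha> s \<omega>) - frac_kernel \<beta> (t - s) * F s (X \<beta> s \<omega>)) / (\<alpha> - \<beta>)\<bar>
      \<le> K' * (t - s) powr (g - 1) * ((1 + \<bar>X \<alpha> s \<omega>\<bar>) + \<bar>D s \<omega>\<bar>)"
    if F: "smooth_coefficient L \<nu> \<delta> F F'" and t: "t \<in> {0..T}" "s \<in> {0..<t}" for F F' t s \<omega>
    unfolding D_eq using t K
    by (intro weaken_constant coefficient_difference_bound[OF F L ne] kle[OF \<beta>] kdiff[OF \<alpha> \<beta>]) auto
  have proc: "volterra_process g K' 0 ?H D"
    by (rule volterra_eq_imp_process[OF D_volterra_eq]) (rule bound[OF f] bound[OF h]; assumption)+
  show ?thesis unfolding volterra_setup_def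
    using brownian_motion_M D_measurable Hm K'(1) proc mom fin by auto
qed

text \<open>Square integrability comes from the moments of D and of Y, the inhomogeneity from those
  of the solutions and of D. After rescaling R satisfies an equation of the same type as D, with
  bounds that do not degenerate as \<beta> approaches \<alpha>.\<close>

lemma R_setup:
  assumes \<nu>: "0 < \<nu>" "\<nu> \<le> real N" and \<delta>: "0 < \<delta>" "\<delta> \<le> 1"
    and mX: "\<And>\<alpha>. \<alpha> \<in> {a..1} \<Longrightarrow> moments_le M T C (X \<alpha>)" and C: "\<And>n. C n \<ge> 0"
    and mD: "moments_le M T C' D" and C': "\<And>n. C' n \<ge> 0"
    and mY: "moments_le M T C'' (Y \<beta>)"
  shows "volterra_setup T g K' (remainder_moments T N C C') M B 0
     (\<lambda>s \<omega>. remainder_bound N (X \<alpha> s \<omega>) (X \<beta> s \<omega>) (D s \<omega>)) R"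
proof -
  note [measurable (raw)] = measurable_joint_compose[OF Xm[OF \<alpha>]] measurable_joint_compose[OF Xm[OF \<beta>]]
    measurable_joint_compose[OF D_measurable]
  let ?H = "\<lambda>s \<omega>. remainder_bound N (X \<alpha> s \<omega>) (X \<beta> s \<omega>) (D s \<omega>)"
  have mom: "moments_le M T (remainder_moments T N C C') ?H"
    by (rule moments_le_remainder[OF prob_space_M T C C' mX[OF \<alpha>] mX[OF \<beta>] mD Xm[OF \<alpha>] Xm[OF \<beta>] D_measurable])
  have Hm: "case_prod ?H \<in> borel_measurable (borel \<Otimes>\<^sub>M M)" unfolding remainder_bound_def by measurable
  have fin: "(\<integral>\<^sup>+\<omega>. (\<integral>\<^sup>+s\<in>{0..T}. ennreal ((R s \<omega>)\<^sup>2) \<partial>lborel) \<partial>M) < \<infinity>"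
    unfolding R_def by (rule square_finite_linear[OF D_measurable Ym[OF \<beta>] square_moment_finite[OF mD] square_moment_finite[OF mY]])
  have h1: "\<bar>\<alpha> - \<beta>\<bar> \<le> 1" using \<alpha> \<beta> a by auto
  have bound: "\<bar>rescale * ((frac_kernel \<alpha> (t - s) * F s (X \<alpha> s \<omega>) - frac_kernel \<beta> (t - s) * F s (X \<beta> s \<omega>)) / (\<alpha> - \<beta>)
       - (frac_kernel_deriv \<beta> (t - s) * F s (X \<beta> s \<omega>) + frac_kernel \<beta> (t - s) * (F' s (X \<beta> s \<omega>) * Y \<beta> s \<omega>)))\<bar>
      \<le> K' * (t - s) powr (g - 1) * (?H s \<omega> + \<bar>R s \<omega>\<bar>)"
    if F: "smooth_coefficient L \<nu> \<delta> F F'" and t: "t \<in> {0..T}" "s \<in> {0..<t}" for F F' t s \<omega>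
    unfolding R_eq D_eq rescale_def using t K remainder_bound_nonneg
    by (intro weaken_constant coefficient_remainder_bound[OF F L _ \<nu> \<delta> ne h1] kle[OF \<beta>] dle[OF \<beta>] kdiff2[OF \<alpha> \<beta>]) auto
  have proc: "volterra_process g K' 0 ?H R"
    by (rule volterra_eq_imp_process[OF R_volterra_eq]) (rule bound[OF f] bound[OF h]; assumption)+
  show ?thesis unfolding volterra_setup_def
    using brownian_motion_M R_measurable Hm K'(1) proc mom fin remainder_bound_nonneg by auto
qed

end

end

lemma remainder_moments_nonneg:
  assumes "T > 0" "\<And>n. C n \<ge> 0" "\<And>n. C' n \<ge> 0"
  shows "remainder_moments T N C C' n \<ge> 0"
  unfolding remainder_moments_def using assms by (intro moments_nonneg) auto

theorem theorem3p1:
  fixes L T p \<alpha>\<^sub>0 x\<^sub>0 \<nu> \<delta> :: real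
  assumes "L > 0" "T > 0" "p \<ge> 2" "\<alpha>\<^sub>0 \<in> {1/2<..1}" "\<nu> > 0" "\<delta> \<in> {0<..1}"
  shows "\<exists>C>0. \<forall>(M :: 'a measure) B b \<sigma> X Y.
    complete_measure M \<longrightarrow>
    brownian_motion M T B \<longrightarrow>
    (\<lambda>(t, x). b t x) \<in> borel_measurable (restrict_space borel ({0..T} \<times> UNIV)) \<longrightarrow>
    (\<lambda>(t, x). \<sigma> t x) \<in> borel_measurable (restrict_space borel ({0..T} \<times> UNIV)) \<longrightarrow>
    (\<forall>t\<in>{0..T}. \<forall>x y. \<bar>b t x - b t y\<bar> + \<bar>\<sigma> t x - \<sigma> t y\<bar> \<le> L * \<bar>x - y\<bar>) \<longrightarrow>
    (\<forall>t\<in>{0..T}. \<forall>x. \<bar>b t x\<bar> + \<bar>\<sigma> t x\<bar> \<le> L * (1 + \<bar>x\<bar>)) \<longrightarrow>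
    (\<forall>t\<in>{0..T}. \<forall>x. b t field_differentiable at x \<and> \<sigma> t field_differentiable at x) \<longrightarrow>
    (\<forall>t\<in>{0..T}. \<forall>x y. \<bar>deriv (b t) x - deriv (b t) y\<bar> + \<bar>deriv (\<sigma> t) x - deriv (\<sigma> t) y\<bar>
        \<le> L * (1 + \<bar>x\<bar> powr \<nu> + \<bar>y\<bar> powr \<nu>) * \<bar>x - y\<bar> powr \<delta>) \<longrightarrow>
    (\<forall>\<alpha>\<in>{1/2<..1}. caputo_fsde_solution M T B b \<sigma> x\<^sub>0 \<alpha> (X \<alpha>)) \<longrightarrow>
    (\<forall>\<beta>\<in>{1/2<..1}. order_derivative_process M T B b \<sigma> \<beta> (X \<beta>) (Y \<beta>)) \<longrightarrow>
    (\<forall>\<alpha>\<in>{\<alpha>\<^sub>0..1}. \<forall>\<beta>\<in>{\<alpha>\<^sub>0..1}. \<alpha> \<noteq> \<beta> \<longrightarrow>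
      (SUP t\<in>{0..T}. \<integral>\<^sup>+\<omega>. ennreal (\<bar>(X \<alpha> t \<omega> - X \<beta> t \<omega>) / (\<alpha> - \<beta>) - Y \<beta> t \<omega>\<bar> powr p) \<partial>M)
        \<le> ennreal (C * \<bar>\<alpha> - \<beta>\<bar> powr (p * \<delta>)))"
proof -
  have L: "L > 0" and T: "T > 0" and p: "p \<ge> 2" and \<nu>: "\<nu> > 0" and \<delta>: "0 < \<delta>" "\<delta> \<le> 1" using assms by auto
  obtain g K where g: "1/2 < g" "g < 1" and K: "K > 0" and ker: "\<forall>\<alpha>\<in>{\<alpha>\<^sub>0..1}. 1 / Gamma \<alpha> \<le> K \<and> (\<forall>u. 0 < u \<longrightarrow> u \<le> T \<longrightarrow>
     u powr (\<alpha> - 1) \<le> K * u powr (g - 1) \<and>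
     \<bar>frac_kernel \<alpha> u\<bar> \<le> K * u powr (g - 1) \<and> \<bar>frac_kernel_deriv \<alpha> u\<bar> \<le> K * u powr (g - 1) \<and>
     (\<forall>\<beta>\<in>{\<alpha>\<^sub>0..1}. \<bar>frac_kernel \<alpha> u - frac_kernel \<beta> u\<bar> \<le> K * u powr (g - 1) * \<bar>\<alpha> - \<beta>\<bar> \<and>
       \<bar>frac_kernel \<alpha> u - frac_kernel \<beta> u - (\<alpha> - \<beta>) * frac_kernel_deriv \<beta> u\<bar> \<le> K * u powr (g - 1) * \<bar>\<alpha> - \<beta>\<bar>\<^sup>2))"
    using frac_kernel_bounds[OF assms(4) T] by blast
  define kb where "kb = K * (L + 1) + \<bar>x\<^sub>0\<bar>"
  have kb: "kb \<ge> 0" using K L by (simp add: kb_def)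
  \<comment> \<open>Integer exponents above \<nu> and p, because moments are recorded for natural
    orders.\<close>
  obtain N where N: "\<nu> \<le> real N" using real_arch_simple by blast
  obtain q where q: "p \<le> real q" using real_arch_simple by blast
  define C1 where "C1 = const_moments T 1"
  have C1: "C1 n \<ge> 0" for n unfolding C1_def using T by (intro moments_nonneg) auto
  \<comment> \<open>The constants are fixed before M, B, the coefficients and the processes: each
    application of the Volterra bounds uses as inhomogeneity moments already bounded, first 1, next
    1 + |X|, last the bound of the remainder. Since g and kb serve all orders in the interval, so do
    the constants.\<close>
  obtain DX where DX: "\<And>n. DX n \<ge> 0" and mX: "\<And>(M::'a measure) B c H Z. volterra_setup T g kb C1 M B c H Z \<Longrightarrow> moments_le M T DX Z"
    using volterra_time_moments[where ?'a='a and C=C1, OF g T C1 kb] by blast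
  define C2 where "C2 = add_moments (const_moments T 1) DX"
  have C2: "C2 n \<ge> 0" for n unfolding C2_def using T DX by (intro moments_nonneg) auto
  obtain DD where DD: "\<And>n. DD n \<ge> 0" and mD: "\<And>(M::'a measure) B c H Z. volterra_setup T g kb C2 M B c H Z \<Longrightarrow> moments_le M T DD Z"
    using volterra_time_moments[where ?'a='a and C=C2, OF g T C2 kb] by blast
  define C3 where "C3 = remainder_moments T N DX DD"
  have C3: "C3 n \<ge> 0" for n unfolding C3_def using T DX DD by (intro remainder_moments_nonneg) auto
  obtain DR where DR: "\<And>n. DR n \<ge> 0" and mR: "\<And>(M::'a measure) B c H Z t n. volterra_setup T g kb C3 M B c H Z \<Longrightarrow> t \<in> {0..T} \<Longrightarrow>
     (\<integral>\<^sup>+\<omega>. ennreal (\<bar>Z t \<omega>\<bar> ^ n) \<partial>M) \<le> ennreal (DR n)"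
    using volterra_moments[where ?'a='a and C=C3, OF g T C3 kb] by blast
  show ?thesis
  proof (intro exI[of _ "1 + DR q"] conjI allI impI ballI)
    \<comment> \<open>The constant comes from
      \<open>\<bar>R\<bar> powr p \<le> 1 + \<bar>R\<bar> ^ q\<close>, integrated over a probability
      space.\<close>
    show "1 + DR q > 0" using DR[of q] by simp
    fix M :: "'a measure" and B b \<sigma> X Y \<alpha> \<beta>
    assume bm: "brownian_motion M T B"
      and bmeas: "(\<lambda>(t, x). b t x) \<in> borel_measurable (restrict_space borel ({0..T} \<times> UNIV))"
      and \<sigma>meas: "(\<lambda>(t, x). \<sigma> t x) \<in> borel_measurable (restrict_space borel ({0..T} \<times> UNIV))"
      and lip: "\<forall>t\<in>{0..T}. \<forall>x y. \<bar>b t x - b t y\<bar> + \<bar>\<sigma> t x - \<sigma> t y\<bar> \<le> L * \<bar>x - y\<bar>"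
      and growth: "\<forall>t\<in>{0..T}. \<forall>x. \<bar>b t x\<bar> + \<bar>\<sigma> t x\<bar> \<le> L * (1 + \<bar>x\<bar>)"
      and diff: "\<forall>t\<in>{0..T}. \<forall>x. b t field_differentiable at x \<and> \<sigma> t field_differentiable at x"
      and holder: "\<forall>t\<in>{0..T}. \<forall>x y. \<bar>deriv (b t) x - deriv (b t) y\<bar> + \<bar>deriv (\<sigma> t) x - deriv (\<sigma> t) y\<bar>
        \<le> L * (1 + \<bar>x\<bar> powr \<nu> + \<bar>y\<bar> powr \<nu>) * \<bar>x - y\<bar> powr \<delta>"
      and solX: "\<forall>\<alpha>\<in>{1/2<..1}. caputo_fsde_solution M T B b \<sigma> x\<^sub>0 \<alpha> (X \<alpha>)"
      and solY: "\<forall>\<beta>\<in>{1/2<..1}. order_derivative_process M T B b \<sigma> \<beta> (X \<beta>) (Y \<beta>)"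
      and \<alpha>: "\<alpha> \<in> {\<alpha>\<^sub>0..1}" and \<beta>: "\<beta> \<in> {\<alpha>\<^sub>0..1}" and ne: "\<alpha> \<noteq> \<beta>"
    interpret brownian_motion M T B by fact
    \<comment> \<open>Everything is extended by 0 outside [0,T]; on [0,T] the equations are
      unchanged.\<close>
    define f where "f = (\<lambda>t x. if t \<in> {0..T} then b t x else 0)"
    define f' where "f' = (\<lambda>t x. if t \<in> {0..T} then deriv (b t) x else 0)"
    define h where "h = (\<lambda>t x. if t \<in> {0..T} then \<sigma> t x else 0)"
    define h' where "h' = (\<lambda>t x. if t \<in> {0..T} then deriv (\<sigma> t) x else 0)"
    define X' where "X' = (\<lambda>\<alpha> t \<omega>. if t \<in> {0..T} then X \<alpha> t \<omega> else 0)"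
    define Y' where "Y' = (\<lambda>\<alpha> t \<omega>. if t \<in> {0..T} then Y \<alpha> t \<omega> else 0)"
    have sf: "smooth_coefficient L \<nu> \<delta> f f'"
      unfolding f_def f'_def
    proof (rule smooth_coefficient_extend[OF L \<nu> \<delta>(1) bmeas])
      fix t x y assume t: "t \<in> {0..T}"
      show "\<bar>b t x - b t y\<bar> \<le> L * \<bar>x - y\<bar>"
        by (rule order_trans[OF _ lip[rule_format, OF t, of x y]]) simp
      show "\<bar>b t x\<bar> \<le> L * (1 + \<bar>x\<bar>)"
        by (rule order_trans[OF _ growth[rule_format, OF t, of x]]) simp
      show "\<bar>deriv (b t) x - deriv (b t) y\<bar> \<le> L * (1 + \<bar>x\<bar> powr \<nu> + \<bar>y\<bar> powr \<nu>) * \<bar>x - y\<bar> powr \<delta>"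
        by (rule order_trans[OF _ holder[rule_format, OF t, of x y]]) simp
      show "b t field_differentiable at x" using diff[rule_format, OF t] by blast
    qed
    have sh: "smooth_coefficient L \<nu> \<delta> h h'"
      unfolding h_def h'_def
    proof (rule smooth_coefficient_extend[OF L \<nu> \<delta>(1) \<sigma>meas])
      fix t x y assume t: "t \<in> {0..T}"
      show "\<bar>\<sigma> t x - \<sigma> t y\<bar> \<le> L * \<bar>x - y\<bar>"
        by (rule order_trans[OF _ lip[rule_format, OF t, of x y]]) simp
      show "\<bar>\<sigma> t x\<bar> \<le> L * (1 + \<bar>x\<bar>)"
        by (rule order_trans[OF _ growth[rule_format, OF t, of x]]) simp
      show "\<bar>deriv (\<sigma> t) x - deriv (\<sigma> t) y\<bar> \<le> L * (1 + \<bar>x\<bar> powr \<nu> + \<bar>y\<bar> powr \<nu>) * \<bar>x - y\<bar> powr \<delta>"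
        by (rule order_trans[OF _ holder[rule_format, OF t, of x y]]) simp
      show "\<sigma> t field_differentiable at x" using diff[rule_format, OF t] by blast
    qed
    have half: "\<gamma> \<in> {1/2<..1}" if "\<gamma> \<in> {\<alpha>\<^sub>0..1}" for \<gamma> using that assms(4) by auto
    have X'm: "case_prod (X' \<gamma>) \<in> borel_measurable (borel \<Otimes>\<^sub>M M)" if "\<gamma> \<in> {\<alpha>\<^sub>0..1}" for \<gamma>
      unfolding X'_def using solX[rule_format, OF half[OF that]]
      by (intro measurable_extend_process) (simp add: caputo_fsde_solution_def Let_def adapted_process_def)
    have Y'm: "case_prod (Y' \<gamma>) \<in> borel_measurable (borel \<Otimes>\<^sub>M M)" if "\<gamma> \<in> {\<alpha>\<^sub>0..1}" for \<gamma>
      unfolding Y'_def using solY[rule_format, OF half[OF that]]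
      by (intro measurable_extend_process) (simp add: order_derivative_process_def Let_def adapted_process_def)
    have X'eq: "volterra_eq x\<^sub>0 (\<lambda>t s \<omega>. frac_kernel \<gamma> (t - s) * f s (X' \<gamma> s \<omega>)) (\<lambda>t s \<omega>. frac_kernel \<gamma> (t - s) * h s (X' \<gamma> s \<omega>)) (X' \<gamma>)"
      if "\<gamma> \<in> {\<alpha>\<^sub>0..1}" for \<gamma>
      by (rule caputo_volterra_eq[OF solX[rule_format, OF half[OF that]] sf _ sh _ X'm[OF that]])
        (auto simp: f_def h_def X'_def)
    have Y'eq: "volterra_eq 0
      (\<lambda>t s \<omega>. frac_kernel_deriv \<gamma> (t - s) * f s (X' \<gamma> s \<omega>) + frac_kernel \<gamma> (t - s) * (f' s (X' \<gamma> s \<omega>) * Y' \<gamma> s \<omega>))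
      (\<lambda>t s \<omega>. frac_kernel_deriv \<gamma> (t - s) * h s (X' \<gamma> s \<omega>) + frac_kernel \<gamma> (t - s) * (h' s (X' \<gamma> s \<omega>) * Y' \<gamma> s \<omega>)) (Y' \<gamma>)"
      if "\<gamma> \<in> {\<alpha>\<^sub>0..1}" for \<gamma>
      by (rule derivative_volterra_eq[OF solY[rule_format, OF half[OF that]] _ sf _ _ sh _ _ X'm[OF that] _ Y'm[OF that]])
        (use half[OF that] in \<open>auto simp: f_def f'_def h_def h'_def X'_def Y'_def\<close>)
    interpret fractional_data M T B L \<nu> \<delta> g K \<alpha>\<^sub>0 x\<^sub>0 f f' h h' X' Y'
      by unfold_locales (use L T assms(4) g K sf sh X'm Y'm X'eq Y'eq ker in auto)
    have kb_eq: "K' = kb" by (simp add: K'_def kb_def)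
    note setups = X_setup[unfolded kb_eq, folded C1_def] Y_setup[unfolded kb_eq] D_setup[unfolded kb_eq] R_setup[unfolded kb_eq]
    have mX': "moments_le M T DX (X' \<gamma>)" if "\<gamma> \<in> {\<alpha>\<^sub>0..1}" for \<gamma>
      by (rule mX[OF setups(1)[OF that]])
    \<comment> \<open>The same DD bounds Y and the difference quotient, because both have an
      inhomogeneity 1 + |X|, with moments bounded by C2, and the same kernel constants.\<close>
    have mY': "moments_le M T DD (Y' \<beta>)"
      by (rule mD) (rule setups(2)[OF \<beta> mX'[OF \<beta>] DX, folded C2_def])
    have mD': "moments_le M T DD (D \<alpha> \<beta>)"
      by (rule mD) (rule setups(3)[OF \<alpha> \<beta> ne mX' DX, folded C2_def])
    have suR: "volterra_setup T g kb C3 M B 0 (\<lambda>s \<omega>. remainder_bound N (X' \<alpha> s \<omega>) (X' \<beta> s \<omega>) (D \<alpha> \<beta> s \<omega>)) (R \<alpha> \<beta>)"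
      unfolding C3_def by (rule setups(4)[OF \<alpha> \<beta> ne \<nu> N \<delta> mX' DX mD' DD mY'])
    define u where "u = \<bar>\<alpha> - \<beta>\<bar>"
    have u: "u > 0" using ne by (simp add: u_def)
    have Rm: "case_prod (R \<alpha> \<beta>) \<in> borel_measurable (borel \<Otimes>\<^sub>M M)" by (rule R_measurable[OF \<alpha> \<beta> ne])
    note [measurable (raw)] = measurable_joint_compose[OF Rm]
    show "(SUP t\<in>{0..T}. \<integral>\<^sup>+\<omega>. ennreal (\<bar>(X \<alpha> t \<omega> - X \<beta> t \<omega>) / (\<alpha> - \<beta>) - Y \<beta> t \<omega>\<bar> powr p) \<partial>M)
        \<le> ennreal ((1 + DR q) * \<bar>\<alpha> - \<beta>\<bar> powr (p * \<delta>))"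
    proof (rule SUP_least)
      fix t assume t: "t \<in> {0..T}"
      \<comment> \<open>Undoing the rescaling: the quantity in question is u^\<delta> times R, and
        its p-th power supplies the rate u^(p \<delta>).\<close>
      have pw: "ennreal (\<bar>(X \<alpha> t \<omega> - X \<beta> t \<omega>) / (\<alpha> - \<beta>) - Y \<beta> t \<omega>\<bar> powr p)
          \<le> ennreal (u powr (p * \<delta>)) * (1 + ennreal (\<bar>R \<alpha> \<beta> t \<omega>\<bar> ^ q))" for \<omega>
      proof -
        have "u powr \<delta> * R \<alpha> \<beta> t \<omega> = (u powr \<delta> * u powr (- \<delta>)) * (D \<alpha> \<beta> t \<omega> - Y' \<beta> t \<omega>)"
          unfolding R_eq[OF \<alpha> \<beta> ne] rescale_def[OF \<alpha> \<beta> ne] u_def[symmetric] by simp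
        also have "\<dots> = (X \<alpha> t \<omega> - X \<beta> t \<omega>) / (\<alpha> - \<beta>) - Y \<beta> t \<omega>"
          unfolding D_eq[OF \<alpha> \<beta> ne] using u t by (simp add: powr_add[symmetric] X'_def Y'_def)
        finally have "\<bar>(X \<alpha> t \<omega> - X \<beta> t \<omega>) / (\<alpha> - \<beta>) - Y \<beta> t \<omega>\<bar> powr p = (u powr \<delta> * \<bar>R \<alpha> \<beta> t \<omega>\<bar>) powr p"
          by (metis abs_mult abs_of_nonneg powr_ge_zero)
        also have "\<dots> = u powr (p * \<delta>) * \<bar>R \<alpha> \<beta> t \<omega>\<bar> powr p"
          by (simp add: powr_mult powr_powr mult.commute)
        also have "\<dots> \<le> u powr (p * \<delta>) * (1 + \<bar>R \<alpha> \<beta> t \<omega>\<bar> ^ q)"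
          using p q by (intro mult_left_mono powr_le_one_plus_power) auto
        finally have "ennreal (\<bar>(X \<alpha> t \<omega> - X \<beta> t \<omega>) / (\<alpha> - \<beta>) - Y \<beta> t \<omega>\<bar> powr p) \<le> ennreal (u powr (p * \<delta>) * (1 + \<bar>R \<alpha> \<beta> t \<omega>\<bar> ^ q))"
          by (rule ennreal_leI)
        then show ?thesis by (simp add: ennreal_mult)
      qed
      have "(\<integral>\<^sup>+\<omega>. ennreal (\<bar>(X \<alpha> t \<omega> - X \<beta> t \<omega>) / (\<alpha> - \<beta>) - Y \<beta> t \<omega>\<bar> powr p) \<partial>M)
        \<le> (\<integral>\<^sup>+\<omega>. ennreal (u powr (p * \<delta>)) * (1 + ennreal (\<bar>R \<alpha> \<beta> t \<omega>\<bar> ^ q)) \<partial>M)"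
        by (rule nn_integral_mono) (rule pw)
      also have "\<dots> = ennreal (u powr (p * \<delta>)) * (1 + (\<integral>\<^sup>+\<omega>. ennreal (\<bar>R \<alpha> \<beta> t \<omega>\<bar> ^ q) \<partial>M))"
        by (simp add: nn_integral_cmult nn_integral_add emeasure_space_1)
      also have "\<dots> \<le> ennreal (u powr (p * \<delta>)) * (1 + ennreal (DR q))"
        by (intro mult_left_mono add_left_mono mR[OF suR t]) auto
      also have "\<dots> = ennreal ((1 + DR q) * \<bar>\<alpha> - \<beta>\<bar> powr (p * \<delta>))"
        using DR[of q] unfolding u_def by (simp add: ennreal_mult mult.commute)
      finally show "(\<integral>\<^sup>+\<omega>. ennreal (\<bar>(X \<alpha> t \<omega> - X \<beta> t \<omega>) / (\<alpha> - \<beta>) - Y \<beta> t \<omega>\<bar> powr p) \<partial>M)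
        \<le> ennreal ((1 + DR q) * \<bar>\<alpha> - \<beta>\<bar> powr (p * \<delta>))" .
    qed
  qed
qed

end
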